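(* Let $\Xi$ denote the solution map of any one of the problems LP, BP ($\ell^1$ or TV), UL ($\ell^1$ or TV), CL defined in the context, with regularisation parameters satisfying $\delta\in[0,1]$, $\lambda\in(0,1/3]$, $\tau\in[1/2,2]$ (and additionally rational in the Turing case), and let the error be measured in the $\|\cdot\|_p$-norm for an arbitrary $p\in[1,\infty]$. Let $K\in\mathbb N$ and fix real $\alpha,\omega$ with $0<\alpha\le\omega<10^{-K}$. Then, for any fixed dimensions $N>m\ge4$, there exists a class of inputs $\Omega\subset\mathbb R^m\times\mathbb R^{m\times N}$ for $\Xi$ such that, if $\Gamma$ is an algorithm for approximating $\Xi$ with $K$ correct digits on $\Omega$ satisfying $$\inf_{\xi\in\Xi(\Omega)}\|\Gamma(\tilde\iota)-\xi\|_p<\alpha\quad\text{for every oracle representation }\tilde\iota\text{ of every }\iota\in\Omega,$$ then the following hold. (i) No algorithm, even (halting) randomised with access to an exact solution oracle of precision $\omega$, can compute the exit flag of $\Gamma$ (with probability exceeding $\mathrm p>1/2$ in the randomised case). (ii) If randomised algorithms with non-zero probability of not halting are allowed, then no such algorithm, even with access to an exact solution oracle of precision $\omega$, can compute the exit flag of $\Gamma$ with probability exceeding $\mathrm p>1/2$. (iii) The problem of computing the exit flag of $\Gamma$ is strictly harder than computing $K$ correct digits of $\Xi$ in the following sense: if one is given the exit flag as an oracle, then it is possible to construct an algorithm that computes $K$ correct digits of $\Xi$; however, if one is instead given an oracle providing a $K$-digit approximation to $\Xi$, then it is still not possible to compute the exit flag of $\Gamma$. (iv) For linear programming and basis pursuit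 there exists a class of inputs $\Omega^\sharp\neq\Omega$ such that, if $\Gamma$ is an algorithm for approximating $\Xi$ with $K$ correct digits on $\Omega^\sharp$ satisfying $$\inf_{\xi\in\Xi(\Omega^\sharp)}\|\Gamma(\tilde\iota)-\xi\|_p<\alpha\quad\text{for every oracle representation }\tilde\iota\text{ of every }\iota\in\Omega^\sharp,$$ then no algorithm, even randomised with non-zero probability of not halting, can compute the exit flag of $\Gamma$ (defined with $\Omega^\sharp$ in place of $\Omega$) (with probability exceeding $\mathrm p>1/2$ in the randomised case), yet one can compute the exit flag with a deterministic algorithm with access to an exact solution oracle of precision $\omega$. Statements (i) and (ii) are true even when the inputs in $\Omega$ are required to be well-conditioned and bounded: for any $\iota=(y,A)\in\Omega$ one has $\mathrm{Cond}(AA^* )\le3.2$, $C_{\mathrm{FP}}(\iota)\le4$ (for LP and BP), $\mathrm{Cond}(\Xi)\le179$, $\|y\|_\infty\le2$ and $\|A\|_{\max}=1$.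
   Context: **Problems.** For $\iota=(y,A)\in\mathbb R^m\times\mathbb R^{m\times N}$ the set-valued solution map $\Xi(\iota)\subset\mathbb R^N$ is one of: LP: $\arg\min_x\langle x,c\rangle$ s.t. $Ax=y$, $x\ge0$, with $c=(1,\dots,1)$; BP: $\arg\min_x\mathcal J(x)$ s.t. $\|Ax-y\|_2\le\delta$; UL: $\arg\min_x\|Ax-y\|_2^2+\lambda\mathcal J(x)$; CL: $\arg\min_x\|Ax-y\|_2$ s.t. $\|x\|_1\le\tau$; where $\mathcal J$ is either $\|x\|_1$ or $\|x\|_{\mathrm{TV}}=\sum_{j=1}^{N-1}|x_j-x_{j+1}|$. $\Xi(\Omega)=\bigcup_{\iota\in\Omega}\Xi(\iota)$. **Inexact input.** Let $\mathbb D_n=\{k2^{-n}:k\in\mathbb Z\}$. Algorithms access an oracle representation $\tilde\iota$ of $\iota$: for each coordinate $f_j(\iota)$ of $\iota=(y,A)$ and each $n\in\mathbb N$ a number $f_{j,n}\in\mathbb D_n$ with $|f_{j,n}-f_j(\iota)|\le2^{-n}$. $\tilde\Omega$ is the set of all such representations of all $\iota\in\Omega$. **Algorithms.** Let $\tilde\Lambda$ be the countable set of evaluations $\tilde f_{j,n}:\tilde\iota\mapsto f_{j,n}$ (plus, with an extra oracle, the evaluations of its components), enumerated $g_1,g_2,\dots$. A general algorithm with values in $\mathcal M$ is a map $\Gamma$ from inputs to $\mathcal M\cup\{\mathrm{NH}\}$ (NH = "not halting", counted as failure, at distance $\infty$ from all points of $\mathcal M$) together with nonempty sets $\Lambda_\Gamma(\tilde\iota)\subset\tilde\Lambda$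 such that $\Lambda_\Gamma(\tilde\iota)$ is finite if $\Gamma(\tilde\iota)\neq\mathrm{NH}$, $\Gamma(\tilde\iota)$ is determined by $\{f(\tilde\iota)\}_{f\in\Lambda_\Gamma(\tilde\iota)}$, and if $f(\tilde\iota')=f(\tilde\iota)$ for all $f\in\Lambda_\Gamma(\tilde\iota)$ then $\Lambda_\Gamma(\tilde\iota')=\Lambda_\Gamma(\tilde\iota)$. A randomised (general) algorithm is a set $X$ of general algorithms with a $\sigma$-algebra $\mathcal F$ and probability measures $\{\mathbb P_{\tilde\iota}\}$ on $\mathcal F$ such that (P1) $\Gamma\mapsto\Gamma(\tilde\iota)$ is measurable for each $\tilde\iota$; (P2) $\{\Gamma\in X:\sup\{k:g_k\in\Lambda_\Gamma(\tilde\iota)\}\le n\}\in\mathcal F$; (P3) if $E\in\mathcal F$ and $f(\tilde\iota_1)=f(\tilde\iota_2)$ for every $\Gamma\in E$, $f\in\Lambda_\Gamma(\tilde\iota_1)$, then $\mathbb P_{\tilde\iota_1}(E)=\mathbb P_{\tilde\iota_2}(E)$. It is halting if $\mathbb P_{\tilde\iota}(\Gamma(\tilde\iota)=\mathrm{NH})=0$ for all $\tilde\iota$. Impossibility statements are for (randomised) general algorithms; "cannot with probability exceeding $\mathrm p>1/2$" means: for every $\mathrm p>1/2$ no randomised algorithm gives the correct value with probability at least $\mathrm p$ on every input. In the existence parts of (iii) and (iv) the given $\Gamma$ and the constructed algorithm are Turing machines or BSS machines querying the $f_{j,n}$ through an oracle. **Exit flag.** The exit flag of $\Gamma$ is the function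 $\Xi^E:\tilde\Omega\to\{0,1\}$ with $\Xi^E(\tilde\iota)=1$ if $\inf_{\xi\in\Xi(\iota)}\|\Gamma(\tilde\iota)-\xi\|_p\le10^{-K}$ and $\Xi^E(\tilde\iota)=0$ otherwise ($\tilde\iota$ a representation of $\iota$). **Exact solution oracle of precision $\omega$.** Besides $\tilde\iota$ the algorithm can access a vector $\rho$ with dyadic rational entries lying strictly within distance $\omega$ of some element of $\Xi(\iota)$; the algorithm is successful only if it is correct for every such $\rho$. With the exit flag as an oracle, the algorithm can access $\Xi^E(\tilde\iota)$. **Condition numbers.** $\mathrm{Cond}(B)=\|B\|_2\|B^{-1}\|_2$. Let $\mathcal A=\{j:\exists x,y\in\Omega,x_j\ne y_j\}$ (coordinates of inputs), $\Omega^{\mathrm{act}}=\{x:\exists y\in\Omega,\ x_{\mathcal A^c}=y_{\mathcal A^c}\}$. With $\hat\Omega\supset\Omega$ the set of feasible inputs, $\mathrm{Cond}(\Xi)=\sup_{x\in\Omega}\lim_{\epsilon\to0^+}\sup\{\mathrm{dist}_\infty(\Xi(x+z),\Xi(x))/\|z\|_\infty: x+z\in\Omega^{\mathrm{act}}\cap\hat\Omega,\ 0<\|z\|_\infty\le\epsilon\}$, where $\mathrm{dist}_\infty(S,S')=\inf_{s\in S,s'\in S'}\|s-s'\|_\infty$ and $\sup\varnothing=0$. For LP and BP, with $\Sigma$ the set of infeasible $(y,A)$, $C_{\mathrm{FP}}(y,A)=\max(\|y\|_2,\|A\|_2)/\mathrm{dist}_2[(y,A),\Sigma\cap\Omega^{\mathrm{act}}]$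 ($\infty$ if the distance is $0$), $\mathrm{dist}_2[(y,A),S]=\inf_{(y',A')\in S}\max(\|y'-y\|_2,\|A'-A\|_2)$. $\|A\|_{\max}=\max_{i,j}|A_{ij}|$. *)

theory Defs
  imports "HOL-Analysis.Analysis" "HOL-Probability.Probability_Measure"
begin

section \<open>Norms\<close>

definition pnorm :: "ereal \<Rightarrow> real ^ 'n \<Rightarrow> real" where
  "pnorm p x = (if p = \<infinity> then infnorm x
     else (\<Sum>i\<in>UNIV. \<bar>x $ i\<bar> powr real_of_ereal p) powr (1 / real_of_ereal p))"

definition norm1 :: "real ^ 'n \<Rightarrow> real" where
  "norm1 x = (\<Sum>i\<in>UNIV. \<bar>x $ i\<bar>)"

text \<open>Index types are of class \<^class>\<open>enum\<close> because the total variation and the oracle queries of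
  machines need an ordering of the coordinates: the \<open>j\<close>-th one is \<open>enum_class.enum ! j\<close>
  (counting from 0).\<close>

definition normTV :: "real ^ ('n::enum) \<Rightarrow> real" where
  "normTV x = (\<Sum>j<CARD('n) - 1.
     \<bar>x $ (enum_class.enum ! j) - x $ (enum_class.enum ! Suc j)\<bar>)"

definition opnorm2 :: "real ^ 'n ^ 'm \<Rightarrow> real" where
  "opnorm2 A = onorm ((*v) A)"

definition max_entry :: "real ^ 'n ^ 'm \<Rightarrow> real" where
  "max_entry A = Max (range (\<lambda>(i, j). \<bar>A $ i $ j\<bar>))"

section \<open>Problems and solution maps\<close>

type_synonym ('m, 'n) input = "(real ^ 'm) \<times> (real ^ 'n ^ 'm)"

datatype regulariser = L1 | TV

primrec reg_fun :: "regulariser \<Rightarrow> real ^ ('n::enum) \<Rightarrow> real" where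
  "reg_fun L1 = norm1"
| "reg_fun TV = normTV"

datatype problem =
    is_LP: LP
  | is_BP: BP regulariser (param: real)
  | is_UL: UL regulariser (param: real)
  | is_CL: CL (param: real)

fun valid_param :: "problem \<Rightarrow> bool" where
  "valid_param LP \<longleftrightarrow> True"
| "valid_param (BP J \<delta>) \<longleftrightarrow> 0 \<le> \<delta> \<and> \<delta> \<le> 1"
| "valid_param (UL J l) \<longleftrightarrow> 0 < l \<and> l \<le> 1 / 3"
| "valid_param (CL \<tau>) \<longleftrightarrow> 1 / 2 \<le> \<tau> \<and> \<tau> \<le> 2"

definition rational_param :: "problem \<Rightarrow> bool" where
  "rational_param pr \<longleftrightarrow> is_LP pr \<or> param pr \<in> \<rat>"

fun constraint :: "problem \<Rightarrow> ('m::finite, 'n::enum) input \<Rightarrow> real ^ ('n::enum) \<Rightarrow> bool" where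
  "constraint LP (y, A) x \<longleftrightarrow> A *v x = y \<and> (\<forall>i. 0 \<le> x $ i)"
| "constraint (BP J \<delta>) (y, A) x \<longleftrightarrow> norm (A *v x - y) \<le> \<delta>"
| "constraint (UL J l) (y, A) x \<longleftrightarrow> True"
| "constraint (CL \<tau>) (y, A) x \<longleftrightarrow> norm1 x \<le> \<tau>"

fun objective :: "problem \<Rightarrow> ('m::finite, 'n::enum) input \<Rightarrow> real ^ ('n::enum) \<Rightarrow> real" where
  "objective LP (y, A) x = x \<bullet> (\<chi> i. 1)"
| "objective (BP J \<delta>) (y, A) x = reg_fun J x"
| "objective (UL J l) (y, A) x = (norm (A *v x - y))\<^sup>2 + l * reg_fun J x"
| "objective (CL \<tau>) (y, A) x = norm (A *v x - y)"

definition Sol :: "problem \<Rightarrow> ('m::finite, 'n::enum) input \<Rightarrow> (real ^ ('n::enum)) set" where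
  "Sol pr \<iota> = {x. is_arg_min (objective pr \<iota>) (constraint pr \<iota>) x}"

definition feasible_inputs :: "problem \<Rightarrow> ('m::finite, 'n::enum) input set" where
  "feasible_inputs pr = {\<iota>. \<exists>x. constraint pr \<iota> x}"

section \<open>Condition numbers\<close>

type_synonym ('m, 'n) coord = "'m + 'm \<times> 'n"

fun coord :: "('m::finite, 'n::finite) input \<Rightarrow> ('m, 'n) coord \<Rightarrow> real" where
  "coord (y, A) (Inl i) = y $ i"
| "coord (y, A) (Inr (i, j)) = A $ i $ j"

definition active_coords :: "('m::finite, 'n::finite) input set \<Rightarrow> ('m, 'n) coord set" where
  "active_coords \<Omega> = {j. \<exists>x\<in>\<Omega>. \<exists>y\<in>\<Omega>. coord x j \<noteq> coord y j}"

definition active_hull :: "('m::finite, 'n::finite) input set \<Rightarrow> ('m, 'n) input set" where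
  "active_hull \<Omega> = {x. \<exists>y\<in>\<Omega>. \<forall>j. j \<notin> active_coords \<Omega> \<longrightarrow> coord x j = coord y j}"

definition Cond_mat :: "real ^ 'm ^ 'm \<Rightarrow> ereal" where
  "Cond_mat B = (if invertible B then ereal (opnorm2 B * opnorm2 (matrix_inv B)) else \<infinity>)"

definition dist_inf :: "(real ^ 'n) set \<Rightarrow> (real ^ 'n) set \<Rightarrow> ennreal" where
  "dist_inf S S' = (INF s\<in>S. INF s'\<in>S'. ennreal (infnorm (s - s')))"

text \<open>On the product space of inputs, \<^const>\<open>infnorm\<close> is the maximum over all coordinates of
  \<open>(y, A)\<close>. Suprema are taken in \<^typ>\<open>ennreal\<close>, so that the supremum of the empty set is 0.\<close>

definition Cond_Sol :: "problem \<Rightarrow> ('m::finite, 'n::enum) input set \<Rightarrow> ennreal" where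
  "Cond_Sol pr \<Omega> = (SUP x\<in>\<Omega>. Lim (at_right (0::real)) (\<lambda>\<epsilon>.
     SUP z\<in>{z. x + z \<in> active_hull \<Omega> \<inter> feasible_inputs pr \<and> 0 < infnorm z \<and> infnorm z \<le> \<epsilon>}.
       dist_inf (Sol pr (x + z)) (Sol pr x) / ennreal (infnorm z)))"

definition dist2_input :: "('m::finite, 'n::finite) input \<Rightarrow> ('m, 'n) input set \<Rightarrow> ennreal" where
  "dist2_input \<iota> S = (INF \<iota>'\<in>S.
     ennreal (max (norm (fst \<iota>' - fst \<iota>)) (opnorm2 (snd \<iota>' - snd \<iota>))))"

definition C_FP :: "problem \<Rightarrow> ('m::finite, 'n::enum) input set \<Rightarrow> ('m, 'n) input \<Rightarrow> ennreal" where
  "C_FP pr \<Omega> \<iota> = (let d = dist2_input \<iota> (- feasible_inputs pr \<inter> active_hull \<Omega>) in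
     if d = 0 then \<infinity> else ennreal (max (norm (fst \<iota>)) (opnorm2 (snd \<iota>))) / d)"

section \<open>Oracle representations of inputs\<close>

definition dyadics :: "nat \<Rightarrow> rat set" where
  "dyadics n = {of_int k / 2 ^ n | k. True}"

type_synonym ('m, 'n) rep = "('m, 'n) coord \<Rightarrow> nat \<Rightarrow> rat"

definition represents :: "('m::finite, 'n::finite) rep \<Rightarrow> ('m, 'n) input \<Rightarrow> bool" where
  "represents r \<iota> \<longleftrightarrow>
     (\<forall>j n. r j n \<in> dyadics n \<and> \<bar>of_rat (r j n) - coord \<iota> j\<bar> \<le> 1 / 2 ^ n)"

definition reps :: "('m::finite, 'n::finite) input set \<Rightarrow> ('m, 'n) rep set" where
  "reps \<Omega> = {r. \<exists>\<iota>\<in>\<Omega>. represents r \<iota>}"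

text \<open>A representation determines the represented input, as \<open>r j n\<close> tends to its \<open>j\<close>-th coordinate.\<close>

definition represented :: "('m::finite, 'n::finite) rep \<Rightarrow> ('m, 'n) input" where
  "represented r = (THE \<iota>. represents r \<iota>)"

text \<open>Extra oracles that provide a vector \<open>\<rho>\<close> are given by the set of admissible \<open>\<rho>\<close> for each input.\<close>

definition rvec :: "rat ^ 'n \<Rightarrow> real ^ 'n" where
  "rvec \<rho> = (\<chi> i. of_rat (\<rho> $ i))"

definition dyadic_vec :: "rat ^ 'n \<Rightarrow> bool" where
  "dyadic_vec \<rho> \<longleftrightarrow> (\<forall>i. \<exists>n. \<rho> $ i \<in> dyadics n)"

definition with_oracle ::
    "(('m::finite, 'n::finite) input \<Rightarrow> (rat ^ ('n::finite)) set) \<Rightarrow> ('m, 'n) input set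
     \<Rightarrow> (('m, 'n) rep \<times> (rat ^ ('n::finite))) set" where
  "with_oracle R \<Omega> = {(r, \<rho>). \<exists>\<iota>\<in>\<Omega>. represents r \<iota> \<and> \<rho> \<in> R \<iota>}"

text \<open>Distance of an output from a solution set; \<^const>\<open>None\<close> is the non-halting value NH.\<close>

definition err :: "ereal \<Rightarrow> (real ^ 'n) option \<Rightarrow> (real ^ 'n) set \<Rightarrow> ennreal" where
  "err p v S = (case v of None \<Rightarrow> \<infinity> | Some x \<Rightarrow> (INF \<xi>\<in>S. ennreal (pnorm p (x - \<xi>))))"

definition exact_oracle ::
    "problem \<Rightarrow> ereal \<Rightarrow> real \<Rightarrow> ('m::finite, 'n::enum) input \<Rightarrow> (rat ^ ('n::enum)) set" where
  "exact_oracle pr p \<omega> \<iota> = {\<rho>. dyadic_vec \<rho> \<and> (\<exists>\<xi>\<in>Sol pr \<iota>. pnorm p (rvec \<rho> - \<xi>) < \<omega>)}"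

definition digits_oracle ::
    "problem \<Rightarrow> ereal \<Rightarrow> nat \<Rightarrow> ('m::finite, 'n::enum) input \<Rightarrow> (rat ^ ('n::enum)) set" where
  "digits_oracle pr p K \<iota> =
     {\<rho>. dyadic_vec \<rho> \<and> err p (Some (rvec \<rho>)) (Sol pr \<iota>) \<le> ennreal ((1 / 10) ^ K)}"

section \<open>General and randomised algorithms\<close>

text \<open>Inputs have type \<open>'i\<close>, labels of evaluations type \<open>'e\<close>, and values in the metric space have
  type \<open>'v\<close>; \<open>val e x\<close> is the value of evaluation \<open>e\<close> at input \<open>x\<close>, and \<open>I\<close> is the set of inputs.\<close>

datatype ('i, 'e, 'v) alg = Alg (result: "'i \<Rightarrow> 'v option") (queries: "'i \<Rightarrow> 'e set")

definition general_algorithm :: "('e \<Rightarrow> 'i \<Rightarrow> rat) \<Rightarrow> 'i set \<Rightarrow> ('i, 'e, 'v) alg \<Rightarrow> bool" where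
  "general_algorithm val I \<Gamma> \<longleftrightarrow>
     (\<forall>x\<in>I. queries \<Gamma> x \<noteq> {} \<and> (result \<Gamma> x \<noteq> None \<longrightarrow> finite (queries \<Gamma> x))) \<and>
     (\<forall>x\<in>I. \<forall>x'\<in>I. (\<forall>e\<in>queries \<Gamma> x. val e x' = val e x) \<longrightarrow>
        result \<Gamma> x' = result \<Gamma> x \<and> queries \<Gamma> x' = queries \<Gamma> x)"

text \<open>\<open>g\<close> enumerates the evaluations. The value space is taken to be discrete: only algorithms with
  values in \<open>{0,1}\<close> are randomised below.\<close>

definition randomised_algorithm ::
    "('e \<Rightarrow> 'i \<Rightarrow> rat) \<Rightarrow> (nat \<Rightarrow> 'e) \<Rightarrow> 'i set \<Rightarrow> ('i, 'e, 'v) alg set \<Rightarrow> ('i, 'e, 'v) alg set set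
     \<Rightarrow> ('i \<Rightarrow> ('i, 'e, 'v) alg measure) \<Rightarrow> bool" where
  "randomised_algorithm val g I X F P \<longleftrightarrow>
     (\<forall>\<Gamma>\<in>X. general_algorithm val I \<Gamma>) \<and> sigma_algebra X F \<and>
     (\<forall>x\<in>I. prob_space (P x) \<and> space (P x) = X \<and> sets (P x) = F) \<and>
     (\<forall>x\<in>I. (\<lambda>\<Gamma>. result \<Gamma> x) \<in> measurable (P x) (count_space UNIV)) \<and>
     (\<forall>x\<in>I. \<forall>n. {\<Gamma>\<in>X. (SUP k\<in>{k. g k \<in> queries \<Gamma> x}. enat k) \<le> enat n} \<in> F) \<and>
     (\<forall>E\<in>F. \<forall>x1\<in>I. \<forall>x2\<in>I. (\<forall>\<Gamma>\<in>E. \<forall>e\<in>queries \<Gamma> x1. val e x1 = val e x2) \<longrightarrow>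
        measure (P x1) E = measure (P x2) E)"

definition halting ::
    "'i set \<Rightarrow> ('i, 'e, 'v) alg set \<Rightarrow> ('i \<Rightarrow> ('i, 'e, 'v) alg measure) \<Rightarrow> bool" where
  "halting I X P \<longleftrightarrow> (\<forall>x\<in>I. measure (P x) {\<Gamma>\<in>X. result \<Gamma> x = None} = 0)"

definition succeeds ::
    "'i set \<Rightarrow> ('i, 'e, 'v) alg set \<Rightarrow> ('i \<Rightarrow> ('i, 'e, 'v) alg measure) \<Rightarrow> real \<Rightarrow> ('i \<Rightarrow> 'v) \<Rightarrow> bool"
  where "succeeds I X P q f \<longleftrightarrow> (\<forall>x\<in>I. q \<le> measure (P x) {\<Gamma>\<in>X. result \<Gamma> x = Some (f x)})"

definition det_computable :: "('e \<Rightarrow> 'i \<Rightarrow> rat) \<Rightarrow> 'i set \<Rightarrow> ('i \<Rightarrow> 'v) \<Rightarrow> bool" where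
  "det_computable val I f \<longleftrightarrow>
     (\<exists>A. general_algorithm val I A \<and> (\<forall>x\<in>I. result A x = Some (f x)))"

definition rand_computable :: "('e \<Rightarrow> 'i \<Rightarrow> rat) \<Rightarrow> 'i set \<Rightarrow> real \<Rightarrow> ('i \<Rightarrow> 'v) \<Rightarrow> bool" where
  "rand_computable val I q f \<longleftrightarrow>
     (\<exists>g X F P. bij g \<and> randomised_algorithm val g I X F P \<and> succeeds I X P q f)"

definition halting_rand_computable ::
    "('e \<Rightarrow> 'i \<Rightarrow> rat) \<Rightarrow> 'i set \<Rightarrow> real \<Rightarrow> ('i \<Rightarrow> 'v) \<Rightarrow> bool" where
  "halting_rand_computable val I q f \<longleftrightarrow>
     (\<exists>g X F P. bij g \<and> randomised_algorithm val g I X F P \<and> halting I X P \<and> succeeds I X P q f)"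

fun ev_rep :: "('m, 'n) coord \<times> nat \<Rightarrow> ('m, 'n) rep \<Rightarrow> rat" where
  "ev_rep (j, n) r = r j n"

fun ev_orc :: "('m, 'n) coord \<times> nat + 'n \<Rightarrow> ('m, 'n) rep \<times> (rat ^ 'n) \<Rightarrow> rat" where
  "ev_orc (Inl (j, n)) (r, \<rho>) = r j n"
| "ev_orc (Inr i) (r, \<rho>) = \<rho> $ i"

text \<open>The values 1 and 0 of the exit flag are \<^const>\<open>True\<close> and \<^const>\<open>False\<close>.\<close>

definition exit_flag ::
    "problem \<Rightarrow> ereal \<Rightarrow> nat \<Rightarrow> (('m::finite, 'n::enum) rep, 'e, real ^ ('n::enum)) alg
     \<Rightarrow> ('m, 'n) rep \<Rightarrow> bool" where
  "exit_flag pr p K \<Gamma> r \<longleftrightarrow>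
     err p (result \<Gamma> r) (Sol pr (represented r)) \<le> ennreal ((1 / 10) ^ K)"

section \<open>Oracle machines\<close>

text \<open>\<open>Coord j n\<close> asks for \<open>f\<^bsub>j,n\<^esub>\<close> with \<open>j\<close> the number of the coordinate, \<open>Extra i\<close> for the \<open>i\<close>-th
  entry of the extra oracle. A machine that asks a question without an answer hangs.\<close>

datatype question = Coord nat nat | Extra nat

type_synonym orc = "question \<Rightarrow> rat option"

fun orc :: "('m::enum, 'n::enum) rep \<Rightarrow> rat list \<Rightarrow> orc" where
  "orc r ex (Coord j n) = (let cs = (enum_class.enum :: ('m, 'n) coord list) in
     if j < length cs then Some (r (cs ! j) n) else None)"
| "orc r ex (Extra i) = (if i < length ex then Some (ex ! i) else None)"

definition vec_list :: "'a ^ ('n::enum) \<Rightarrow> 'a list" where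
  "vec_list x = map (\<lambda>i. x $ i) enum_class.enum"

subsection \<open>Turing machines\<close>

datatype symbol = Blank | Bit bool | Minus | Slash | Comma

datatype move = Left | Right | Stay

text \<open>\<open>Next q acts\<close>: go to state \<open>q\<close>, and on each tape write a symbol and move the head;
  \<open>Ask q\<close>: replace the question on tape 1 by its answer and go to state \<open>q\<close>.
  Further work symbols can be coded on additional tapes, whose number is arbitrary.\<close>

datatype action = Stop | Ask nat | Next nat "(symbol \<times> move) list"

datatype tm = TM (states: nat) (tapes: nat) (trans: "nat \<Rightarrow> symbol list \<Rightarrow> action")

definition wf_tm :: "tm \<Rightarrow> bool" where
  "wf_tm M \<longleftrightarrow> 1 \<le> states M \<and> 2 \<le> tapes M \<and>
     (\<forall>q<states M. \<forall>ss. length ss = tapes M \<longrightarrow>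
       (case trans M q ss of Stop \<Rightarrow> True | Ask q' \<Rightarrow> q' < states M
        | Next q' acts \<Rightarrow> q' < states M \<and> length acts = tapes M))"

text \<open>Tapes are two-way infinite and are shifted relative to the head, which always scans cell 0.\<close>

type_synonym tape = "int \<Rightarrow> symbol"

fun update_tape :: "symbol \<times> move \<Rightarrow> tape \<Rightarrow> tape" where
  "update_tape (s, Left) t = (\<lambda>i. (t(0 := s)) (i - 1))"
| "update_tape (s, Right) t = (\<lambda>i. (t(0 := s)) (i + 1))"
| "update_tape (s, Stay) t = t(0 := s)"

text \<open>The word on a tape: from the head rightwards up to the first blank.\<close>

definition word :: "tape \<Rightarrow> symbol list" where
  "word t = map (\<lambda>i. t (int i)) [0..<(LEAST n. t (int n) = Blank)]"

definition tape_of :: "symbol list \<Rightarrow> tape" where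
  "tape_of w = (\<lambda>i. if 0 \<le> i \<and> i < int (length w) then w ! nat i else Blank)"

fun binary_digits :: "nat \<Rightarrow> bool list" where
  "binary_digits n = (if n = 0 then [] else odd n # binary_digits (n div 2))"

declare binary_digits.simps [simp del]

text \<open>A rational is written as sign, numerator, slash, denominator, in binary with the least
  significant digit first. In outputs the fraction need not be in lowest terms.\<close>

definition encode_rat :: "rat \<Rightarrow> symbol list" where
  "encode_rat q = (let (a, b) = quotient_of q in
     (if a < 0 then [Minus] else []) @ map Bit (binary_digits (nat \<bar>a\<bar>)) @ [Slash]
       @ map Bit (binary_digits (nat b)))"

definition denotes_rat :: "symbol list \<Rightarrow> rat \<Rightarrow> bool" where
  "denotes_rat w q \<longleftrightarrow> (\<exists>s as bs.
     w = (if s then [Minus] else []) @ map Bit as @ [Slash] @ map Bit bs \<and>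
     horner_sum of_bool 2 bs \<noteq> (0::rat) \<and>
     q = (if s then - 1 else 1) * horner_sum of_bool 2 as / horner_sum of_bool 2 bs)"

definition denotes_vec :: "symbol list \<Rightarrow> rat ^ ('n::enum) \<Rightarrow> bool" where
  "denotes_vec w x \<longleftrightarrow> (\<exists>us. w = concat (map (\<lambda>u. u @ [Comma]) us) \<and>
     list_all2 denotes_rat us (vec_list x))"

text \<open>Questions are in unary, as is usual for the precision of an oracle for a real number.\<close>

fun encode_question :: "question \<Rightarrow> symbol list" where
  "encode_question (Coord j n) = replicate j (Bit True) @ [Comma] @ replicate n (Bit True)"
| "encode_question (Extra i) = Slash # replicate i (Bit True)"

text \<open>A configuration consists of the state and the tapes; the initial state is 0.\<close>

fun tm_step :: "tm \<Rightarrow> orc \<Rightarrow> nat \<times> tape list \<Rightarrow> nat \<times> tape list" where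
  "tm_step M Q (q, ts) = (case trans M q (map (\<lambda>t. t 0) ts) of
     Stop \<Rightarrow> (q, ts)
   | Ask q' \<Rightarrow> (if \<exists>k a. word (ts ! 1) = encode_question k \<and> Q k = Some a
       then (q', ts[1 := tape_of (encode_rat
          (the (Q (THE k. word (ts ! 1) = encode_question k))))])
       else (q, ts))
   | Next q' acts \<Rightarrow> (q', map2 update_tape acts ts))"

definition tm_halts :: "tm \<Rightarrow> orc \<Rightarrow> symbol list \<Rightarrow> bool" where
  "tm_halts M Q w \<longleftrightarrow> (\<exists>n q ts.
     (tm_step M Q ^^ n) (0, replicate (tapes M) (\<lambda>_. Blank)) = (q, ts) \<and>
     trans M q (map (\<lambda>t. t 0) ts) = Stop \<and> w = word (ts ! 0))"

subsection \<open>BSS machines\<close>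

text \<open>The state space consists of two-way infinite sequences of reals with finitely many nonzero
  entries, with shift nodes. Division by zero, which a program can avoid by branching, gives 0.
  \<open>GetCoord i j k\<close> asks for \<open>f\<^bsub>j,n\<^esub>\<close> with \<open>j\<close> and \<open>n\<close> the contents of cells \<open>j\<close> and \<open>k\<close>.\<close>

datatype instr =
    Const nat real | Copy nat nat
  | Add nat nat nat | Sub nat nat nat | Mul nat nat nat | Div nat nat nat
  | BranchNonneg nat nat | ShiftLeft | ShiftRight
  | GetCoord nat nat nat | GetExtra nat nat

type_synonym cells = "int \<Rightarrow> real"

fun exec :: "orc \<Rightarrow> instr \<Rightarrow> nat \<times> cells \<Rightarrow> nat \<times> cells" where
  "exec Q (Const i c) (pc, x) = (Suc pc, x(int i := c))"
| "exec Q (Copy i j) (pc, x) = (Suc pc, x(int i := x (int j)))"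
| "exec Q (Add i j k) (pc, x) = (Suc pc, x(int i := x (int j) + x (int k)))"
| "exec Q (Sub i j k) (pc, x) = (Suc pc, x(int i := x (int j) - x (int k)))"
| "exec Q (Mul i j k) (pc, x) = (Suc pc, x(int i := x (int j) * x (int k)))"
| "exec Q (Div i j k) (pc, x) = (Suc pc, x(int i := x (int j) / x (int k)))"
| "exec Q (BranchNonneg i l) (pc, x) = (if 0 \<le> x (int i) then l else Suc pc, x)"
| "exec Q ShiftLeft (pc, x) = (Suc pc, \<lambda>i. x (i + 1))"
| "exec Q ShiftRight (pc, x) = (Suc pc, \<lambda>i. x (i - 1))"
| "exec Q (GetCoord i j k) (pc, x) =
     (if x (int j) \<in> \<nat> \<and> x (int k) \<in> \<nat> then
        (case Q (Coord (nat \<lfloor>x (int j)\<rfloor>) (nat \<lfloor>x (int k)\<rfloor>)) of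
           None \<Rightarrow> (pc, x) | Some a \<Rightarrow> (Suc pc, x(int i := of_rat a)))
      else (pc, x))"
| "exec Q (GetExtra i j) (pc, x) =
     (if x (int j) \<in> \<nat> then
        (case Q (Extra (nat \<lfloor>x (int j)\<rfloor>)) of
           None \<Rightarrow> (pc, x) | Some a \<Rightarrow> (Suc pc, x(int i := of_rat a)))
      else (pc, x))"

text \<open>A program halts when the program counter is no longer the index of an instruction.\<close>

fun bss_step :: "instr list \<Rightarrow> orc \<Rightarrow> nat \<times> cells \<Rightarrow> nat \<times> cells" where
  "bss_step P Q (pc, x) = (if pc < length P then exec Q (P ! pc) (pc, x) else (pc, x))"

definition bss_halts :: "instr list \<Rightarrow> orc \<Rightarrow> cells \<Rightarrow> bool" where
  "bss_halts P Q x \<longleftrightarrow>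
     (\<exists>n pc. (bss_step P Q ^^ n) (0, \<lambda>_. 0) = (pc, x) \<and> length P \<le> pc)"

subsection \<open>Machines of either kind\<close>

datatype machine = is_Turing: Turing tm | is_BSS: BSS "instr list"

fun wf_machine :: "machine \<Rightarrow> bool" where
  "wf_machine (Turing M) = wf_tm M"
| "wf_machine (BSS P) = True"

fun outputs_vec :: "machine \<Rightarrow> orc \<Rightarrow> real ^ ('n::enum) \<Rightarrow> bool" where
  "outputs_vec (Turing M) Q x \<longleftrightarrow> (\<exists>w v. tm_halts M Q w \<and> denotes_vec w v \<and> x = rvec v)"
| "outputs_vec (BSS P) Q x \<longleftrightarrow>
     (\<exists>c. bss_halts P Q c \<and> vec_list x = map (\<lambda>i. c (int i)) [0..<CARD('n)])"

fun outputs_bit :: "machine \<Rightarrow> orc \<Rightarrow> bool \<Rightarrow> bool" where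
  "outputs_bit (Turing M) Q b \<longleftrightarrow> tm_halts M Q [Bit b]"
| "outputs_bit (BSS P) Q b \<longleftrightarrow> (\<exists>c. bss_halts P Q c \<and> c 0 = of_bool b)"

definition realises ::
    "machine \<Rightarrow> ('m::enum, 'n::enum) input set \<Rightarrow> (('m, 'n) rep, 'e, real ^ ('n::enum)) alg \<Rightarrow> bool" where
  "realises M \<Omega> \<Gamma> \<longleftrightarrow> wf_machine M \<and>
     (\<forall>r\<in>reps \<Omega>. \<forall>x. result \<Gamma> r = Some x \<longleftrightarrow> outputs_vec M (orc r []) x)"

section \<open>The class of inputs\<close>

definition admissible ::
    "problem \<Rightarrow> ereal \<Rightarrow> real \<Rightarrow> ('m::finite, 'n::enum) input set
     \<Rightarrow> (('m, 'n) rep, ('m, 'n) coord \<times> nat, real ^ ('n::enum)) alg \<Rightarrow> bool" where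
  "admissible pr p \<alpha> \<Omega> \<Gamma> \<longleftrightarrow> general_algorithm ev_rep (reps \<Omega>) \<Gamma> \<and>
     (\<forall>r\<in>reps \<Omega>. err p (result \<Gamma> r) (\<Union>\<iota>\<in>\<Omega>. Sol pr \<iota>) < ennreal \<alpha>)"

definition well_conditioned :: "problem \<Rightarrow> ('m::finite, 'n::enum) input set \<Rightarrow> bool" where
  "well_conditioned pr \<Omega> \<longleftrightarrow> Cond_Sol pr \<Omega> \<le> 179 \<and>
     (\<forall>(y, A)\<in>\<Omega>. Cond_mat (A ** transpose A) \<le> ereal (32 / 10) \<and>
        (is_LP pr \<or> is_BP pr \<longrightarrow> C_FP pr \<Omega> (y, A) \<le> 4) \<and>
        infnorm y \<le> 2 \<and> max_entry A = 1)"

end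

theory Submission
  imports Defs
begin

text \<open>The inputs of the class differ in a single matrix entry \<open>t\<close>, equal to \<open>0\<close> or to \<open>\<plusminus>3 / 2\<^sup>m\<close> with \<open>m\<close>
  large. At \<open>t = 0\<close> the solution set contains two points \<open>s\<^sub>1\<close>, \<open>s\<^sub>2\<close> that are far apart, whereas the
  solution is unique and near \<open>s\<^sub>1\<close> for \<open>t > 0\<close>, and unique and near \<open>s\<^sub>2\<close> for \<open>t < 0\<close>. An output of
  \<open>\<Gamma>\<close> is \<open>\<alpha>\<close>-close to some solution, hence correct at \<open>t = 0\<close>, but it is far from \<open>s\<^sub>1\<close> or from \<open>s\<^sub>2\<close>.
  An input with a tiny \<open>t\<close> of the corresponding sign agrees with \<open>t = 0\<close> in any finite number of
  queries, admits the same oracle answer \<open>\<rho>\<close>, and has flag 0. Conversely, the flag 0 reveals \<open>t \<noteq> 0\<close>;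
  then a search for the sign of \<open>t\<close> ends and determines a correct output.

  In the class of the last part the solution at \<open>t = 0\<close> is unique and far from those for
  \<open>t > 0\<close>, and the oracle answer tells which case holds. The flag is 1 if and only if \<open>\<rho>\<close> and the output
  of \<open>\<Gamma>\<close>, whose first entries are compared with 1, point to the same case.

  Solutions are computed by means of dual vectors.\<close>

text \<open>The strict inequality \<omega> < 10^-K supplies the slack: M is taken so large that all
  solutions of the class lie within 10^-K - \<omega> of solutions at t = 0. Hence \<alpha>-closeness
  to any solution of the class gives correctness at t = 0, and two constant vectors near
  \<open>s1 0\<close> and \<open>s2 0\<close> are correct outputs for all t of the respective sign.
  Since K \<ge> 1, the separation of more than 1/5 exceeds 2 * 10^-K.

  The conditioning bounds shape the family. Only one entry is active and every real value of it
  gives a feasible input, so no infeasible input lies in the active hull and C_FP is 0. The many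
  solutions at t = 0 do not spoil Cond(\<Xi>), because the distance of solution sets is an infimum
  over pairs: a nearby unique solution only has to be close to one of them.

  In the positive results the size of t is unknown. Answers of increasing precision n are requested
  until one is at least 2 / 2^n in absolute value, which fixes the sign. A Turing machine receives
  reduced fractions and tests the numerator instead.\<close>

lemma represents_unique:
  fixes r :: "('m::finite, 'n::finite) rep"
  assumes "represents r x" "represents r y"
  shows "x = y"
proof -
  have eq: "coord x j = coord y j" for j
  proof (rule ccontr)
    assume "coord x j \<noteq> coord y j"
    define e where "e = \<bar>coord x j - coord y j\<bar>"
    have "0 < e / 2" using \<open>coord x j \<noteq> coord y j\<close> by (simp add: e_def)
    then obtain n where n: "(1 / 2) ^ n < e / 2"
      using real_arch_pow_inv[of "e / 2" "1 / 2"] by auto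
    have "\<bar>of_rat (r j n) - coord x j\<bar> \<le> (1 / 2) ^ n" "\<bar>of_rat (r j n) - coord y j\<bar> \<le> (1 / 2) ^ n"
      using assms by (auto simp: represents_def power_one_over)
    then have "e \<le> (1 / 2) ^ n + (1 / 2) ^ n" by (simp only: e_def abs_le_iff) linarith
    then show False using n by argo
  qed
  obtain a A b B where xy: "x = (a, A)" "y = (b, B)" by (cases x, cases y)
  have "a = b" using eq[of "Inl _"] by (simp add: xy vec_eq_iff)
  moreover have "A = B" using eq[of "Inr (_, _)"] by (simp add: xy vec_eq_iff)
  ultimately show ?thesis by (simp add: xy)
qed

lemma represented_eq: "represents r \<iota> \<Longrightarrow> represented r = \<iota>"
  unfolding represented_def using represents_unique by blast

lemma coord_le_infnorm:
  fixes z :: "('m::finite, 'n::finite) input"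
  shows "\<bar>coord z j\<bar> \<le> infnorm z"
proof -
  obtain a A where z: "z = (a, A)" by (cases z)
  show ?thesis
  proof (cases j)
    case (Inl i)
    have "(axis i 1, 0) \<in> (Basis :: ('m, 'n) input set)"
      by (auto simp: Basis_prod_def axis_in_Basis_iff)
    from Basis_le_infnorm[OF this, of z] show ?thesis
      by (simp add: z Inl inner_axis)
  next
    case (Inr p)
    obtain i k where p: "p = (i, k)" by (cases p)
    have "(0, axis i (axis k 1)) \<in> (Basis :: ('m, 'n) input set)"
      by (auto simp: Basis_prod_def axis_in_Basis_iff)
    from Basis_le_infnorm[OF this, of z] show ?thesis
      by (simp add: z Inr p inner_axis)
  qed
qed

lemma coord_add: "coord (x + z) j = coord x j + coord z j"
  by (cases "(x, j)" rule: coord.cases; cases z) auto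

lemma coord_eqI: "(\<And>j. coord x j = coord y j) \<Longrightarrow> x = y"
  for x y :: "('m::finite, 'n::finite) input"
proof -
  assume eq: "\<And>j. coord x j = coord y j"
  obtain a A b B where xy: "x = (a, A)" "y = (b, B)" by (cases x, cases y)
  have "a = b" using eq[of "Inl _"] by (simp add: xy vec_eq_iff)
  moreover have "A = B" using eq[of "Inr (_, _)"] by (simp add: xy vec_eq_iff)
  ultimately show ?thesis by (simp add: xy)
qed

section \<open>Norms and errors\<close>

lemma nth_le_infnorm: "\<bar>x $ i\<bar> \<le> infnorm x" for x :: "real ^ 'n"
  using Basis_le_infnorm[of "axis i 1" x] by (simp add: axis_in_Basis_iff inner_axis)

lemma infnorm_le_iff: "infnorm x \<le> c \<longleftrightarrow> (\<forall>i. \<bar>x $ i\<bar> \<le> c)" for x :: "real ^ 'n"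
proof
  assume "infnorm x \<le> c"
  then show "\<forall>i. \<bar>x $ i\<bar> \<le> c" using nth_le_infnorm order_trans by blast
next
  assume "\<forall>i. \<bar>x $ i\<bar> \<le> c"
  then show "infnorm x \<le> c"
    unfolding infnorm_Max by (auto simp: Basis_vec_def inner_axis)
qed

lemma infnorm_le_pnorm:
  assumes "1 \<le> p" shows "infnorm x \<le> pnorm p (x :: real ^ 'n)"
proof (cases p)
  case (real q)
  then have q: "1 \<le> q" using assms by simp
  show ?thesis unfolding infnorm_le_iff
  proof
    fix i
    have "\<bar>x $ i\<bar> = (\<bar>x $ i\<bar> powr q) powr (1 / q)" using q by (simp add: powr_powr)
    also have "\<dots> \<le> (\<Sum>i\<in>UNIV. \<bar>x $ i\<bar> powr q) powr (1 / q)"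
      using q by (intro powr_mono2 member_le_sum) auto
    finally show "\<bar>x $ i\<bar> \<le> pnorm p x" by (simp add: pnorm_def real)
  qed
qed (use assms in \<open>auto simp: pnorm_def\<close>)

text \<open>The factor is crude but serves every p in [1, \<infinity>] at once, so all later
  estimates can be made in the maximum norm.\<close>

lemma pnorm_le_infnorm:
  assumes "1 \<le> p" shows "pnorm p (x :: real ^ 'n) \<le> CARD('n) * infnorm x"
proof (cases p)
  case (real q)
  then have q: "1 \<le> q" using assms by simp
  have c: "1 \<le> real CARD('n)" by (simp add: Suc_leI)
  have "(\<Sum>i\<in>UNIV. \<bar>x $ i\<bar> powr q) \<le> CARD('n) * infnorm x powr q"
    using q nth_le_infnorm[of x] sum_mono[of UNIV "\<lambda>i. \<bar>x $ i\<bar> powr q" "\<lambda>_. infnorm x powr q"]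
    by (simp add: powr_mono2)
  then have "pnorm p x \<le> (CARD('n) * infnorm x powr q) powr (1 / q)"
    using q by (simp add: pnorm_def real powr_mono2 sum_nonneg)
  also have "\<dots> = CARD('n) powr (1 / q) * infnorm x"
    using q by (simp add: powr_mult powr_powr infnorm_pos_le)
  also have "\<dots> \<le> CARD('n) powr 1 * infnorm x"
    using q c by (intro mult_right_mono powr_mono) (auto simp: infnorm_pos_le)
  finally show ?thesis using c by simp
next
  case PInf
  have "1 \<le> real CARD('n)" by (simp add: Suc_leI)
  then show ?thesis using mult_right_mono[of 1 "real CARD('n)" "infnorm x"]
    by (simp add: pnorm_def PInf infnorm_pos_le)
qed (use assms in auto)

lemma err_Some_less:
  assumes "err p v S < ennreal a"
  obtains x \<xi> where "v = Some x" "\<xi> \<in> S" "pnorm p (x - \<xi>) < a"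
proof (cases v)
  case None
  then show ?thesis using assms by (simp add: err_def)
next
  case (Some x)
  then obtain \<xi> where "\<xi> \<in> S" "ennreal (pnorm p (x - \<xi>)) < ennreal a"
    using assms by (auto simp: err_def Inf_less_iff)
  moreover from this have "pnorm p (x - \<xi>) < a"
    using ennreal_leI[of a "pnorm p (x - \<xi>)"] by (meson leI leD)
  ultimately show ?thesis using that Some by blast
qed

lemma err_Some_le: "\<xi> \<in> S \<Longrightarrow> pnorm p (x - \<xi>) \<le> c \<Longrightarrow> err p (Some x) S \<le> ennreal c"
  unfolding err_def by (auto intro!: INF_lower2[of \<xi>] ennreal_leI)

lemma pnorm_nonneg: "0 \<le> pnorm p x"
  by (simp add: pnorm_def infnorm_pos_le)

lemma err_singleton_le_iff:
  "0 \<le> c \<Longrightarrow> err p (Some x) {\<xi>} \<le> ennreal c \<longleftrightarrow> pnorm p (x - \<xi>) \<le> c"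
  by (simp add: err_def pnorm_nonneg)

section \<open>Indistinguishable inputs defeat deterministic and randomised algorithms\<close>

lemma not_det_computable:
  assumes "x0 \<in> I"
    and "\<And>F. finite F \<Longrightarrow> \<exists>x\<in>I. (\<forall>e\<in>F. val e x = val e x0) \<and> f x \<noteq> f x0"
  shows "\<not> det_computable val I f"
proof
  assume "det_computable val I f"
  then obtain A where A: "general_algorithm val I A" "\<And>x. x \<in> I \<Longrightarrow> result A x = Some (f x)"
    unfolding det_computable_def by blast
  \<comment> \<open>Halting at \<open>x0\<close> makes the set of queries finite; this set serves as
    \<open>F\<close>.\<close>
  have "result A x0 \<noteq> None" using A(2) assms(1) by simp
  then have "finite (queries A x0)"
    using A(1) assms(1) unfolding general_algorithm_def by blast
  then obtain x where "x \<in> I" "\<forall>e\<in>queries A x0. val e x = val e x0" "f x \<noteq> f x0"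
    using assms(2) by blast
  moreover from this have "result A x = result A x0"
    using A(1) assms(1) unfolding general_algorithm_def by blast
  ultimately show False using A(2) assms(1) by auto
qed

text \<open>By continuity from below, already the algorithms that succeed at \<open>x0\<close> with queries among
  \<open>g 0, \<dots>, g n\<close> have probability greater than \<open>1/2\<close> for some \<open>n\<close>; this event is not affected by
  moving to an indistinguishable input \<open>x\<close>, where it is an event of failure.\<close>

lemma not_rand_computable:
  fixes f :: "'i \<Rightarrow> 'v" and val :: "'e \<Rightarrow> 'i \<Rightarrow> rat"
  assumes x0: "x0 \<in> I"
    and near: "\<And>F. finite F \<Longrightarrow> \<exists>x\<in>I. (\<forall>e\<in>F. val e x = val e x0) \<and> f x \<noteq> f x0"
    and q: "1 / 2 < q"
  shows "\<not> rand_computable val I q f"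
proof
  assume "rand_computable val I q f"
  then obtain g :: "nat \<Rightarrow> 'e" and X F P where g: "bij g"
    and ra: "randomised_algorithm val g I X F P" and suc: "succeeds I X P q f"
    unfolding rand_computable_def by blast
  note ra' = ra[unfolded randomised_algorithm_def]
  note r2 = ra'[THEN conjunct2, THEN conjunct2] and r4 = ra'[THEN conjunct2, THEN conjunct2, THEN conjunct2, THEN conjunct2]
  have GA: "\<And>A. A \<in> X \<Longrightarrow> general_algorithm val I A"
    using ra'[THEN conjunct1] by (rule bspec)
  have PS: "prob_space (P x)" and sp: "space (P x) = X" and st: "sets (P x) = F" if "x \<in> I" for x
    using bspec[OF r2[THEN conjunct1] that] by blast+
  have P1: "(\<lambda>A. result A x) \<in> measurable (P x) (count_space UNIV)" if "x \<in> I" for x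
    using r2[THEN conjunct2, THEN conjunct1] that by (rule bspec)
  have P2: "{A\<in>X. (SUP k\<in>{k. g k \<in> queries A x}. enat k) \<le> enat n} \<in> F" if "x \<in> I" for x n
    using bspec[OF r4[THEN conjunct1] that] by (rule spec)
  have P3: "measure (P x1) E = measure (P x2) E"
    if "E \<in> F" "x1 \<in> I" "x2 \<in> I" "\<forall>A\<in>E. \<forall>e\<in>queries A x1. val e x1 = val e x2" for E x1 x2
    using r4[THEN conjunct2] that by blast
  define S where "S = {A\<in>X. result A x0 = Some (f x0)}"
  have good: "{A\<in>X. result A x = Some w} \<in> F" if "x \<in> I" for x w
  proof -
    have "(\<lambda>A. result A x) -` {Some w} \<inter> space (P x) \<in> sets (P x)"
      by (rule measurable_sets[OF P1[OF that]]) simp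
    moreover have "(\<lambda>A. result A x) -` {Some w} \<inter> space (P x) = {A\<in>X. result A x = Some w}"
      using sp[OF that] by auto
    ultimately show ?thesis using st[OF that] by simp
  qed
  define B where "B n = {A\<in>X. (SUP k\<in>{k. g k \<in> queries A x0}. enat k) \<le> enat n} \<inter> S" for n
  have BF: "B n \<in> F" for n
    unfolding B_def S_def st[OF x0, symmetric]
    by (intro sets.Int) (use P2[OF x0] good[OF x0] st[OF x0] in auto)
  interpret prob_space "P x0" using PS[OF x0] .
  have inc: "incseq B" unfolding B_def incseq_def by (auto intro: order_trans)
  have un: "(\<Union>n. B n) = S"
  proof
    show "S \<subseteq> (\<Union>n. B n)"
    proof
      fix A assume A: "A \<in> S"
      then have "A \<in> X" "result A x0 \<noteq> None" by (auto simp: S_def)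
      then have "finite (queries A x0)"
        using GA x0 unfolding general_algorithm_def by blast
      then have "finite {k. g k \<in> queries A x0}"
        using g finite_vimageI[of "queries A x0" g] by (simp add: bij_is_inj vimage_def)
      then obtain n where "\<forall>k\<in>{k. g k \<in> queries A x0}. k \<le> n"
        by (meson finite_nat_set_iff_bounded_le)
      then have "(SUP k\<in>{k. g k \<in> queries A x0}. enat k) \<le> enat n"
        by (intro SUP_least) auto
      then show "A \<in> (\<Union>n. B n)" using A \<open>A \<in> X\<close> by (auto simp: B_def)
    qed
  qed (auto simp: B_def)
  have "(\<lambda>n. measure (P x0) (B n)) \<longlonglongrightarrow> measure (P x0) S"
    using finite_Lim_measure_incseq[of B] BF inc st[OF x0] un by auto
  moreover have "1 / 2 < measure (P x0) S"
    using suc x0 q unfolding succeeds_def S_def by force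
  ultimately have "eventually (\<lambda>n. 1 / 2 < measure (P x0) (B n)) sequentially"
    by (rule order_tendstoD)
  then obtain n where n: "1 / 2 < measure (P x0) (B n)"
    by (auto simp: eventually_sequentially)
  obtain x where x: "x \<in> I" "\<forall>e\<in>g ` {..n}. val e x = val e x0" "f x \<noteq> f x0"
    using near[of "g ` {..n}"] by auto
  have same: "val e x0 = val e x" if "A \<in> B n" "e \<in> queries A x0" for A e
  proof -
    obtain k where k: "e = g k" using g by (meson bij_pointE)
    have "enat k \<le> (SUP k\<in>{k. g k \<in> queries A x0}. enat k)"
      using that(2) k by (intro SUP_upper) auto
    also have "\<dots> \<le> enat n" using that(1) by (simp add: B_def)
    finally show ?thesis using x(2) k by auto
  qed
  have "measure (P x0) (B n) = measure (P x) (B n)"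
    using P3[OF BF x0 x(1)] same by blast
  moreover have "B n \<inter> {A\<in>X. result A x = Some (f x)} = {}"
  proof (rule ccontr)
    assume "B n \<inter> {A\<in>X. result A x = Some (f x)} \<noteq> {}"
    then obtain A where A: "A \<in> B n" "result A x = Some (f x)" by auto
    then have "A \<in> X" "result A x0 = Some (f x0)" by (auto simp: B_def S_def)
    moreover have "result A x = result A x0"
    proof -
      have "\<forall>e\<in>queries A x0. val e x = val e x0" using same[OF A(1)] by simp
      then show ?thesis
        using GA[OF \<open>A \<in> X\<close>] x(1) x0 unfolding general_algorithm_def by blast
    qed
    ultimately show False using A(2) x(3) by auto
  qed
  ultimately have "measure (P x) (B n \<union> {A\<in>X. result A x = Some (f x)}) > 1 / 2 + 1 / 2"
  proof -
    assume eq: "measure (P x0) (B n) = measure (P x) (B n)"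
      and dis: "B n \<inter> {A\<in>X. result A x = Some (f x)} = {}"
    interpret Q: prob_space "P x" using PS[OF x(1)] .
    have "q \<le> measure (P x) {A\<in>X. result A x = Some (f x)}"
      using suc x(1) unfolding succeeds_def by blast
    then show ?thesis
      using Q.finite_measure_Union[OF _ _ dis] BF good[OF x(1)] st[OF x(1)] eq n q by auto
  qed
  moreover have "measure (P x) (B n \<union> {A\<in>X. result A x = Some (f x)}) \<le> 1"
    using prob_space.prob_le_1[OF PS[OF x(1)]] .
  ultimately show False by simp
qed

lemma halting_rand_computable_imp_rand_computable:
  "halting_rand_computable val I q f \<Longrightarrow> rand_computable val I q f"
  unfolding halting_rand_computable_def rand_computable_def by blast

section \<open>Runs of Turing machines and contents of tapes\<close>

definition reach :: "tm \<Rightarrow> orc \<Rightarrow> nat \<times> tape list \<Rightarrow> nat \<times> tape list \<Rightarrow> bool" where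
  "reach M Q c c' \<longleftrightarrow> (\<exists>n. (tm_step M Q ^^ n) c = c')"

lemma reach_refl [simp]: "reach M Q c c"
  unfolding reach_def by (rule exI[of _ 0]) simp

lemma reach_trans [trans]: "reach M Q c c' \<Longrightarrow> reach M Q c' c'' \<Longrightarrow> reach M Q c c''"
  unfolding reach_def by (metis comp_apply funpow_add)

lemma reach_step: "tm_step M Q c = c' \<Longrightarrow> reach M Q c c'"
  unfolding reach_def by (rule exI[of _ 1]) simp

definition heads :: "tape list \<Rightarrow> symbol list" where "heads ts = map (\<lambda>t. t 0) ts"

lemma length_heads [simp]: "length (heads ts) = length ts"
  and nth_heads [simp]: "X < length ts \<Longrightarrow> heads ts ! X = (ts ! X) 0"
  by (simp_all add: heads_def)

definition stay :: "symbol list \<Rightarrow> (symbol \<times> move) list" where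
  "stay ss = map (\<lambda>s. (s, Stay)) ss"

lemma length_stay [simp]: "length (stay ss) = length ss"
  by (simp add: stay_def)

lemma map2_stay [simp]: "map2 update_tape (stay (heads ts)) ts = ts"
  by (rule nth_equalityI) (auto simp: stay_def heads_def)

lemma map2_update_tape_list_update:
  "length acts = length ts \<Longrightarrow>
   map2 update_tape (acts[X := a]) ts = (map2 update_tape acts ts)[X := update_tape a (ts ! X)]"
  by (cases "X < length ts") (auto intro!: nth_equalityI simp: nth_list_update list_update_beyond)

lemma tm_step_Next:
  "trans M q (heads ts) = Next q' acts \<Longrightarrow> tm_step M Q (q, ts) = (q', map2 update_tape acts ts)"
  by (simp add: heads_def)

lemma reach_Next:
  assumes "trans M q (heads ts) = Next q' acts" "reach M Q (q', map2 update_tape acts ts) c"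
  shows "reach M Q (q, ts) c"
  using reach_trans[OF reach_step[OF tm_step_Next[OF assms(1)]] assms(2)] .

lemma reach_Next1:
  "trans M q (heads ts) = Next q' acts \<Longrightarrow> reach M Q (q, ts) (q', map2 update_tape acts ts)"
  by (rule reach_step) (rule tm_step_Next)

lemma map2_stay_update [simp]:
  "map2 update_tape ((stay (heads ts))[i := u]) ts = ts[i := update_tape u (ts ! i)]"
  by (simp add: map2_update_tape_list_update)

lemma map2_stay_update2 [simp]:
  "map2 update_tape ((stay (heads ts))[i := u, j := v]) ts
    = ts[i := update_tape u (ts ! i), j := update_tape v (ts ! j)]"
  by (simp add: map2_update_tape_list_update)

text \<open>The machine step selects the question with \<open>THE\<close>, so unique readability is
  needed. A leading slash separates the two kinds; for \<open>Coord\<close>, the block before the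
  comma gives \<open>j\<close>, and the total length then gives \<open>n\<close>.\<close>

lemma encode_question_inj:
  assumes "encode_question k = encode_question k'"
  shows "k = k'"
proof -
  have tw: "takeWhile ((=) (Bit True)) (replicate j (Bit True) @ [Comma] @ ys) = replicate j (Bit True)"
    for j ys by (induction j) auto
  have c: "j = j' \<and> n = n'"
    if "replicate j (Bit True) @ [Comma] @ replicate n (Bit True)
      = replicate j' (Bit True) @ [Comma] @ replicate n' (Bit True)" for j j' n n'
  proof -
    have "j = j'" using arg_cong[OF that, of "\<lambda>w. length (takeWhile ((=) (Bit True)) w)"]
      by (simp only: tw length_replicate)
    then show ?thesis using arg_cong[OF that, of length] by simp
  qed
  have d: "replicate j (Bit True) @ [Comma] @ ys \<noteq> Slash # zs" for j ys zs
    by (cases j) auto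
  note eq = assms
  show "k = k'"
  proof (cases k)
    case k: (Coord j n)
    show ?thesis
    proof (cases k')
      case (Coord j' n')
      then show ?thesis using c[of j n j' n'] eq k by (simp only: encode_question.simps)
    next
      case (Extra i)
      then show ?thesis using d eq k by (simp only: encode_question.simps)
    qed
  next
    case k: (Extra i)
    show ?thesis
    proof (cases k')
      case (Coord j' n')
      then show ?thesis using d eq[symmetric] k by (simp only: encode_question.simps)
    next
      case (Extra i')
      then show ?thesis using arg_cong[OF eq, of length] k by simp
    qed
  qed
qed

lemma reach_Ask:
  assumes "trans M q (heads ts) = Ask q'" "word (ts ! 1) = encode_question k" "Q k = Some a"
  shows "reach M Q (q, ts) (q', ts[1 := tape_of (encode_rat a)])"
proof -
  have "(THE k. word (ts ! 1) = encode_question k) = k"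
    using assms(2) encode_question_inj by auto
  moreover have "\<exists>k a. word (ts ! 1) = encode_question k \<and> Q k = Some a"
    using assms by blast
  ultimately show ?thesis
    using assms by (intro reach_step) (simp add: heads_def)
qed

text \<open>Both predicates constrain finitely many cells only, here from the head rightwards, in
  \<open>lreads\<close> from the left neighbour of the head outwards. The rest of the tape may carry
  leftovers of an earlier computation, hence end markers are listed explicitly in
  \<open>w\<close>.\<close>

definition reads :: "tape \<Rightarrow> symbol list \<Rightarrow> bool" where
  "reads t w \<longleftrightarrow> (\<forall>i<length w. t (int i) = w ! i)"

definition lreads :: "tape \<Rightarrow> symbol list \<Rightarrow> bool" where
  "lreads t w \<longleftrightarrow> (\<forall>i<length w. t (- 1 - int i) = w ! i)"

lemma reads_Nil [simp]: "reads t []" and lreads_Nil [simp]: "lreads t []"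
  by (simp_all add: reads_def lreads_def)

lemma reads_Cons: "reads t (a # w) \<longleftrightarrow> t 0 = a \<and> reads (\<lambda>i. t (i + 1)) w"
proof
  assume r: "reads t (a # w)"
  have "t (int i + 1) = w ! i" if "i < length w" for i
    using r[unfolded reads_def, rule_format, of "Suc i"] that by (simp add: add.commute)
  then show "t 0 = a \<and> reads (\<lambda>i. t (i + 1)) w"
    using r[unfolded reads_def, rule_format, of 0] by (simp add: reads_def)
next
  assume r: "t 0 = a \<and> reads (\<lambda>i. t (i + 1)) w"
  show "reads t (a # w)" unfolding reads_def
  proof (intro allI impI)
    fix i assume "i < length (a # w)"
    then show "t (int i) = (a # w) ! i" using r by (cases i) (auto simp: reads_def add.commute)
  qed
qed

lemma lreads_Cons: "lreads t (a # w) \<longleftrightarrow> t (- 1) = a \<and> lreads (\<lambda>i. t (i - 1)) w"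
  unfolding lreads_def by (auto simp: All_less_Suc2 algebra_simps)

lemma reads_head: "reads t (a # w) \<Longrightarrow> t 0 = a"
  by (simp add: reads_Cons)

lemma reads_Right: "reads t (a # w) \<Longrightarrow> reads (update_tape (s, Right) t) w"
  unfolding reads_Cons by (auto simp: reads_def)

lemma lreads_Right: "lreads t l \<Longrightarrow> lreads (update_tape (s, Right) t) (s # l)"
  by (auto simp: lreads_Cons) (auto simp: lreads_def)

lemma reads_Left: "reads t (a # w) \<Longrightarrow> lreads t (b # l) \<Longrightarrow> reads (update_tape (s, Left) t) (b # s # w)"
  by (auto simp: reads_Cons lreads_Cons) (auto simp: reads_def add.commute)

lemma reads_Left': "reads t (a # w) \<Longrightarrow> \<exists>b. reads (update_tape (s, Left) t) (b # s # w)"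
  by (auto simp: reads_Cons) (auto simp: reads_def add.commute)

lemma lreads_Left: "lreads t (b # l) \<Longrightarrow> lreads (update_tape (s, Left) t) l"
  unfolding lreads_Cons by (auto simp: lreads_def)

lemma word_eqI:
  assumes "reads t (w @ [Blank])" "Blank \<notin> set w"
  shows "word t = w"
proof -
  have "(LEAST n. t (int n) = Blank) = length w"
  proof (rule Least_equality)
    show "t (int (length w)) = Blank" using assms(1) by (auto simp: reads_def nth_append)
    fix n assume "t (int n) = Blank"
    show "length w \<le> n"
    proof (rule ccontr)
      assume "\<not> length w \<le> n"
      then have "t (int n) = w ! n" "w ! n \<in> set w"
        using assms(1) by (auto simp: reads_def nth_append)
      then show False using assms(2) \<open>t (int n) = Blank\<close> by auto
    qed
  qed
  then show ?thesis
    unfolding word_def using assms(1)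
    by (intro nth_equalityI) (auto simp: reads_def nth_append)
qed

lemma reads_word: "reads t (word t)"
  by (simp add: reads_def word_def)

lemma reads_appendD: "reads t (v @ w) \<Longrightarrow> reads t v"
  unfolding reads_def by (metis length_append nth_append trans_less_add1)

lemma reads_tape_of: "reads (tape_of w) (w @ [Blank])"
  by (auto simp: reads_def tape_of_def nth_append)

text \<open>Letters are supplied in reverse, so that the head ends next to the first letter of the
  finished word, where \<open>word\<close> starts reading; one move to the right completes
  it.\<close>

definition write_left :: "symbol list \<Rightarrow> tape \<Rightarrow> tape" where
  "write_left w t = fold (\<lambda>s. update_tape (s, Left)) w t"

lemma write_left_simps [simp]:
  "write_left [] t = t" "write_left (s # w) t = write_left w (update_tape (s, Left) t)"
  "write_left (w @ v) t = write_left v (write_left w t)"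
  by (simp_all add: write_left_def)

lemma reads_write_left:
  assumes "reads t (x # r)" shows "\<exists>b. reads (write_left w t) (b # rev w @ r)"
  using assms
proof (induction w arbitrary: x r t)
  case (Cons s w)
  obtain b where "reads (update_tape (s, Left) t) (b # s # r)" using reads_Left' Cons.prems by blast
  from Cons.IH[OF this] show ?case by simp
qed auto

lemma reads_write_left_Right:
  "reads (update_tape (s, Right) (write_left w t)) (rev w)"
proof -
  obtain b where "reads (write_left w t) (b # rev w @ [])"
    using reads_write_left[of t "t 0" "[]" w] by (auto simp: reads_Cons)
  then show ?thesis using reads_Right by fastforce
qed

definition write_segment :: "nat \<Rightarrow> symbol list \<Rightarrow> nat \<Rightarrow> (symbol list \<Rightarrow> action) list" where
  "write_segment X w b = map (\<lambda>i ss. Next (b + i + 1) ((stay ss)[X := (w ! i, Left)])) [0..<length w]"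

lemma reach_write_segment:
  assumes "\<And>i ss. i < length w \<Longrightarrow> trans M (b + i) ss = Next (b + i + 1) ((stay ss)[X := (w ! i, Left)])"
    and "X < length ts"
  shows "reach M Q (b, ts) (b + length w, ts[X := write_left w (ts ! X)])"
  using assms
proof (induction w arbitrary: b ts)
  case (Cons s w)
  let ?t = "update_tape (s, Left) (ts ! X)"
  have "trans M (b + 1 + i) ss = Next (b + 1 + i + 1) ((stay ss)[X := (w ! i, Left)])"
    if "i < length w" for i ss
    using Cons.prems(1)[of "Suc i" ss] that by simp
  from Cons.IH[OF this, of "ts[X := ?t]"]
  have "reach M Q (b + 1, ts[X := ?t]) (b + 1 + length w, ts[X := write_left w ?t])"
    using Cons.prems(2) by simp
  moreover have "trans M b (heads ts) = Next (b + 1) ((stay (heads ts))[X := (s, Left)])"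
    using Cons.prems(1)[of 0] by simp
  moreover have "map2 update_tape ((stay (heads ts))[X := (s, Left)]) ts = ts[X := ?t]"
    by (simp only: map2_update_tape_list_update length_stay length_heads map2_stay)
  ultimately have "reach M Q (b, ts) (b + 1 + length w, ts[X := write_left w ?t])"
    by (metis reach_Next)
  then show ?case by simp
qed simp

section \<open>Extending a Turing machine by a program that runs on its final configuration\<close>

text \<open>The list \<open>cs\<close> holds one transition function per new state. \<open>M\<close>
  acts on its own tapes only, so the \<open>e\<close> extra tapes are still blank when its halting
  leads into the program.\<close>

definition extend :: "tm \<Rightarrow> nat \<Rightarrow> (symbol list \<Rightarrow> action) list \<Rightarrow> tm" where
  "extend M e cs = TM (states M + length cs) (tapes M + e)
     (\<lambda>q ss. if q < states M then
        (case trans M q (take (tapes M) ss) of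
           Stop \<Rightarrow> Next (states M) (stay ss)
         | Ask q' \<Rightarrow> Ask q'
         | Next q' acts \<Rightarrow> Next q' (acts @ stay (drop (tapes M) ss)))
      else (cs ! (q - states M)) ss)"

fun valid_action :: "nat \<Rightarrow> nat \<Rightarrow> action \<Rightarrow> bool" where
  "valid_action S T Stop \<longleftrightarrow> True"
| "valid_action S T (Ask q) \<longleftrightarrow> q < S"
| "valid_action S T (Next q acts) \<longleftrightarrow> q < S \<and> length acts = T"

lemma valid_action_case:
  "valid_action S T a \<longleftrightarrow> (case a of Stop \<Rightarrow> True | Ask q' \<Rightarrow> q' < S
     | Next q' acts \<Rightarrow> q' < S \<and> length acts = T)"
  by (cases a) auto

lemma wf_tm_iff:
  "wf_tm M \<longleftrightarrow> 1 \<le> states M \<and> 2 \<le> tapes M \<and>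
     (\<forall>q<states M. \<forall>ss. length ss = tapes M \<longrightarrow> valid_action (states M) (tapes M) (trans M q ss))"
  unfolding wf_tm_def valid_action_case ..

lemma wf_extend:
  assumes "wf_tm M" "cs \<noteq> []"
    and "\<And>c ss. c \<in> set cs \<Longrightarrow> length ss = tapes M + e \<Longrightarrow>
      valid_action (states M + length cs) (tapes M + e) (c ss)"
  shows "wf_tm (extend M e cs)"
proof -
  have "valid_action (states M + length cs) (tapes M + e) (trans (extend M e cs) q ss)"
    if q: "q < states M + length cs" and ss: "length ss = tapes M + e" for q ss
  proof (cases "q < states M")
    case True
    have "valid_action (states M) (tapes M) (trans M q (take (tapes M) ss))"
      using assms(1) True ss unfolding wf_tm_iff by auto
    then show ?thesis
      using True assms(1,2) ss unfolding extend_def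
      by (cases "trans M q (take (tapes M) ss)") auto
  next
    case False
    then have "cs ! (q - states M) \<in> set cs" using q by auto
    then show ?thesis using False assms(3) ss by (simp add: extend_def)
  qed
  then show ?thesis
    using assms(1,2) unfolding wf_tm_iff by (auto simp: extend_def)
qed

lemma trans_extend:
  "i < length cs \<Longrightarrow> trans (extend M e cs) (states M + i) = cs ! i"
  by (auto simp: extend_def)

text \<open>A configuration in which \<open>M\<close> waits for an answer is a fixed point of its step function, hence
  the induction on the number of steps also covers it.\<close>

lemma reach_extend:
  assumes "wf_tm M" "\<And>k a. Q k = Some a \<Longrightarrow> Q' k = Some a"
    and "q < states M" "length ts = tapes M" "length zs = e"
    and "(tm_step M Q ^^ n) (q, ts) = (q', ts')" "trans M q' (heads ts') = Stop"
  shows "reach (extend M e cs) Q' (q, ts @ zs) (states M, ts' @ zs) \<and> length ts' = tapes M"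
  using assms(3-)
proof (induction n arbitrary: q ts)
  case 0
  then have "trans (extend M e cs) q (heads (ts @ zs)) = Next (states M) (stay (heads (ts @ zs)))"
    by (auto simp: extend_def heads_def)
  then show ?case using 0 reach_Next[of "extend M e cs" q "ts @ zs" _ _ Q' "(states M, ts @ zs)"]
    by auto
next
  case (Suc n)
  have tk: "take (tapes M) (heads (ts @ zs)) = heads ts"
    and dr: "drop (tapes M) (heads (ts @ zs)) = heads zs" using Suc.prems(2) by (simp_all add: heads_def)
  have next_steps: "(tm_step M Q ^^ n) (tm_step M Q (q, ts)) = (q', ts')"
    using Suc.prems(4) by (simp only: funpow_Suc_right comp_apply)
  have valid: "valid_action (states M) (tapes M) (trans M q (heads ts))"
    using assms(1) Suc.prems(1,2) unfolding wf_tm_iff by auto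
  show ?case
  proof (cases "trans M q (heads ts)")
    case Stop
    then have "tm_step M Q (q, ts) = (q, ts)" by (simp add: heads_def)
    then show ?thesis using Suc.IH[OF Suc.prems(1-3)] next_steps Suc.prems(5) by simp
  next
    case (Ask q1)
    show ?thesis
    proof (cases "\<exists>k a. word (ts ! 1) = encode_question k \<and> Q k = Some a")
      case True
      then obtain k a where k: "word (ts ! 1) = encode_question k" "Q k = Some a" by blast
      then have "(THE k. word (ts ! 1) = encode_question k) = k"
        using encode_question_inj by auto
      then have st: "tm_step M Q (q, ts) = (q1, ts[1 := tape_of (encode_rat a)])"
        using True k Ask by (simp add: heads_def)
      have "1 < tapes M" using assms(1) unfolding wf_tm_iff by simp
      then have "reach (extend M e cs) Q' (q, ts @ zs) (q1, (ts @ zs)[1 := tape_of (encode_rat a)])"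
        using Suc.prems(1,2) Ask tk k assms(2)
        by (intro reach_Ask[of _ _ _ _ k]) (auto simp: extend_def nth_append)
      moreover have "reach (extend M e cs) Q' (q1, ts[1 := tape_of (encode_rat a)] @ zs) (states M, ts' @ zs)
          \<and> length ts' = tapes M"
        using Suc.prems valid Ask next_steps st by (intro Suc.IH) auto
      ultimately show ?thesis
        using \<open>1 < tapes M\<close> Suc.prems(2) by (auto simp: list_update_append intro: reach_trans)
    next
      case False
      then have "tm_step M Q (q, ts) = (q, ts)"
        using Ask unfolding heads_def tm_step.simps by (simp only: action.case if_False)
      then show ?thesis using Suc.IH[OF Suc.prems(1-3)] next_steps Suc.prems(5) by simp
    qed
  next
    case (Next q1 acts)
    have st: "tm_step M Q (q, ts) = (q1, map2 update_tape acts ts)"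
      using Next by (rule tm_step_Next)
    have "reach (extend M e cs) Q' (q1, map2 update_tape acts ts @ zs) (states M, ts' @ zs)
        \<and> length ts' = tapes M"
      using Suc.prems valid Next next_steps st by (intro Suc.IH) auto
    moreover have "trans (extend M e cs) q (heads (ts @ zs)) = Next q1 (acts @ stay (heads zs))"
      using Next Suc.prems(1) tk dr by (simp add: extend_def)
    moreover have "map2 update_tape (acts @ stay (heads zs)) (ts @ zs) = map2 update_tape acts ts @ zs"
      using valid Next Suc.prems(2) by simp
    ultimately show ?thesis by (metis reach_Next)
  qed
qed

text \<open>\<open>M\<close> is known to halt with the oracle \<open>Q\<close> of the bare input,
  while the extension runs with \<open>Q'\<close>, which may also answer \<open>Extra\<close>. A
  question without an answer would make \<open>M\<close> hang, so a halting run only asks what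
  \<open>Q\<close> answers.\<close>

lemma extend_runs:
  assumes "wf_tm M" "\<And>k a. Q k = Some a \<Longrightarrow> Q' k = Some a" "tm_halts M Q w"
  obtains ts where "length ts = tapes M" "word (ts ! 0) = w"
    "reach (extend M e cs) Q' (0, replicate (tapes M + e) (\<lambda>_. Blank))
      (states M, ts @ replicate e (\<lambda>_. Blank))"
proof -
  obtain n q ts where "(tm_step M Q ^^ n) (0, replicate (tapes M) (\<lambda>_. Blank)) = (q, ts)"
    "trans M q (heads ts) = Stop" "w = word (ts ! 0)"
    using assms(3) unfolding tm_halts_def heads_def by blast
  moreover from this(1,2) have "reach (extend M e cs) Q'
     (0, replicate (tapes M) (\<lambda>_. Blank) @ replicate e (\<lambda>_. Blank)) (states M, ts @ replicate e (\<lambda>_. Blank))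
     \<and> length ts = tapes M"
    using assms(1,2) by (intro reach_extend[of M Q Q']) (auto simp: wf_tm_iff)
  ultimately show ?thesis using that[of ts] by (simp only: replicate_add)
qed

lemma tm_haltsI:
  assumes "reach M Q (0, replicate (tapes M) (\<lambda>_. Blank)) (q, ts)" "trans M q (heads ts) = Stop"
    and "word (ts ! 0) = w"
  shows "tm_halts M Q w"
  using assms unfolding tm_halts_def reach_def heads_def by blast

section \<open>Binary representations\<close>

lemma horner_sum_binary_digits: "horner_sum of_bool 2 (binary_digits n) = n"
proof (induction n rule: binary_digits.induct)
  case (1 n)
  show ?case
  proof (cases "n = 0")
    case False
    then show ?thesis using 1 by (subst binary_digits.simps) simp
  qed (simp add: binary_digits.simps)
qed

lemma of_nat_horner_sum:
  "horner_sum of_bool 2 as = (of_nat (horner_sum of_bool 2 as) :: 'a::comm_semiring_1)"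
  by (induction as) auto

lemma horner_sum_binary_digits_rat: "horner_sum of_bool 2 (binary_digits n) = (of_nat n :: rat)"
  by (subst of_nat_horner_sum) (simp add: horner_sum_binary_digits)

lemma denotes_encode_rat: "denotes_rat (encode_rat a) a"
proof -
  obtain p q where pq: "quotient_of a = (p, q)" by (cases "quotient_of a")
  then have q: "0 < q" and a: "a = of_int p / of_int q"
    by (simp_all add: quotient_of_denom_pos quotient_of_div)
  have "encode_rat a = (if p < 0 then [Minus] else []) @ map Bit (binary_digits (nat \<bar>p\<bar>)) @ [Slash]
      @ map Bit (binary_digits (nat q))"
    by (simp add: encode_rat_def pq)
  then show ?thesis unfolding denotes_rat_def
    by (intro exI[of _ "p < 0"] exI[of _ "binary_digits (nat \<bar>p\<bar>)"] exI[of _ "binary_digits (nat q)"])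
      (use q in \<open>auto simp: horner_sum_binary_digits_rat a\<close>)
qed

lemma Blank_notin_encode_rat: "Blank \<notin> set (encode_rat a)"
  by (auto simp: encode_rat_def split: prod.splits)

text \<open>Digits come least significant first, so a later difference overrides the verdict
  \<open>c\<close> on the digits before it. Missing digits count as 0, hence leading zeros, which an
  output may contain, are harmless.\<close>

fun cmp :: "bool \<Rightarrow> bool list \<Rightarrow> bool list \<Rightarrow> bool" where
  "cmp c [] [] = c"
| "cmp c (a # as) [] = cmp (a \<or> c) as []"
| "cmp c [] (b # bs) = cmp (\<not> b \<and> c) [] bs"
| "cmp c (a # as) (b # bs) = cmp (if a = b then c else a) as bs"

lemma cmp_iff:
  "cmp c as bs \<longleftrightarrow> (horner_sum of_bool 2 bs :: nat) < horner_sum of_bool 2 as \<or>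
     c \<and> horner_sum of_bool 2 bs = (horner_sum of_bool 2 as :: nat)"
  by (induction c as bs rule: cmp.induct) (auto simp: of_bool_def split: if_splits; presburger)+

text \<open>The program \<open>compare_prog X Y b\<close> is placed at states \<open>b, \<dots>, b + 4\<close> and decides whether the
  fraction on tape \<open>X\<close> is at least 1. It copies the numerator to tape \<open>Y\<close> and rewinds it, then
  compares it with the denominator, least significant digits first; the verdict so far is the
  choice between states \<open>b + 3\<close> and \<open>b + 4\<close>, and the final one is left on tape \<open>Y\<close>.\<close>

definition digit :: "symbol \<Rightarrow> bool" where "digit s \<longleftrightarrow> (\<exists>b. s = Bit b)"

lemma digit_simps [simp]: "digit (Bit b)" "\<not> digit Blank" "\<not> digit Minus" "\<not> digit Slash" "\<not> digit Comma"
  by (auto simp: digit_def)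

text \<open>A head that has reached the end of its number stays there, and every symbol other than
  \<open>Bit True\<close> counts as the digit 0; this realises the padding in
  \<open>cmp\<close>.\<close>

definition compare_digits :: "nat \<Rightarrow> nat \<Rightarrow> nat \<Rightarrow> bool \<Rightarrow> symbol list \<Rightarrow> action" where
  "compare_digits X Y b c ss =
     (if digit (ss ! X) \<or> digit (ss ! Y) then
        Next (if (if (ss ! Y = Bit True) = (ss ! X = Bit True) then c else ss ! Y = Bit True)
              then b + 4 else b + 3)
          ((stay ss)[X := (ss ! X, if digit (ss ! X) then Right else Stay),
                     Y := (ss ! Y, if digit (ss ! Y) then Right else Stay)])
      else Next (b + 5) ((stay ss)[Y := (Bit c, Stay)]))"

definition compare_prog :: "nat \<Rightarrow> nat \<Rightarrow> nat \<Rightarrow> (symbol list \<Rightarrow> action) list" where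
  "compare_prog X Y b =
    [\<lambda>ss. if ss ! X = Minus then Next (b + 5) ((stay ss)[Y := (Bit False, Stay)])
          else Next (b + 1) (stay ss),
     \<lambda>ss. if ss ! X = Slash then Next (b + 2) ((stay ss)[X := (Slash, Right), Y := (ss ! Y, Left)])
          else Next (b + 1) ((stay ss)[X := (ss ! X, Right), Y := (ss ! X, Right)]),
     \<lambda>ss. if ss ! Y = Blank then Next (b + 4) ((stay ss)[Y := (Blank, Right)])
          else Next (b + 2) ((stay ss)[Y := (ss ! Y, Left)]),
     compare_digits X Y b False, compare_digits X Y b True]"

locale compare_machine =
  fixes M :: tm and Q :: orc and X Y b T :: nat
  assumes trans: "\<And>i. i < 5 \<Longrightarrow> trans M (b + i) = compare_prog X Y b ! i"
    and XY: "X < T" "Y < T" "X \<noteq> Y"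
begin

lemma trans_compare:
  "trans M b = compare_prog X Y b ! 0" "trans M (Suc b) = compare_prog X Y b ! 1"
  "trans M (Suc (Suc b)) = compare_prog X Y b ! 2" "trans M (b + 3) = compare_prog X Y b ! 3"
  "trans M (b + 4) = compare_prog X Y b ! 4"
  using trans[of 0] trans[of 1] trans[of 2] trans[of 3] trans[of 4]
  by (simp_all add: numeral_eq_Suc)

lemma updates [simp]: "ts[X := p, Y := q, X := p', Y := q'] = ts[X := p', Y := q']"
  using XY by (simp add: list_update_swap[of Y X])

text \<open>The digits already copied lie to the left of the head on tape \<open>Y\<close>, closed
  off by a blank at which the rewinding will stop. The result refers to the tape \<open>tY\<close>
  before the final move to the left, which is the form needed for the induction that
  rewinds.\<close>

lemma copy_numerator:
  assumes "length ts = T" "reads (ts ! X) (map Bit as @ Slash # r)" "lreads (ts ! Y) (l @ [Blank])"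
    and "\<forall>i\<ge>0. (ts ! Y) i = Blank"
  shows "\<exists>tX tY. reach M Q (Suc b, ts) (Suc (Suc b), ts[X := tX, Y := update_tape (tY 0, Left) tY])
      \<and> reads tX r \<and> lreads tY (map Bit (rev as) @ l @ [Blank]) \<and> reads tY [Blank]"
  using assms
proof (induction as arbitrary: ts l)
  case Nil
  then have "(ts ! X) 0 = Slash" by (simp add: reads_Cons)
  then have "trans M (Suc b) (heads ts)
      = Next (Suc (Suc b)) ((stay (heads ts))[X := (Slash, Right), Y := ((ts ! Y) 0, Left)])"
    using Nil.prems(1) XY by (simp add: trans_compare compare_prog_def)
  from reach_Next1[OF this] have "reach M Q (Suc b, ts)
      (Suc (Suc b), ts[X := update_tape (Slash, Right) (ts ! X), Y := update_tape ((ts ! Y) 0, Left) (ts ! Y)])"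
    using XY by simp
  moreover have "reads (update_tape (Slash, Right) (ts ! X)) r"
    using Nil.prems(2) by (intro reads_Right) simp
  ultimately show ?case using Nil.prems
    by (intro exI[of _ "update_tape (Slash, Right) (ts ! X)"] exI[of _ "ts ! Y"])
      (auto simp: reads_Cons simp del: update_tape.simps)
next
  case (Cons a as)
  let ?tX = "update_tape (Bit a, Right) (ts ! X)" and ?tY = "update_tape (Bit a, Right) (ts ! Y)"
  let ?ts = "ts[X := ?tX, Y := ?tY]"
  have "(ts ! X) 0 = Bit a" using Cons.prems by (simp add: reads_Cons)
  then have "trans M (Suc b) (heads ts)
      = Next (Suc b) ((stay (heads ts))[X := (Bit a, Right), Y := (Bit a, Right)])"
    using Cons.prems(1) XY by (simp add: trans_compare compare_prog_def)
  from reach_Next1[OF this] have "reach M Q (Suc b, ts) (Suc b, ?ts)"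
    using XY by simp
  moreover have "\<exists>tX tY. reach M Q (Suc b, ?ts) (Suc (Suc b), ?ts[X := tX, Y := update_tape (tY 0, Left) tY])
      \<and> reads tX r \<and> lreads tY (map Bit (rev as) @ (Bit a # l) @ [Blank]) \<and> reads tY [Blank]"
    using Cons.prems XY reads_Right[of "ts ! X" "Bit a" _ "Bit a"]
      lreads_Right[of "ts ! Y" "l @ [Blank]" "Bit a"]
    by (intro Cons.IH) auto
  ultimately show ?case
    using XY by (auto simp: list_update_swap[of Y X] intro: reach_trans)
qed

lemma rewind_numerator:
  assumes "length ts = T" "reads tY w" "w \<noteq> []" "lreads tY (map Bit l @ [Blank])"
  shows "\<exists>tY'. reach M Q (Suc (Suc b), ts[Y := update_tape (tY 0, Left) tY]) (b + 4, ts[Y := tY'])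
      \<and> reads tY' (map Bit (rev l) @ w)"
  using assms
proof (induction l arbitrary: tY w)
  case Nil
  let ?t = "update_tape (tY 0, Left) tY"
  obtain x v where w: "w = x # v" using Nil.prems(3) by (cases w) auto
  have x: "tY 0 = x" using Nil.prems(2) w by (simp add: reads_Cons)
  have r: "reads ?t (Blank # x # v)"
    using reads_Left[of tY x v Blank "[]" x] Nil.prems w x by simp
  have "trans M (Suc (Suc b)) (heads (ts[Y := ?t]))
      = Next (b + 4) ((stay (heads (ts[Y := ?t])))[Y := (Blank, Right)])"
    using Nil.prems(1) XY reads_head[OF r] by (simp add: trans_compare compare_prog_def)
  from reach_Next1[OF this] have "reach M Q (Suc (Suc b), ts[Y := ?t]) (b + 4, ts[Y := update_tape (Blank, Right) ?t])"
    using XY Nil.prems(1) by simp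
  then show ?case using reads_Right[OF r] w by auto
next
  case (Cons a l)
  let ?t = "update_tape (tY 0, Left) tY"
  obtain x v where w: "w = x # v" using Cons.prems(3) by (cases w) auto
  have x: "tY 0 = x" using Cons.prems(2) w by (simp add: reads_Cons)
  have r: "reads ?t (Bit a # w)" "lreads ?t (map Bit l @ [Blank])"
    using reads_Left[of tY x v "Bit a" "map Bit l @ [Blank]" x] lreads_Left Cons.prems w x by simp_all
  have h: "?t 0 = Bit a" using r(1) by (rule reads_head)
  have "trans M (Suc (Suc b)) (heads (ts[Y := ?t]))
      = Next (Suc (Suc b)) ((stay (heads (ts[Y := ?t])))[Y := (?t 0, Left)])"
    using Cons.prems(1) XY h by (simp add: trans_compare compare_prog_def del: update_tape.simps)
  from reach_Next1[OF this] have "reach M Q (Suc (Suc b), ts[Y := ?t]) (Suc (Suc b), ts[Y := update_tape (?t 0, Left) ?t])"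
    using XY Cons.prems(1) by (simp del: update_tape.simps)
  moreover obtain tY' where "reach M Q (Suc (Suc b), ts[Y := update_tape (?t 0, Left) ?t]) (b + 4, ts[Y := tY'])"
    "reads tY' (map Bit (rev l) @ (Bit a # w))"
    using Cons.IH[OF Cons.prems(1) r(1) _ r(2)] by auto
  ultimately show ?case by (auto intro: reach_trans simp del: update_tape.simps)
qed

abbreviation (input) verdict :: "bool \<Rightarrow> nat" where
  "verdict c \<equiv> if c then b + 4 else b + 3"

lemma compare_step:
  assumes "length ts = T"
  shows "trans M (verdict c) (heads ts) = compare_digits X Y b c (heads ts)"
  by (simp add: trans_compare compare_prog_def)

text \<open>The terminator \<open>E\<close> is a comma behind an entry of an output and a blank
  behind an oracle answer.\<close>

lemma compare_loop:
  assumes "length ts = T" "reads (ts ! X) (map Bit bs @ [E])" "reads (ts ! Y) (map Bit as @ [Blank])"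
    and "\<not> digit E"
  shows "\<exists>tX tY. reach M Q (verdict c, ts) (b + 5, ts[X := tX, Y := tY]) \<and> tY 0 = Bit (cmp c as bs)"
  using assms
proof (induction c as bs arbitrary: ts rule: cmp.induct)
  case (1 c)
  have h: "(ts ! X) 0 = E" "(ts ! Y) 0 = Blank" using "1.prems" by (simp_all add: reads_Cons)
  then have "trans M (verdict c) (heads ts) = Next (b + 5) ((stay (heads ts))[Y := (Bit c, Stay)])"
    using "1.prems" XY by (simp only: compare_step) (simp add: compare_digits_def)
  from reach_Next1[OF this] have "reach M Q (verdict c, ts) (b + 5, ts[Y := update_tape (Bit c, Stay) (ts ! Y)])"
    by simp
  then have "reach M Q (verdict c, ts) (b + 5, ts[X := ts ! X, Y := update_tape (Bit c, Stay) (ts ! Y)])"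
    by simp
  then show ?case by (intro exI conjI) (assumption, simp)
next
  case (2 c a as)
  let ?tX = "update_tape (E, Stay) (ts ! X)" and ?tY = "update_tape (Bit a, Right) (ts ! Y)"
  let ?ts = "ts[X := ?tX, Y := ?tY]"
  have h: "(ts ! X) 0 = E" "(ts ! Y) 0 = Bit a" using "2.prems" by (simp_all add: reads_Cons)
  have "trans M (verdict c) (heads ts)
      = Next (verdict (a \<or> c)) ((stay (heads ts))[X := (E, Stay), Y := (Bit a, Right)])"
    using "2.prems" XY h by (simp only: compare_step) (auto simp: compare_digits_def)
  from reach_Next1[OF this] have "reach M Q (verdict c, ts) (verdict (a \<or> c), ?ts)"
    using XY by simp
  moreover have "reads (?ts ! X) (map Bit [] @ [E])" "reads (?ts ! Y) (map Bit as @ [Blank])"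
    using "2.prems" XY reads_Right[of "ts ! Y" "Bit a" _ "Bit a"] by (simp_all add: reads_Cons)
  with "2.IH"[of ?ts] obtain tX tY where "reach M Q (verdict (a \<or> c), ?ts) (b + 5, ?ts[X := tX, Y := tY])"
    "tY 0 = Bit (cmp (a \<or> c) as [])"
    using "2.prems" by auto
  ultimately show ?case by (simp only: updates cmp.simps) (blast intro: reach_trans)
next
  case (3 c a bs)
  let ?tX = "update_tape (Bit a, Right) (ts ! X)" and ?tY = "update_tape (Blank, Stay) (ts ! Y)"
  let ?ts = "ts[X := ?tX, Y := ?tY]"
  have h: "(ts ! X) 0 = Bit a" "(ts ! Y) 0 = Blank" using "3.prems" by (simp_all add: reads_Cons)
  have "trans M (verdict c) (heads ts)
      = Next (verdict (\<not> a \<and> c)) ((stay (heads ts))[X := (Bit a, Right), Y := (Blank, Stay)])"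
    using "3.prems" XY h by (simp only: compare_step) (auto simp: compare_digits_def)
  from reach_Next1[OF this] have "reach M Q (verdict c, ts) (verdict (\<not> a \<and> c), ?ts)"
    using XY by simp
  moreover have "reads (?ts ! Y) (map Bit [] @ [Blank])" "reads (?ts ! X) (map Bit bs @ [E])"
    using "3.prems" XY reads_Right[of "ts ! X" "Bit a" _ "Bit a"] by (simp_all add: reads_Cons)
  with "3.IH"[of ?ts] obtain tX tY where "reach M Q (verdict (\<not> a \<and> c), ?ts) (b + 5, ?ts[X := tX, Y := tY])"
    "tY 0 = Bit (cmp (\<not> a \<and> c) [] bs)"
    using "3.prems" by auto
  ultimately show ?case by (simp only: updates cmp.simps) (blast intro: reach_trans)
next
  case (4 c a as d bs)
  let ?tX = "update_tape (Bit d, Right) (ts ! X)" and ?tY = "update_tape (Bit a, Right) (ts ! Y)"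
  let ?ts = "ts[X := ?tX, Y := ?tY]" and ?c = "if a = d then c else a"
  have h: "(ts ! X) 0 = Bit d" "(ts ! Y) 0 = Bit a" using "4.prems" by (simp_all add: reads_Cons)
  have "trans M (verdict c) (heads ts)
      = Next (verdict ?c) ((stay (heads ts))[X := (Bit d, Right), Y := (Bit a, Right)])"
    using "4.prems" XY h by (simp only: compare_step) (auto simp: compare_digits_def)
  from reach_Next1[OF this] have "reach M Q (verdict c, ts) (verdict ?c, ?ts)"
    using XY by simp
  moreover have "reads (?ts ! Y) (map Bit as @ [Blank])" "reads (?ts ! X) (map Bit bs @ [E])"
    using "4.prems" XY reads_Right[of "ts ! X" "Bit d" _ "Bit d"] reads_Right[of "ts ! Y" "Bit a" _ "Bit a"]
    by simp_all
  with "4.IH"[of ?ts] obtain tX tY where "reach M Q (verdict ?c, ?ts) (b + 5, ?ts[X := tX, Y := tY])"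
    "tY 0 = Bit (cmp ?c as bs)"
    using "4.prems" by auto
  ultimately show ?case by (simp only: updates cmp.simps) (blast intro: reach_trans)
qed

text \<open>A minus sign settles the question. Otherwise the fraction is at least 1 if and only if
  the numerator is at least the denominator, so no division is required; the initial verdict
  \<open>True\<close> accounts for equality.\<close>

lemma reach_compare:
  assumes "length ts = T" "denotes_rat u a" "reads (ts ! X) (u @ [E])" "\<not> digit E"
    and "ts ! Y = (\<lambda>_. Blank)"
  shows "\<exists>tX tY. reach M Q (b, ts) (b + 5, ts[X := tX, Y := tY]) \<and> tY 0 = Bit (1 \<le> a)"
proof -
  obtain s as bs where u: "u = (if s then [Minus] else []) @ map Bit as @ [Slash] @ map Bit bs"
    and bs: "horner_sum of_bool 2 bs \<noteq> (0::rat)"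
    and a: "a = (if s then - 1 else 1) * horner_sum of_bool 2 as / horner_sum of_bool 2 bs"
    using assms(2) unfolding denotes_rat_def by blast
  define n d :: nat where "n = horner_sum of_bool 2 as" and "d = horner_sum of_bool 2 bs"
  have nd: "horner_sum of_bool 2 as = (of_nat n :: rat)" "horner_sum of_bool 2 bs = (of_nat d :: rat)"
    unfolding n_def d_def by (rule of_nat_horner_sum)+
  have d: "0 < d" using bs nd by simp
  show ?thesis
  proof (cases s)
    case True
    then have "(ts ! X) 0 = Minus" using assms(3) u by (simp add: reads_Cons)
    then have "trans M b (heads ts) = Next (b + 5) ((stay (heads ts))[Y := (Bit False, Stay)])"
      using assms(1) XY by (simp add: trans_compare compare_prog_def)
    from reach_Next1[OF this] have "reach M Q (b, ts) (b + 5, ts[X := ts ! X, Y := update_tape (Bit False, Stay) (ts ! Y)])"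
      by simp
    moreover have "\<not> 1 \<le> a"
    proof -
      have "a \<le> 0" using True a nd by simp
      then show ?thesis by linarith
    qed
    ultimately show ?thesis by (intro exI conjI) (assumption, simp)
  next
    case False
    then have r: "reads (ts ! X) (map Bit as @ Slash # map Bit bs @ [E])" using assms(3) u by simp
    then have "(ts ! X) 0 \<noteq> Minus" by (cases as) (auto simp: reads_Cons)
    then have "trans M b (heads ts) = Next (Suc b) (stay (heads ts))"
      using assms(1) XY by (simp add: trans_compare compare_prog_def)
    from reach_Next1[OF this] have "reach M Q (b, ts) (Suc b, ts)" by simp
    also obtain tX tY where c: "reach M Q (Suc b, ts) (Suc (Suc b), ts[X := tX, Y := update_tape (tY 0, Left) tY])"
      "reads tX (map Bit bs @ [E])" "lreads tY (map Bit (rev as) @ [Blank])" "reads tY [Blank]"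
      using copy_numerator[OF assms(1) r, of "[]"] assms(5) by (auto simp: lreads_Cons)
    note c(1)
    also obtain tY' where w: "reach M Q (Suc (Suc b), ts[X := tX, Y := update_tape (tY 0, Left) tY]) (b + 4, ts[X := tX, Y := tY'])"
      "reads tY' (map Bit as @ [Blank])"
      using rewind_numerator[of "ts[X := tX]", OF _ c(4) _ c(3)] assms(1) by auto
    note w(1)
    finally have 1: "reach M Q (b, ts) (b + 4, ts[X := tX, Y := tY'])" .
    obtain sX sY where 2: "reach M Q (b + 4, ts[X := tX, Y := tY']) (b + 5, ts[X := tX, Y := tY', X := sX, Y := sY])"
      "sY 0 = Bit (cmp True as bs)"
      using compare_loop[of "ts[X := tX, Y := tY']" bs E as True] assms(1,4) c(2) w(2) XY by auto
    have "cmp True as bs \<longleftrightarrow> d \<le> n" unfolding cmp_iff n_def d_def by auto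
    also have "\<dots> \<longleftrightarrow> 1 \<le> a" using d False by (simp add: a nd)
    finally have "sY 0 = Bit (1 \<le> a)" using 2(2) by simp
    moreover have "reach M Q (b, ts) (b + 5, ts[X := sX, Y := sY])"
      using reach_trans[OF 1 2(1)] XY by (simp add: list_update_swap[of Y X])
    ultimately show ?thesis by blast
  qed
qed

end

lemma compare_valid:
  assumes "c \<in> set (compare_prog X Y b)" "length ss = T" "b + 5 < S"
  shows "valid_action S T (c ss)"
  using assms by (auto simp: compare_prog_def compare_digits_def)

section \<open>Comparing an output with an oracle answer on a Turing machine\<close>

lemma write_extra_question:
  "reads (update_tape (Blank, Left) (update_tape (Slash, Right) t)) [Slash, Blank]"
  by (simp add: reads_Cons)

text \<open>Tape 1 may hold anything after the run of \<open>M\<close>. The blank behind the slash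
  ends the question, and a slash followed by no digit asks for entry 0.\<close>

lemma word_extra_question:
  "word (update_tape (Blank, Left) (update_tape (Slash, Right) t)) = encode_question (Extra 0)"
  using write_extra_question by (intro word_eqI) simp_all

text \<open>Each comparison leaves its verdict on an extra tape of its own, so both are still
  visible when the answer is formed. A blank is written to the right of the answer bit, since
  \<open>word\<close> reads up to the first blank and tape 0 still holds the old output.\<close>

definition decide_prog :: "nat \<Rightarrow> nat \<Rightarrow> (symbol list \<Rightarrow> action) list" where
  "decide_prog T S = compare_prog 0 T S @
    [\<lambda>ss. Next (S + 6) ((stay ss)[1 := (Slash, Right)]),
     \<lambda>ss. Next (S + 7) ((stay ss)[1 := (Blank, Left)]),
     \<lambda>ss. Ask (S + 8)] @ compare_prog 1 (Suc T) (S + 8) @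
    [\<lambda>ss. Next (S + 14) ((stay ss)[0 := (Blank, Left)]),
     \<lambda>ss. Next (S + 15) ((stay ss)[0 := (Bit (ss ! T = ss ! Suc T), Stay)]),
     \<lambda>ss. Stop]"

lemma length_compare_prog [simp]: "length (compare_prog X Y b) = 5"
  by (simp add: compare_prog_def)

lemma length_decide_prog [simp]: "length (decide_prog T S) = 16"
  by (simp add: decide_prog_def)

lemma decide_prog_reach:
  assumes tr: "\<And>i. i < 16 \<Longrightarrow> trans M (S + i) = decide_prog T S ! i"
    and T: "2 \<le> T" "tapes M = T + 2" "length ts = T"
    and u: "denotes_rat u a" "reads (ts ! 0) (u @ [Comma])" and Q: "Q (Extra 0) = Some \<rho>"
  shows "\<exists>ts'. reach M Q (S, ts @ [\<lambda>_. Blank, \<lambda>_. Blank]) (S + 15, ts') \<and>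
     trans M (S + 15) (heads ts') = Stop \<and> word (ts' ! 0) = [Bit ((1 \<le> a) = (1 \<le> \<rho>))]"
proof -
  have ext: "decide_prog T S ! i = compare_prog 0 T S ! i" if "i < 5" for i
    using that by (simp add: decide_prog_def nth_append)
  have ext': "decide_prog T S ! (8 + i) = compare_prog 1 (Suc T) (S + 8) ! i" if "i < 5" for i
    using that by (simp add: decide_prog_def nth_append)
  interpret A: compare_machine M Q 0 T S "T + 2"
    by unfold_locales (use tr ext T in auto)
  interpret B: compare_machine M Q 1 "Suc T" "S + 8" "T + 2"
    by unfold_locales (use tr[of "8 + i" for i] ext' T in \<open>auto simp: add.assoc\<close>)
  have t5: "trans M (S + 5) = (\<lambda>ss. Next (S + 6) ((stay ss)[1 := (Slash, Right)]))"
    and t6: "trans M (S + 6) = (\<lambda>ss. Next (S + 7) ((stay ss)[1 := (Blank, Left)]))"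
    and t7: "trans M (S + 7) = (\<lambda>ss. Ask (S + 8))"
    and t13: "trans M (S + 13) = (\<lambda>ss. Next (S + 14) ((stay ss)[0 := (Blank, Left)]))"
    and t14: "trans M (S + 14) = (\<lambda>ss. Next (S + 15) ((stay ss)[0 := (Bit (ss ! T = ss ! Suc T), Stay)]))"
    and t15: "trans M (S + 15) = (\<lambda>ss. Stop)"
    using tr[of 5] tr[of 6] tr[of 7] tr[of 13] tr[of 14] tr[of 15]
    by (simp_all add: decide_prog_def nth_append)
  let ?ts = "ts @ [\<lambda>_. Blank, \<lambda>_. Blank]"
  obtain tX tY where 1: "reach M Q (S, ?ts) (S + 5, ?ts[0 := tX, T := tY])" "tY 0 = Bit (1 \<le> a)"
    using A.reach_compare[of ?ts u a Comma] T u by (auto simp: nth_append)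
  let ?ts1 = "?ts[0 := tX, T := tY]"
  let ?q = "update_tape (Blank, Left) (update_tape (Slash, Right) (?ts1 ! 1))"
  have "reach M Q (S + 5, ?ts1) (S + 6, ?ts1[1 := update_tape (Slash, Right) (?ts1 ! 1)])"
    using reach_Next1[of M "S + 5" ?ts1] by (simp add: t5 del: update_tape.simps)
  also have "reach M Q \<dots> (S + 7, ?ts1[1 := ?q])"
    using reach_Next1[of M "S + 6" "?ts1[1 := update_tape (Slash, Right) (?ts1 ! 1)]"] T
    by (simp add: t6 del: update_tape.simps)
  finally have 2: "reach M Q (S + 5, ?ts1) (S + 7, ?ts1[1 := ?q])" .
  have 3: "reach M Q (S + 7, ?ts1[1 := ?q]) (S + 8, ?ts1[1 := tape_of (encode_rat \<rho>)])"
    using reach_Ask[of M "S + 7" "?ts1[1 := ?q]" "S + 8" "Extra 0" Q \<rho>] Q T(1,3)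
    by (simp add: t7 word_extra_question del: update_tape.simps)
  let ?ts2 = "?ts1[1 := tape_of (encode_rat \<rho>)]"
  obtain sX sY where 4: "reach M Q (S + 8, ?ts2) (S + 13, ?ts2[1 := sX, Suc T := sY])" "sY 0 = Bit (1 \<le> \<rho>)"
    using B.reach_compare[of ?ts2 "encode_rat \<rho>" \<rho> Blank] T denotes_encode_rat reads_tape_of
    by (auto simp: nth_append add.assoc)
  let ?ts3 = "?ts2[1 := sX, Suc T := sY]"
  let ?b = "Bit ((1 \<le> a) = (1 \<le> \<rho>))"
  let ?t = "update_tape (Blank, Left) (?ts3 ! 0)"
  have h: "(?ts3[0 := ?t] ! T) 0 = Bit (1 \<le> a)" "(?ts3[0 := ?t] ! Suc T) 0 = Bit (1 \<le> \<rho>)"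
    using 1(2) 4(2) T by (simp_all add: nth_list_update)
  have "reach M Q (S + 13, ?ts3) (S + 14, ?ts3[0 := ?t])"
    using reach_Next1[of M "S + 13" ?ts3] by (cases "digit (t 0)") (simp_all add: t13)
  also have "reach M Q (S + 14, ?ts3[0 := ?t]) (S + 15, ?ts3[0 := update_tape (?b, Stay) ?t])"
    using reach_Next1[of M "S + 14" "?ts3[0 := ?t]"] h T
    by (simp add: t14 del: update_tape.simps)
  finally have 5: "reach M Q (S + 13, ?ts3) (S + 15, ?ts3[0 := update_tape (?b, Stay) ?t])" .
  have "reach M Q (S, ?ts) (S + 15, ?ts3[0 := update_tape (?b, Stay) ?t])"
    using reach_trans[OF reach_trans[OF reach_trans[OF reach_trans[OF 1(1) 2] 3] 4(1)] 5] .
  moreover have "word (?ts3[0 := update_tape (?b, Stay) ?t] ! 0) = [?b]"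
    using T by (intro word_eqI) (auto simp: reads_Cons)
  ultimately show ?thesis by (auto simp: t15)
qed

lemma wf_decide:
  assumes "wf_tm M" shows "wf_tm (extend M 2 (decide_prog (tapes M) (states M)))"
proof (rule wf_extend[OF assms])
  fix c and ss :: "symbol list" assume c: "c \<in> set (decide_prog (tapes M) (states M))" and ss: "length ss = tapes M + 2"
  have "valid_action (states M + 16) (tapes M + 2) (c ss)"
  proof (cases "c \<in> set (compare_prog 0 (tapes M) (states M))
       \<or> c \<in> set (compare_prog 1 (Suc (tapes M)) (states M + 8))")
    case True
    then show ?thesis using ss by (auto intro: compare_valid)
  next
    case False
    then show ?thesis using c ss by (auto simp: decide_prog_def)
  qed
  then show "valid_action (states M + length (decide_prog (tapes M) (states M))) (tapes M + 2) (c ss)"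
    by simp
qed (simp add: decide_prog_def)

lemma enum_not_Nil [simp]: "(enum_class.enum :: 'a::enum list) \<noteq> []"
  using UNIV_enum[where ?'a = 'a] by (metis UNIV_not_empty list.set(1))

lemma denotes_vec_first:
  assumes "denotes_vec w (v :: rat ^ ('n::enum))"
  obtains u w' where "w = u @ Comma # w'" "denotes_rat u (v $ (enum_class.enum ! 0))"
proof -
  obtain us where us: "w = concat (map (\<lambda>u. u @ [Comma]) us)" "list_all2 denotes_rat us (vec_list v)"
    using assms unfolding denotes_vec_def by blast
  have "vec_list v \<noteq> []" "hd (vec_list v) = v $ (enum_class.enum ! 0)"
    by (simp_all add: vec_list_def hd_map hd_conv_nth)
  with us(2) obtain u us' where "us = u # us'" "denotes_rat u (v $ (enum_class.enum ! 0))"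
    by (cases "vec_list v") (auto simp: list_all2_Cons2)
  then show ?thesis using that us(1) by simp
qed

lemma tm_decides:
  assumes "wf_tm M"
  shows "\<exists>M'. wf_tm M' \<and> (\<forall>Q Q' w (v :: rat ^ ('n::enum)) \<rho>. (\<forall>k a. Q k = Some a \<longrightarrow> Q' k = Some a) \<longrightarrow>
     tm_halts M Q w \<longrightarrow> denotes_vec w v \<longrightarrow> Q' (Extra 0) = Some \<rho> \<longrightarrow>
     tm_halts M' Q' [Bit ((1 \<le> v $ (enum_class.enum ! 0)) = (1 \<le> \<rho>))])"
proof (intro exI conjI allI impI)
  let ?cs = "decide_prog (tapes M) (states M)"
  let ?M = "extend M 2 ?cs"
  show "wf_tm ?M" using wf_decide[OF assms] .
  fix Q Q' w and v :: "rat ^ ('n::enum)" and \<rho>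
  assume ext: "\<forall>k a. Q k = Some a \<longrightarrow> Q' k = Some a" and h: "tm_halts M Q w"
    and v: "denotes_vec w v" and Q: "Q' (Extra 0) = Some \<rho>"
  obtain u w' where u: "w = u @ Comma # w'" "denotes_rat u (v $ (enum_class.enum ! 0))"
    using denotes_vec_first[OF v] .
  obtain ts where ts: "length ts = tapes M" "word (ts ! 0) = w"
    and r: "reach ?M Q' (0, replicate (tapes M + 2) (\<lambda>_. Blank)) (states M, ts @ replicate 2 (\<lambda>_. Blank))"
    using extend_runs[OF assms _ h, of Q' 2 ?cs] ext by blast
  have "reads (ts ! 0) (u @ [Comma])"
    using reads_word[of "ts ! 0"] reads_appendD[of "ts ! 0" "u @ [Comma]" w'] by (simp add: ts u)
  from decide_prog_reach[where S = "states M" and M = ?M and Q = Q', OF _ _ _ ts(1) u(2) this Q]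
  obtain ts' where "reach ?M Q' (states M, ts @ [\<lambda>_. Blank, \<lambda>_. Blank]) (states M + 15, ts')"
    "trans ?M (states M + 15) (heads ts') = Stop"
    "word (ts' ! 0) = [Bit ((1 \<le> v $ (enum_class.enum ! 0)) = (1 \<le> \<rho>))]"
    using assms trans_extend[of _ ?cs M 2] by (auto simp: wf_tm_iff extend_def)
  moreover have "tapes ?M = tapes M + 2" by (simp add: extend_def)
  ultimately show "tm_halts ?M Q' [Bit ((1 \<le> v $ (enum_class.enum ! 0)) = (1 \<le> \<rho>))]"
    using r by (intro tm_haltsI[of _ _ "states M + 15" ts'])
      (auto simp: numeral_2_eq_2 intro: reach_trans)
qed

section \<open>Replacing an incorrect output\<close>

text \<open>If the flag is 1, the program stops with tape 0 untouched. Otherwise it asks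
  \<open>Coord j n\<close> for n = 0, 1, and so on. The question is written from right to left; its
  \<open>n\<close> digits are counted off on tape \<open>T\<close>, which is lengthened by one in
  the same pass so as to hold the next precision, while the \<open>j\<close> digits in front are
  part of the program. The search ends at the first answer whose numerator has two digits, and the
  sign of that answer selects \<open>w1\<close> or \<open>w2\<close>.\<close>

definition correct_prog ::
    "nat \<Rightarrow> nat \<Rightarrow> nat \<Rightarrow> symbol list \<Rightarrow> symbol list \<Rightarrow> (symbol list \<Rightarrow> action) list" where
  "correct_prog T S j w1 w2 =
    ([\<lambda>ss. Next (S + 1) ((stay ss)[1 := (Slash, Right)]),
      \<lambda>ss. Next (S + 2) ((stay ss)[1 := (Blank, Left)]),
      \<lambda>ss. Ask (S + 3),
      \<lambda>ss. if ss ! 1 = Bit True then Next (S + 4) (stay ss) else Next (S + 5) (stay ss),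
      \<lambda>ss. Stop,
      \<lambda>ss. Next (S + 6) ((stay ss)[1 := (Blank, Left)]),
      \<lambda>ss. if ss ! T = Blank then Next (S + 7) ((stay ss)[1 := (Comma, Left), T := (Bit True, Left)])
           else Next (S + 6) ((stay ss)[1 := (Bit True, Left), T := (Bit True, Right)]),
      \<lambda>ss. if ss ! T = Blank then Next (S + 14) ((stay ss)[T := (Blank, Right)])
           else Next (S + 7) ((stay ss)[T := (Bit True, Left)]),
      \<lambda>ss. Next (S + 9) ((stay ss)[1 := (ss ! 1, Right)]),
      \<lambda>ss. Ask (S + 10),
      \<lambda>ss. if ss ! 1 = Minus then Next (S + 12) ((stay ss)[1 := (ss ! 1, Right)])
           else if ss ! 1 = Slash then Next (S + 5) (stay ss)
           else Next (S + 11) ((stay ss)[1 := (ss ! 1, Right)]),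
      \<lambda>ss. if digit (ss ! 1) then Next (S + 15 + j) (stay ss) else Next (S + 5) (stay ss),
      \<lambda>ss. Next (S + 13) ((stay ss)[1 := (ss ! 1, Right)]),
      \<lambda>ss. if digit (ss ! 1) then Next (S + 17 + j + length w1) (stay ss) else Next (S + 5) (stay ss)]
     @ write_segment 1 (replicate j (Bit True)) (S + 14))
     @ (\<lambda>ss. Next (S + 8) (stay ss))
     # (write_segment 0 (Blank # rev w1) (S + 15 + j)
     @ (\<lambda>ss. Next (S + 4) ((stay ss)[0 := (ss ! 0, Right)]))
     # (write_segment 0 (Blank # rev w2) (S + 17 + j + length w1)
     @ [\<lambda>ss. Next (S + 4) ((stay ss)[0 := (ss ! 0, Right)])]))"

lemma length_write_segment [simp]: "length (write_segment X w b) = length w"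
  and nth_write_segment [simp]: "i < length w \<Longrightarrow>
    write_segment X w b ! i = (\<lambda>ss. Next (b + i + 1) ((stay ss)[X := (w ! i, Left)]))"
  by (simp_all add: write_segment_def)

text \<open>A counter \<open>n\<close> is a block of \<open>n\<close> digits, and the head scans position \<open>i\<close> of the block.\<close>

definition counter :: "nat \<Rightarrow> int \<Rightarrow> tape" where
  "counter n i = (\<lambda>c. if 0 \<le> c + i \<and> c + i < int n then Bit True else Blank)"

text \<open>An answer of precision \<open>n\<close> with this property is at least 2 / 2^n in
  absolute value, twice the possible error, so its sign is that of the entry. Unlike the size of the
  answer, the property can be read off a bounded number of symbols of the fraction.\<close>

definition big_numerator :: "rat \<Rightarrow> bool" where
  "big_numerator a \<longleftrightarrow> 2 \<le> \<bar>fst (quotient_of a)\<bar>"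

locale correct_machine =
  fixes M :: tm and Q :: orc and T S j :: nat and w1 w2 :: "symbol list"
  assumes trans: "\<And>i. i < 19 + j + length w1 + length w2 \<Longrightarrow>
      trans M (S + i) = correct_prog T S j w1 w2 ! i"
    and T: "2 \<le> T"
begin

lemma t0: "trans M S = (\<lambda>ss. Next (S + 1) ((stay ss)[1 := (Slash, Right)]))"
  and t1: "trans M (S + 1) = (\<lambda>ss. Next (S + 2) ((stay ss)[1 := (Blank, Left)]))"
  and t2: "trans M (S + 2) = (\<lambda>ss. Ask (S + 3))"
  and t3: "trans M (S + 3) = (\<lambda>ss. if ss ! 1 = Bit True then Next (S + 4) (stay ss) else Next (S + 5) (stay ss))"
  and t4: "trans M (S + 4) = (\<lambda>ss. Stop)"
  and t5: "trans M (S + 5) = (\<lambda>ss. Next (S + 6) ((stay ss)[1 := (Blank, Left)]))"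
  and t6: "trans M (S + 6) = (\<lambda>ss. if ss ! T = Blank
        then Next (S + 7) ((stay ss)[1 := (Comma, Left), T := (Bit True, Left)])
        else Next (S + 6) ((stay ss)[1 := (Bit True, Left), T := (Bit True, Right)]))"
  and t7: "trans M (S + 7) = (\<lambda>ss. if ss ! T = Blank then Next (S + 14) ((stay ss)[T := (Blank, Right)])
        else Next (S + 7) ((stay ss)[T := (Bit True, Left)]))"
  and t8: "trans M (S + 8) = (\<lambda>ss. Next (S + 9) ((stay ss)[1 := (ss ! 1, Right)]))"
  and t9: "trans M (S + 9) = (\<lambda>ss. Ask (S + 10))"
  and t10: "trans M (S + 10) = (\<lambda>ss. if ss ! 1 = Minus then Next (S + 12) ((stay ss)[1 := (ss ! 1, Right)])
        else if ss ! 1 = Slash then Next (S + 5) (stay ss)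
        else Next (S + 11) ((stay ss)[1 := (ss ! 1, Right)]))"
  and t11: "trans M (S + 11) = (\<lambda>ss. if digit (ss ! 1) then Next (S + 15 + j) (stay ss) else Next (S + 5) (stay ss))"
  and t12: "trans M (S + 12) = (\<lambda>ss. Next (S + 13) ((stay ss)[1 := (ss ! 1, Right)]))"
  and t13: "trans M (S + 13) = (\<lambda>ss. if digit (ss ! 1) then Next (S + 17 + j + length w1) (stay ss) else Next (S + 5) (stay ss))"
  using trans[of 0] trans[of 1] trans[of 2] trans[of 3] trans[of 4] trans[of 5] trans[of 6]
    trans[of 7] trans[of 8] trans[of 9] trans[of 10] trans[of 11] trans[of 12] trans[of 13]
  by (simp_all add: correct_prog_def nth_append)

lemma trans_prefix: "i < j \<Longrightarrow>
    trans M (S + 14 + i) ss = Next (S + 14 + i + 1) ((stay ss)[1 := (replicate j (Bit True) ! i, Left)])"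
  using trans[of "14 + i"] by (simp add: correct_prog_def nth_append add.assoc)

lemma trans_prefix_end: "trans M (S + 14 + j) = (\<lambda>ss. Next (S + 8) (stay ss))"
  using trans[of "14 + j"] by (simp add: correct_prog_def nth_append add.assoc)

lemma trans_out1: "i < length (Blank # rev w1) \<Longrightarrow> trans M (S + 15 + j + i) ss =
    Next (S + 15 + j + i + 1) ((stay ss)[0 := ((Blank # rev w1) ! i, Left)])"
  using trans[of "15 + j + i"]
  by (simp add: correct_prog_def nth_append add.assoc nth_Cons' split del: if_split)

lemma trans_out1_end: "trans M (S + 15 + j + length (Blank # rev w1)) =
    (\<lambda>ss. Next (S + 4) ((stay ss)[0 := (ss ! 0, Right)]))"
  using trans[of "16 + j + length w1"] by (simp add: correct_prog_def nth_append ac_simps)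

lemma trans_out2: "i < length (Blank # rev w2) \<Longrightarrow> trans M (S + 17 + j + length w1 + i) ss =
    Next (S + 17 + j + length w1 + i + 1) ((stay ss)[0 := ((Blank # rev w2) ! i, Left)])"
  using trans[of "17 + j + length w1 + i"]
  by (simp add: correct_prog_def nth_append add.assoc nth_Cons' split del: if_split)

lemma trans_out2_end: "trans M (S + 17 + j + length w1 + length (Blank # rev w2)) =
    (\<lambda>ss. Next (S + 4) ((stay ss)[0 := (ss ! 0, Right)]))"
  using trans[of "18 + j + length w1 + length w2"] by (simp add: correct_prog_def nth_append ac_simps)

text \<open>With the head at position \<open>i\<close> of the counter, \<open>k\<close> digits of
  the question remain to be written. The step that meets the blank behind the counter writes the
  comma and one more digit of the counter; moving back, the head is at position n - 1 of a counter
  of length n + 1.\<close>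

lemma write_question_digits:
  assumes "length ts = T + 1" "i + k = n"
  shows "reach M Q (S + 6, ts[T := counter n (int i)])
    (S + 7, ts[1 := write_left (replicate k (Bit True) @ [Comma]) (ts ! 1), T := counter (n + 1) (int n - 1)])"
  using assms
proof (induction k arbitrary: i ts)
  case 0
  let ?ts = "ts[T := counter n (int i)]"
  have "trans M (S + 6) (heads ?ts) = Next (S + 7) ((stay (heads ?ts))[1 := (Comma, Left), T := (Bit True, Left)])"
    using 0 T by (simp add: t6 counter_def)
  from reach_Next1[OF this]
  have "reach M Q (S + 6, ?ts)
     (S + 7, ts[1 := update_tape (Comma, Left) (ts ! 1), T := update_tape (Bit True, Left) (counter n (int i))])"
    using 0 T by (simp add: list_update_swap[of T "Suc 0"] del: update_tape.simps)
  moreover have "update_tape (Bit True, Left) (counter n (int i)) = counter (n + 1) (int n - 1)"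
    using 0 by (auto simp: counter_def fun_eq_iff)
  ultimately show ?case by simp
next
  case (Suc k)
  let ?ts = "ts[T := counter n (int i)]"
  let ?t = "update_tape (Bit True, Left) (ts ! 1)"
  have "trans M (S + 6) (heads ?ts) = Next (S + 6) ((stay (heads ?ts))[1 := (Bit True, Left), T := (Bit True, Right)])"
    using Suc.prems T by (simp add: t6 counter_def)
  from reach_Next1[OF this]
  have "reach M Q (S + 6, ?ts)
     (S + 6, ts[1 := ?t, T := update_tape (Bit True, Right) (counter n (int i))])"
    using Suc.prems T by (simp add: list_update_swap[of T "Suc 0"] del: update_tape.simps)
  moreover have "update_tape (Bit True, Right) (counter n (int i)) = counter n (int (Suc i))"
    using Suc.prems by (auto simp: counter_def fun_eq_iff)
  moreover have "reach M Q (S + 6, ts[1 := ?t, T := counter n (int (Suc i))])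
    (S + 7, ts[1 := ?t, 1 := write_left (replicate k (Bit True) @ [Comma]) (ts[1 := ?t] ! 1), T := counter (n + 1) (int n - 1)])"
    using Suc.prems by (intro Suc.IH) auto
  ultimately show ?case using Suc.prems T
    by (auto simp del: update_tape.simps intro: reach_trans)
qed

lemma rewind_counter:
  assumes "length ts = T + 1" "i \<le> n"
  shows "reach M Q (S + 7, ts[T := counter n (int i - 1)]) (S + 14, ts[T := counter n 0])"
  using assms
proof (induction i)
  case 0
  let ?ts = "ts[T := counter n (int 0 - 1)]"
  have "trans M (S + 7) (heads ?ts) = Next (S + 14) ((stay (heads ?ts))[T := (Blank, Right)])"
    using 0 T by (simp add: t7 counter_def)
  moreover have "update_tape (Blank, Right) (counter n (int 0 - 1)) = counter n 0"
    by (auto simp: counter_def fun_eq_iff)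
  ultimately show ?case
    using reach_Next1[of M "S + 7" ?ts] 0 by (simp del: update_tape.simps)
next
  case (Suc i)
  let ?ts = "ts[T := counter n (int (Suc i) - 1)]"
  have "trans M (S + 7) (heads ?ts) = Next (S + 7) ((stay (heads ?ts))[T := (Bit True, Left)])"
    using Suc.prems T by (simp add: t7 counter_def)
  moreover have "update_tape (Bit True, Left) (counter n (int (Suc i) - 1)) = counter n (int i - 1)"
    using Suc.prems by (auto simp: counter_def fun_eq_iff)
  ultimately have "reach M Q (S + 7, ?ts) (S + 7, ts[T := counter n (int i - 1)])"
    using reach_Next1[of M "S + 7" ?ts] Suc.prems by (simp del: update_tape.simps)
  also have "reach M Q \<dots> (S + 14, ts[T := counter n 0])" using Suc by simp
  finally show ?case .
qed

lemma ask_coordinate: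
  assumes len: "length ts = T + 1" and c: "ts ! T = counter n 0" and Q: "Q (Coord j n) = Some a"
  shows "reach M Q (S + 5, ts) (S + 10, ts[1 := tape_of (encode_rat a), T := counter (n + 1) 0])"
proof -
  let ?w = "Blank # replicate n (Bit True) @ [Comma]" and ?v = "replicate j (Bit True)"
  let ?C = "counter (n + 1) 0"
  define st where "st x c = ts[1 := x, T := c]" for x c
  have st: "st x c ! 1 = x" "(st x c)[1 := y] = st y c" "(st x c)[T := c'] = st x c'"
    "length (st x c) = T + 1" for x y c c'
    using T len by (simp_all add: st_def list_update_swap[of T "Suc 0"])
  have ts: "ts = st (ts ! 1) (counter n 0)"
    using c list_update_id[of ts T] by (simp add: st_def)
  let ?t = "update_tape (Blank, Left) (ts ! 1)"
  let ?t' = "write_left (replicate n (Bit True) @ [Comma]) ?t"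
  let ?q = "update_tape ((write_left ?v ?t') 0, Right) (write_left ?v ?t')"
  have "reach M Q (S + 5, st (ts ! 1) (counter n 0)) (S + 6, st ?t (counter n (int 0)))"
    using reach_Next1[of M "S + 5" "st (ts ! 1) (counter n 0)"] st by (simp add: t5 del: update_tape.simps)
  also have "reach M Q \<dots> (S + 7, st ?t' (counter (n + 1) (int n - 1)))"
    using write_question_digits[OF st(4), of 0 n n ?t "counter n (int 0)"] st by (simp del: update_tape.simps)
  also have "reach M Q \<dots> (S + 14, st ?t' ?C)"
    using rewind_counter[OF st(4), of n "n + 1" ?t' ?C] st by (simp del: update_tape.simps)
  also have "reach M Q \<dots> (S + 14 + j, st (write_left ?v ?t') ?C)"
    using reach_write_segment[of ?v M "S + 14" 1 "st ?t' ?C" Q] trans_prefix st T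
    by (simp del: update_tape.simps)
  also have "reach M Q \<dots> (S + 8, st (write_left ?v ?t') ?C)"
    using reach_Next1[of M "S + 14 + j" "st (write_left ?v ?t') ?C"] by (simp add: trans_prefix_end)
  also have "reach M Q \<dots> (S + 9, st ?q ?C)"
    using reach_Next1[of M "S + 8" "st (write_left ?v ?t') ?C"] st T by (simp add: t8 del: update_tape.simps)
  also have "reach M Q \<dots> (S + 10, st (tape_of (encode_rat a)) ?C)"
  proof -
    have "reads ?q (rev (?w @ ?v))"
      using reads_write_left_Right[of _ "?w @ ?v" "ts ! 1"] by (simp del: update_tape.simps)
    then have "word ?q = encode_question (Coord j n)"
      by (intro word_eqI) (simp_all del: update_tape.simps)
    then show ?thesis
      using reach_Ask[of M "S + 9" "st ?q ?C" "S + 10" "Coord j n" Q a] Q st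
      by (simp add: t9 del: update_tape.simps encode_question.simps)
  qed
  finally show ?thesis using ts by (simp add: st_def)
qed

text \<open>A numerator 0 has no binary digit and 1 has exactly one. So, unless a slash comes first,
  the second symbol behind the sign is a digit exactly if the numerator is at least 2 in absolute
  value.\<close>

lemma encode_rat_cases:
  obtains "a = 0" "\<not> big_numerator a" "\<exists>r. encode_rat a = Slash # r"
  | "0 < a" "\<not> big_numerator a" "\<exists>r. encode_rat a = Bit True # Slash # r"
  | "a < 0" "\<not> big_numerator a" "\<exists>r. encode_rat a = Minus # Bit True # Slash # r"
  | "0 < a" "big_numerator a" "\<exists>x y r. encode_rat a = Bit x # Bit y # r"
  | "a < 0" "big_numerator a" "\<exists>x y r. encode_rat a = Minus # Bit x # Bit y # r"
proof -
  obtain p q where pq: "quotient_of a = (p, q)" by (cases "quotient_of a")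
  then have q: "0 < q" and a: "a = of_int p / of_int q"
    by (simp_all add: quotient_of_denom_pos quotient_of_div)
  have e: "encode_rat a = (if p < 0 then [Minus] else []) @ map Bit (binary_digits (nat \<bar>p\<bar>)) @ [Slash]
      @ map Bit (binary_digits (nat q))" by (simp add: encode_rat_def pq)
  have d: "binary_digits 0 = []" "binary_digits 1 = [True]" by (simp_all add: binary_digits.simps)
  have d2: "\<exists>x y r. binary_digits k = x # y # r" if "2 \<le> k" for k
  proof -
    have "k \<noteq> 0" "k div 2 \<noteq> 0" using that by auto
    then show ?thesis by (subst binary_digits.simps, subst binary_digits.simps) simp
  qed
  have s: "0 < a \<longleftrightarrow> 0 < p" "a < 0 \<longleftrightarrow> p < 0" "a = 0 \<longleftrightarrow> p = 0"
    using q by (simp_all add: a zero_less_divide_iff divide_less_0_iff)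
  have b: "big_numerator a \<longleftrightarrow> 2 \<le> \<bar>p\<bar>" by (simp add: big_numerator_def pq)
  consider "p = 0" | "p = 1" | "p = - 1" | "2 \<le> p" | "p \<le> - 2" by linarith
  then show ?thesis
  proof cases
    case 4
    then have "2 \<le> nat \<bar>p\<bar>" by simp
    from d2[OF this] obtain x y r where "binary_digits (nat \<bar>p\<bar>) = x # y # r" by blast
    then show ?thesis using that(4) 4 s b e by simp
  next
    case 5
    then have "2 \<le> nat \<bar>p\<bar>" by simp
    from d2[OF this] obtain x y r where "binary_digits (nat \<bar>p\<bar>) = x # y # r" by blast
    then show ?thesis using that(5) 5 s b e by simp
  qed (use that s b e d in auto)
qed

lemma inspect_answer:
  assumes len: "length ts = T + 1" and r: "ts ! 1 = tape_of (encode_rat a)"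
  shows "\<exists>t. reach M Q (S + 10, ts)
    (if \<not> big_numerator a then S + 5 else if 0 < a then S + 15 + j else S + 17 + j + length w1, ts[1 := t])"
proof -
  have R: "reads (ts ! 1) (encode_rat a)" using r reads_tape_of reads_appendD by metis
  define R1 where "R1 t = update_tape (t 0, Right) t" for t :: tape
  have R1: "reads (R1 t) w" if "reads t (x # w)" for t x w
    unfolding R1_def using reads_Right[OF that] .
  have stop: ?thesis if "reach M Q (S + 10, ts) (q, ts[1 := t])"
    "q = (if \<not> big_numerator a then S + 5 else if 0 < a then S + 15 + j else S + 17 + j + length w1)" for q t
    using that by auto
  have s10: "reach M Q (S + 10, ts) (if (ts ! 1) 0 = Minus then S + 12 else if (ts ! 1) 0 = Slash then S + 5 else S + 11,
      if (ts ! 1) 0 = Slash then ts else ts[1 := R1 (ts ! 1)])"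
    using reach_Next1[of M "S + 10" ts] len T 
    by (cases "(ts ! 1) 0 = Minus"; cases "(ts ! 1) 0 = Slash")
      (simp_all add: t10 R1_def del: update_tape.simps One_nat_def)
  have s11: "reach M Q (S + 11, ts[1 := t]) (if digit (t 0) then S + 15 + j else S + 5, ts[1 := t])" for t
    using reach_Next1[of M "S + 11" "ts[1 := t]"] len T by (cases "digit (t 0)") (simp_all add: t11)
  have s12: "reach M Q (S + 12, ts[1 := t]) (S + 13, ts[1 := R1 t])" for t
    using reach_Next1[of M "S + 12" "ts[1 := t]"] len T by (simp add: t12 R1_def del: update_tape.simps)
  have s13: "reach M Q (S + 13, ts[1 := t]) (if digit (t 0) then S + 17 + j + length w1 else S + 5, ts[1 := t])" for t
    using reach_Next1[of M "S + 13" "ts[1 := t]"] len T by (cases "digit (t 0)") (simp_all add: t13)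
  have pos: ?thesis
    if "encode_rat a = Bit x # y # w" "digit y = big_numerator a" "0 < a" for x y w
  proof -
    have h: "(ts ! 1) 0 = Bit x" "R1 (ts ! 1) 0 = y"
      using R R1[of "ts ! 1"] that(1) by (auto intro: reads_head)
    show ?thesis
      using stop[OF reach_trans[OF _ s11]] s10 h that by (simp del: One_nat_def)
  qed
  have neg: ?thesis
    if "encode_rat a = Minus # x # y # w" "digit y = big_numerator a" "a < 0" for x y w
  proof -
    have h: "(ts ! 1) 0 = Minus" "R1 (R1 (ts ! 1)) 0 = y"
      using reads_head[of "ts ! 1" Minus] reads_head[OF R1[OF R1[of "ts ! 1" Minus "x # y # w"]]] R that(1)
      by simp_all
    show ?thesis
      using stop[OF reach_trans[OF reach_trans[OF _ s12] s13]] s10 h that by (simp del: One_nat_def)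
  qed
  show ?thesis
  proof (cases rule: encode_rat_cases[of a])
    case 1
    then have "(ts ! 1) 0 = Slash" using R reads_head by metis
    then show ?thesis using s10 1 stop[of "S + 5" "ts ! 1"] by simp
  qed (use pos neg in fastforce)+
qed

lemma write_output:
  assumes "0 < length ts"
  shows "\<exists>t. reach M Q (S + 15 + j, ts) (S + 4, ts[0 := t]) \<and> reads t (w1 @ [Blank])"
    and "\<exists>t. reach M Q (S + 17 + j + length w1, ts) (S + 4, ts[0 := t]) \<and> reads t (w2 @ [Blank])"
proof -
  let ?w = "Blank # rev w1"
  let ?t = "write_left ?w (ts ! 0)"
  have "reach M Q (S + 15 + j, ts) (S + 15 + j + length ?w, ts[0 := ?t])"
    using trans_out1 assms by (intro reach_write_segment) auto
  also have "reach M Q \<dots> (S + 4, ts[0 := update_tape (?t 0, Right) ?t])"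
    using reach_Next1[of M "S + 15 + j + length ?w" "ts[0 := ?t]"] assms
    by (simp only: trans_out1_end) (simp del: update_tape.simps)
  finally show "\<exists>t. reach M Q (S + 15 + j, ts) (S + 4, ts[0 := t]) \<and> reads t (w1 @ [Blank])"
    using reads_write_left_Right[of _ ?w "ts ! 0"] by (auto simp del: update_tape.simps write_left_simps(2))
next
  let ?w = "Blank # rev w2"
  let ?t = "write_left ?w (ts ! 0)"
  have "reach M Q (S + 17 + j + length w1, ts) (S + 17 + j + length w1 + length ?w, ts[0 := ?t])"
    using trans_out2 assms by (intro reach_write_segment) auto
  also have "reach M Q \<dots> (S + 4, ts[0 := update_tape (?t 0, Right) ?t])"
    using reach_Next1[of M "S + 17 + j + length w1 + length ?w" "ts[0 := ?t]"] assms
    by (simp only: trans_out2_end) (simp del: update_tape.simps)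
  finally show "\<exists>t. reach M Q (S + 17 + j + length w1, ts) (S + 4, ts[0 := t]) \<and> reads t (w2 @ [Blank])"
    using reads_write_left_Right[of _ ?w "ts ! 0"] by (auto simp del: update_tape.simps write_left_simps(2))
qed

text \<open>The induction runs over the distance to \<open>N\<close>, a precision known to be
  informative. The search may stop earlier, hence only some \<open>k\<close> with a big numerator is
  claimed, and the branch taken depends on the sign of \<open>c k\<close>.\<close>

lemma search_sign:
  assumes "\<And>n. Q (Coord j n) = Some (c n)" "big_numerator (c N)"
    and "length ts = T + 1" "ts ! T = counter n 0" "n \<le> N"
  shows "\<exists>k ts'. big_numerator (c k) \<and> length ts' = T + 1 \<and>
    reach M Q (S + 5, ts) (if 0 < c k then S + 15 + j else S + 17 + j + length w1, ts')"
  using assms(3-)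
proof (induction "N - n" arbitrary: n ts rule: less_induct)
  case less
  let ?ts = "ts[1 := tape_of (encode_rat (c n)), T := counter (n + 1) 0]"
  have 1: "reach M Q (S + 5, ts) (S + 10, ?ts)"
    using ask_coordinate[OF less.prems(1,2) assms(1)] .
  obtain t where t: "reach M Q (S + 10, ?ts) (if \<not> big_numerator (c n) then S + 5
      else if 0 < c n then S + 15 + j else S + 17 + j + length w1, ?ts[1 := t])"
    using inspect_answer[of ?ts "c n"] less.prems T by auto
  show ?case
  proof (cases "big_numerator (c n)")
    case True
    then show ?thesis using reach_trans[OF 1 t] less.prems(1)
      by (intro exI[of _ n] exI[of _ "?ts[1 := t]"]) simp
  next
    case False
    then have "n \<noteq> N" using assms(2) by auto
    then have "N - (n + 1) < N - n" using less.prems(3) by simp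
    then obtain k ts' where "big_numerator (c k)" "length ts' = T + 1"
      "reach M Q (S + 5, ?ts[1 := t]) (if 0 < c k then S + 15 + j else S + 17 + j + length w1, ts')"
      using less.prems T less.hyps[of "n + 1" "?ts[1 := t]"] \<open>n \<noteq> N\<close> by (auto simp del: One_nat_def)
    moreover have "reach M Q (S + 5, ts) (S + 5, ?ts[1 := t])"
      using reach_trans[OF 1 t] False by simp
    ultimately show ?thesis by (blast intro: reach_trans)
  qed
qed

end

lemma length_correct_prog [simp]:
  "length (correct_prog T S j w1 w2) = 19 + j + length w1 + length w2"
  by (simp add: correct_prog_def)

lemma wf_correct:
  assumes "wf_tm M" shows "wf_tm (extend M 1 (correct_prog (tapes M) (states M) j w1 w2))"
proof (rule wf_extend[OF assms])
  fix c and ss :: "symbol list"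
  assume c: "c \<in> set (correct_prog (tapes M) (states M) j w1 w2)" and ss: "length ss = tapes M + 1"
  then show "valid_action (states M + length (correct_prog (tapes M) (states M) j w1 w2)) (tapes M + 1) (c ss)"
    unfolding length_correct_prog by (auto simp: correct_prog_def write_segment_def)
qed (simp add: correct_prog_def)

text \<open>\<open>Extra 0\<close> delivers the exit flag. One informative answer makes the search
  end; that all informative answers have the same sign makes the precision at which it ends
  immaterial.\<close>

lemma tm_corrects:
  assumes "wf_tm M" "Blank \<notin> set w1" "Blank \<notin> set w2"
  shows "\<exists>M'. wf_tm M' \<and> (\<forall>Q Q' w b. (\<forall>k a. Q k = Some a \<longrightarrow> Q' k = Some a) \<longrightarrow>
     tm_halts M Q w \<longrightarrow> Q' (Extra 0) = Some (of_bool b) \<longrightarrow>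
     (b \<longrightarrow> tm_halts M' Q' w) \<and>
     (\<not> b \<longrightarrow> (\<forall>c n. (\<forall>n. Q' (Coord j n) = Some (c n)) \<longrightarrow> big_numerator (c n) \<longrightarrow>
        ((\<forall>n. big_numerator (c n) \<longrightarrow> 0 < c n) \<longrightarrow> tm_halts M' Q' w1) \<and>
        ((\<forall>n. big_numerator (c n) \<longrightarrow> c n < 0) \<longrightarrow> tm_halts M' Q' w2))))"
proof -
  let ?cs = "correct_prog (tapes M) (states M) j w1 w2"
  let ?M = "extend M 1 ?cs"
  let ?S = "states M" and ?T = "tapes M"
  have "(b \<longrightarrow> tm_halts ?M Q' w) \<and>
     (\<not> b \<longrightarrow> (\<forall>c n. (\<forall>n. Q' (Coord j n) = Some (c n)) \<longrightarrow> big_numerator (c n) \<longrightarrow>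
        ((\<forall>n. big_numerator (c n) \<longrightarrow> 0 < c n) \<longrightarrow> tm_halts ?M Q' w1) \<and>
        ((\<forall>n. big_numerator (c n) \<longrightarrow> c n < 0) \<longrightarrow> tm_halts ?M Q' w2)))"
    if ext: "\<forall>k a. Q k = Some a \<longrightarrow> Q' k = Some a" and h: "tm_halts M Q w"
      and b: "Q' (Extra 0) = Some (of_bool b)" for Q Q' w b
  proof -
    interpret correct_machine ?M Q' ?T ?S j w1 w2
      using assms(1) trans_extend[of _ ?cs M 1] by unfold_locales (auto simp: wf_tm_iff)
    obtain ts where ts: "length ts = ?T" "word (ts ! 0) = w"
      and r: "reach ?M Q' (0, replicate (?T + 1) (\<lambda>_. Blank)) (?S, ts @ replicate 1 (\<lambda>_. Blank))"
      using extend_runs[OF assms(1) _ h, of Q' 1 ?cs] ext by blast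
    let ?ts = "ts @ [\<lambda>_. Blank]"
    let ?t = "update_tape (Slash, Right) (?ts ! 1)"
    let ?q = "update_tape (Blank, Left) ?t"
    let ?ts' = "?ts[1 := tape_of (encode_rat (of_bool b))]"
    have tps: "tapes ?M = ?T + 1" by (simp add: extend_def)
    have "reach ?M Q' (0, replicate (tapes ?M) (\<lambda>_. Blank)) (?S, ?ts)" using r tps by simp
    also have "reach ?M Q' (?S, ?ts) (?S + 1, ?ts[1 := ?t])"
      using reach_Next1[of ?M ?S ?ts] 
      by (simp only: t0) (simp del: update_tape.simps)
    also have "reach ?M Q' \<dots> (?S + 2, ?ts[1 := ?q])"
      using reach_Next1[of ?M "?S + 1" "?ts[1 := ?t]"] ts T
      by (simp only: t1) (simp del: update_tape.simps)
    also have "reach ?M Q' \<dots> (?S + 3, ?ts')"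
      using reach_Ask[of ?M "?S + 2" "?ts[1 := ?q]" "?S + 3" "Extra 0" Q' "of_bool b"] b ts T
      by (simp only: t2) (simp add: word_extra_question del: update_tape.simps encode_question.simps)
    finally have s3: "reach ?M Q' (0, replicate (tapes ?M) (\<lambda>_. Blank)) (?S + 3, ?ts')" .
    \<comment> \<open>The flag 1 is encoded with a digit in front, the flag 0 with the slash,
      because its numerator has no digits.\<close>
    have first: "tape_of (encode_rat (of_bool b)) 0 = Bit True \<longleftrightarrow> b"
      by (cases b) (simp_all add: encode_rat_def tape_of_def binary_digits.simps)
    have "reach ?M Q' (?S + 3, ?ts') (if b then ?S + 4 else ?S + 5, ?ts')"
      using reach_Next1[of ?M "?S + 3" ?ts'] ts T first
      by (cases b; simp only: t3) (simp_all del: update_tape.simps)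
    with s3 have s: "reach ?M Q' (0, replicate (tapes ?M) (\<lambda>_. Blank)) (if b then ?S + 4 else ?S + 5, ?ts')"
      by (rule reach_trans)
    show ?thesis
    proof (intro conjI impI allI)
      assume b
      with s have "reach ?M Q' (0, replicate (tapes ?M) (\<lambda>_. Blank)) (?S + 4, ?ts')" by simp
      then show "tm_halts ?M Q' w"
        by (rule tm_haltsI) (simp only: t4, use ts T in \<open>simp add: nth_append\<close>)
    next
      fix c n
      assume nb: "\<not> b" and c: "\<forall>n. Q' (Coord j n) = Some (c n)" "big_numerator (c n)"
      have cT: "?ts' ! ?T = counter 0 0" using ts T by (auto simp: nth_append counter_def)
      obtain k ts2 where k: "big_numerator (c k)" "length ts2 = ?T + 1"
        "reach ?M Q' (?S + 5, ?ts') (if 0 < c k then ?S + 15 + j else ?S + 17 + j + length w1, ts2)"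
        using search_sign[where c = c and N = n and n = 0 and ts = ?ts'] c cT ts T by auto
      have "reach ?M Q' (0, replicate (tapes ?M) (\<lambda>_. Blank)) (?S + 5, ?ts')" using s nb by simp
      note reach2 = reach_trans[OF this k(3)]
      obtain t1 where t1: "reach ?M Q' (?S + 15 + j, ts2) (?S + 4, ts2[0 := t1])" "reads t1 (w1 @ [Blank])"
        using write_output(1)[of ts2] k(2) by auto
      obtain t2 where t2: "reach ?M Q' (?S + 17 + j + length w1, ts2) (?S + 4, ts2[0 := t2])" "reads t2 (w2 @ [Blank])"
        using write_output(2)[of ts2] k(2) by auto
      show "tm_halts ?M Q' w1" if "\<forall>n. big_numerator (c n) \<longrightarrow> 0 < c n"
      proof (rule tm_haltsI)
        show "reach ?M Q' (0, replicate (tapes ?M) (\<lambda>_. Blank)) (?S + 4, ts2[0 := t1])"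
          using reach2 t1(1) that k(1) nb by (auto intro: reach_trans)
        show "word (ts2[0 := t1] ! 0) = w1" using word_eqI[OF t1(2) assms(2)] k(2) by simp
      qed (simp only: t4)
      show "tm_halts ?M Q' w2" if "\<forall>n. big_numerator (c n) \<longrightarrow> c n < 0"
      proof (rule tm_haltsI)
        have "\<not> 0 < c k" using that k(1) by force
        then show "reach ?M Q' (0, replicate (tapes ?M) (\<lambda>_. Blank)) (?S + 4, ts2[0 := t2])"
          using reach2 t2(1) nb by (auto intro: reach_trans)
        show "word (ts2[0 := t2] ! 0) = w2" using word_eqI[OF t2(2) assms(3)] k(2) by simp
      qed (simp only: t4)
    qed
  qed
  then show ?thesis using wf_correct[OF assms(1)] by blast
qed

section \<open>BSS programs that decide the flag or correct an output\<close>

fun clip_jump :: "nat \<Rightarrow> instr \<Rightarrow> instr" where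
  "clip_jump L (BranchNonneg i l) = BranchNonneg i (min l L)"
| "clip_jump L ins = ins"

definition bss_reach :: "instr list \<Rightarrow> orc \<Rightarrow> nat \<times> cells \<Rightarrow> nat \<times> cells \<Rightarrow> bool" where
  "bss_reach P Q c c' \<longleftrightarrow> (\<exists>n. (bss_step P Q ^^ n) c = c')"

lemma bss_reach_refl [simp]: "bss_reach P Q c c"
  unfolding bss_reach_def by (rule exI[of _ 0]) simp

lemma bss_reach_trans [trans]: "bss_reach P Q c c' \<Longrightarrow> bss_reach P Q c' c'' \<Longrightarrow> bss_reach P Q c c''"
  unfolding bss_reach_def by (metis comp_apply funpow_add)

lemma bss_reach_step:
  assumes "pc < length P" "bss_reach P Q (exec Q (P ! pc) (pc, x)) c"
  shows "bss_reach P Q (pc, x) c"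
proof -
  have "bss_reach P Q (pc, x) (exec Q (P ! pc) (pc, x))"
    unfolding bss_reach_def using assms(1) by (intro exI[of _ 1]) simp
  then show ?thesis using assms(2) by (rule bss_reach_trans)
qed

text \<open>The first alternative covers in particular a query without an answer, at which the
  program stays where it is.\<close>

lemma bss_step_clip:
  assumes ext: "\<And>k a. Q k = Some a \<Longrightarrow> Q' k = Some a" and pc: "pc < length P"
  shows "exec Q (P ! pc) (pc, x) = (pc, x) \<or>
    exec Q' (clip_jump (length P) (P ! pc)) (pc, x)
      = (min (fst (exec Q (P ! pc) (pc, x))) (length P), snd (exec Q (P ! pc) (pc, x)))"
proof (cases "P ! pc")
  case (GetCoord i j k)
  then show ?thesis using pc
    by (cases "Q (Coord (nat \<lfloor>x (int j)\<rfloor>) (nat \<lfloor>x (int k)\<rfloor>))") (auto dest: ext)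
next
  case (GetExtra i j)
  then show ?thesis using pc
    by (cases "Q (Extra (nat \<lfloor>x (int j)\<rfloor>))") (auto dest: ext)
qed (use pc in auto)

text \<open>A program halts as soon as the counter leaves it, possibly by a far jump. Clipping the
  jumps to \<open>length P\<close> makes every exit arrive at the first appended
  instruction.\<close>

lemma bss_reach_extend:
  assumes "\<And>k a. Q k = Some a \<Longrightarrow> Q' k = Some a"
    and "(bss_step P Q ^^ n) (pc, x) = (pc', c)" "length P \<le> pc'"
  shows "bss_reach (map (clip_jump (length P)) P @ R) Q' (min pc (length P), x) (length P, c)"
  using assms(2,3)
proof (induction n arbitrary: pc x)
  case 0
  then show ?case by (simp add: min_absorb2)
next
  case (Suc n)
  have n: "(bss_step P Q ^^ n) (bss_step P Q (pc, x)) = (pc', c)"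
    using Suc.prems(1) by (simp only: funpow_Suc_right comp_apply)
  show ?case
  proof (cases "bss_step P Q (pc, x) = (pc, x)")
    case True
    then show ?thesis using Suc.IH n Suc.prems(2) by simp
  next
    case False
    then have pc: "pc < length P" by (auto split: if_splits)
    obtain q y where qy: "exec Q (P ! pc) (pc, x) = (q, y)" by (cases "exec Q (P ! pc) (pc, x)")
    have "exec Q' (clip_jump (length P) (P ! pc)) (pc, x) = (min q (length P), y)"
      using bss_step_clip[of Q Q' pc P x] assms(1) False pc qy by auto
    moreover have "bss_reach (map (clip_jump (length P)) P @ R) Q' (min q (length P), y) (length P, c)"
      using n pc qy Suc.prems(2) by (intro Suc.IH) auto
    ultimately show ?thesis
      using pc bss_reach_step[of pc "map (clip_jump (length P)) P @ R" Q' x]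
      by (simp add: nth_append min_absorb1)
  qed
qed

lemma bss_extend_runs:
  assumes "\<And>k a. Q k = Some a \<Longrightarrow> Q' k = Some a" "bss_halts P Q c"
  shows "bss_reach (map (clip_jump (length P)) P @ R) Q' (0, \<lambda>_. 0) (length P, c)"
  using assms bss_reach_extend[where Q = Q and Q' = Q' and P = P and pc = 0 and c = c and R = R] unfolding bss_halts_def by auto

lemma bss_haltsI: "bss_reach P Q (0, \<lambda>_. 0) (pc, x) \<Longrightarrow> length P \<le> pc \<Longrightarrow> bss_halts P Q x"
  unfolding bss_halts_def bss_reach_def by auto

text \<open>Cells \<open>0\<close> and \<open>B + 1\<close> come to hold the first entry of the
  output minus 1 and the oracle answer minus 1, whose signs are compared. Cell \<open>B\<close> then
  contains 1, which makes \<open>BranchNonneg B\<close> an unconditional jump.\<close>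

definition bss_decide_prog :: "nat \<Rightarrow> nat \<Rightarrow> instr list" where
  "bss_decide_prog B L =
    [Const B 0, GetExtra (B + 1) B, Const B 1, Sub (B + 1) (B + 1) B, Sub 0 0 B,
     BranchNonneg 0 (L + 9), BranchNonneg (B + 1) (L + 10), Const 0 1, BranchNonneg B (L + 13),
     BranchNonneg (B + 1) (L + 12), Const 0 0, BranchNonneg B (L + 13), Const 0 1]"

lemma bss_decides:
  shows "\<exists>P'. \<forall>Q Q' c \<rho>. (\<forall>k a. Q k = Some a \<longrightarrow> Q' k = Some a) \<longrightarrow> bss_halts P Q c \<longrightarrow>
    Q' (Extra 0) = Some \<rho> \<longrightarrow> (\<exists>c'. bss_halts P' Q' c' \<and> c' 0 = of_bool ((1 \<le> c 0) = (1 \<le> \<rho>)))"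
proof (rule exI, intro allI impI)
  let ?L = "length P"
  let ?R = "bss_decide_prog 1 ?L"
  let ?P = "map (clip_jump ?L) P @ ?R"
  fix Q Q' :: orc and c \<rho>
  assume ext: "\<forall>k a. Q k = Some a \<longrightarrow> Q' k = Some a" and h: "bss_halts P Q c"
    and Q: "Q' (Extra 0) = Some \<rho>"
  have nth: "?P ! (?L + i) = ?R ! i" for i by (simp add: nth_append)
  have n0: "?P ! ?L = ?R ! 0" using nth[of 0] by simp
  have len: "length ?R = 13" by (simp add: bss_decide_prog_def)
  have st: "bss_reach ?P Q' (exec Q' (?R ! i) (?L + i, x)) d \<Longrightarrow> i < 13 \<Longrightarrow> bss_reach ?P Q' (?L + i, x) d"
    for i x d using bss_reach_step[of "?L + i" ?P Q' x d] len by (simp add: nth_append)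
  have st': "exec Q' (?R ! i) (?L + i, x) = (?L + i', y) \<Longrightarrow> i < 13 \<Longrightarrow> bss_reach ?P Q' (?L + i, x) (?L + i', y)"
    for i x i' y using st[of i x] by simp
  have rho: "(1::real) \<le> of_rat \<rho> \<longleftrightarrow> 1 \<le> \<rho>"
    using of_rat_less_eq[of 1 \<rho>, where ?'a = real] by simp
  define x where "x = c(1 := 1, 2 := of_rat \<rho> - 1, 0 := c 0 - 1)"
  have "bss_reach ?P Q' (0, \<lambda>_. 0) (?L + 0, c)"
    using bss_extend_runs[of Q Q' P c ?R] ext h by simp
  also have "bss_reach ?P Q' \<dots> (?L + 1, c(1 := 0))"
    by (rule st') (simp_all add: bss_decide_prog_def)
  also have "bss_reach ?P Q' \<dots> (?L + 2, c(1 := 0, 2 := of_rat \<rho>))"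
    by (rule st') (simp_all add: bss_decide_prog_def Q)
  also have "bss_reach ?P Q' \<dots> (?L + 3, c(1 := 1, 2 := of_rat \<rho>))"
    by (rule st') (simp_all add: bss_decide_prog_def fun_upd_twist)
  also have "bss_reach ?P Q' \<dots> (?L + 4, c(1 := 1, 2 := of_rat \<rho> - 1))"
    by (rule st') (simp_all add: bss_decide_prog_def)
  also have "bss_reach ?P Q' \<dots> (?L + 5, x)"
    by (rule st') (simp_all add: bss_decide_prog_def x_def)
  also have "bss_reach ?P Q' \<dots> (?L + (if 1 \<le> c 0 then 9 else 6), x)"
    by (rule st') (simp_all add: bss_decide_prog_def x_def)
  also have "bss_reach ?P Q' \<dots> (?L + 13, x(0 := of_bool ((1 \<le> c 0) = (1 \<le> \<rho>))))"
  proof -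
    have 7: "bss_reach ?P Q' (?L + 7, x) (?L + 13, x(0 := 1))"
    proof -
      have "bss_reach ?P Q' (?L + 7, x) (?L + 8, x(0 := 1))"
        by (rule st') (simp_all add: bss_decide_prog_def)
      also have "bss_reach ?P Q' \<dots> (?L + 13, x(0 := 1))"
        by (rule st') (simp_all add: bss_decide_prog_def x_def)
      finally show ?thesis .
    qed
    have 10: "bss_reach ?P Q' (?L + 10, x) (?L + 13, x(0 := 0))"
    proof -
      have "bss_reach ?P Q' (?L + 10, x) (?L + 11, x(0 := 0))"
        by (rule st') (simp_all add: bss_decide_prog_def)
      also have "bss_reach ?P Q' \<dots> (?L + 13, x(0 := 0))"
        by (rule st') (simp_all add: bss_decide_prog_def x_def)
      finally show ?thesis .
    qed
    have 12: "bss_reach ?P Q' (?L + 12, x) (?L + 13, x(0 := 1))"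
      by (rule st') (simp_all add: bss_decide_prog_def)
    have 6: "bss_reach ?P Q' (?L + 6, x) (?L + (if 1 \<le> \<rho> then 10 else 7), x)"
      by (rule st') (simp_all add: bss_decide_prog_def x_def rho)
    have 9: "bss_reach ?P Q' (?L + 9, x) (?L + (if 1 \<le> \<rho> then 12 else 10), x)"
      by (rule st') (simp_all add: bss_decide_prog_def x_def rho)
    show ?thesis
      using bss_reach_trans[OF 6] bss_reach_trans[OF 9] 7 10 12
      by (cases "1 \<le> c 0"; cases "1 \<le> \<rho>") simp_all
  qed
  finally have "bss_halts ?P Q' (x(0 := of_bool ((1 \<le> c 0) = (1 \<le> \<rho>))))"
    by (rule bss_haltsI) (simp add: bss_decide_prog_def)
  then show "\<exists>c'. bss_halts ?P Q' c' \<and> c' 0 = of_bool ((1 \<le> c 0) = (1 \<le> \<rho>))"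
    by (intro exI conjI) (assumption, simp)
qed

text \<open>Cells \<open>0, \<dots>, B - 1\<close> hold the output. The program keeps the precision \<open>n\<close> in cell \<open>B\<close> and
  \<open>2 / 2 ^ n\<close> in cell \<open>B + 1\<close>, and leaves the search when an answer exceeds this threshold.\<close>

definition bss_correct_prog :: "nat \<Rightarrow> nat \<Rightarrow> nat \<Rightarrow> real list \<Rightarrow> real list \<Rightarrow> instr list" where
  "bss_correct_prog B L j u1 u2 =
    [Const B 0, GetExtra (B + 1) B, Const B 1, Sub (B + 1) (B + 1) B,
     BranchNonneg (B + 1) (L + 21 + length u1 + length u2),
     Const B 0, Const (B + 1) 2, Const (B + 2) (real j), Const (B + 3) 1, Const (B + 4) 2, Const (B + 7) 0,
     GetCoord (B + 5) (B + 2) B, Sub (B + 6) (B + 5) (B + 1), BranchNonneg (B + 6) (L + 20),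
     Add (B + 6) (B + 5) (B + 1), Sub (B + 6) (B + 7) (B + 6), BranchNonneg (B + 6) (L + 21 + length u1),
     Add B B (B + 3), Div (B + 1) (B + 1) (B + 4), BranchNonneg (B + 3) (L + 11)]
    @ (map (\<lambda>i. Const i (u1 ! i)) [0..<length u1]
    @ BranchNonneg (B + 3) (L + 21 + length u1 + length u2)
    # map (\<lambda>i. Const i (u2 ! i)) [0..<length u2])"

lemma bss_reach_constants:
  assumes "\<And>i. i < length u \<Longrightarrow> b + i < length P \<and> P ! (b + i) = Const i (u ! i)" "k \<le> length u"
  shows "bss_reach P Q (b, x) (b + k, \<lambda>i. if 0 \<le> i \<and> i < int k then u ! nat i else x i)"
  using assms(2)
proof (induction k)
  case (Suc k)
  let ?x = "\<lambda>k i. if 0 \<le> i \<and> i < int k then u ! nat i else x i"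
  have "(?x k)(int k := u ! k) = ?x (Suc k)" by (auto simp: fun_eq_iff)
  then have "bss_reach P Q (b + k, ?x k) (b + Suc k, ?x (Suc k))"
    using assms(1)[of k] Suc.prems by (intro bss_reach_step) auto
  with Suc show ?case by (auto intro: bss_reach_trans)
next
  case 0
  have "(\<lambda>i. if 0 \<le> i \<and> i < int 0 then u ! nat i else x i) = x" by auto
  then show ?case by simp
qed

lemma bss_corrects:
  assumes "length u1 = B" "length u2 = B"
  shows "\<exists>P'. \<forall>Q Q' c b. (\<forall>k a. Q k = Some a \<longrightarrow> Q' k = Some a) \<longrightarrow>
     bss_halts P Q c \<longrightarrow> Q' (Extra 0) = Some (of_bool b) \<longrightarrow>
     (b \<longrightarrow> (\<exists>c'. bss_halts P' Q' c' \<and> (\<forall>i<B. c' (int i) = c (int i)))) \<and>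
     (\<not> b \<longrightarrow> (\<forall>a n. (\<forall>n. Q' (Coord j n) = Some (a n)) \<longrightarrow> 2 / 2 ^ n \<le> \<bar>real_of_rat (a n)\<bar> \<longrightarrow>
        ((\<forall>n. 2 / 2 ^ n \<le> \<bar>real_of_rat (a n)\<bar> \<longrightarrow> 0 < a n) \<longrightarrow>
           (\<exists>c'. bss_halts P' Q' c' \<and> (\<forall>i<B. c' (int i) = u1 ! i))) \<and>
        ((\<forall>n. 2 / 2 ^ n \<le> \<bar>real_of_rat (a n)\<bar> \<longrightarrow> a n < 0) \<longrightarrow>
           (\<exists>c'. bss_halts P' Q' c' \<and> (\<forall>i<B. c' (int i) = u2 ! i)))))"
proof (intro exI allI impI)
  let ?L = "length P"
  let ?R = "bss_correct_prog B ?L j u1 u2"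
  let ?P = "map (clip_jump ?L) P @ ?R"
  fix Q Q' :: orc and c b
  assume ext: "\<forall>k a. Q k = Some a \<longrightarrow> Q' k = Some a" and h: "bss_halts P Q c"
    and Q: "Q' (Extra 0) = Some (of_bool b)"
  have len: "length ?R = 21 + B + B" by (simp add: bss_correct_prog_def assms)
  have st: "exec Q' (?R ! i) (?L + i, x) = (?L + i', y) \<Longrightarrow> i < 20 \<Longrightarrow> bss_reach ?P Q' (?L + i, x) (?L + i', y)"
    for i x i' y using bss_reach_step[of "?L + i" ?P Q' x "(?L + i', y)"] len by (simp add: nth_append)
  note R = bss_correct_prog_def nth_append assms
  define x where "x = c(int B := 1, 1 + int B := of_bool b - 1)"
  have "bss_reach ?P Q' (0, \<lambda>_. 0) (?L + 0, c)"
    using bss_extend_runs[of Q Q' P c ?R] ext h by simp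
  also have "bss_reach ?P Q' \<dots> (?L + 1, c(int B := 0))"
    by (rule st) (simp_all add: R)
  also have "bss_reach ?P Q' \<dots> (?L + 2, c(int B := 0, 1 + int B := of_bool b))"
    by (rule st) (simp_all add: R Q)
  also have "bss_reach ?P Q' \<dots> (?L + 3, c(int B := 1, 1 + int B := of_bool b))"
    by (rule st) (simp_all add: R fun_upd_twist)
  also have "bss_reach ?P Q' \<dots> (?L + 4, x)"
    by (rule st) (simp_all add: R x_def)
  also have "bss_reach ?P Q' \<dots> (?L + (if b then 21 + B + B else 5), x)"
    by (rule st) (simp_all add: R x_def)
  finally have start: "bss_reach ?P Q' (0, \<lambda>_. 0) (?L + (if b then 21 + B + B else 5), x)" .
  \<comment> \<open>The invariant at the head of the loop; the remaining cells hold the number of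
    the coordinate and the constants 1, 2 and 0.\<close>
  define good where "good n d \<longleftrightarrow> d (int B) = real n \<and> d (1 + int B) = 2 / 2 ^ n \<and> d (int B + 2) = real j
      \<and> d (int B + 3) = 1 \<and> d (int B + 4) = 2 \<and> d (int B + 7) = 0" for n and d :: cells
  have out1: "\<exists>c'. bss_reach ?P Q' (?L + 20, d) (?L + 21 + B + B, c') \<and> (\<forall>i<B. c' (int i) = u1 ! i)"
    if d: "d (int B + 3) = 1" for d
  proof -
    let ?d = "\<lambda>i. if 0 \<le> i \<and> i < int B then u1 ! nat i else d i"
    have "bss_reach ?P Q' (?L + 20, d) (?L + 20 + B, ?d)"
      by (rule bss_reach_constants[of u1, simplified assms])
        (simp_all add: bss_correct_prog_def nth_append assms)
    also have "?P ! (?L + 20 + B) = BranchNonneg (B + 3) (?L + 21 + B + B)"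
      by (simp add: bss_correct_prog_def nth_append assms)
    then have "bss_reach ?P Q' (?L + 20 + B, ?d) (?L + 21 + B + B, ?d)"
      using d len by (intro bss_reach_step) (simp_all add: ac_simps)
    finally show ?thesis by (intro exI conjI) (assumption, simp)
  qed
  have out2: "\<exists>c'. bss_reach ?P Q' (?L + 21 + B, d) (?L + 21 + B + B, c') \<and> (\<forall>i<B. c' (int i) = u2 ! i)"
    for d
  proof -
    let ?d = "\<lambda>i. if 0 \<le> i \<and> i < int B then u2 ! nat i else d i"
    have "bss_reach ?P Q' (?L + 21 + B, d) (?L + 21 + B + B, ?d)"
      by (rule bss_reach_constants[of u2, simplified assms])
        (simp_all add: bss_correct_prog_def nth_append assms nth_Cons')
    then show ?thesis by (intro exI conjI) (assumption, simp)
  qed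
  have fin: "bss_halts ?P Q' c'" if "bss_reach ?P Q' (0, \<lambda>_. 0) (?L + 21 + B + B, c')" for c'
    by (rule bss_haltsI[OF that]) (simp add: len)
  show "(b \<longrightarrow> (\<exists>c'. bss_halts ?P Q' c' \<and> (\<forall>i<B. c' (int i) = c (int i)))) \<and>
     (\<not> b \<longrightarrow> (\<forall>a n. (\<forall>n. Q' (Coord j n) = Some (a n)) \<longrightarrow> 2 / 2 ^ n \<le> \<bar>real_of_rat (a n)\<bar> \<longrightarrow>
        ((\<forall>n. 2 / 2 ^ n \<le> \<bar>real_of_rat (a n)\<bar> \<longrightarrow> 0 < a n) \<longrightarrow>
           (\<exists>c'. bss_halts ?P Q' c' \<and> (\<forall>i<B. c' (int i) = u1 ! i))) \<and>
        ((\<forall>n. 2 / 2 ^ n \<le> \<bar>real_of_rat (a n)\<bar> \<longrightarrow> a n < 0) \<longrightarrow>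
           (\<exists>c'. bss_halts ?P Q' c' \<and> (\<forall>i<B. c' (int i) = u2 ! i)))))"
  proof (rule conjI; intro impI)
    assume b
    then have "bss_halts ?P Q' x" using start by (intro fin) (simp add: add.assoc)
    then show "\<exists>c'. bss_halts ?P Q' c' \<and> (\<forall>i<B. c' (int i) = c (int i))"
      by (intro exI conjI) (assumption, simp add: x_def)
  next
    assume nb: "\<not> b"
    show "\<forall>a n. (\<forall>n. Q' (Coord j n) = Some (a n)) \<longrightarrow> 2 / 2 ^ n \<le> \<bar>real_of_rat (a n)\<bar> \<longrightarrow>
        ((\<forall>n. 2 / 2 ^ n \<le> \<bar>real_of_rat (a n)\<bar> \<longrightarrow> 0 < a n) \<longrightarrow>
           (\<exists>c'. bss_halts ?P Q' c' \<and> (\<forall>i<B. c' (int i) = u1 ! i))) \<and>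
        ((\<forall>n. 2 / 2 ^ n \<le> \<bar>real_of_rat (a n)\<bar> \<longrightarrow> a n < 0) \<longrightarrow>
           (\<exists>c'. bss_halts ?P Q' c' \<and> (\<forall>i<B. c' (int i) = u2 ! i)))"
    proof (intro allI impI)
      fix a n assume a: "\<forall>n. Q' (Coord j n) = Some (a n)" and n: "2 / 2 ^ n \<le> \<bar>real_of_rat (a n)\<bar>"
      \<comment> \<open>The answer of precision \<open>n\<close> passes the threshold, so the loop
        is left at \<open>n\<close> at the latest.\<close>
      have loop: "\<exists>l d'. good l d' \<and> 2 / 2 ^ l \<le> \<bar>real_of_rat (a l)\<bar> \<and>
          bss_reach ?P Q' (?L + 11, d) (?L + (if 0 < a l then 20 else 21 + B), d')"
        if "good k d" "k \<le> n" for k d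
        using that
      proof (induction "n - k" arbitrary: k d rule: less_induct)
        case less
        let ?r = "real_of_rat (a k)"
        let ?d1 = "d(int B + 5 := ?r)"
        let ?d2 = "?d1(int B + 6 := ?r - 2 / 2 ^ k)"
        let ?d3 = "?d1(int B + 6 := - (?r + 2 / 2 ^ k))"
        have g: "d (int B) = real k" "d (1 + int B) = 2 / 2 ^ k" "d (int B + 2) = real j" "d (2 + int B) = real j"
          "d (int B + 3) = 1" "d (int B + 4) = 2" "d (int B + 7) = 0"
          using less.prems(1) by (simp_all add: good_def add.commute)
        have "bss_reach ?P Q' (?L + 11, d) (?L + 12, ?d1)"
          by (rule st) (simp_all add: R g a)
        also have "bss_reach ?P Q' \<dots> (?L + 13, ?d2)"
          by (rule st) (simp_all add: R g)
        also have "bss_reach ?P Q' \<dots> (?L + (if 2 / 2 ^ k \<le> ?r then 20 else 14), ?d2)"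
          by (rule st) (simp_all add: R g)
        finally have 1: "bss_reach ?P Q' (?L + 11, d) (?L + (if 2 / 2 ^ k \<le> ?r then 20 else 14), ?d2)" .
        have "bss_reach ?P Q' (?L + 14, ?d2) (?L + 15, ?d1(int B + 6 := ?r + 2 / 2 ^ k))"
          by (rule st) (simp_all add: R g)
        also have "bss_reach ?P Q' \<dots> (?L + 16, ?d3)"
          by (rule st) (simp_all add: R g)
        also have "bss_reach ?P Q' \<dots> (?L + (if 2 / 2 ^ k \<le> - ?r then 21 + B else 17), ?d3)"
          by (rule st) (simp_all add: R g)
        finally have 2: "bss_reach ?P Q' (?L + 14, ?d2) (?L + (if 2 / 2 ^ k \<le> - ?r then 21 + B else 17), ?d3)" .
        let ?d4 = "?d3(int B := real (Suc k), 1 + int B := 2 / 2 ^ Suc k)"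
        have "bss_reach ?P Q' (?L + 17, ?d3) (?L + 18, ?d3(int B := real (Suc k)))"
          by (rule st) (simp_all add: R g add.commute)
        also have "bss_reach ?P Q' \<dots> (?L + 19, ?d4)"
          by (rule st) (simp_all add: R g)
        also have "bss_reach ?P Q' \<dots> (?L + 11, ?d4)"
          by (rule st) (simp_all add: R g)
        finally have 3: "bss_reach ?P Q' (?L + 17, ?d3) (?L + 11, ?d4)" .
        have pos: "0 < (2::real) / 2 ^ k" by simp
        consider "2 / 2 ^ k \<le> ?r" | "\<not> 2 / 2 ^ k \<le> ?r" "2 / 2 ^ k \<le> - ?r"
          | "\<not> 2 / 2 ^ k \<le> ?r" "\<not> 2 / 2 ^ k \<le> - ?r" by blast
        then show ?case
        proof cases
          case 1
          then have "0 < ?r" using pos by linarith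
          then show ?thesis using 1 \<open>bss_reach ?P Q' (?L + 11, d) (?L + (if 2 / 2 ^ k \<le> ?r then 20 else 14), ?d2)\<close> g
            by (intro exI[of _ k] exI[of _ ?d2]) (simp add: good_def)
        next
          case 2
          then have "\<not> 0 < ?r" "2 / 2 ^ k \<le> \<bar>?r\<bar>" using pos by linarith+
          then show ?thesis using 2 bss_reach_trans[OF 1 [unfolded if_not_P[OF 2(1)]]
              \<open>bss_reach ?P Q' (?L + 14, ?d2) (?L + (if 2 / 2 ^ k \<le> - ?r then 21 + B else 17), ?d3)\<close>] g
            by (intro exI[of _ k] exI[of _ ?d3]) (simp add: good_def)
        next
          case no: 3
          have "\<not> 2 / 2 ^ k \<le> \<bar>?r\<bar>" using no by linarith
          then have "k \<noteq> n" using n by blast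
          moreover have "good (Suc k) ?d4" using g by (simp add: good_def)
          moreover have "n - Suc k < n - k" using \<open>k \<noteq> n\<close> less.prems(2) by simp
          ultimately obtain l d' where "good l d'" "2 / 2 ^ l \<le> \<bar>real_of_rat (a l)\<bar>"
            "bss_reach ?P Q' (?L + 11, ?d4) (?L + (if 0 < a l then 20 else 21 + B), d')"
            using less.hyps[of "Suc k" ?d4] less.prems(2) by auto
          moreover have "bss_reach ?P Q' (?L + 11, d) (?L + 11, ?d4)"
            using bss_reach_trans[OF 1 [unfolded if_not_P[OF no(1)]] bss_reach_trans[OF 2 [unfolded if_not_P[OF no(2)]] 3]] .
          ultimately show ?thesis by (blast intro: bss_reach_trans)
        qed
      qed
      let ?d0 = "x(int B := 0, 1 + int B := 2, int B + 2 := real j, int B + 3 := 1, int B + 4 := 2, int B + 7 := 0)"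
      have "bss_reach ?P Q' (0, \<lambda>_. 0) (?L + 5, x)" using start nb by simp
      also have "bss_reach ?P Q' \<dots> (?L + 6, x(int B := 0))"
        by (rule st) (simp_all add: R add.commute)
      also have "bss_reach ?P Q' \<dots> (?L + 7, x(int B := 0, 1 + int B := 2))"
        by (rule st) (simp_all add: R add.commute)
      also have "bss_reach ?P Q' \<dots> (?L + 8, x(int B := 0, 1 + int B := 2, int B + 2 := real j))"
        by (rule st) (simp_all add: R add.commute)
      also have "bss_reach ?P Q' \<dots> (?L + 9, x(int B := 0, 1 + int B := 2, int B + 2 := real j, int B + 3 := 1))"
        by (rule st) (simp_all add: R add.commute)
      also have "bss_reach ?P Q' \<dots> (?L + 10, x(int B := 0, 1 + int B := 2, int B + 2 := real j, int B + 3 := 1, int B + 4 := 2))"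
        by (rule st) (simp_all add: R add.commute)
      also have "bss_reach ?P Q' \<dots> (?L + 11, ?d0)"
        by (rule st) (simp_all add: R add.commute)
      finally have s11: "bss_reach ?P Q' (0, \<lambda>_. 0) (?L + 11, ?d0)" .
      obtain l d' where l: "good l d'" "2 / 2 ^ l \<le> \<bar>real_of_rat (a l)\<bar>"
        "bss_reach ?P Q' (?L + 11, ?d0) (?L + (if 0 < a l then 20 else 21 + B), d')"
        using loop[of 0 ?d0] by (auto simp: good_def)
      note s = bss_reach_trans[OF s11 l(3)]
      show "((\<forall>n. 2 / 2 ^ n \<le> \<bar>real_of_rat (a n)\<bar> \<longrightarrow> 0 < a n) \<longrightarrow>
           (\<exists>c'. bss_halts ?P Q' c' \<and> (\<forall>i<B. c' (int i) = u1 ! i))) \<and>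
        ((\<forall>n. 2 / 2 ^ n \<le> \<bar>real_of_rat (a n)\<bar> \<longrightarrow> a n < 0) \<longrightarrow>
           (\<exists>c'. bss_halts ?P Q' c' \<and> (\<forall>i<B. c' (int i) = u2 ! i)))"
      proof (intro conjI impI)
        assume "\<forall>n. 2 / 2 ^ n \<le> \<bar>real_of_rat (a n)\<bar> \<longrightarrow> 0 < a n"
        then have "bss_reach ?P Q' (0, \<lambda>_. 0) (?L + 20, d')" using s l(2) by simp
        then show "\<exists>c'. bss_halts ?P Q' c' \<and> (\<forall>i<B. c' (int i) = u1 ! i)"
          using out1[of d'] l(1) fin unfolding good_def by (blast intro: bss_reach_trans)
      next
        assume "\<forall>n. 2 / 2 ^ n \<le> \<bar>real_of_rat (a n)\<bar> \<longrightarrow> a n < 0"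
        then have "\<not> 0 < a l" using l(2) by (meson order_less_asym)
        then have "bss_reach ?P Q' (0, \<lambda>_. 0) (?L + 21 + B, d')" using s by (simp add: add.assoc)
        then show "\<exists>c'. bss_halts ?P Q' c' \<and> (\<forall>i<B. c' (int i) = u2 ! i)"
          using out2[of d'] fin by (blast intro: bss_reach_trans)
      qed
    qed
  qed
qed

section \<open>Coordinates by position\<close>

text \<open>Total variation and the families below refer to consecutive coordinates, so vectors and
  matrices are described by positions in the enumeration rather than by elements of the index
  type.\<close>

definition pos :: "'a::enum \<Rightarrow> nat" where
  "pos x = (THE k. k < CARD('a) \<and> enum_class.enum ! k = x)"

abbreviation entry :: "'b ^ 'a::enum \<Rightarrow> nat \<Rightarrow> 'b" (infixl "!." 100) where
  "x !. k \<equiv> x $ (enum_class.enum ! k)"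

lemma length_enum: "length (enum_class.enum :: 'a::enum list) = CARD('a)"
  using distinct_card[OF enum_distinct, where ?'a1 = 'a] by (simp add: UNIV_enum[symmetric])

lemma pos_ex1: "\<exists>!k. k < CARD('a) \<and> enum_class.enum ! k = (x :: 'a::enum)"
proof -
  have "x \<in> set enum_class.enum" by (simp add: UNIV_enum[symmetric])
  then show ?thesis
    using distinct_Ex1[OF enum_distinct] by (simp add: length_enum)
qed

lemma pos_less [simp]: "pos (x :: 'a::enum) < CARD('a)"
  and enum_pos [simp]: "enum_class.enum ! pos (x :: 'a) = x"
  using theI'[OF pos_ex1[of x]] unfolding pos_def by auto

lemma pos_enum [simp]: "k < CARD('a) \<Longrightarrow> pos (enum_class.enum ! k :: 'a::enum) = k"
  using pos_ex1[of "enum_class.enum ! k :: 'a"] pos_less enum_pos by metis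

lemma sum_UNIV_enum: "(\<Sum>i\<in>UNIV. f i) = (\<Sum>k<CARD('a). f (enum_class.enum ! k :: 'a::enum))"
  by (rule sum.reindex_bij_witness[of _ "\<lambda>k. enum_class.enum ! k" pos]) auto

lemma vec_eq_entry_iff: "x = y \<longleftrightarrow> (\<forall>k<CARD('a). x !. k = y !. k)" for x y :: "'b ^ ('a::enum)"
  unfolding vec_eq_iff by (metis enum_pos pos_less)

lemma all_entry_iff: "(\<forall>i. P (x $ i)) \<longleftrightarrow> (\<forall>k<CARD('a). P (x !. k))" for x :: "'b ^ ('a::enum)"
  by (metis enum_pos pos_less)

definition vec_of :: "(nat \<Rightarrow> 'b) \<Rightarrow> 'b ^ ('a::enum)" where
  "vec_of f = (\<chi> i. f (pos i))"

lemma vec_of_entry [simp]: "k < CARD('a) \<Longrightarrow> (vec_of f :: 'b ^ ('a::enum)) !. k = f k"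
  by (simp add: vec_of_def)

definition mat_of :: "(nat \<Rightarrow> nat \<Rightarrow> 'b) \<Rightarrow> 'b ^ ('a::enum) ^ ('c::enum)" where
  "mat_of f = (\<chi> i j. f (pos i) (pos j))"

lemma mat_of_entry [simp]: "k < CARD('c) \<Longrightarrow> l < CARD('a) \<Longrightarrow>
    (mat_of f :: 'b ^ ('a::enum) ^ ('c::enum)) !. k !. l = f k l"
  by (simp add: mat_of_def)

lemma mult_entry: "k < CARD('c) \<Longrightarrow> ((mat_of f :: real ^ ('a::enum) ^ ('c::enum)) *v x) !. k
    = (\<Sum>l<CARD('a). f k l * x !. l)"
  by (simp add: matrix_vector_mult_def sum_UNIV_enum)

lemma transpose_mult_entry: "l < CARD('a) \<Longrightarrow>
    (transpose (mat_of f :: real ^ ('a::enum) ^ ('c::enum)) *v v) !. l = (\<Sum>k<CARD('c). f k l * v !. k)"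
  by (simp add: matrix_vector_mult_def sum_UNIV_enum transpose_def)

lemma inner_entry: "x \<bullet> y = (\<Sum>k<CARD('a). x !. k * y !. k)" for x y :: "real ^ ('a::enum)"
  by (simp add: inner_vec_def sum_UNIV_enum)

lemma norm1_entry: "norm1 x = (\<Sum>k<CARD('a). \<bar>x !. k\<bar>)" for x :: "real ^ ('a::enum)"
  by (simp add: norm1_def sum_UNIV_enum)

lemma norm_entry: "(norm x)\<^sup>2 = (\<Sum>k<CARD('a). (x !. k)\<^sup>2)" for x :: "real ^ ('a::enum)"
  unfolding power2_norm_eq_inner inner_entry by (simp add: power2_eq_square)

lemma infnorm_entry_le_iff: "infnorm x \<le> c \<longleftrightarrow> (\<forall>k<CARD('a). \<bar>x !. k\<bar> \<le> c)" for x :: "real ^ ('a::enum)"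
  using all_entry_iff[of "\<lambda>a. \<bar>a\<bar> \<le> c" x] by (simp add: infnorm_le_iff)

lemma sum_of_bool_eq:
  "finite I \<Longrightarrow> (\<Sum>l\<in>I. of_bool (l = a) * f l) = (if a \<in> I then f a else (0::real))"
  "finite I \<Longrightarrow> (\<Sum>l\<in>I. of_bool (a = l) * f l) = (if a \<in> I then f a else (0::real))"
  by (simp_all add: of_bool_def if_distrib[of "\<lambda>c. c * _"] sum.delta sum.delta' cong: if_cong)

section \<open>Optimality certificates\<close>

definition reg_of :: "problem \<Rightarrow> regulariser" where
  "reg_of pr = (case pr of LP \<Rightarrow> L1 | BP J _ \<Rightarrow> J | UL J _ \<Rightarrow> J | CL _ \<Rightarrow> L1)"

text \<open>The dual vector \<open>z\<close> certifies that \<open>b\<close> is the image under \<open>A\<close> of every solution. The second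
  alternative for basis pursuit covers inputs without a dual solution.\<close>

definition certifies :: "problem \<Rightarrow> real ^ 'm \<Rightarrow> real ^ ('n::enum) ^ 'm \<Rightarrow> real ^ 'm \<Rightarrow> real ^ 'm \<Rightarrow> bool" where
  "certifies pr y A z b \<longleftrightarrow> (case pr of
      LP \<Rightarrow> b = y
    | BP _ \<delta> \<Rightarrow> (\<exists>\<kappa>\<ge>0. b = y - \<kappa> *\<^sub>R z \<and> \<kappa> * norm z = \<delta>)
        \<or> norm (b - y) \<le> \<delta> \<and> (\<forall>x. norm (A *v x - y) \<le> \<delta> \<longrightarrow> A *v x = b)
    | UL _ l \<Rightarrow> b = y - (l / 2) *\<^sub>R z
    | CL \<tau> \<Rightarrow> z \<noteq> 0 \<and> z \<bullet> b = \<tau> \<and> (\<exists>\<kappa>\<ge>0. b = y - \<kappa> *\<^sub>R z))"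

text \<open>The case of equality in the Cauchy-Schwarz inequality: expanding the squared norm of u -
  k z gives at most 0.\<close>

lemma eq_scaled_of_inner:
  fixes u z :: "'a::real_inner"
  assumes "norm u \<le> k * norm z" "z \<bullet> u = k * (norm z)\<^sup>2"
  shows "u = k *\<^sub>R z"
proof -
  have "(norm (u - k *\<^sub>R z))\<^sup>2 = (norm u)\<^sup>2 - 2 * k * (z \<bullet> u) + k\<^sup>2 * (norm z)\<^sup>2"
    unfolding power2_norm_eq_inner by (simp add: algebra_simps inner_commute power2_eq_square)
  also have "\<dots> \<le> (k * norm z)\<^sup>2 - 2 * k * (z \<bullet> u) + k\<^sup>2 * (norm z)\<^sup>2"
    using assms(1) by (simp add: power_mono)
  also have "\<dots> = 0" unfolding assms(2) by (simp add: power2_eq_square algebra_simps)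
  finally show ?thesis by simp
qed

text \<open>Weak duality. The hypothesis \<open>sub\<close> bounds the regulariser below by a linear
  function of the image A x, and the certificate makes \<open>b\<close> the only image at which the
  resulting bound on the objective can be attained. The point \<open>s\<close> attains it, so the
  solutions are exactly the points that do.\<close>

lemma Sol_eq:
  fixes A :: "real ^ ('n::enum) ^ 'm"
  assumes valid: "valid_param pr" and cert: "certifies pr y A z b"
    and sub: "\<And>x. z \<bullet> (A *v x) \<le> reg_fun (reg_of pr) x"
    and s: "A *v s = b" "reg_fun (reg_of pr) s = z \<bullet> b" "is_LP pr \<longrightarrow> (\<forall>i. 0 \<le> s $ i)"
  shows "Sol pr (y, A) = {x. A *v x = b \<and> reg_fun (reg_of pr) x = z \<bullet> b \<and> (is_LP pr \<longrightarrow> (\<forall>i. 0 \<le> x $ i))}"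
proof -
  have reduce: "Sol pr (y, A) = {x. A *v x = b \<and> reg_fun (reg_of pr) x = z \<bullet> b \<and> (is_LP pr \<longrightarrow> (\<forall>i. 0 \<le> x $ i))}"
    if "\<And>x. constraint pr (y, A) x \<Longrightarrow> v \<le> objective pr (y, A) x"
      and "\<And>x. constraint pr (y, A) x \<and> objective pr (y, A) x = v \<longleftrightarrow>
        A *v x = b \<and> reg_fun (reg_of pr) x = z \<bullet> b \<and> (is_LP pr \<longrightarrow> (\<forall>i. 0 \<le> x $ i))" for v
  proof -
    have sv: "constraint pr (y, A) s" "objective pr (y, A) s = v" using that(2)[of s] s by auto
    have "x \<in> Sol pr (y, A) \<longleftrightarrow> constraint pr (y, A) x \<and> objective pr (y, A) x = v" for x
      unfolding Sol_def is_arg_min_def using that(1) sv by (force simp: not_less)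
    then show ?thesis using that(2) by auto
  qed
  show ?thesis
  proof (cases pr)
    case LP
    have norm1: "x \<bullet> (\<chi> i. 1) = norm1 x" if "\<forall>i. 0 \<le> x $ i" for x :: "real ^ ('n::enum)"
      using that by (simp add: inner_vec_def norm1_def)
    have "b = y" using cert LP by (simp add: certifies_def)
    show ?thesis
      by (rule reduce[of "z \<bullet> b"]) (use sub \<open>b = y\<close> norm1 LP in \<open>auto simp: reg_of_def\<close>)
  next
    case (BP J \<delta>)
    let ?J = "reg_fun J"
    have sub: "z \<bullet> (A *v x) \<le> ?J x" for x using sub[of x] BP by (simp add: reg_of_def)
    consider \<kappa> where "\<kappa> \<ge> 0" "b = y - \<kappa> *\<^sub>R z" "\<kappa> * norm z = \<delta>"
      | "norm (b - y) \<le> \<delta>" "\<forall>x. norm (A *v x - y) \<le> \<delta> \<longrightarrow> A *v x = b"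
      using cert BP by (auto simp: certifies_def)
    then show ?thesis
    proof cases
      case 1
      have zb: "z \<bullet> b = z \<bullet> y - norm z * \<delta>"
        unfolding 1(2) 1(3)[symmetric]
        by (simp add: inner_diff_right power2_norm_eq_inner[symmetric] power2_eq_square)
      \<comment> \<open>On the ball of radius \<delta> about y the linear function given by z is
        least at b, and by \<open>img\<close> at no other image.\<close>
      have low: "z \<bullet> b \<le> z \<bullet> (A *v x)" if "norm (A *v x - y) \<le> \<delta>" for x
      proof -
        have "z \<bullet> (y - A *v x) \<le> norm z * norm (y - A *v x)" by (rule norm_cauchy_schwarz)
        also have "\<dots> \<le> norm z * \<delta>" using that by (simp add: norm_minus_commute mult_left_mono)
        finally show ?thesis by (simp add: zb inner_diff_right)
      qed
      have img: "A *v x = b" if "norm (A *v x - y) \<le> \<delta>" "z \<bullet> (A *v x) = z \<bullet> b" for x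
      proof -
        have "y - A *v x = \<kappa> *\<^sub>R z"
        proof (rule eq_scaled_of_inner)
          show "norm (y - A *v x) \<le> \<kappa> * norm z" using that(1) 1(3) by (simp add: norm_minus_commute)
          show "z \<bullet> (y - A *v x) = \<kappa> * (norm z)\<^sup>2"
            using that(2) zb 1(3) by (simp add: inner_diff_right power2_eq_square)
        qed
        then show ?thesis unfolding 1(2) by (simp add: algebra_simps)
      qed
      have nb: "norm (b - y) \<le> \<delta>" using 1 by simp
      have tight: "z \<bullet> (A *v x) = z \<bullet> b" if "norm (A *v x - y) \<le> \<delta>" "?J x = z \<bullet> b" for x
        using low[OF that(1)] sub[of x] that(2) by simp
      show ?thesis
      proof (rule reduce[of "z \<bullet> b"])
        show "z \<bullet> b \<le> objective pr (y, A) x" if "constraint pr (y, A) x" for x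
          using that low[of x] sub[of x] BP by simp
        show "constraint pr (y, A) x \<and> objective pr (y, A) x = z \<bullet> b \<longleftrightarrow> A *v x = b \<and>
          reg_fun (reg_of pr) x = z \<bullet> b \<and> (is_LP pr \<longrightarrow> (\<forall>i. 0 \<le> x $ i))" for x
          using img[of x] tight[of x] nb BP by (auto simp: reg_of_def)
      qed
    next
      case 2
      show ?thesis
      proof (rule reduce[of "z \<bullet> b"])
        show "z \<bullet> b \<le> objective pr (y, A) x" if "constraint pr (y, A) x" for x
          using that 2(2) sub[of x] BP by auto
        show "constraint pr (y, A) x \<and> objective pr (y, A) x = z \<bullet> b \<longleftrightarrow> A *v x = b \<and>
          reg_fun (reg_of pr) x = z \<bullet> b \<and> (is_LP pr \<longrightarrow> (\<forall>i. 0 \<le> x $ i))" for x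
          using 2 BP by (auto simp: reg_of_def)
      qed
    qed
  next
    case (UL J l)
    let ?J = "reg_fun J"
    have sub: "z \<bullet> (A *v x) \<le> ?J x" for x using sub[of x] UL by (simp add: reg_of_def)
    have b: "b = y - (l / 2) *\<^sub>R z" using cert UL by (simp add: certifies_def)
    have l: "0 < l" using valid UL by simp
    \<comment> \<open>Completing the square: b minimises the left-hand side, and the excess is the
      squared distance to b.\<close>
    have sq: "(norm (u - y))\<^sup>2 + l * (z \<bullet> u) = (norm (b - y))\<^sup>2 + l * (z \<bullet> b) + (norm (u - b))\<^sup>2" for u
      unfolding b power2_norm_eq_inner by (simp add: algebra_simps inner_commute)
    have obj: "objective pr (y, A) x = (norm (b - y))\<^sup>2 + l * (z \<bullet> b)
        + ((norm (A *v x - b))\<^sup>2 + l * (?J x - z \<bullet> (A *v x)))" for x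
      using sq[of "A *v x"] UL by (simp add: algebra_simps)
    have nn: "0 \<le> l * (?J x - z \<bullet> (A *v x))" for x using sub[of x] l by simp
    have eq0: "(norm (A *v x - b))\<^sup>2 + l * (?J x - z \<bullet> (A *v x)) = 0 \<longleftrightarrow> A *v x = b \<and> ?J x = z \<bullet> b" for x
      using nn[of x] l by (subst add_nonneg_eq_0_iff) auto
    have r: "reg_of pr = J" "\<not> is_LP pr" "constraint pr (y, A) x" for x
      using UL by (simp_all add: reg_of_def)
    have nn2: "0 \<le> (norm (A *v x - b))\<^sup>2 + l * (?J x - z \<bullet> (A *v x))" for x
      using nn[of x] by simp
    have shift: "v + r = v \<longleftrightarrow> r = 0" for v r :: real by simp
    show ?thesis
    proof (rule reduce[of "(norm (b - y))\<^sup>2 + l * (z \<bullet> b)"])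
      show "(norm (b - y))\<^sup>2 + l * (z \<bullet> b) \<le> objective pr (y, A) x" for x
        unfolding obj using nn2[of x] by linarith
      show "constraint pr (y, A) x \<and> objective pr (y, A) x = (norm (b - y))\<^sup>2 + l * (z \<bullet> b) \<longleftrightarrow>
        A *v x = b \<and> reg_fun (reg_of pr) x = z \<bullet> b \<and> (is_LP pr \<longrightarrow> (\<forall>i. 0 \<le> x $ i))" for x
        unfolding obj shift eq0 using r by simp
    qed
  next
    case (CL \<tau>)
    have sub: "z \<bullet> (A *v x) \<le> norm1 x" for x using sub[of x] CL by (simp add: reg_of_def)
    obtain \<kappa> where z: "z \<noteq> 0" "z \<bullet> b = \<tau>" "\<kappa> \<ge> 0" "b = y - \<kappa> *\<^sub>R z"
      using cert CL by (auto simp: certifies_def)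
    have zy: "z \<bullet> y = \<tau> + \<kappa> * (norm z)\<^sup>2"
      using z(2) unfolding z(4) by (simp add: inner_diff_right power2_norm_eq_inner)
    have nb: "norm (b - y) = \<kappa> * norm z" using z by simp
    \<comment> \<open>The constraint puts A x into the half-space where z \<bullet> u \<le> \<tau>,
      and b is the point of this half-space nearest to y.\<close>
    have low: "\<kappa> * (norm z)\<^sup>2 \<le> z \<bullet> (y - A *v x)" if "norm1 x \<le> \<tau>" for x
      using sub[of x] that zy by (simp add: inner_diff_right)
    have cs: "z \<bullet> (y - A *v x) \<le> norm z * norm (A *v x - y)" for x
      using norm_cauchy_schwarz[of z "y - A *v x"] by (simp add: norm_minus_commute)
    have min: "norm (b - y) \<le> norm (A *v x - y)" if "norm1 x \<le> \<tau>" for x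
    proof -
      have "norm z * (\<kappa> * norm z) \<le> norm z * norm (A *v x - y)"
        using low[OF that] cs[of x] by (simp add: power2_eq_square algebra_simps)
      then show ?thesis using z(1) nb by simp
    qed
    have img: "A *v x = b" if "norm1 x \<le> \<tau>" "norm (A *v x - y) = norm (b - y)" for x
    proof -
      have "y - A *v x = \<kappa> *\<^sub>R z"
      proof (rule eq_scaled_of_inner)
        show "norm (y - A *v x) \<le> \<kappa> * norm z" using that(2) nb by (simp add: norm_minus_commute)
        show "z \<bullet> (y - A *v x) = \<kappa> * (norm z)\<^sup>2"
          using low[OF that(1)] cs[of x] that(2) nb by (simp add: power2_eq_square algebra_simps)
      qed
      then show ?thesis unfolding z(4) by (simp add: algebra_simps)
    qed
    show ?thesis
    proof (rule reduce[of "norm (b - y)"])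
      show "norm (b - y) \<le> objective pr (y, A) x" if "constraint pr (y, A) x" for x
        using that min[of x] CL by simp
      show "constraint pr (y, A) x \<and> objective pr (y, A) x = norm (b - y) \<longleftrightarrow> A *v x = b \<and>
        reg_fun (reg_of pr) x = z \<bullet> b \<and> (is_LP pr \<longrightarrow> (\<forall>i. 0 \<le> x $ i))" for x
        using img[of x] sub[of x] z(2) CL by (auto simp: reg_of_def)
    qed
  qed
qed

text \<open>Both branches are optimal at t = 0, and one of them survives on each side. Feasibility
  is required for every real t because perturbations within the active hull are arbitrary shifts of
  t. The separation 1/5 is at least twice 10^-K, since K \<ge> 1; the Lipschitz constant 100 is a
  generous common bound below 179.\<close>

locale unstable_family =
  fixes pr :: problem and \<iota> :: "real \<Rightarrow> ('m::enum, 'n::enum) input" and c :: "('m, 'n) coord"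
    and s1 s2 :: "real \<Rightarrow> real ^ ('n::enum)"
  assumes coord_active: "coord (\<iota> t) c = t"
    and coord_other: "j \<noteq> c \<Longrightarrow> coord (\<iota> t) j = coord (\<iota> t') j"
    and feasible: "\<iota> t \<in> feasible_inputs pr"
    and Sol_zero: "s1 0 \<in> Sol pr (\<iota> 0)" "s2 0 \<in> Sol pr (\<iota> 0)"
    and Sol_pos: "0 < t \<Longrightarrow> t \<le> 1 / 1000 \<Longrightarrow> Sol pr (\<iota> t) = {s1 t}"
    and Sol_neg: "t < 0 \<Longrightarrow> - 1 / 1000 \<le> t \<Longrightarrow> Sol pr (\<iota> t) = {s2 t}"
    and lipschitz1: "t \<in> {0..1 / 1000} \<Longrightarrow> t' \<in> {0..1 / 1000} \<Longrightarrow>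
      infnorm (s1 t - s1 t') \<le> 100 * \<bar>t - t'\<bar>"
    and lipschitz2: "t \<in> {- 1 / 1000..0} \<Longrightarrow> t' \<in> {- 1 / 1000..0} \<Longrightarrow>
      infnorm (s2 t - s2 t') \<le> 100 * \<bar>t - t'\<bar>"
    and separated: "t \<in> {0..1 / 1000} \<Longrightarrow> t' \<in> {- 1 / 1000..0} \<Longrightarrow> 1 / 5 < infnorm (s1 t - s2 t')"
    and Cond_le: "\<bar>t\<bar> \<le> 1 / 1000 \<Longrightarrow>
      Cond_mat (snd (\<iota> t) ** transpose (snd (\<iota> t))) \<le> ereal (32 / 10)"
    and y_le: "infnorm (fst (\<iota> t)) \<le> 2"
    and max_entry_eq: "\<bar>t\<bar> \<le> 1 / 1000 \<Longrightarrow> max_entry (snd (\<iota> t)) = 1"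

text \<open>The hypotheses say that I \<le> A A^T \<le> c I in the order of symmetric matrices. The
  lower bound yields invertibility and an inverse of norm at most 1, the upper bound a norm of at
  most c.\<close>

lemma Cond_mat_le:
  fixes A :: "real ^ 'n ^ 'm"
  assumes low: "\<And>v. (norm v)\<^sup>2 \<le> (norm (transpose A *v v))\<^sup>2"
    and up: "\<And>v. (norm (transpose A *v v))\<^sup>2 \<le> c * (norm v)\<^sup>2" and c: "0 \<le> c"
  shows "Cond_mat (A ** transpose A) \<le> ereal c"
proof -
  let ?B = "A ** transpose A"
  have Bv: "?B *v v = A *v (transpose A *v v)" for v by (simp only: matrix_vector_mul_assoc)
  have adj: "(A *v u) \<bullet> v = u \<bullet> (transpose A *v v)" for u v
    by (metis dot_lmul_matrix vector_transpose_matrix transpose_transpose inner_commute)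
  have ge: "norm v \<le> norm (?B *v v)" for v
  proof (cases "v = 0")
    case False
    have "norm v * norm v \<le> v \<bullet> (?B *v v)"
      using low[of v] adj[of "transpose A *v v" v]
      by (simp add: Bv power2_norm_eq_inner inner_commute power2_eq_square[symmetric])
    also have "\<dots> \<le> norm v * norm (?B *v v)" by (rule norm_cauchy_schwarz)
    finally show ?thesis using False by simp
  qed simp
  have upT: "norm (transpose A *v v) \<le> sqrt c * norm v" for v
    using real_le_rsqrt[OF up[of v]] by (simp add: real_sqrt_mult)
  have upA: "norm (A *v u) \<le> sqrt c * norm u" for u
  proof (cases "A *v u = 0")
    case False
    have "norm (A *v u) * norm (A *v u) = u \<bullet> (transpose A *v (A *v u))"
      using adj[of u "A *v u"] by (simp add: power2_norm_eq_inner power2_eq_square[symmetric])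
    also have "\<dots> \<le> norm u * (sqrt c * norm (A *v u))"
      by (rule order_trans[OF norm_cauchy_schwarz mult_left_mono[OF upT norm_ge_zero]])
    also have "\<dots> = (sqrt c * norm u) * norm (A *v u)" by (simp only: ac_simps)
    finally show ?thesis by (rule mult_right_le_imp_le) (use False in simp)
  qed (simp add: c)
  have upB: "norm (?B *v v) \<le> c * norm v" for v
  proof -
    have "norm (?B *v v) \<le> sqrt c * (sqrt c * norm v)"
      unfolding Bv by (rule order_trans[OF upA mult_left_mono[OF upT]]) (use c in simp)
    then show ?thesis using c by (simp add: mult.assoc[symmetric])
  qed
  have inv: "invertible ?B"
  proof -
    have "v = 0" if "?B *v v = 0" for v
      using ge[of v] unfolding that by simp
    then have "\<forall>v. ?B *v v = 0 \<longrightarrow> v = 0" by blast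
    then show ?thesis
      unfolding invertible_left_inverse matrix_left_invertible_ker .
  qed
  have right: "?B ** matrix_inv ?B = mat 1"
    using someI_ex[OF inv[unfolded invertible_def]] unfolding matrix_inv_def by blast
  have "norm (matrix_inv ?B *v v) \<le> 1 * norm v" for v
    using ge[of "matrix_inv ?B *v v"] right by (simp add: matrix_vector_mul_assoc)
  then have i: "opnorm2 (matrix_inv ?B) \<le> 1" unfolding opnorm2_def by (intro onorm_bound) simp_all
  have b: "opnorm2 ?B \<le> c" unfolding opnorm2_def using upB c by (rule onorm_bound[rotated])
  have "opnorm2 ?B * opnorm2 (matrix_inv ?B) \<le> c * 1"
    using i b c by (intro mult_mono) (auto simp: opnorm2_def onorm_pos_le)
  then show ?thesis using inv by (simp add: Cond_mat_def)
qed

section \<open>Tight sums and Lipschitz estimates\<close>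

lemma max_entry_eqI:
  assumes "\<And>i j. i < CARD('m) \<Longrightarrow> j < CARD('n) \<Longrightarrow> \<bar>f i j\<bar> \<le> 1" "k < CARD('m)" "l < CARD('n)" "\<bar>f k l\<bar> = 1"
  shows "max_entry (mat_of f :: real ^ ('n::enum) ^ ('m::enum)) = 1"
  unfolding max_entry_def
proof (rule Max_eqI)
  show "1 \<in> range (\<lambda>(i, j). \<bar>(mat_of f :: real ^ ('n::enum) ^ ('m::enum)) $ i $ j\<bar>)"
    using assms(2-4) by (intro image_eqI[of _ _ "(enum_class.enum ! k, enum_class.enum ! l)"]) auto
qed (use assms(1) in \<open>auto simp: mat_of_def\<close>)

text \<open>Complementary slackness: \<open>w\<close> will hold the dual weights and
  \<open>f\<close> the entries, or successive differences, of a candidate solution. Every term of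
  the difference of the two sums is nonnegative, so equality of the sums is equality of the
  terms.\<close>

lemma sum_abs_tight:
  fixes f w :: "nat \<Rightarrow> real"
  assumes "\<And>k. k < n \<Longrightarrow> \<bar>w k\<bar> \<le> 1"
  shows "(\<Sum>k<n. w k * f k) \<le> (\<Sum>k<n. \<bar>f k\<bar>)"
    and "(\<Sum>k<n. \<bar>f k\<bar>) = (\<Sum>k<n. w k * f k) \<longleftrightarrow> (\<forall>k<n. \<bar>f k\<bar> = w k * f k)"
proof -
  have le: "w k * f k \<le> \<bar>f k\<bar>" if "k < n" for k
  proof -
    have "w k * f k \<le> \<bar>w k\<bar> * \<bar>f k\<bar>" by (metis abs_ge_self abs_mult)
    also have "\<dots> \<le> 1 * \<bar>f k\<bar>" using assms[OF that] by (intro mult_right_mono) auto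
    finally show ?thesis by simp
  qed
  show "(\<Sum>k<n. w k * f k) \<le> (\<Sum>k<n. \<bar>f k\<bar>)" by (rule sum_mono) (use le in auto)
  have "(\<Sum>k<n. \<bar>f k\<bar>) = (\<Sum>k<n. w k * f k) \<longleftrightarrow> (\<Sum>k<n. \<bar>f k\<bar> - w k * f k) = 0"
    by (simp add: sum_subtractf)
  also have "\<dots> \<longleftrightarrow> (\<forall>k<n. \<bar>f k\<bar> - w k * f k = 0)"
    using le by (subst sum_nonneg_eq_0_iff) auto
  finally show "(\<Sum>k<n. \<bar>f k\<bar>) = (\<Sum>k<n. w k * f k) \<longleftrightarrow> (\<forall>k<n. \<bar>f k\<bar> = w k * f k)" by simp
qed

text \<open>Where the dual weight is below 1 in absolute value, the primal entry is forced to
  vanish; this is the source of uniqueness away from t = 0.\<close>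

lemma tight_zero: "\<bar>x\<bar> = w * x \<Longrightarrow> \<bar>w\<bar> < 1 \<Longrightarrow> x = 0" for x w :: real
proof (rule ccontr)
  assume w: "\<bar>x\<bar> = w * x" "\<bar>w\<bar> < 1" and "x \<noteq> 0"
  then have "\<bar>w\<bar> * \<bar>x\<bar> < 1 * \<bar>x\<bar>" by (intro mult_strict_right_mono) auto
  moreover have "w * x \<le> \<bar>w\<bar> * \<bar>x\<bar>" by (metis abs_ge_self abs_mult)
  ultimately show False using w(1) by simp
qed

text \<open>With r and s the two roots, (r - s)(r + s) = (u - v)(u + v), and |u + v| \<le> r +
  s.\<close>

lemma sqrt_sum_lipschitz:
  assumes "0 \<le> d" shows "\<bar>sqrt (u\<^sup>2 + d) - sqrt (v\<^sup>2 + d)\<bar> \<le> \<bar>u - v\<bar>"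
proof (cases "sqrt (u\<^sup>2 + d) + sqrt (v\<^sup>2 + d) = 0")
  case True
  moreover have "0 \<le> sqrt (u\<^sup>2 + d)" "0 \<le> sqrt (v\<^sup>2 + d)" using assms by simp_all
  ultimately have "sqrt (u\<^sup>2 + d) = 0" "sqrt (v\<^sup>2 + d) = 0" by linarith+
  then show ?thesis by simp
next
  case False
  let ?r = "sqrt (u\<^sup>2 + d)" and ?s = "sqrt (v\<^sup>2 + d)"
  have pos: "0 < ?r + ?s" using False assms by (simp add: less_le add_nonneg_nonneg)
  have "\<bar>u\<bar> \<le> ?r" "\<bar>v\<bar> \<le> ?s" using assms by (auto intro: real_le_rsqrt)
  then have uv: "\<bar>u + v\<bar> \<le> ?r + ?s" by linarith
  have "(?r - ?s) * (?r + ?s) = (u - v) * (u + v)"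
    using assms by (simp add: algebra_simps power2_eq_square[symmetric])
  then have "\<bar>?r - ?s\<bar> * (?r + ?s) = \<bar>u - v\<bar> * \<bar>u + v\<bar>"
    using pos by (metis abs_mult abs_of_pos)
  also have "\<dots> \<le> \<bar>u - v\<bar> * (?r + ?s)" using uv by (intro mult_left_mono) auto
  finally show ?thesis using pos by simp
qed

lemma inverse_lipschitz:
  fixes r s m e :: real
  assumes "m \<le> r" "m \<le> s" "0 < m" "\<bar>r - s\<bar> \<le> e"
  shows "\<bar>1 / r - 1 / s\<bar> \<le> e / m\<^sup>2"
proof -
  have "0 < r" "0 < s" using assms by auto
  then have "\<bar>1 / r - 1 / s\<bar> = \<bar>r - s\<bar> / (r * s)"
    by (simp add: divide_simps abs_minus_commute abs_mult)
  also have "\<dots> \<le> e / m\<^sup>2"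
    using assms by (intro frac_le) (auto simp: power2_eq_square intro: mult_mono)
  finally show ?thesis .
qed

lemma product_lipschitz:
  fixes a b a' b' :: real
  assumes "\<bar>a - a'\<bar> \<le> p * e" "\<bar>b - b'\<bar> \<le> q * e" "\<bar>b\<bar> \<le> r" "\<bar>a'\<bar> \<le> s" "0 \<le> e"
  shows "\<bar>a * b - a' * b'\<bar> \<le> (p * r + q * s) * e"
proof -
  have "a * b - a' * b' = (a - a') * b + a' * (b - b')" by (simp add: algebra_simps)
  then have "\<bar>a * b - a' * b'\<bar> \<le> \<bar>a - a'\<bar> * \<bar>b\<bar> + \<bar>a'\<bar> * \<bar>b - b'\<bar>"
    by (metis abs_triangle_ineq abs_mult)
  also have "\<dots> \<le> (p * e) * r + s * (q * e)"
    using assms by (intro add_mono mult_mono) auto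
  finally show ?thesis by (simp add: algebra_simps)
qed

lemma entry_le_infnorm: "k < CARD('a) \<Longrightarrow> \<bar>x !. k\<bar> \<le> infnorm x" for x :: "real ^ ('a::enum)"
  using infnorm_entry_le_iff[of x "infnorm x"] by simp

section \<open>The family for the 1-norm\<close>

text \<open>Row 0 reads x0 + x1, row 1 reads x2 + t x0, and each later row a single entry. At t = 0
  the entries 0 and 1 can be traded at no cost; for t > 0 entry 0 also helps to reach the datum of
  row 1, for t < 0 it works against it.\<close>

definition A1 :: "real \<Rightarrow> real ^ ('n::enum) ^ ('m::enum)" where
  "A1 t = mat_of (\<lambda>i j. of_bool (j = Suc i) + of_bool (i = 0 \<and> j = 0) + t * of_bool (i = 1 \<and> j = 0))"

definition y1 :: "real ^ ('m::enum)" where "y1 = vec_of (\<lambda>i. if i < 2 then 2 else 0)"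

text \<open>A^T z has the entries a + t, a, 1, 0 and so on. The choice a = 1 - t for t > 0 makes the
  weight of entry 1 less than 1, the choice a = 1 for t < 0 that of entry 0.\<close>

definition z1 :: "real \<Rightarrow> real ^ ('m::enum)" where
  "z1 a = vec_of (\<lambda>i. if i = 0 then a else if i = 1 then 1 else 0)"

text \<open>The residual is \<kappa> z. Its norm is \<delta> for BP, stationarity determines it for
  UL, and for CL it follows from z \<bullet> (y - \<kappa> z) = \<tau>, where z \<bullet> y = 2 a +
  2.\<close>

definition kappa1 :: "problem \<Rightarrow> real \<Rightarrow> real" where
  "kappa1 pr a = (case pr of LP \<Rightarrow> 0 | BP _ \<delta> \<Rightarrow> \<delta> / sqrt (a\<^sup>2 + 1) | UL _ l \<Rightarrow> l / 2
     | CL \<tau> \<Rightarrow> (2 * a + 2 - \<tau>) / (a\<^sup>2 + 1))"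

lemma A1_entry:
  assumes "CARD('m) < CARD('n)" "i < CARD('m)"
  shows "((A1 t :: real ^ ('n::enum) ^ ('m::enum)) *v x) !. i
    = x !. Suc i + (if i = 0 then x !. 0 else 0) + (if i = 1 then t * x !. 0 else 0)"
proof -
  have s: "(\<Sum>l<CARD('n). (of_bool (l = Suc i) + of_bool (i = 0 \<and> l = 0) + t * of_bool (i = 1 \<and> l = 0)) * x !. l)
     = (\<Sum>l<CARD('n). of_bool (l = Suc i) * x !. l)
       + of_bool (i = 0) * (\<Sum>l<CARD('n). of_bool (l = 0) * x !. l)
       + t * of_bool (i = 1) * (\<Sum>l<CARD('n). of_bool (l = 0) * x !. l)"
    by (simp only: sum_distrib_left sum.distrib[symmetric])
      (rule sum.cong, auto simp: algebra_simps of_bool_def)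
  show ?thesis
    unfolding A1_def mult_entry[OF assms(2)] s using assms by (simp add: sum_of_bool_eq)
qed

lemma inner_z1:
  assumes "4 \<le> CARD('m)"
  shows "z1 a \<bullet> (u :: real ^ ('m::enum)) = a * u !. 0 + u !. 1"
proof -
  have "z1 a \<bullet> u = (\<Sum>k<CARD('m). of_bool (k = 0) * (a * u !. k) + of_bool (k = 1) * u !. k)"
    unfolding inner_entry by (rule sum.cong) (auto simp: z1_def)
  also have "\<dots> = a * u !. 0 + u !. 1"
    using assms by (simp only: sum.distrib sum_of_bool_eq finite_lessThan) simp
  finally show ?thesis .
qed

lemma certifies1:
  fixes A :: "real ^ ('n::enum) ^ ('m::enum)"
  assumes "valid_param pr" "4 \<le> CARD('m)" "0 \<le> kappa1 pr a"
  shows "certifies pr y1 A (z1 a) (y1 - kappa1 pr a *\<^sub>R z1 a)"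
proof -
  have zz: "z1 a \<bullet> (z1 a :: real ^ ('m::enum)) = a\<^sup>2 + 1" "z1 a \<bullet> (y1 :: real ^ ('m::enum)) = 2 * a + 2"
    unfolding inner_z1[OF assms(2)] using assms(2) by (simp_all add: z1_def y1_def power2_eq_square)
  have nz: "norm (z1 a :: real ^ ('m::enum)) = sqrt (a\<^sup>2 + 1)" by (simp add: norm_eq_sqrt_inner zz)
  have pos: "0 < a\<^sup>2 + 1" by (simp add: add_nonneg_pos)
  show ?thesis
  proof (cases pr)
    case (CL \<tau>)
    have "z1 a \<noteq> (0 :: real ^ ('m::enum))" using zz(1) pos by auto
    moreover have "z1 a \<bullet> (y1 - kappa1 pr a *\<^sub>R z1 a :: real ^ ('m::enum)) = \<tau>"
      using pos CL by (simp add: inner_diff_right zz kappa1_def)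
    ultimately show ?thesis using assms(3) CL by (auto simp: certifies_def)
  next
    case (BP J \<delta>)
    then show ?thesis using assms(3) pos nz by (auto simp: certifies_def kappa1_def intro!: exI[of _ "kappa1 pr a"])
  qed (auto simp: certifies_def kappa1_def)
qed

text \<open>The extreme case is CL with \<tau> = 1/2, where the quotient is at most 3.5 / 1.998 <
  1.76. The bound has to stay below 2 - 1/5, so that the entries 2 - \<kappa> are positive and
  separate the branches.\<close>

lemma kappa1_bounds:
  assumes "valid_param pr" "a \<in> {999 / 1000..1}"
  shows "0 \<le> kappa1 pr a" "kappa1 pr a \<le> 88 / 50"
proof -
  have sq: "(999 / 1000)\<^sup>2 \<le> a\<^sup>2" "a\<^sup>2 \<le> 1\<^sup>2" using assms(2) by (intro power_mono; simp)+
  then have den: "1998 / 1000 \<le> a\<^sup>2 + 1" by (simp add: power2_eq_square)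
  have "0 \<le> kappa1 pr a \<and> kappa1 pr a \<le> 88 / 50"
  proof (cases pr)
    case (BP J \<delta>)
    have "1 \<le> sqrt (a\<^sup>2 + 1)" by simp
    then have "\<delta> / sqrt (a\<^sup>2 + 1) \<le> 1 / 1" using BP assms(1) by (intro frac_le) auto
    then have "\<delta> / sqrt (a\<^sup>2 + 1) \<le> 88 / 50" by linarith
    then show ?thesis using BP assms(1) by (simp add: kappa1_def del: divide_le_eq_numeral1 le_divide_eq_numeral1)
  next
    case (CL \<tau>)
    have "(2 * a + 2 - \<tau>) / (a\<^sup>2 + 1) \<le> (35 / 10) / (1998 / 1000)"
      using CL assms den by (intro frac_le) auto
    moreover have "0 \<le> 2 * a + 2 - \<tau>" using CL assms by auto
    then have "0 \<le> (2 * a + 2 - \<tau>) / (a\<^sup>2 + 1)" by simp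
    moreover have "kappa1 pr a = (2 * a + 2 - \<tau>) / (a\<^sup>2 + 1)" using CL by (simp add: kappa1_def)
    ultimately show ?thesis by (intro conjI) argo+
  qed (use assms in \<open>auto simp: kappa1_def\<close>)
  then show "0 \<le> kappa1 pr a" "kappa1 pr a \<le> 88 / 50" by auto
qed

text \<open>The constant is dictated by CL: it is 2 * 1 + 2 * 4, from the product of a numerator
  bounded by 4 and the reciprocal of a^2 + 1, bounded by 1.\<close>

lemma kappa1_lipschitz:
  assumes "valid_param pr" "a \<in> {999 / 1000..1}" "a' \<in> {999 / 1000..1}"
  shows "\<bar>kappa1 pr a - kappa1 pr a'\<bar> \<le> 10 * \<bar>a - a'\<bar>"
proof (cases pr)
  case (BP J \<delta>)
  have "\<bar>1 / sqrt (a\<^sup>2 + 1) - 1 / sqrt (a'\<^sup>2 + 1)\<bar> \<le> \<bar>a - a'\<bar> / 1\<^sup>2"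
    by (rule inverse_lipschitz) (use sqrt_sum_lipschitz[of 1] in auto)
  moreover have "kappa1 pr a - kappa1 pr a' = \<delta> * (1 / sqrt (a\<^sup>2 + 1) - 1 / sqrt (a'\<^sup>2 + 1))"
    using BP by (simp add: kappa1_def algebra_simps)
  ultimately have "\<bar>kappa1 pr a - kappa1 pr a'\<bar> \<le> 1 * \<bar>a - a'\<bar>"
    using BP assms(1) by (simp only: abs_mult) (intro mult_mono, auto)
  then show ?thesis by linarith
next
  case (CL \<tau>)
  have sq: "\<bar>(a\<^sup>2 + 1) - (a'\<^sup>2 + 1)\<bar> \<le> 2 * \<bar>a - a'\<bar>"
  proof -
    have "(a\<^sup>2 + 1) - (a'\<^sup>2 + 1) = (a + a') * (a - a')" by (simp add: algebra_simps power2_eq_square)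
    then have "\<bar>(a\<^sup>2 + 1) - (a'\<^sup>2 + 1)\<bar> = \<bar>a + a'\<bar> * \<bar>a - a'\<bar>" by (simp only: abs_mult)
    also have "\<dots> \<le> 2 * \<bar>a - a'\<bar>" using assms by (intro mult_right_mono) auto
    finally show ?thesis .
  qed
  have i: "\<bar>1 / (a\<^sup>2 + 1) - 1 / (a'\<^sup>2 + 1)\<bar> \<le> 2 * \<bar>a - a'\<bar>"
    using inverse_lipschitz[of 1 "a\<^sup>2 + 1" "a'\<^sup>2 + 1", OF _ _ _ sq] by simp
  have "\<bar>(2 * a + 2 - \<tau>) * (1 / (a\<^sup>2 + 1)) - (2 * a' + 2 - \<tau>) * (1 / (a'\<^sup>2 + 1))\<bar> \<le> (2 * 1 + 2 * 4) * \<bar>a - a'\<bar>"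
  proof (rule product_lipschitz)
    have "2 * a + 2 - \<tau> - (2 * a' + 2 - \<tau>) = 2 * (a - a')" by simp
    then show "\<bar>2 * a + 2 - \<tau> - (2 * a' + 2 - \<tau>)\<bar> \<le> 2 * \<bar>a - a'\<bar>" by (simp only: abs_mult)
    have "1 / (a\<^sup>2 + 1) \<le> 1 / 1" by (rule frac_le) auto
    then show "\<bar>1 / (a\<^sup>2 + 1)\<bar> \<le> 1" by simp
  qed (use i CL assms in auto)
  then show ?thesis using CL by (simp add: kappa1_def)
qed (auto simp: kappa1_def)

lemma pairing1:
  fixes x :: "real ^ ('n::enum)"
  assumes "4 \<le> CARD('m)" "CARD('m) < CARD('n)"
  shows "z1 a \<bullet> ((A1 t :: real ^ ('n::enum) ^ ('m::enum)) *v x) = (\<Sum>k<CARD('n).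
    (if k = 0 then a + t else if k = 1 then a else if k = 2 then 1 else 0) * x !. k)"
proof -
  have "(\<Sum>k<CARD('n). (if k = 0 then a + t else if k = 1 then a else if k = 2 then 1 else 0) * x !. k)
     = (\<Sum>k<CARD('n). of_bool (k = 0) * ((a + t) * x !. k) + of_bool (k = 1) * (a * x !. k)
         + of_bool (k = 2) * x !. k)"
    by (rule sum.cong) auto
  also have "\<dots> = (a + t) * x !. 0 + a * x !. 1 + x !. 2"
    using assms by (simp only: sum.distrib sum_of_bool_eq finite_lessThan) simp
  finally show ?thesis
    using assms by (simp add: inner_z1 A1_entry algebra_simps numeral_2_eq_2)
qed

text \<open>Entries from 3 on have dual weight 0 and vanish. A weight below 1 removes entry 0 or
  entry 1 as well, and the equations determine what is left; if both weights are 1, these two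
  entries may be traded.\<close>

lemma Sol1:
  fixes s :: "real ^ ('n::enum)"
  assumes valid: "valid_param pr" and card: "4 \<le> CARD('m)" "CARD('m) < CARD('n)" and L1: "reg_of pr = L1"
    and a: "a \<in> {999 / 1000..1}" "a + t \<in> {0..1}"
    and s: "(A1 t :: real ^ ('n::enum) ^ ('m::enum)) *v s = y1 - kappa1 pr a *\<^sub>R z1 a"
      "\<And>k. k < CARD('n) \<Longrightarrow> 0 \<le> s !. k"
      "a + t < 1 \<Longrightarrow> s !. 0 = 0" "a < 1 \<Longrightarrow> s !. 1 = 0" "\<And>k. 3 \<le> k \<Longrightarrow> k < CARD('n) \<Longrightarrow> s !. k = 0"
  shows "s \<in> Sol pr (y1, A1 t :: real ^ ('n::enum) ^ ('m::enum))"
    and "a + t < 1 \<or> a < 1 \<Longrightarrow> Sol pr (y1, A1 t :: real ^ ('n::enum) ^ ('m::enum)) = {s}"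
proof -
  let ?A = "A1 t :: real ^ ('n::enum) ^ ('m::enum)" and ?b = "y1 - kappa1 pr a *\<^sub>R z1 a :: real ^ ('m::enum)"
  define w where "w k = (if k = 0 then a + t else if k = 1 then a else if k = 2 then 1 else 0)" for k :: nat
  have w1: "\<bar>w k\<bar> \<le> 1" for k using a by (auto simp: w_def)
  have pair: "z1 a \<bullet> (?A *v x) = (\<Sum>k<CARD('n). w k * x !. k)" for x
    unfolding w_def using pairing1[OF card] .
  have J: "reg_fun (reg_of pr) x = (\<Sum>k<CARD('n). \<bar>x !. k\<bar>)" for x :: "real ^ ('n::enum)"
    by (simp add: L1 norm1_entry)
  have tight: "reg_fun (reg_of pr) x = z1 a \<bullet> ?b \<longleftrightarrow> (\<forall>k<CARD('n). \<bar>x !. k\<bar> = w k * x !. k)"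
    if "?A *v x = ?b" for x
    unfolding that[symmetric] pair J using sum_abs_tight(2)[OF w1] .
  have "\<bar>s !. k\<bar> = w k * s !. k" if "k < CARD('n)" for k
    using s(2)[OF that] s(3,4) s(5)[of k] a that by (cases "k \<ge> 3") (auto simp: w_def)
  then have ts: "reg_fun (reg_of pr) s = z1 a \<bullet> ?b" using tight[OF s(1)] by simp
  have pos: "\<forall>i. 0 \<le> s $ i" using s(2) by (simp add: all_entry_iff)
  have Sol: "Sol pr (y1, ?A) = {x. ?A *v x = ?b \<and> reg_fun (reg_of pr) x = z1 a \<bullet> ?b \<and> (is_LP pr \<longrightarrow> (\<forall>i. 0 \<le> x $ i))}"
  proof (rule Sol_eq[OF valid _ _ s(1) ts])
    show "certifies pr y1 ?A (z1 a) ?b" using certifies1 valid card kappa1_bounds[OF valid a(1)] by blast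
    show "z1 a \<bullet> (?A *v x) \<le> reg_fun (reg_of pr) x" for x
      unfolding pair J using sum_abs_tight(1)[OF w1] .
  qed (use pos in blast)
  show "s \<in> Sol pr (y1, ?A)" unfolding Sol using s(1) ts pos by simp
  have "x = s" if x: "x \<in> Sol pr (y1, ?A)" and strict: "a + t < 1 \<or> a < 1" for x
  proof -
    have Ax: "?A *v x = ?b" using x unfolding Sol by simp
    have tx: "\<bar>x !. k\<bar> = w k * x !. k" if "k < CARD('n)" for k
      using x tight[OF Ax] that unfolding Sol by blast
    have z: "x !. k = 0" if "k < CARD('n)" "\<bar>w k\<bar> < 1" for k
      using tight_zero[OF tx] that by blast
    have eq: "x !. Suc i + (if i = 0 then x !. 0 else 0) + (if i = 1 then t * x !. 0 else 0)
        = s !. Suc i + (if i = 0 then s !. 0 else 0) + (if i = 1 then t * s !. 0 else 0)"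
      if "i < CARD('m)" for i
    proof -
      have "(?A *v x) !. i = (?A *v s) !. i" using Ax s(1) by simp
      then show ?thesis unfolding A1_entry[OF card(2) that] .
    qed
    have e01: "x !. 1 + x !. 0 = s !. 1 + s !. 0" "x !. 2 + t * x !. 0 = s !. 2 + t * s !. 0"
      using eq[of 0] eq[of 1] card by (simp_all add: numeral_2_eq_2)
    have x3: "x !. k = s !. k" if "3 \<le> k" "k < CARD('n)" for k
      using z[of k] s(5)[of k] that by (simp add: w_def)
    have x01: "x !. 0 = s !. 0 \<and> x !. 1 = s !. 1"
    proof (cases "a + t < 1")
      case True
      then show ?thesis using z[of 0] s(3) a card e01 by (simp add: w_def)
    next
      case False
      then show ?thesis using strict z[of 1] s(4) a card e01 by (simp add: w_def)
    qed
    have "x !. k = s !. k" if "k < CARD('n)" for k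
    proof -
      consider "k = 0" | "k = 1" | "k = 2" | "3 \<le> k" by linarith
      then show ?thesis using x01 e01 x3 that by cases auto
    qed
    then show ?thesis by (simp add: vec_eq_entry_iff)
  qed
  then show "Sol pr (y1, ?A) = {s}" if "a + t < 1 \<or> a < 1" using that \<open>s \<in> _\<close> by blast
qed


text \<open>Obtained from A x = y - \<kappa> z with a = 1 - t and entry 1 equal to 0;
  \<open>s2_one\<close> arises likewise from a = 1 and entry 0 equal to 0.\<close>

definition s1_one :: "problem \<Rightarrow> real \<Rightarrow> real ^ ('n::enum)" where
  "s1_one pr t = vec_of (\<lambda>k. if k = 0 then 2 - kappa1 pr (1 - t) * (1 - t)
     else if k = 2 then 2 - kappa1 pr (1 - t) - t * (2 - kappa1 pr (1 - t) * (1 - t)) else 0)"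

definition s2_one :: "problem \<Rightarrow> real \<Rightarrow> real ^ ('n::enum)" where
  "s2_one pr t = vec_of (\<lambda>k. if k = 1 \<or> k = 2 then 2 - kappa1 pr 1 else 0)"

lemma feasible1:
  assumes "valid_param pr" "reg_of pr = L1" "4 \<le> CARD('m)" "CARD('m) < CARD('n)"
  shows "(y1, A1 t) \<in> (feasible_inputs pr :: ('m::enum, 'n::enum) input set)"
proof -
  let ?x = "vec_of (\<lambda>k. if k = 1 \<or> k = 2 then 2 else 0) :: real ^ ('n::enum)"
  have "(A1 t *v ?x :: real ^ ('m::enum)) !. i = (y1 :: real ^ ('m::enum)) !. i" if "i < CARD('m)" for i
    unfolding A1_entry[OF assms(4) that] using assms(3,4) that by (auto simp: y1_def)
  then have "A1 t *v ?x = (y1 :: real ^ ('m::enum))" by (simp add: vec_eq_entry_iff)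
  moreover have "\<forall>i. 0 \<le> ?x $ i" by (simp add: all_entry_iff)
  ultimately show ?thesis
    using assms(1) unfolding feasible_inputs_def
    by (cases pr) (auto intro: exI[of _ ?x] exI[of _ 0] simp: norm1_def)
qed

text \<open>A^T v lists the entries of v and in addition v0 + t v1, whose square is at most twice
  the squared norm of v. So A A^T lies between I and 3 I.\<close>

lemma Cond1:
  assumes "4 \<le> CARD('m)" "CARD('m) < CARD('n)" "\<bar>t\<bar> \<le> 1"
  shows "Cond_mat ((A1 t :: real ^ ('n::enum) ^ ('m::enum)) ** transpose (A1 t)) \<le> ereal (32 / 10)"
proof -
  let ?A = "A1 t :: real ^ ('n::enum) ^ ('m::enum)"
  obtain N where N: "CARD('n) = Suc N" using assms(2) by (cases "CARD('n)") auto
  define T where "T v = transpose ?A *v v" for v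
  have e: "(transpose ?A *v v) !. 0 = v !. 0 + t * v !. 1"
    "\<And>l. Suc l < CARD('n) \<Longrightarrow> (transpose ?A *v v) !. Suc l = (if l < CARD('m) then v !. l else 0)" for v
  proof -
    have "(\<Sum>k<CARD('m). (of_bool (l = Suc k) + of_bool (k = 0 \<and> l = 0) + t * of_bool (k = 1 \<and> l = 0)) * v !. k)
      = (\<Sum>k<CARD('m). (of_bool (l = Suc k)) * v !. k) + of_bool (l = 0) * (\<Sum>k<CARD('m). of_bool (k = 0) * v !. k)
        + t * of_bool (l = 0) * (\<Sum>k<CARD('m). of_bool (k = 1) * v !. k)" for l
      by (simp only: sum_distrib_left sum.distrib[symmetric])
        (rule sum.cong, auto simp: algebra_simps of_bool_def)
    then have s: "(transpose ?A *v v) !. l = (\<Sum>k<CARD('m). (of_bool (l = Suc k)) * v !. k)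
        + of_bool (l = 0) * (\<Sum>k<CARD('m). of_bool (k = 0) * v !. k)
        + t * of_bool (l = 0) * (\<Sum>k<CARD('m). of_bool (k = 1) * v !. k)" if "l < CARD('n)" for l
      unfolding A1_def transpose_mult_entry[OF that] by simp
    show "(transpose ?A *v v) !. 0 = v !. 0 + t * v !. 1"
      unfolding s[OF zero_less_card_finite] using assms by (simp add: sum_of_bool_eq)
    show "(transpose ?A *v v) !. Suc l = (if l < CARD('m) then v !. l else 0)" if "Suc l < CARD('n)" for l
      unfolding s[OF that] by (simp add: sum_of_bool_eq)
  qed
  note e' = e[folded T_def]
  have norm: "(norm (transpose ?A *v v))\<^sup>2 = (v !. 0 + t * v !. 1)\<^sup>2 + (norm v)\<^sup>2" for v
  proof -
    have "(\<Sum>l<N. ((T v) !. Suc l)\<^sup>2) = (\<Sum>l<N. (if l < CARD('m) then v !. l else 0)\<^sup>2)"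
      by (rule sum.cong) (auto simp: e' N)
    also have "\<dots> = (\<Sum>l<CARD('m). (v !. l)\<^sup>2)"
      using assms(2) N by (intro sum.mono_neutral_cong_right) auto
    finally show ?thesis
      by (simp only: T_def[symmetric] norm_entry[of "T v"] N sum.lessThan_Suc_shift e'(1) norm_entry[of v])
  qed
  show ?thesis
  proof (rule Cond_mat_le)
    show "(norm v)\<^sup>2 \<le> (norm (transpose ?A *v v))\<^sup>2" for v unfolding norm by simp
    show "(norm (transpose ?A *v v))\<^sup>2 \<le> 32 / 10 * (norm v)\<^sup>2" for v
    proof -
      have "(v !. 0)\<^sup>2 + (v !. 1)\<^sup>2 = (\<Sum>k\<in>{0, 1}. (v !. k)\<^sup>2)" by simp
      also have "\<dots> \<le> (norm v)\<^sup>2"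
        unfolding norm_entry[of v] using assms(1) by (intro sum_mono2) auto
      finally have v01: "(v !. 0)\<^sup>2 + (v !. 1)\<^sup>2 \<le> (norm v)\<^sup>2" .
      have "(v !. 0 + t * v !. 1)\<^sup>2 \<le> 2 * ((v !. 0)\<^sup>2 + (t * v !. 1)\<^sup>2)"
        using sum_squares_bound[of "v !. 0" "t * v !. 1"] by (simp add: power2_sum)
      moreover have "(t * v !. 1)\<^sup>2 \<le> 1 * (v !. 1)\<^sup>2"
        unfolding power_mult_distrib using assms(3) by (intro mult_right_mono) (auto simp: abs_square_le_1)
      ultimately have "(v !. 0 + t * v !. 1)\<^sup>2 \<le> 2 * (norm v)\<^sup>2" using v01 by argo
      then show ?thesis unfolding norm using zero_le_power2[of "norm v"] by argo
    qed
  qed simp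
qed

lemma unstable_family_one:
  assumes valid: "valid_param pr" and L1: "reg_of pr = L1" and card: "4 \<le> CARD('m)" "CARD('m) < CARD('n)"
  shows "unstable_family pr (\<lambda>t. (y1, A1 t :: real ^ ('n::enum) ^ ('m::enum)))
    (Inr (enum_class.enum ! 1, enum_class.enum ! 0)) (s1_one pr) (s2_one pr)"
proof -
  let ?k = "\<lambda>t. kappa1 pr (1 - t)"
  have k: "0 \<le> ?k t" "?k t \<le> 88 / 50" "0 \<le> ?k t * (1 - t)" "?k t * (1 - t) \<le> 88 / 50"
    if "t \<in> {0..1 / 1000}" for t
  proof -
    show 1: "0 \<le> ?k t" "?k t \<le> 88 / 50" using kappa1_bounds[OF valid, of "1 - t"] that by auto
    show "0 \<le> ?k t * (1 - t)" using 1 that by simp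
    have "?k t * (1 - t) \<le> 88 / 50 * 1" using 1 that by (intro mult_mono) auto
    then show "?k t * (1 - t) \<le> 88 / 50" by simp
  qed
  have x0: "0 \<le> t * (2 - ?k t * (1 - t))" "t * (2 - ?k t * (1 - t)) \<le> 1 / 500" if "t \<in> {0..1 / 1000}" for t
  proof -
    show "0 \<le> t * (2 - ?k t * (1 - t))" using k[OF that] that by simp
    have "t * (2 - ?k t * (1 - t)) \<le> 1 / 1000 * 2" using k[OF that] that by (intro mult_mono) auto
    then show "t * (2 - ?k t * (1 - t)) \<le> 1 / 500" by simp
  qed
  have k1: "0 \<le> kappa1 pr 1" "kappa1 pr 1 \<le> 88 / 50" using k[of 0] by auto
  have img1: "(A1 t :: real ^ ('n::enum) ^ ('m::enum)) *v s1_one pr t = y1 - ?k t *\<^sub>R z1 (1 - t)" for t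
  proof -
    have "((A1 t :: real ^ ('n::enum) ^ ('m::enum)) *v s1_one pr t) !. i = (y1 - ?k t *\<^sub>R z1 (1 - t) :: real ^ ('m::enum)) !. i"
      if "i < CARD('m)" for i
      unfolding A1_entry[OF card(2) that] using card that by (auto simp: s1_one_def y1_def z1_def algebra_simps)
    then show ?thesis by (simp add: vec_eq_entry_iff)
  qed
  have img2: "(A1 t :: real ^ ('n::enum) ^ ('m::enum)) *v s2_one pr t = y1 - kappa1 pr 1 *\<^sub>R z1 1" for t
  proof -
    have "((A1 t :: real ^ ('n::enum) ^ ('m::enum)) *v s2_one pr t) !. i = (y1 - kappa1 pr 1 *\<^sub>R z1 1 :: real ^ ('m::enum)) !. i"
      if "i < CARD('m)" for i
      unfolding A1_entry[OF card(2) that] using card that by (auto simp: s2_one_def y1_def z1_def algebra_simps)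
    then show ?thesis by (simp add: vec_eq_entry_iff)
  qed
  have pos1: "0 \<le> (s1_one pr t :: real ^ ('n::enum)) !. k" if "k < CARD('n)" "t \<in> {0..1 / 1000}" for k t
    using k[OF that(2)] x0[OF that(2)] that(1) by (auto simp: s1_one_def)
  have pos2: "0 \<le> (s2_one pr t :: real ^ ('n::enum)) !. k" if "k < CARD('n)" for k t
    using k1 that by (auto simp: s2_one_def)
  show ?thesis
  proof
    show "coord (y1 :: real ^ ('m::enum), A1 t :: real ^ ('n::enum) ^ ('m::enum)) (Inr (enum_class.enum ! 1, enum_class.enum ! 0)) = t" for t
      using card by (simp add: A1_def mat_of_def)
    show "coord (y1 :: real ^ ('m::enum), A1 t :: real ^ ('n::enum) ^ ('m::enum)) j = coord (y1, A1 t') j"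
      if "j \<noteq> Inr (enum_class.enum ! 1, enum_class.enum ! 0)" for j t t'
    proof (cases j)
      case (Inr p)
      obtain i l where p: "p = (i, l)" by (cases p)
      have "\<not> (pos i = 1 \<and> pos l = 0)" using that enum_pos[of i] enum_pos[of l] unfolding Inr p by metis
      then show ?thesis by (auto simp: Inr p A1_def mat_of_def)
    qed simp
    show "(y1, A1 t) \<in> (feasible_inputs pr :: ('m, 'n) input set)" for t
      using feasible1 valid L1 card by blast
    show "s1_one pr 0 \<in> Sol pr (y1 :: real ^ ('m::enum), A1 0 :: real ^ ('n::enum) ^ ('m::enum))"
      by (rule Sol1(1)[OF valid card L1, of 1]) (use img1[of 0] pos1[of _ 0] in \<open>auto simp: s1_one_def\<close>)
    show "s2_one pr 0 \<in> Sol pr (y1 :: real ^ ('m::enum), A1 0 :: real ^ ('n::enum) ^ ('m::enum))"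
      by (rule Sol1(1)[OF valid card L1, of 1]) (use img2[of 0] pos2[of _ 0] in \<open>auto simp: s2_one_def\<close>)
    show "Sol pr (y1 :: real ^ ('m::enum), A1 t :: real ^ ('n::enum) ^ ('m::enum)) = {s1_one pr t}"
      if "0 < t" "t \<le> 1 / 1000" for t
      by (rule Sol1(2)[OF valid card L1, of "1 - t"]) (use img1[of t] pos1[of _ t] that card in \<open>auto simp: s1_one_def\<close>)
    show "Sol pr (y1 :: real ^ ('m::enum), A1 t :: real ^ ('n::enum) ^ ('m::enum)) = {s2_one pr t}"
      if "t < 0" "- 1 / 1000 \<le> t" for t
      by (rule Sol1(2)[OF valid card L1, of 1]) (use img2[of t] pos2[of _ t] that card in \<open>auto simp: s2_one_def\<close>)
    show "infnorm (s1_one pr t - s1_one pr t' :: real ^ ('n::enum)) \<le> 100 * \<bar>t - t'\<bar>"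
      if t: "t \<in> {0..1 / 1000}" "t' \<in> {0..1 / 1000}" for t t'
    proof -
      let ?e = "\<bar>t - t'\<bar>"
      have a: "\<bar>?k t - ?k t'\<bar> \<le> 10 * ?e"
        using kappa1_lipschitz[OF valid, of "1 - t" "1 - t'"] t by (simp add: abs_minus_commute)
      have b: "\<bar>?k t * (1 - t) - ?k t' * (1 - t')\<bar> \<le> (10 * 1 + 1 * 2) * ?e"
        using a t k[OF t(2)] by (intro product_lipschitz) auto
      have c: "\<bar>t * (2 - ?k t * (1 - t)) - t' * (2 - ?k t' * (1 - t'))\<bar> \<le> (1 * 2 + 12 * 1) * ?e"
        using b t k[OF t(1)] by (intro product_lipschitz) auto
      show ?thesis
        unfolding infnorm_entry_le_iff using a b c by (auto simp: s1_one_def)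
    qed
    show "infnorm (s2_one pr t - s2_one pr t' :: real ^ ('n::enum)) \<le> 100 * \<bar>t - t'\<bar>" for t t'
      by (simp add: s2_one_def infnorm_0)
    show "1 / 5 < infnorm (s1_one pr t - s2_one pr t' :: real ^ ('n::enum))"
      if t: "t \<in> {0..1 / 1000}" for t t'
    proof -
      \<comment> \<open>Entry 0 separates the branches: it is at least 2 - 88/50 = 0.24 on the first
        and 0 on the second.\<close>
      have "\<bar>(s1_one pr t - s2_one pr t' :: real ^ ('n::enum)) !. 0\<bar> \<le> infnorm (s1_one pr t - s2_one pr t' :: real ^ ('n::enum))"
        by (rule entry_le_infnorm) (use card in auto)
      moreover have "(s1_one pr t - s2_one pr t' :: real ^ ('n::enum)) !. 0 = 2 - ?k t * (1 - t)"
        using card by (simp add: s1_one_def s2_one_def)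
      ultimately show ?thesis using k[OF t] by linarith
    qed
    show "Cond_mat (snd (y1 :: real ^ ('m::enum), A1 t :: real ^ ('n::enum) ^ ('m::enum)) ** transpose (snd (y1 :: real ^ ('m::enum), A1 t))) \<le> ereal (32 / 10)"
      if "\<bar>t\<bar> \<le> 1 / 1000" for t
      unfolding snd_conv by (rule Cond1) (use card that in auto)
    show "infnorm (fst (y1 :: real ^ ('m::enum), A1 t :: real ^ ('n::enum) ^ ('m::enum))) \<le> 2" for t
      by (auto simp: infnorm_entry_le_iff y1_def)
    show "max_entry (snd (y1 :: real ^ ('m::enum), A1 t :: real ^ ('n::enum) ^ ('m::enum))) = 1"
      if "\<bar>t\<bar> \<le> 1 / 1000" for t
      unfolding snd_conv A1_def by (rule max_entry_eqI[of _ 0 1]) (use card that in auto)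
  qed
qed

section \<open>The family for total variation\<close>

text \<open>Row 0 reads x0 + t x1, and row i \<ge> 1 reads entry i + 1. So entry 1 is not observed
  at t = 0 and may lie anywhere between its neighbours at no cost. For t > 0 it pays to raise it to
  entry 0, for t < 0 to lower it to entry 2.\<close>

definition A2 :: "real \<Rightarrow> real ^ ('n::enum) ^ ('m::enum)" where
  "A2 t = mat_of (\<lambda>i j. of_bool (1 \<le> i \<and> j = Suc i) + of_bool (i = 0 \<and> j = 0) + t * of_bool (i = 0 \<and> j = 1))"

definition y2 :: "real ^ ('m::enum)" where "y2 = vec_of (\<lambda>i. if i = 0 then 2 else 0)"

text \<open>The rows i \<ge> 1 share the weight - w evenly. The entries of A^T z must sum to 0, as
  total variation ignores constants; this forces w = u (1 + t). The two branches use u = 1 / (1 +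
  t), w = 1 and u = 1, w = 1 + t.\<close>

definition z2 :: "real \<Rightarrow> real \<Rightarrow> real ^ ('m::enum)" where
  "z2 u w = vec_of (\<lambda>i. if i = 0 then u else - w / (CARD('m) - 1))"

definition kappa2 :: "problem \<Rightarrow> nat \<Rightarrow> real \<Rightarrow> real \<Rightarrow> real" where
  "kappa2 pr M u w = (case pr of BP _ \<delta> \<Rightarrow> \<delta> / sqrt (u\<^sup>2 + w\<^sup>2 / (M - 1)) | UL _ l \<Rightarrow> l / 2 | _ \<Rightarrow> 0)"

lemma A2_entry:
  assumes "4 \<le> CARD('m)" "CARD('m) < CARD('n)" "i < CARD('m)"
  shows "((A2 t :: real ^ ('n::enum) ^ ('m::enum)) *v x) !. i
    = (if i = 0 then x !. 0 + t * x !. 1 else x !. Suc i)"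
proof -
  have s: "(\<Sum>l<CARD('n). (of_bool (1 \<le> i \<and> l = Suc i) + of_bool (i = 0 \<and> l = 0) + t * of_bool (i = 0 \<and> l = 1)) * x !. l)
     = of_bool (1 \<le> i) * (\<Sum>l<CARD('n). of_bool (l = Suc i) * x !. l)
       + of_bool (i = 0) * (\<Sum>l<CARD('n). of_bool (l = 0) * x !. l)
       + t * of_bool (i = 0) * (\<Sum>l<CARD('n). of_bool (l = 1) * x !. l)"
    by (simp only: sum_distrib_left sum.distrib[symmetric])
      (rule sum.cong, auto simp: algebra_simps of_bool_def)
  show ?thesis
    unfolding A2_def mult_entry[OF assms(3)] s using assms by (auto simp: sum_of_bool_eq)
qed

lemma sum_lessThan_split_first: "0 < n \<Longrightarrow> (\<Sum>k<n. f k) = f 0 + (\<Sum>k\<in>{1..<n}. f k)" for f :: "nat \<Rightarrow> real"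
  by (simp add: lessThan_atLeast0 sum.atLeast_Suc_lessThan)

lemma inner_z2:
  "z2 u w \<bullet> (v :: real ^ ('m::enum)) = u * v !. 0 + (\<Sum>k\<in>{1..<CARD('m)}. - w / (CARD('m) - 1) * v !. k)"
proof -
  have "z2 u w \<bullet> v = (\<Sum>k<CARD('m). (if k = 0 then u else - w / (CARD('m) - 1)) * v !. k)"
    unfolding inner_entry by (rule sum.cong) (auto simp: z2_def)
  then show ?thesis by (simp add: sum_lessThan_split_first)
qed

lemma norm_z2:
  assumes "4 \<le> CARD('m)"
  shows "norm (z2 u w :: real ^ ('m::enum)) = sqrt (u\<^sup>2 + w\<^sup>2 / (CARD('m) - 1))"
proof -
  have "z2 u w \<bullet> (z2 u w :: real ^ ('m::enum)) = u\<^sup>2 + (CARD('m) - 1) * (w / (CARD('m) - 1))\<^sup>2"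
    unfolding inner_z2 by (simp add: z2_def power2_eq_square of_nat_diff)
  also have "\<dots> = u\<^sup>2 + w\<^sup>2 / (CARD('m) - 1)"
    using assms by (simp add: power2_eq_square)
  finally show ?thesis by (simp only: norm_eq_sqrt_inner)
qed

text \<open>Summation by parts for weights in arithmetic progression.\<close>

lemma sum_weighted_differences:
  fixes x :: "nat \<Rightarrow> real"
  shows "(\<Sum>k\<in>{1..<Suc n}. (w + (real k - 1) * d) * (x k - x (Suc k)))
    = w * x 1 + d * (\<Sum>k\<in>{1..<Suc n}. x (Suc k)) - (w + real n * d) * x (Suc n)"
  by (induction n) (simp_all add: algebra_simps)

text \<open>The dual weights of the successive differences, that is, the partial sums of the entries
  of A^T z. They fall linearly to 0 because the rows i \<ge> 1 all contribute the same
  amount.\<close>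

definition w2 :: "nat \<Rightarrow> real \<Rightarrow> real \<Rightarrow> nat \<Rightarrow> real" where
  "w2 M u w k = (if k = 0 then u else if k < M then w * (1 - (real k - 1) / (M - 1)) else 0)"

lemma pairing2:
  fixes x :: "real ^ ('n::enum)"
  assumes "4 \<le> CARD('m)" "CARD('m) < CARD('n)" "w = u * (1 + t)"
  shows "z2 u w \<bullet> ((A2 t :: real ^ ('n::enum) ^ ('m::enum)) *v x)
    = (\<Sum>k<CARD('n) - 1. w2 (CARD('m)) u w k * (x !. k - x !. Suc k))"
proof -
  obtain n where n: "CARD('m) = Suc n" "3 \<le> n" using assms(1) by (cases "CARD('m)") auto
  let ?d = "- w / n"
  have "(\<Sum>k<CARD('n) - 1. w2 (CARD('m)) u w k * (x !. k - x !. Suc k))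
      = (\<Sum>k<CARD('m). w2 (CARD('m)) u w k * (x !. k - x !. Suc k))"
    using assms(2) by (intro sum.mono_neutral_right) (auto simp: w2_def)
  also have "\<dots> = u * (x !. 0 - x !. 1) + (\<Sum>k\<in>{1..<Suc n}. (w + (real k - 1) * ?d) * (x !. k - x !. Suc k))"
    unfolding n sum_lessThan_split_first[OF zero_less_Suc]
    by (intro arg_cong2[of _ _ _ _ "(+)"] sum.cong) (auto simp: w2_def algebra_simps diff_divide_distrib)
  also have "\<dots> = u * (x !. 0 - x !. 1) + (w * x !. 1 + ?d * (\<Sum>k\<in>{1..<Suc n}. x !. Suc k))"
    unfolding sum_weighted_differences[of w ?d "\<lambda>k. x !. k"] using n(2) by simp
  also have "\<dots> = z2 u w \<bullet> ((A2 t :: real ^ ('n::enum) ^ ('m::enum)) *v x)"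
  proof -
    have "(\<Sum>k\<in>{1..<CARD('m)}. - w / (CARD('m) - 1) * ((A2 t :: real ^ ('n::enum) ^ ('m::enum)) *v x) !. k)
       = (\<Sum>k\<in>{1..<Suc n}. ?d * x !. Suc k)"
      unfolding n using assms n by (intro sum.cong) (auto simp: A2_entry)
    then have z: "z2 u w \<bullet> ((A2 t :: real ^ ('n::enum) ^ ('m::enum)) *v x)
        = u * ((A2 t :: real ^ ('n::enum) ^ ('m::enum)) *v x) !. 0 + ?d * (\<Sum>k\<in>{1..<Suc n}. x !. Suc k)"
      by (simp only: inner_z2 sum_distrib_left)
    have h: "((A2 t :: real ^ ('n::enum) ^ ('m::enum)) *v x) !. 0 = x !. 0 + t * x !. 1"
      using assms by (simp add: A2_entry)
    have "u * (x !. 0 - x !. 1) + w * x !. 1 = u * (x !. 0 + t * x !. 1)"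
      unfolding assms(3) by (simp add: algebra_simps)
    then show ?thesis unfolding z h by (simp only: add.assoc[symmetric])
  qed
  finally show ?thesis by simp
qed

lemma certifies2:
  fixes A :: "real ^ ('n::enum) ^ ('m::enum)"
  assumes "valid_param pr" "4 \<le> CARD('m)" "reg_of pr = TV" "0 < u"
  shows "certifies pr y2 A (z2 u w) (y2 - kappa2 pr (CARD('m)) u w *\<^sub>R z2 u w)"
proof -
  have "0 < u\<^sup>2 + w\<^sup>2 / (CARD('m) - 1)" using assms by (intro add_pos_nonneg) auto
  then show ?thesis
    using assms norm_z2[OF assms(2), of u w]
    by (cases pr) (auto simp: certifies_def reg_of_def kappa2_def intro!: exI[of _ "kappa2 pr (CARD('m)) u w"])
qed

text \<open>The weights of the differences from position 2 on are strictly below 1, so solutions are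
  constant from there. If \<open>u\<close> or \<open>w\<close> is below 1, entry 1 agrees with entry
  0 or entry 2 respectively, and the observed values fix everything.\<close>

lemma Sol2:
  fixes s :: "real ^ ('n::enum)"
  assumes valid: "valid_param pr" and card: "4 \<le> CARD('m)" "CARD('m) < CARD('n)" and TV: "reg_of pr = TV"
    and u: "u \<in> {0<..1}" "w \<in> {0<..1}" "w = u * (1 + t)" "t \<noteq> - 1"
    and s: "(A2 t :: real ^ ('n::enum) ^ ('m::enum)) *v s = y2 - kappa2 pr (CARD('m)) u w *\<^sub>R z2 u w"
      "s !. 1 \<le> s !. 0" "s !. 2 \<le> s !. 1" "\<And>k. 2 \<le> k \<Longrightarrow> Suc k < CARD('n) \<Longrightarrow> s !. Suc k = s !. k"
      "u < 1 \<Longrightarrow> s !. 1 = s !. 0" "w < 1 \<Longrightarrow> s !. 2 = s !. 1"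
  shows "s \<in> Sol pr (y2, A2 t :: real ^ ('n::enum) ^ ('m::enum))"
    and "u < 1 \<or> w < 1 \<Longrightarrow> Sol pr (y2, A2 t :: real ^ ('n::enum) ^ ('m::enum)) = {s}"
proof -
  let ?A = "A2 t :: real ^ ('n::enum) ^ ('m::enum)"
  let ?b = "y2 - kappa2 pr (CARD('m)) u w *\<^sub>R z2 u w :: real ^ ('m::enum)"
  let ?w = "w2 (CARD('m)) u w"
  let ?d = "\<lambda>x :: real ^ ('n::enum). \<lambda>k. x !. k - x !. Suc k"
  have M: "0 < real (CARD('m) - 1)" using card by simp
  have w01: "0 \<le> ?w k \<and> ?w k \<le> 1" for k
  proof -
    have "0 \<le> 1 - (real k - 1) / (CARD('m) - 1) \<and> 1 - (real k - 1) / (CARD('m) - 1) \<le> 1"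
      if "k < CARD('m)" "k \<noteq> 0"
      using that M by (simp add: field_simps)
    then have "0 \<le> w * (1 - (real k - 1) / (CARD('m) - 1)) \<and> w * (1 - (real k - 1) / (CARD('m) - 1)) \<le> 1"
      if "k < CARD('m)" "k \<noteq> 0"
      using that u(2) by (auto intro: mult_le_one)
    then show ?thesis using u(1) by (auto simp: w2_def)
  qed
  then have w1: "\<bar>?w k\<bar> \<le> 1" for k using abs_of_nonneg by metis
  have strict: "\<bar>?w k\<bar> < 1" if "2 \<le> k" for k
  proof (cases "k < CARD('m)")
    case True
    then have "0 < (real k - 1) / (CARD('m) - 1)" using that M by simp
    moreover have "(real k - 1) / (CARD('m) - 1) \<le> 1" using True M by (simp add: field_simps)
    ultimately have "w * (1 - (real k - 1) / (CARD('m) - 1)) \<le> 1 * (1 - (real k - 1) / (CARD('m) - 1))"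
      using u(2) by (intro mult_right_mono) auto
    also have "\<dots> < 1" using \<open>0 < _ / _\<close> by simp
    finally show ?thesis using w01[of k] that True by (simp add: w2_def)
  qed (use that in \<open>simp add: w2_def\<close>)
  have w0: "?w 0 = u" "?w 1 = w" using card by (simp_all add: w2_def)
  have pair: "z2 u w \<bullet> (?A *v x) = (\<Sum>k<CARD('n) - 1. ?w k * ?d x k)" for x
    using pairing2[OF card u(3)] .
  have J: "reg_fun (reg_of pr) x = (\<Sum>k<CARD('n) - 1. \<bar>?d x k\<bar>)" for x :: "real ^ ('n::enum)"
    by (simp add: TV normTV_def)
  have tight: "reg_fun (reg_of pr) x = z2 u w \<bullet> ?b \<longleftrightarrow> (\<forall>k<CARD('n) - 1. \<bar>?d x k\<bar> = ?w k * ?d x k)"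
    if "?A *v x = ?b" for x
    unfolding that[symmetric] pair J using sum_abs_tight(2)[OF w1] .
  have "\<bar>?d s k\<bar> = ?w k * ?d s k" if "k < CARD('n) - 1" for k
  proof -
    consider "k = 0" | "k = 1" | "2 \<le> k" by linarith
    then show ?thesis
    proof cases
      case 1
      then show ?thesis using s(2,5) w0 u(1) by (cases "u < 1") auto
    next
      case 2
      then show ?thesis using s(3,6) w0 u(2) by (cases "w < 1") (auto simp: numeral_2_eq_2)
    next
      case 3
      then show ?thesis using s(4)[of k] that by simp
    qed
  qed
  then have ts: "reg_fun (reg_of pr) s = z2 u w \<bullet> ?b" using tight[OF s(1)] by simp
  have nLP: "\<not> is_LP pr" using TV by (auto simp: reg_of_def split: problem.splits)
  have Sol: "Sol pr (y2, ?A) = {x. ?A *v x = ?b \<and> reg_fun (reg_of pr) x = z2 u w \<bullet> ?b \<and> (is_LP pr \<longrightarrow> (\<forall>i. 0 \<le> x $ i))}"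
  proof (rule Sol_eq[OF valid _ _ s(1) ts])
    show "certifies pr y2 ?A (z2 u w) ?b" using certifies2 valid card TV u(1) by auto
    show "z2 u w \<bullet> (?A *v x) \<le> reg_fun (reg_of pr) x" for x
      unfolding pair J using sum_abs_tight(1)[OF w1] .
  qed (use nLP in blast)
  show "s \<in> Sol pr (y2, ?A)" unfolding Sol using s(1) ts nLP by simp
  have "x = s" if x: "x \<in> Sol pr (y2, ?A)" and uw: "u < 1 \<or> w < 1" for x
  proof -
    have Ax: "?A *v x = ?b" using x unfolding Sol by simp
    have tx: "\<bar>?d x k\<bar> = ?w k * ?d x k" if "k < CARD('n) - 1" for k
      using x tight[OF Ax] that unfolding Sol by blast
    have eq: "(if i = 0 then x !. 0 + t * x !. 1 else x !. Suc i) = (if i = 0 then s !. 0 + t * s !. 1 else s !. Suc i)"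
      if "i < CARD('m)" for i
    proof -
      have "(?A *v x) !. i = (?A *v s) !. i" using Ax s(1) by simp
      then show ?thesis unfolding A2_entry[OF card that] .
    qed
    have e: "x !. 0 + t * x !. 1 = s !. 0 + t * s !. 1" "x !. 2 = s !. 2"
      using eq[of 0] eq[of 1] card by (simp_all add: numeral_2_eq_2)
    have later: "x !. k = s !. k" if "2 \<le> k" "k < CARD('n)" for k
      using that
    proof (induction k rule: dec_induct)
      case (step k)
      then have "?d x k = 0" using tight_zero[OF tx strict] by simp
      then show ?case using step s(4)[of k] by simp
    qed (use e in simp)
    have x01: "x !. 0 = s !. 0 \<and> x !. 1 = s !. 1"
    proof (cases "u < 1")
      case True
      then have "?d x 0 = 0" using tight_zero[OF tx[of 0]] card w0 u(1) by simp
      then have "x !. 0 = x !. 1" "s !. 0 = s !. 1" using s(5) True by simp_all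
      then have "(1 + t) * x !. 1 = (1 + t) * s !. 1" using e(1) by (simp add: algebra_simps)
      then have "x !. 1 = s !. 1" using u(4) by (simp add: add_eq_0_iff)
      then show ?thesis using \<open>x !. 0 = x !. 1\<close> \<open>s !. 0 = s !. 1\<close> by simp
    next
      case False
      then have "?d x 1 = 0" using tight_zero[OF tx[of 1]] card w0 u(2) uw by simp
      then have "x !. 1 = x !. 2" "s !. 1 = s !. 2" using s(6) False uw by (simp_all add: numeral_2_eq_2)
      then show ?thesis using e by simp
    qed
    have "x !. k = s !. k" if "k < CARD('n)" for k
    proof -
      consider "k = 0" | "k = 1" | "2 \<le> k" by linarith
      then show ?thesis using x01 later that by cases auto
    qed
    then show ?thesis by (simp add: vec_eq_entry_iff)
  qed
  then show "Sol pr (y2, ?A) = {s}" if "u < 1 \<or> w < 1" using that \<open>s \<in> _\<close> by blast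
qed

lemma feasible2:
  assumes "valid_param pr" "reg_of pr = TV" "4 \<le> CARD('m)" "CARD('m) < CARD('n)"
  shows "(y2, A2 t) \<in> (feasible_inputs pr :: ('m::enum, 'n::enum) input set)"
proof -
  let ?x = "vec_of (\<lambda>k. if k = 0 then 2 else 0) :: real ^ ('n::enum)"
  have "(A2 t *v ?x :: real ^ ('m::enum)) !. i = (y2 :: real ^ ('m::enum)) !. i" if "i < CARD('m)" for i
    unfolding A2_entry[OF assms(3,4) that] using assms(3,4) that by (auto simp: y2_def)
  then have "A2 t *v ?x = (y2 :: real ^ ('m::enum))" by (simp add: vec_eq_entry_iff)
  then show ?thesis
    using assms(1,2) unfolding feasible_inputs_def
    by (cases pr) (auto intro: exI[of _ ?x] simp: reg_of_def)
qed

text \<open>A^T v lists the entries of v and in addition t v0, so A A^T lies between I and 2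
  I.\<close>

lemma Cond2:
  assumes "4 \<le> CARD('m)" "CARD('m) < CARD('n)" "\<bar>t\<bar> \<le> 1"
  shows "Cond_mat ((A2 t :: real ^ ('n::enum) ^ ('m::enum)) ** transpose (A2 t)) \<le> ereal (32 / 10)"
proof -
  let ?A = "A2 t :: real ^ ('n::enum) ^ ('m::enum)"
  define N where "N = CARD('n) - 2"
  have N: "CARD('n) = Suc (Suc N)" using assms(1,2) by (simp add: N_def)
  define T where "T v = transpose ?A *v v" for v
  have e: "T v !. l = (if l = 0 then v !. 0 else if l = 1 then t * v !. 0 else if l \<le> CARD('m) then v !. (l - 1) else 0)"
    if "l < CARD('n)" for v l
  proof -
    have "T v !. l = (\<Sum>k<CARD('m). (of_bool (1 \<le> k \<and> l = Suc k) + of_bool (k = 0 \<and> l = 0) + t * of_bool (k = 0 \<and> l = 1)) * v !. k)"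
      unfolding A2_def T_def transpose_mult_entry[OF that] by simp
    also have "\<dots> = (\<Sum>k<CARD('m). of_bool (k = l - 1) * (of_bool (2 \<le> l) * v !. k)) + of_bool (l = 0) * (\<Sum>k<CARD('m). of_bool (k = 0) * v !. k)
        + t * of_bool (l = 1) * (\<Sum>k<CARD('m). of_bool (k = 0) * v !. k)"
      by (simp only: sum_distrib_left sum.distrib[symmetric])
        (rule sum.cong, auto simp: algebra_simps of_bool_def)
    finally show ?thesis by (auto simp: sum_of_bool_eq)
  qed
  have norm: "(norm (transpose ?A *v v))\<^sup>2 = (t * v !. 0)\<^sup>2 + (norm v)\<^sup>2" for v
  proof -
    have "(\<Sum>l<N. (T v !. Suc (Suc l))\<^sup>2) = (\<Sum>l<N. (if Suc l < CARD('m) then v !. Suc l else 0)\<^sup>2)"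
      by (rule sum.cong) (auto simp: e N)
    also have "\<dots> = (\<Sum>l<CARD('m) - 1. (v !. Suc l)\<^sup>2)"
      using assms(2) N by (intro sum.mono_neutral_cong_right) auto
    finally have 1: "(\<Sum>l<N. (T v !. Suc (Suc l))\<^sup>2) = (\<Sum>l<CARD('m) - 1. (v !. Suc l)\<^sup>2)" .
    have 2: "(norm v)\<^sup>2 = (v !. 0)\<^sup>2 + (\<Sum>l<CARD('m) - 1. (v !. Suc l)\<^sup>2)"
      unfolding norm_entry[of v] using sum.lessThan_Suc_shift[of "\<lambda>k. (v !. k)\<^sup>2" "CARD('m) - 1"] by simp
    have "(norm (T v))\<^sup>2 = (v !. 0)\<^sup>2 + ((t * v !. 0)\<^sup>2 + (\<Sum>l<N. (T v !. Suc (Suc l))\<^sup>2))"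
      using N by (simp add: norm_entry[of "T v"] sum.lessThan_Suc_shift e del: sum.lessThan_Suc)
    then have "(norm (T v))\<^sup>2 = (t * v !. 0)\<^sup>2 + (norm v)\<^sup>2" unfolding 1 2 by simp
    then show ?thesis unfolding T_def .
  qed
  show ?thesis
  proof (rule Cond_mat_le)
    show "(norm v)\<^sup>2 \<le> (norm (transpose ?A *v v))\<^sup>2" for v unfolding norm by simp
    show "(norm (transpose ?A *v v))\<^sup>2 \<le> 32 / 10 * (norm v)\<^sup>2" for v
    proof -
      have "(v !. 0)\<^sup>2 = (\<Sum>k\<in>{0}. (v !. k)\<^sup>2)" by simp
      also have "\<dots> \<le> (norm v)\<^sup>2" unfolding norm_entry[of v] by (intro sum_mono2) auto
      finally have "(v !. 0)\<^sup>2 \<le> (norm v)\<^sup>2" .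
      moreover have "(t * v !. 0)\<^sup>2 \<le> 1 * (v !. 0)\<^sup>2"
        unfolding power_mult_distrib using assms(3) by (intro mult_right_mono) (auto simp: abs_square_le_1)
      ultimately show ?thesis unfolding norm using zero_le_power2[of "norm v"] by argo
    qed
  qed simp
qed

text \<open>In \<open>s1_tv\<close> the entries 0 and 1 agree, and row 0 gives (1 + t) x0 = 2 -
  \<kappa> u; in \<open>s2_tv\<close> entry 1 joins the later entries. The later entries are the
  components of - \<kappa> z, because y vanishes there.\<close>

definition s1_tv :: "problem \<Rightarrow> nat \<Rightarrow> real \<Rightarrow> real ^ ('n::enum)" where
  "s1_tv pr M t = (let u = 1 / (1 + t); \<kappa> = kappa2 pr M u 1 in
     vec_of (\<lambda>k. if k \<le> 1 then (2 - \<kappa> * u) * u else \<kappa> / (M - 1)))"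

definition s2_tv :: "problem \<Rightarrow> nat \<Rightarrow> real \<Rightarrow> real ^ ('n::enum)" where
  "s2_tv pr M t = (let \<kappa> = kappa2 pr M 1 (1 + t); c = \<kappa> * (1 + t) / (M - 1) in
     vec_of (\<lambda>k. if k = 0 then 2 - \<kappa> - t * c else c))"

text \<open>For BP the norm of z is at least u, which bounds \<kappa> by 1 / u \<le> 1000/999 and
  \<kappa> u by 1.\<close>

lemma kappa2_bounds:
  assumes "valid_param pr" "2 \<le> M" "999 / 1000 \<le> u" "u \<le> 1"
  shows "0 \<le> kappa2 pr M u w" "kappa2 pr M u w \<le> 1001 / 999" "kappa2 pr M u w * u \<le> 1"
proof -
  have "0 \<le> kappa2 pr M u w \<and> kappa2 pr M u w \<le> 1001 / 999 \<and> kappa2 pr M u w * u \<le> 1"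
  proof (cases pr)
    case (BP J \<delta>)
    let ?r = "sqrt (u\<^sup>2 + w\<^sup>2 / (M - 1))"
    have \<delta>: "0 \<le> \<delta>" "\<delta> \<le> 1" using BP assms(1) by auto
    have r: "u \<le> ?r" by (rule real_le_rsqrt) simp
    have "\<delta> / ?r \<le> 1 / (999 / 1000)" using \<delta> r assms(3) by (intro frac_le) auto
    moreover have "\<delta> / ?r * u \<le> 1"
    proof -
      have "\<delta> * u \<le> 1 * ?r" using \<delta> r assms(3) by (intro mult_mono) auto
      moreover have "0 < ?r" using r assms(3) by linarith
      ultimately have "\<delta> * u / ?r \<le> 1" by (simp only: divide_le_eq_1_pos mult_1)
      then show ?thesis by simp
    qed
    moreover have "0 \<le> \<delta> / ?r" using \<delta> r assms(3) by auto
    moreover have m: "kappa2 pr M u w = \<delta> / ?r" using BP by (simp add: kappa2_def)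
    ultimately show ?thesis unfolding m by (intro conjI) (assumption | argo)+
  next
    case (UL J l)
    then have l: "0 < l" "l \<le> 1 / 3" "kappa2 pr M u w = l / 2" using assms(1) by (auto simp: kappa2_def)
    moreover have "l / 2 * u \<le> 1 * 1" using l assms(3,4) by (intro mult_mono) auto
    ultimately show ?thesis by auto
  qed (use assms in \<open>auto simp: kappa2_def\<close>)
  then show "0 \<le> kappa2 pr M u w" "kappa2 pr M u w \<le> 1001 / 999" "kappa2 pr M u w * u \<le> 1" by auto
qed

text \<open>For BP the norm of z is 1-Lipschitz in each of u and w. Inverting a norm of at least
  999/1000 costs the factor (1000/999)^2 < 2.\<close>

lemma kappa2_lipschitz:
  assumes "valid_param pr" "2 \<le> M" "999 / 1000 \<le> u" "999 / 1000 \<le> u'"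
  shows "\<bar>kappa2 pr M u w - kappa2 pr M u' w'\<bar> \<le> 2 * (\<bar>u - u'\<bar> + \<bar>w - w'\<bar>)"
proof (cases pr)
  case (BP J \<delta>)
  have \<delta>: "0 \<le> \<delta>" "\<delta> \<le> 1" using BP assms(1) by auto
  let ?d = "real (M - 1)"
  let ?r = "\<lambda>u w. sqrt (u\<^sup>2 + w\<^sup>2 / ?d)"
  let ?e = "\<bar>u - u'\<bar> + \<bar>w - w'\<bar>"
  have d: "1 \<le> ?d" "1 \<le> sqrt ?d" using assms(2) by simp_all
  have ru: "u \<le> ?r u w" for u w by (rule real_le_rsqrt) (use d in simp)
  have 1: "\<bar>?r u w - ?r u' w\<bar> \<le> \<bar>u - u'\<bar>" using d by (intro sqrt_sum_lipschitz) auto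
  have "?r u' w = sqrt ((w / sqrt ?d)\<^sup>2 + u'\<^sup>2)" for w
    using d by (simp add: power_divide add.commute)
  then have "\<bar>?r u' w - ?r u' w'\<bar> \<le> \<bar>w / sqrt ?d - w' / sqrt ?d\<bar>"
    by (simp only:) (rule sqrt_sum_lipschitz, simp)
  also have "\<dots> = \<bar>w - w'\<bar> / sqrt ?d" by (simp add: diff_divide_distrib[symmetric])
  also have "\<dots> \<le> \<bar>w - w'\<bar> / 1" using d by (intro divide_left_mono) auto
  finally have 2: "\<bar>?r u' w - ?r u' w'\<bar> \<le> \<bar>w - w'\<bar>" by simp
  have "\<bar>?r u w - ?r u' w'\<bar> \<le> \<bar>?r u w - ?r u' w\<bar> + \<bar>?r u' w - ?r u' w'\<bar>"
    using abs_triangle_ineq[of "?r u w - ?r u' w" "?r u' w - ?r u' w'"] by simp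
  then have 3: "\<bar>?r u w - ?r u' w'\<bar> \<le> ?e" using 1 2 by argo
  have "\<bar>1 / ?r u w - 1 / ?r u' w'\<bar> \<le> ?e / (999 / 1000)\<^sup>2"
    by (rule inverse_lipschitz[OF order_trans[OF assms(3) ru] order_trans[OF assms(4) ru] _ 3]) simp
  also have "\<dots> \<le> 2 * ?e"
  proof -
    have "?e / (999 / 1000)\<^sup>2 = (1000 / 999)\<^sup>2 * ?e" by (simp add: power2_eq_square)
    also have "\<dots> \<le> 2 * ?e" by (intro mult_right_mono) (auto simp: power2_eq_square)
    finally show ?thesis .
  qed
  finally have "\<bar>\<delta>\<bar> * \<bar>1 / ?r u w - 1 / ?r u' w'\<bar> \<le> 1 * (2 * ?e)"
    using \<delta> by (intro mult_mono) auto
  moreover have "kappa2 pr M u w - kappa2 pr M u' w' = \<delta> * (1 / ?r u w - 1 / ?r u' w')"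
    using BP by (simp add: kappa2_def algebra_simps)
  ultimately show ?thesis by (simp only: abs_mult)
qed (auto simp: kappa2_def)

lemma unstable_family_tv:
  assumes valid: "valid_param pr" and TV: "reg_of pr = TV" and card: "4 \<le> CARD('m)" "CARD('m) < CARD('n)"
  shows "unstable_family pr (\<lambda>t. (y2, A2 t :: real ^ ('n::enum) ^ ('m::enum)))
    (Inr (enum_class.enum ! 0, enum_class.enum ! 1)) (s1_tv pr (CARD('m))) (s2_tv pr (CARD('m)))"
proof -
  let ?M = "CARD('m)"
  let ?u = "\<lambda>t. 1 / (1 + t :: real)"
  let ?k = "\<lambda>t. kappa2 pr ?M (?u t) 1" and ?l = "\<lambda>t. kappa2 pr ?M 1 (1 + t)"
  let ?c = "\<lambda>t. ?l t * (1 + t) / (?M - 1)"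
  have M: "3 \<le> real (?M - 1)" "2 \<le> ?M" using card by simp_all
  have u: "999 / 1000 \<le> ?u t" "?u t \<le> 1" if "t \<in> {0..1 / 1000}" for t
    using that by (simp_all add: field_simps)
  have k: "0 \<le> ?k t" "?k t \<le> 1001 / 999" "?k t * ?u t \<le> 1" "0 \<le> ?k t * ?u t" "0 \<le> ?k t / (?M - 1)" "?k t / (?M - 1) \<le> 1 / 2"
    if "t \<in> {0..1 / 1000}" for t
  proof -
    show 1: "0 \<le> ?k t" "?k t \<le> 1001 / 999" "?k t * ?u t \<le> 1"
      using kappa2_bounds[OF valid M(2) u[OF that]] by blast+
    have "0 \<le> ?u t" using u[OF that] by argo
    with 1(1) show "0 \<le> ?k t * ?u t" by (rule mult_nonneg_nonneg)
    show "0 \<le> ?k t / (?M - 1)" using 1(1) by simp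
    have "?k t / (?M - 1) \<le> (1001 / 999) / 3" using 1 M by (intro frac_le) auto
    then show "?k t / (?M - 1) \<le> 1 / 2" by argo
  qed
  have x1: "999 / 1000 \<le> (2 - ?k t * ?u t) * ?u t" if "t \<in> {0..1 / 1000}" for t
  proof -
    have "1 * (999 / 1000) \<le> (2 - ?k t * ?u t) * ?u t"
      using k[OF that] u[OF that] by (intro mult_mono) auto
    then show ?thesis by simp
  qed
  have l: "0 \<le> ?l t" "?l t \<le> 1001 / 999" "?l t \<le> 1" "0 \<le> ?c t" "?c t \<le> 1 / 2"
    if "t \<in> {- 1 / 1000..0}" for t
  proof -
    show 1: "0 \<le> ?l t" "?l t \<le> 1001 / 999" "?l t \<le> 1"
      using kappa2_bounds[OF valid M(2), of 1] by auto
    show "0 \<le> ?c t" using 1 that by simp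
    have "?l t * (1 + t) \<le> 1 * 1" using 1 that by (intro mult_mono) auto
    then have "?c t \<le> 1 / 3" using M by (intro frac_le) auto
    then show "?c t \<le> 1 / 2" by argo
  qed
  have img1: "(A2 t :: real ^ ('n::enum) ^ ('m::enum)) *v s1_tv pr ?M t = y2 - ?k t *\<^sub>R z2 (?u t) 1"
    if t: "t \<in> {0..1 / 1000}" for t
  proof -
    have "(1 + t) * ((2 - ?k t * ?u t) * ?u t) = 2 - ?k t * ?u t" using t by simp
    then have "(2 - ?k t * ?u t) * ?u t + t * ((2 - ?k t * ?u t) * ?u t) = 2 - ?k t * ?u t"
      by (simp only: distrib_right mult_1)
    then have "((A2 t :: real ^ ('n::enum) ^ ('m::enum)) *v s1_tv pr ?M t) !. i
        = (y2 - ?k t *\<^sub>R z2 (?u t) 1 :: real ^ ('m::enum)) !. i"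
      if "i < CARD('m)" for i
      unfolding A2_entry[OF card that] using card that
      by (auto simp: s1_tv_def Let_def y2_def z2_def)
    then show ?thesis by (simp add: vec_eq_entry_iff)
  qed
  have img2: "(A2 t :: real ^ ('n::enum) ^ ('m::enum)) *v s2_tv pr ?M t = y2 - ?l t *\<^sub>R z2 1 (1 + t)" for t
  proof -
    have "((A2 t :: real ^ ('n::enum) ^ ('m::enum)) *v s2_tv pr ?M t) !. i
        = (y2 - ?l t *\<^sub>R z2 1 (1 + t) :: real ^ ('m::enum)) !. i"
      if "i < CARD('m)" for i
      unfolding A2_entry[OF card that] using card that
      by (auto simp: s2_tv_def Let_def y2_def z2_def)
        (simp add: algebra_simps diff_divide_distrib add_divide_distrib)
    then show ?thesis by (simp add: vec_eq_entry_iff)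
  qed
  have sol1: "s1_tv pr ?M t \<in> Sol pr (y2 :: real ^ ('m::enum), A2 t :: real ^ ('n::enum) ^ ('m::enum))"
    "t \<noteq> 0 \<Longrightarrow> Sol pr (y2 :: real ^ ('m::enum), A2 t :: real ^ ('n::enum) ^ ('m::enum)) = {s1_tv pr ?M t}"
    if t: "t \<in> {0..1 / 1000}" for t
  proof -
    have le: "?k t / (?M - 1) \<le> (2 - ?k t * ?u t) * ?u t"
      using k(6)[OF t] x1[OF t] by argo
    have s: "(s1_tv pr ?M t :: real ^ ('n::enum)) !. 1 \<le> (s1_tv pr ?M t :: real ^ ('n::enum)) !. 0"
      "(s1_tv pr ?M t :: real ^ ('n::enum)) !. 2 \<le> (s1_tv pr ?M t :: real ^ ('n::enum)) !. 1"
      "\<And>k. 2 \<le> k \<Longrightarrow> Suc k < CARD('n) \<Longrightarrow> (s1_tv pr ?M t :: real ^ ('n::enum)) !. Suc k = (s1_tv pr ?M t :: real ^ ('n::enum)) !. k"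
      "(s1_tv pr ?M t :: real ^ ('n::enum)) !. 1 = (s1_tv pr ?M t :: real ^ ('n::enum)) !. 0"
      using card le by (auto simp: s1_tv_def Let_def)
    have uu: "?u t \<in> {0<..1}" "1 \<in> {0<..1::real}" "1 = ?u t * (1 + t)" "t \<noteq> - 1" using t by auto
    note S = Sol2[OF valid card TV uu img1[OF t] s(1,2,3)]
    show "s1_tv pr ?M t \<in> Sol pr (y2 :: real ^ ('m::enum), A2 t :: real ^ ('n::enum) ^ ('m::enum))"
      by (rule S(1)) (use s(4) in auto)
    show "Sol pr (y2 :: real ^ ('m::enum), A2 t :: real ^ ('n::enum) ^ ('m::enum)) = {s1_tv pr ?M t}" if "t \<noteq> 0"
      by (rule S(2)) (use s(4) t that in auto)
  qed
  have sol2: "s2_tv pr ?M t \<in> Sol pr (y2 :: real ^ ('m::enum), A2 t :: real ^ ('n::enum) ^ ('m::enum))"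
    "t \<noteq> 0 \<Longrightarrow> Sol pr (y2 :: real ^ ('m::enum), A2 t :: real ^ ('n::enum) ^ ('m::enum)) = {s2_tv pr ?M t}"
    if t: "t \<in> {- 1 / 1000..0}" for t
  proof -
    have "?c t * (1 + t) \<le> 1 / 2 * 1" using l[OF t] t by (intro mult_mono) auto
    moreover have "C * (1 + t) = C + t * C" for C by (simp add: algebra_simps)
    ultimately have "?c t + t * ?c t \<le> 1 / 2" by (simp only: mult_1_right)
    then have "?c t \<le> 2 - ?l t - t * ?c t" using l(3)[OF t] by argo
    then have s: "(s2_tv pr ?M t :: real ^ ('n::enum)) !. 1 \<le> (s2_tv pr ?M t :: real ^ ('n::enum)) !. 0"
      "(s2_tv pr ?M t :: real ^ ('n::enum)) !. 2 \<le> (s2_tv pr ?M t :: real ^ ('n::enum)) !. 1"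
      "\<And>k. 2 \<le> k \<Longrightarrow> Suc k < CARD('n) \<Longrightarrow> (s2_tv pr ?M t :: real ^ ('n::enum)) !. Suc k = (s2_tv pr ?M t :: real ^ ('n::enum)) !. k"
      "(s2_tv pr ?M t :: real ^ ('n::enum)) !. 2 = (s2_tv pr ?M t :: real ^ ('n::enum)) !. 1"
      using card by (auto simp: s2_tv_def Let_def)
    have uu: "1 \<in> {0<..1::real}" "1 + t \<in> {0<..1::real}" "1 + t = 1 * (1 + t)" "t \<noteq> - 1" using t by auto
    note S = Sol2[OF valid card TV uu img2 s(1,2,3)]
    show "s2_tv pr ?M t \<in> Sol pr (y2 :: real ^ ('m::enum), A2 t :: real ^ ('n::enum) ^ ('m::enum))"
      by (rule S(1)) (use s(4) in auto)
    show "Sol pr (y2 :: real ^ ('m::enum), A2 t :: real ^ ('n::enum) ^ ('m::enum)) = {s2_tv pr ?M t}" if "t \<noteq> 0"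
      by (rule S(2)) (use s(4) t that in auto)
  qed
  have div_M: "\<bar>p / (?M - 1) - q / (?M - 1)\<bar> \<le> \<bar>p - q\<bar>" for p q
  proof -
    have "\<bar>p / (?M - 1) - q / (?M - 1)\<bar> = \<bar>p - q\<bar> / (?M - 1)"
      by (simp add: diff_divide_distrib[symmetric])
    also have "\<dots> \<le> \<bar>p - q\<bar> / 1" using M by (intro divide_left_mono) auto
    finally show ?thesis by simp
  qed
  show ?thesis
  proof
    show "coord (y2 :: real ^ ('m::enum), A2 t :: real ^ ('n::enum) ^ ('m::enum)) (Inr (enum_class.enum ! 0, enum_class.enum ! 1)) = t" for t
      using card by (simp add: A2_def mat_of_def)
    show "coord (y2 :: real ^ ('m::enum), A2 t :: real ^ ('n::enum) ^ ('m::enum)) j = coord (y2, A2 t') j"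
      if "j \<noteq> Inr (enum_class.enum ! 0, enum_class.enum ! 1)" for j t t'
    proof (cases j)
      case (Inr p)
      obtain i l where p: "p = (i, l)" by (cases p)
      have "\<not> (pos i = 0 \<and> pos l = 1)" using that enum_pos[of i] enum_pos[of l] unfolding Inr p by metis
      then show ?thesis by (auto simp: Inr p A2_def mat_of_def)
    qed simp
    show "(y2, A2 t) \<in> (feasible_inputs pr :: ('m, 'n) input set)" for t
      using feasible2 valid TV card by blast
    show "s1_tv pr ?M 0 \<in> Sol pr (y2 :: real ^ ('m::enum), A2 0 :: real ^ ('n::enum) ^ ('m::enum))"
      by (rule sol1) simp
    show "s2_tv pr ?M 0 \<in> Sol pr (y2 :: real ^ ('m::enum), A2 0 :: real ^ ('n::enum) ^ ('m::enum))"
      by (rule sol2) simp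
    show "Sol pr (y2 :: real ^ ('m::enum), A2 t :: real ^ ('n::enum) ^ ('m::enum)) = {s1_tv pr ?M t}"
      if "0 < t" "t \<le> 1 / 1000" for t by (rule sol1) (use that in auto)
    show "Sol pr (y2 :: real ^ ('m::enum), A2 t :: real ^ ('n::enum) ^ ('m::enum)) = {s2_tv pr ?M t}"
      if "t < 0" "- 1 / 1000 \<le> t" for t by (rule sol2) (use that in auto)
    show "infnorm (s1_tv pr ?M t - s1_tv pr ?M t' :: real ^ ('n::enum)) \<le> 100 * \<bar>t - t'\<bar>"
      if t: "t \<in> {0..1 / 1000}" "t' \<in> {0..1 / 1000}" for t t'
    proof -
      let ?e = "\<bar>t - t'\<bar>"
      have du: "\<bar>?u t - ?u t'\<bar> \<le> 1 * ?e"
        using inverse_lipschitz[of 1 "1 + t" "1 + t'" ?e] t by simp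
      have a: "\<bar>?k t - ?k t'\<bar> \<le> 2 * ?e"
        using kappa2_lipschitz[OF valid M(2), of "?u t" "?u t'" 1 1] u t du by simp
      have "0 \<le> ?u t" using u(1)[OF t(1)] by argo
      then have au: "\<bar>?u t\<bar> \<le> 1" using u(2)[OF t(1)] by (simp only: abs_of_nonneg)
      have "?k t' \<le> 2" using k(2)[OF t(2)] by argo
      then have ak: "\<bar>?k t'\<bar> \<le> 2" using k(1)[OF t(2)] by (simp only: abs_of_nonneg)
      have b: "\<bar>?k t * ?u t - ?k t' * ?u t'\<bar> \<le> (2 * 1 + 1 * 2) * ?e"
        using a du au ak by (rule product_lipschitz) simp
      have "(2 - ?k t * ?u t) - (2 - ?k t' * ?u t') = - (?k t * ?u t - ?k t' * ?u t')" by argo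
      then have b': "\<bar>(2 - ?k t * ?u t) - (2 - ?k t' * ?u t')\<bar> \<le> (2 * 1 + 1 * 2) * ?e"
        using b by (simp only: abs_minus_cancel)
      have "0 \<le> 2 - ?k t' * ?u t'" "2 - ?k t' * ?u t' \<le> 2" using k(3,4)[OF t(2)] by argo+
      then have "\<bar>2 - ?k t' * ?u t'\<bar> \<le> 2" by (simp only: abs_of_nonneg)
      from product_lipschitz[OF b' du au this]
      have c: "\<bar>(2 - ?k t * ?u t) * ?u t - (2 - ?k t' * ?u t') * ?u t'\<bar> \<le> 6 * ?e"
        by simp
      have d: "\<bar>?k t / (?M - 1) - ?k t' / (?M - 1)\<bar> \<le> 2 * ?e"
        using order_trans[OF div_M a] .
      show ?thesis
        unfolding infnorm_entry_le_iff
      proof (intro allI impI)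
        fix i assume "i < CARD('n)"
        then have "(s1_tv pr ?M t - s1_tv pr ?M t' :: real ^ ('n::enum)) !. i =
          (if i \<le> 1 then (2 - ?k t * ?u t) * ?u t - (2 - ?k t' * ?u t') * ?u t' else ?k t / (?M - 1) - ?k t' / (?M - 1))"
          by (simp add: s1_tv_def Let_def)
        then show "\<bar>(s1_tv pr ?M t - s1_tv pr ?M t' :: real ^ ('n::enum)) !. i\<bar> \<le> 100 * \<bar>t - t'\<bar>"
          using c d abs_ge_zero[of "t - t'"] by (cases "i \<le> 1") argo+
      qed
    qed
    show "infnorm (s2_tv pr ?M t - s2_tv pr ?M t' :: real ^ ('n::enum)) \<le> 100 * \<bar>t - t'\<bar>"
      if t: "t \<in> {- 1 / 1000..0}" "t' \<in> {- 1 / 1000..0}" for t t'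
    proof -
      let ?e = "\<bar>t - t'\<bar>"
      have a: "\<bar>?l t - ?l t'\<bar> \<le> 2 * ?e"
        using kappa2_lipschitz[OF valid M(2), of 1 1 "1 + t" "1 + t'"] by simp
      have b: "\<bar>?l t * (1 + t) - ?l t' * (1 + t')\<bar> \<le> (2 * 1 + 1 * 2) * ?e"
        using a t l[OF t(2)] by (intro product_lipschitz) auto
      have c: "\<bar>?c t - ?c t'\<bar> \<le> 4 * ?e" using order_trans[OF div_M b] by simp
      have d: "\<bar>t * ?c t - t' * ?c t'\<bar> \<le> (1 * 1 + 4 * 1) * ?e"
      proof (rule product_lipschitz)
        have "?c t \<le> 1" using l(5)[OF t(1)] by argo
        then show "\<bar>?c t\<bar> \<le> 1" using l(4)[OF t(1)] by (simp only: abs_of_nonneg)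
      qed (use c t in auto)
      have e: "\<bar>(2 - ?l t - t * ?c t) - (2 - ?l t' - t' * ?c t')\<bar> \<le> 7 * ?e"
      proof -
        have "(2 - ?l t - t * ?c t) - (2 - ?l t' - t' * ?c t') = - (?l t - ?l t') - (t * ?c t - t' * ?c t')"
          by argo
        then show ?thesis
          using abs_triangle_ineq4[of "- (?l t - ?l t')" "t * ?c t - t' * ?c t'"] a d
          by (simp only: abs_minus_cancel) argo
      qed
      show ?thesis
        unfolding infnorm_entry_le_iff
      proof (intro allI impI)
        fix i assume "i < CARD('n)"
        then have "(s2_tv pr ?M t - s2_tv pr ?M t' :: real ^ ('n::enum)) !. i =
          (if i = 0 then (2 - ?l t - t * ?c t) - (2 - ?l t' - t' * ?c t') else ?c t - ?c t')"
          by (simp add: s2_tv_def Let_def)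
        then show "\<bar>(s2_tv pr ?M t - s2_tv pr ?M t' :: real ^ ('n::enum)) !. i\<bar> \<le> 100 * \<bar>t - t'\<bar>"
          using c e abs_ge_zero[of "t - t'"] by (cases "i = 0") argo+
      qed
    qed
    show "1 / 5 < infnorm (s1_tv pr ?M t - s2_tv pr ?M t' :: real ^ ('n::enum))"
      if t: "t \<in> {0..1 / 1000}" "t' \<in> {- 1 / 1000..0}" for t t'
    proof -
      \<comment> \<open>Entry 1 separates the branches: it is at least 999/1000 on the first and at
        most 1/2 on the second.\<close>
      have "\<bar>(s1_tv pr ?M t - s2_tv pr ?M t' :: real ^ ('n::enum)) !. 1\<bar> \<le> infnorm (s1_tv pr ?M t - s2_tv pr ?M t' :: real ^ ('n::enum))"
        by (rule entry_le_infnorm) (use card in auto)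
      moreover have "(s1_tv pr ?M t - s2_tv pr ?M t' :: real ^ ('n::enum)) !. 1 = (2 - ?k t * ?u t) * ?u t - ?c t'"
        using card by (simp add: s1_tv_def s2_tv_def Let_def)
      moreover have "999 / 1000 - 1 / 2 \<le> (2 - ?k t * ?u t) * ?u t - ?c t'"
        using x1[OF t(1)] l[OF t(2)] by argo
      ultimately show ?thesis by argo
    qed
    show "Cond_mat (snd (y2 :: real ^ ('m::enum), A2 t :: real ^ ('n::enum) ^ ('m::enum)) ** transpose (snd (y2 :: real ^ ('m::enum), A2 t))) \<le> ereal (32 / 10)"
      if "\<bar>t\<bar> \<le> 1 / 1000" for t
      unfolding snd_conv by (rule Cond2) (use card that in auto)
    show "infnorm (fst (y2 :: real ^ ('m::enum), A2 t :: real ^ ('n::enum) ^ ('m::enum))) \<le> 2" for t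
      by (auto simp: infnorm_entry_le_iff y2_def)
    show "max_entry (snd (y2 :: real ^ ('m::enum), A2 t :: real ^ ('n::enum) ^ ('m::enum))) = 1"
      if "\<bar>t\<bar> \<le> 1 / 1000" for t
      unfolding snd_conv A2_def by (rule max_entry_eqI[of _ 0 0]) (use card that in auto)
  qed
qed

section \<open>The triangle inequality for the p-norm\<close>

lemma powr_convex_nonneg:
  fixes a b u :: real
  assumes "1 \<le> q" "0 \<le> a" "0 \<le> b" "0 \<le> u" "u \<le> 1"
  shows "(u * a + (1 - u) * b) powr q \<le> u * a powr q + (1 - u) * b powr q"
proof -
  \<comment> \<open>If one argument is 0, convexity reduces to v^q \<le> v for v in [0, 1].\<close>
  have one: "(v * c) powr q \<le> v * c powr q" if "0 \<le> v" "v \<le> 1" "0 \<le> c" for v c :: real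
  proof -
    have "v powr q \<le> v powr 1" using that assms(1) by (intro powr_mono') auto
    then show ?thesis using that by (simp add: powr_mult mult_right_mono)
  qed
  consider "a = 0" | "b = 0" | "0 < a" "0 < b" using assms by linarith
  then show ?thesis
  proof cases
    case 3
    then show ?thesis
      using convex_onD[OF powr_convex[OF assms(1)], of "1 - u" a b] assms by (simp add: algebra_simps)
  qed (use one[of u a] one[of "1 - u" b] assms in auto)
qed

text \<open>Minkowski's inequality: after division by their norms a and b the vectors are mixed with
  weights a / (a + b) and b / (a + b), and convexity of the power is applied entry by entry.\<close>

lemma pnorm_triangle:
  fixes x y :: "real ^ 'n"
  assumes "1 \<le> p" shows "pnorm p (x + y) \<le> pnorm p x + pnorm p y"
proof (cases p)
  case (real q)
  then have q: "1 \<le> q" using assms by simp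
  have P: "pnorm p x = (\<Sum>i\<in>UNIV. \<bar>x $ i\<bar> powr q) powr (1 / q)" for x :: "real ^ 'n"
    by (simp add: pnorm_def real)
  have Pq: "pnorm p x powr q = (\<Sum>i\<in>UNIV. \<bar>x $ i\<bar> powr q)" for x :: "real ^ 'n"
    unfolding P using q by (simp add: powr_powr sum_nonneg)
  have zero: "x = 0" if "pnorm p x = 0" for x :: "real ^ 'n"
    using infnorm_le_pnorm[OF assms, of x] that by (metis infnorm_eq_0 infnorm_pos_le order_antisym)
  consider "x = 0" | "y = 0" | "0 < pnorm p x" "0 < pnorm p y"
    using zero pnorm_nonneg[of p] by (metis less_le)
  then show ?thesis
  proof cases
    case 3
    define a b where "a = pnorm p x" and "b = pnorm p y"
    have ab: "0 < a" "0 < b" using 3 by (simp_all add: a_def b_def)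
    define u where "u = a / (a + b)"
    have u: "0 \<le> u" "u \<le> 1" "1 - u = b / (a + b)" using ab by (simp_all add: u_def field_simps)
    have "\<bar>x $ i + y $ i\<bar> powr q \<le> (a + b) powr q * (u * (\<bar>x $ i\<bar> powr q / a powr q) + (1 - u) * (\<bar>y $ i\<bar> powr q / b powr q))" for i
    proof -
      have "\<bar>x $ i + y $ i\<bar> \<le> (a + b) * (u * (\<bar>x $ i\<bar> / a) + (1 - u) * (\<bar>y $ i\<bar> / b))"
      proof -
        have "(a + b) * (u * (\<bar>x $ i\<bar> / a) + (1 - u) * (\<bar>y $ i\<bar> / b)) = \<bar>x $ i\<bar> + \<bar>y $ i\<bar>"
          unfolding u(3) unfolding u_def using ab by (simp add: distrib_left)
        then show ?thesis by simp
      qed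
      then have "\<bar>x $ i + y $ i\<bar> powr q \<le> ((a + b) * (u * (\<bar>x $ i\<bar> / a) + (1 - u) * (\<bar>y $ i\<bar> / b))) powr q"
        using q by (intro powr_mono2) auto
      also have "\<dots> = (a + b) powr q * (u * (\<bar>x $ i\<bar> / a) + (1 - u) * (\<bar>y $ i\<bar> / b)) powr q"
        using ab u by (subst powr_mult) auto
      also have "\<dots> \<le> (a + b) powr q * (u * (\<bar>x $ i\<bar> / a) powr q + (1 - u) * (\<bar>y $ i\<bar> / b) powr q)"
        using powr_convex_nonneg[OF q, of "\<bar>x $ i\<bar> / a" "\<bar>y $ i\<bar> / b" u] ab u by (intro mult_left_mono) auto
      finally show ?thesis using ab by (simp add: powr_divide)
    qed
    then have "pnorm p (x + y) powr q \<le> (\<Sum>i\<in>UNIV. (a + b) powr q * (u * (\<bar>x $ i\<bar> powr q / a powr q) + (1 - u) * (\<bar>y $ i\<bar> powr q / b powr q)))"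
      unfolding Pq by (intro sum_mono) simp
    also have "\<dots> = (a + b) powr q * (u * (pnorm p x powr q / a powr q) + (1 - u) * (pnorm p y powr q / b powr q))"
      unfolding Pq by (simp only: sum_distrib_left sum.distrib[symmetric] sum_divide_distrib)
    also have "\<dots> = (a + b) powr q" using ab by (simp add: a_def[symmetric] b_def[symmetric])
    finally have "(pnorm p (x + y) powr q) powr (1 / q) \<le> ((a + b) powr q) powr (1 / q)"
      using q by (intro powr_mono2[of "1 / q"]) auto
    then show ?thesis using q ab pnorm_nonneg[of p "x + y"] by (simp add: powr_powr a_def b_def)
  qed (simp_all add: pnorm_nonneg)
qed (use assms infnorm_triangle in \<open>auto simp: pnorm_def\<close>)

lemma pnorm_minus: "pnorm p (- x) = pnorm p x"
  by (simp add: pnorm_def infnorm_neg)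

lemma pnorm_triangle_diff:
  assumes "1 \<le> p" shows "pnorm p (x - z) \<le> pnorm p (x - y) + pnorm p (y - z)"
  using pnorm_triangle[OF assms, of "x - y" "y - z"] by simp

section \<open>Dyadic approximations of inputs and solutions\<close>

definition approx :: "real \<Rightarrow> nat \<Rightarrow> rat" where
  "approx x n = of_int \<lfloor>x * 2 ^ n\<rfloor> / 2 ^ n"

lemma approx_dyadic: "approx x n \<in> dyadics n"
  by (auto simp: approx_def dyadics_def)

lemma approx_close: "\<bar>of_rat (approx x n) - x\<bar> \<le> 1 / 2 ^ n"
proof -
  have "of_rat (approx x n) - x = (of_int \<lfloor>x * 2 ^ n\<rfloor> - x * 2 ^ n) / 2 ^ n"
    by (simp add: approx_def of_rat_divide of_rat_power field_simps)
  moreover have "\<bar>of_int \<lfloor>x * 2 ^ n\<rfloor> - x * 2 ^ n\<bar> \<le> 1" by linarith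
  ultimately show ?thesis by (simp add: divide_right_mono)
qed

lemma represents_approx: "represents (\<lambda>j. approx (coord \<iota> j)) \<iota>"
  by (simp add: represents_def approx_dyadic approx_close)

text \<open>The approximation of 0 is exactly 0, which leaves the whole tolerance 2^-n for the
  active entry. So the answers for the base input remain valid up to precision
  \<open>N\<close>.\<close>

lemma close_representation:
  assumes "\<And>j. j \<noteq> c \<Longrightarrow> coord \<iota> j = coord \<iota>0 j" "coord \<iota>0 c = 0" "\<bar>coord \<iota> c\<bar> \<le> 1 / 2 ^ N"
  shows "\<exists>r. represents r \<iota> \<and> (\<forall>j n. n \<le> N \<longrightarrow> r j n = approx (coord \<iota>0 j) n)"
proof (intro exI conjI allI impI)
  let ?r = "\<lambda>j n. if n \<le> N then approx (coord \<iota>0 j) n else approx (coord \<iota> j) n"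
  show "represents ?r \<iota>" unfolding represents_def
  proof (intro allI conjI)
    fix j n
    show "?r j n \<in> dyadics n" by (simp add: approx_dyadic)
    show "\<bar>of_rat (?r j n) - coord \<iota> j\<bar> \<le> 1 / 2 ^ n"
    proof (cases "n \<le> N \<and> j = c")
      case True
      then have "(1::real) / 2 ^ N \<le> 1 / 2 ^ n" by (simp add: frac_le power_increasing)
      then show ?thesis using True assms(2,3) by (simp add: approx_def)
    next
      case False
      then show ?thesis using assms(1) approx_close[of "coord \<iota> j" n] by auto
    qed
  qed
qed auto

lemma dyadic_vec_dense:
  fixes x :: "real ^ 'n"
  assumes "1 \<le> p" "0 < e"
  shows "\<exists>\<rho>. dyadic_vec \<rho> \<and> pnorm p (rvec \<rho> - x) < e"
proof -
  have "0 < e / CARD('n)" using assms(2) by simp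
  then obtain n where n: "(1 / 2) ^ n < e / CARD('n)"
    using real_arch_pow_inv[of "e / CARD('n)" "1 / 2"] by auto
  let ?\<rho> = "\<chi> i. approx (x $ i) n"
  have "infnorm (rvec ?\<rho> - x) \<le> (1 / 2) ^ n"
    unfolding infnorm_le_iff using approx_close by (simp add: rvec_def power_one_over)
  then have "CARD('n) * infnorm (rvec ?\<rho> - x) < e"
    using n by (simp add: pos_less_divide_eq mult.commute) (meson le_less_trans mult_left_mono of_nat_0_le_iff)
  then have "pnorm p (rvec ?\<rho> - x) < e"
    using pnorm_le_infnorm[OF assms(1)] le_less_trans by blast
  then show ?thesis by (auto simp: dyadic_vec_def intro!: exI[of _ ?\<rho>] approx_dyadic)
qed

section \<open>Signs of approximations\<close>

text \<open>Reducing a fraction can only shrink the numerator, so a big reduced numerator forces the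
  dyadic numerator k to have absolute value at least 2.\<close>

lemma big_numerator_ge:
  assumes "a \<in> dyadics n" "big_numerator a"
  shows "2 / 2 ^ n \<le> \<bar>real_of_rat a\<bar>"
proof -
  obtain k :: int where k: "a = of_int k / 2 ^ n" using assms(1) by (auto simp: dyadics_def)
  have "2 \<le> \<bar>k\<bar>"
  proof (rule ccontr)
    assume "\<not> 2 \<le> \<bar>k\<bar>"
    then consider "k = 0" | "k = 1" | "k = - 1" by linarith
    then have "\<bar>fst (quotient_of a)\<bar> \<le> 1"
    proof cases
      case 1
      then show ?thesis by (simp add: k)
    next
      case 2
      then have "a = Fract 1 (2 ^ n)" by (simp add: k Fract_of_int_quotient)
      then show ?thesis by (simp add: quotient_of_Fract normalize_stable)
    next
      case 3
      then have "a = Fract (- 1) (2 ^ n)" by (simp add: k Fract_of_int_quotient)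
      then show ?thesis by (simp add: quotient_of_Fract normalize_stable)
    qed
    then show False using assms(2) by (simp add: big_numerator_def)
  qed
  then have "2 \<le> \<bar>real_of_int k\<bar>" by linarith
  then show ?thesis by (simp add: k of_rat_divide of_rat_power divide_right_mono)
qed

lemma sign_of_approximation:
  fixes t :: real
  assumes "2 / 2 ^ n \<le> \<bar>real_of_rat a\<bar>" "\<bar>real_of_rat a - t\<bar> \<le> 1 / 2 ^ n"
  shows "0 < t \<Longrightarrow> 0 < a" "t < 0 \<Longrightarrow> a < 0"
proof -
  have pos: "0 < 1 / (2::real) ^ n" by simp
  have two: "2 / (2::real) ^ n = 1 / 2 ^ n + 1 / 2 ^ n" by simp
  have close: "real_of_rat a - t \<le> 1 / 2 ^ n" "t - real_of_rat a \<le> 1 / 2 ^ n"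
    using assms(2) by (simp_all only: abs_le_iff minus_diff_eq)
  show "0 < a" if "0 < t"
  proof -
    have "0 < real_of_rat a"
    proof (rule ccontr)
      assume "\<not> 0 < real_of_rat a"
      then have "\<bar>real_of_rat a\<bar> = - real_of_rat a" by (intro abs_of_nonpos) (simp only: not_less)
      then show False using assms(1) close pos that unfolding two by argo
    qed
    then show ?thesis by (simp only: zero_less_of_rat_iff)
  qed
  show "a < 0" if "t < 0"
  proof -
    have "real_of_rat a < 0"
    proof (rule ccontr)
      assume "\<not> real_of_rat a < 0"
      then have "\<bar>real_of_rat a\<bar> = real_of_rat a" by (intro abs_of_nonneg) (simp only: not_less)
      then show False using assms(1) close pos that unfolding two by argo
    qed
    then show ?thesis by (simp only: of_rat_less_0_iff)
  qed
qed

text \<open>The factor 3 keeps the approximations away from the powers of 2, whose reduced numerators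
  are 1.\<close>

lemma eventually_big_numerator:
  fixes t :: real
  assumes "a \<in> dyadics (m + 2)" "\<bar>real_of_rat a - t\<bar> \<le> 1 / 2 ^ (m + 2)" "\<bar>t\<bar> = 3 / 2 ^ m"
  shows "big_numerator a"
proof (rule ccontr)
  assume nb: "\<not> big_numerator a"
  obtain k :: int where k: "a = of_int k / 2 ^ (m + 2)" using assms(1) by (auto simp: dyadics_def)
  obtain p q where pq: "quotient_of a = (p, q)" by (cases "quotient_of a")
  then have q: "0 < q" and a: "a = of_int p / of_int q"
    by (simp_all add: quotient_of_denom_pos quotient_of_div)
  have ak: "real_of_rat a = of_int k / 2 ^ (m + 2)" by (simp add: k of_rat_divide of_rat_power of_rat_mult)
  have t: "\<bar>t\<bar> = 12 / 2 ^ (m + 2)" using assms(3) by simp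
  have "\<bar>\<bar>real_of_rat a\<bar> - \<bar>t\<bar>\<bar> \<le> 1 / 2 ^ (m + 2)"
    using assms(2) abs_triangle_ineq3 order_trans by blast
  then have "\<bar>\<bar>of_int k\<bar> / 2 ^ (m + 2) - 12 / 2 ^ (m + 2)\<bar> \<le> 1 / (2::real) ^ (m + 2)"
    unfolding ak t by (simp add: abs_divide)
  then have "\<bar>(\<bar>of_int k\<bar> - 12) / (2::real) ^ (m + 2)\<bar> \<le> 1 / 2 ^ (m + 2)"
    by (simp only: diff_divide_distrib)
  then have "\<bar>\<bar>real_of_int k\<bar> - 12\<bar> \<le> 1"
    by (simp add: abs_divide divide_le_cancel)
  \<comment> \<open>Since |t| = 12 / 2^(m + 2), only these three values are within the error. None
    of them divides a power of 2, as a reduced numerator of absolute value 1 would require.\<close>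
  then have k3: "\<bar>k\<bar> = 11 \<or> \<bar>k\<bar> = 12 \<or> \<bar>k\<bar> = 13" by linarith
  have "\<bar>p\<bar> < 2" using nb by (simp add: big_numerator_def pq)
  moreover have "p \<noteq> 0" using k3 a k by auto
  ultimately have p: "\<bar>p\<bar> = 1" by linarith
  have "\<bar>a\<bar> = 1 / of_int q" using p q by (simp add: a abs_divide flip: of_int_abs)
  moreover have "\<bar>a\<bar> = of_int \<bar>k\<bar> / 2 ^ (m + 2)" by (simp add: k abs_divide)
  ultimately have "rat_of_int (\<bar>k\<bar> * q) = rat_of_int (2 ^ (m + 2))"
    using q by (simp add: field_simps)
  then have e: "\<bar>k\<bar> * q = 2 ^ (m + 2)" by (simp only: of_int_eq_iff)
  then have d: "\<bar>k\<bar> dvd 2 ^ (m + 2)" by (metis dvd_triv_left)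
  have cop: "coprime d (2 ^ (m + 2))" if "odd d" for d :: int
    using that by (simp only: coprime_power_right_iff coprime_right_2_iff_odd) simp
  have nd: "\<not> d dvd 2 ^ (m + 2)" if "odd d" "1 < d" for d :: int
    using cop[OF that(1)] that(2) coprime_absorb_left[of d "2 ^ (m + 2)"] zdvd1_eq[of d] by auto
  have d12: "\<not> 12 dvd (2::int) ^ (m + 2)"
    using nd[of 3] dvd_trans[of 3 12 "2 ^ (m + 2) :: int"] by fastforce
  from k3 show False
  proof (elim disjE)
    assume "\<bar>k\<bar> = 11"
    from d[unfolded this] show False using nd[of 11] by simp
  next
    assume "\<bar>k\<bar> = 12"
    from d[unfolded this] show False using d12 by simp
  next
    assume "\<bar>k\<bar> = 13"
    from d[unfolded this] show False using nd[of 13] by simp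
  qed
qed

section \<open>Machines of either kind\<close>

lemma vec_list_nth: "k < CARD('n) \<Longrightarrow> vec_list (x :: 'b ^ ('n::enum)) ! k = x !. k"
  and length_vec_list: "length (vec_list (x :: 'b ^ ('n::enum))) = CARD('n)"
  by (simp_all add: vec_list_def length_enum)

lemma rvec_entry: "rvec v !. k = of_rat (v !. k)"
  by (simp add: rvec_def)

lemma machine_decides:
  assumes "wf_machine M"
  shows "\<exists>M'. wf_machine M' \<and> is_Turing M' = is_Turing M \<and>
    (\<forall>Q Q' (x :: real ^ ('n::enum)) \<rho>. (\<forall>k a. Q k = Some a \<longrightarrow> Q' k = Some a) \<longrightarrow> outputs_vec M Q x \<longrightarrow>
       Q' (Extra 0) = Some \<rho> \<longrightarrow> outputs_bit M' Q' ((1 \<le> x !. 0) = (1 \<le> \<rho>)))"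
proof (cases M)
  case (Turing T)
  then obtain T' where T': "wf_tm T'" "\<And>Q Q' w (v :: rat ^ ('n::enum)) \<rho>. (\<forall>k a. Q k = Some a \<longrightarrow> Q' k = Some a) \<Longrightarrow>
     tm_halts T Q w \<Longrightarrow> denotes_vec w v \<Longrightarrow> Q' (Extra 0) = Some \<rho> \<Longrightarrow>
     tm_halts T' Q' [Bit ((1 \<le> v !. 0) = (1 \<le> \<rho>))]"
    using tm_decides[of T, where ?'n = 'n] assms by auto
  have r: "1 \<le> real_of_rat c \<longleftrightarrow> 1 \<le> c" for c
    using of_rat_less_eq[of 1 c, where ?'a = real] by simp
  show ?thesis
    by (rule exI[of _ "Turing T'"]) (use T' Turing r in \<open>auto simp: rvec_entry\<close>)
next
  case (BSS P)
  obtain P' where P': "\<And>Q Q' c \<rho>. (\<forall>k a. Q k = Some a \<longrightarrow> Q' k = Some a) \<Longrightarrow> bss_halts P Q c \<Longrightarrow>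
    Q' (Extra 0) = Some \<rho> \<Longrightarrow> (\<exists>c'. bss_halts P' Q' c' \<and> c' 0 = of_bool ((1 \<le> c 0) = (1 \<le> \<rho>)))"
    using bss_decides[of P] by metis
  have c0: "c 0 = x !. 0" if "vec_list x = map (\<lambda>i. c (int i)) [0..<CARD('n)]" for c and x :: "real ^ ('n::enum)"
    using arg_cong[OF that, of "\<lambda>l. l ! 0"] by (simp add: vec_list_nth)
  have "outputs_bit (BSS P') Q' ((1 \<le> x !. 0) = (1 \<le> \<rho>))"
    if ext: "\<forall>k a. Q k = Some a \<longrightarrow> Q' k = Some a" and x: "outputs_vec M Q x" and Q: "Q' (Extra 0) = Some \<rho>"
    for Q Q' and x :: "real ^ ('n::enum)" and \<rho>
  proof -
    obtain c where "bss_halts P Q c" "vec_list x = map (\<lambda>i. c (int i)) [0..<CARD('n)]"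
      using x BSS by auto
    then show ?thesis using P'[OF ext _ Q, of c] c0[of x c] by (simp only: outputs_bit.simps)
  qed
  then show ?thesis using BSS by (intro exI[of _ "BSS P'"]) simp
qed

text \<open>The replacements \<open>v1\<close> and \<open>v2\<close> are fixed rational vectors, so
  either kind of machine can contain them; neither t nor m is known to it. The special form of |t|
  guarantees that the search ends, also for the test on reduced numerators.\<close>

lemma machine_corrects:
  fixes v1 v2 :: "rat ^ ('n::enum)"
  assumes "wf_machine M"
  shows "\<exists>M'. wf_machine M' \<and> is_Turing M' = is_Turing M \<and>
    (\<forall>Q Q' (x :: real ^ ('n::enum)) b. (\<forall>k a. Q k = Some a \<longrightarrow> Q' k = Some a) \<longrightarrow> outputs_vec M Q x \<longrightarrow>
       Q' (Extra 0) = Some (of_bool b) \<longrightarrow>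
       (b \<longrightarrow> outputs_vec M' Q' x) \<and>
       (\<not> b \<longrightarrow> (\<forall>a (t :: real) m. (\<forall>n. Q' (Coord j n) = Some (a n) \<and> a n \<in> dyadics n \<and> \<bar>of_rat (a n) - t\<bar> \<le> 1 / 2 ^ n) \<longrightarrow>
          \<bar>t\<bar> = 3 / 2 ^ m \<longrightarrow> (0 < t \<longrightarrow> outputs_vec M' Q' (rvec v1)) \<and> (t < 0 \<longrightarrow> outputs_vec M' Q' (rvec v2)))))"
proof (cases M)
  case (Turing T)
  define wd where "wd v = concat (map (\<lambda>u. u @ [Comma]) (map encode_rat (vec_list v)))" for v :: "rat ^ ('n::enum)"
  have wd: "denotes_vec (wd v) v" "Blank \<notin> set (wd v)" for v
  proof -
    have "list_all2 denotes_rat (map encode_rat (vec_list v)) (vec_list v)"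
      by (simp add: list_all2_conv_all_nth denotes_encode_rat)
    then show "denotes_vec (wd v) v" unfolding denotes_vec_def wd_def by blast
    show "Blank \<notin> set (wd v)" using Blank_notin_encode_rat by (auto simp: wd_def)
  qed
  obtain T' where T': "wf_tm T'" "\<forall>Q Q' w b. (\<forall>k a. Q k = Some a \<longrightarrow> Q' k = Some a) \<longrightarrow>
     tm_halts T Q w \<longrightarrow> Q' (Extra 0) = Some (of_bool b) \<longrightarrow>
     (b \<longrightarrow> tm_halts T' Q' w) \<and>
     (\<not> b \<longrightarrow> (\<forall>c n. (\<forall>n. Q' (Coord j n) = Some (c n)) \<longrightarrow> big_numerator (c n) \<longrightarrow>
        ((\<forall>n. big_numerator (c n) \<longrightarrow> 0 < c n) \<longrightarrow> tm_halts T' Q' (wd v1)) \<and>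
        ((\<forall>n. big_numerator (c n) \<longrightarrow> c n < 0) \<longrightarrow> tm_halts T' Q' (wd v2))))"
    using tm_corrects[of T "wd v1" "wd v2" j] wd(2) assms Turing by auto
  show ?thesis
  proof (intro exI[of _ "Turing T'"] conjI allI impI)
    fix Q Q' and x :: "real ^ ('n::enum)" and b
    assume ext: "\<forall>k a. Q k = Some a \<longrightarrow> Q' k = Some a" and x: "outputs_vec M Q x"
      and Q: "Q' (Extra 0) = Some (of_bool b)"
    obtain w v where w: "tm_halts T Q w" "denotes_vec w v" "x = rvec v" using x Turing by auto
    note step = T'(2)[THEN spec, THEN spec, THEN spec, THEN spec, THEN mp, OF ext, THEN mp, OF w(1), THEN mp, OF Q]
    show "outputs_vec (Turing T') Q' x" if b using step that w by auto
    fix a and t :: real and m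
    assume nb: "\<not> b" and t: "\<bar>t\<bar> = 3 / 2 ^ m" and a: "\<forall>n. Q' (Coord j n) = Some (a n) \<and> a n \<in> dyadics n \<and> \<bar>of_rat (a n) - t\<bar> \<le> 1 / 2 ^ n"
    have big: "big_numerator (a (m + 2))" using eventually_big_numerator a t by blast
    have sgn: "0 < t \<Longrightarrow> 0 < a n" "t < 0 \<Longrightarrow> a n < 0" if "big_numerator (a n)" for n
      using sign_of_approximation[OF big_numerator_ge[OF _ that]] a by blast+
    have step': "((\<forall>n. big_numerator (a n) \<longrightarrow> 0 < a n) \<longrightarrow> tm_halts T' Q' (wd v1)) \<and>
        ((\<forall>n. big_numerator (a n) \<longrightarrow> a n < 0) \<longrightarrow> tm_halts T' Q' (wd v2))"
      using step nb a big by blast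
    show "outputs_vec (Turing T') Q' (rvec v1)" if "0 < t"
      using step' sgn(1) that wd(1)[of v1] by auto
    show "outputs_vec (Turing T') Q' (rvec v2)" if "t < 0"
      using step' sgn(2) that wd(1)[of v2] by auto
  qed (use T' Turing in auto)
next
  case (BSS P)
  let ?u = "\<lambda>v :: rat ^ ('n::enum). vec_list (rvec v)"
  obtain P' where P': "\<forall>Q Q' c b. (\<forall>k a. Q k = Some a \<longrightarrow> Q' k = Some a) \<longrightarrow>
     bss_halts P Q c \<longrightarrow> Q' (Extra 0) = Some (of_bool b) \<longrightarrow>
     (b \<longrightarrow> (\<exists>c'. bss_halts P' Q' c' \<and> (\<forall>i<CARD('n). c' (int i) = c (int i)))) \<and>
     (\<not> b \<longrightarrow> (\<forall>a n. (\<forall>n. Q' (Coord j n) = Some (a n)) \<longrightarrow> 2 / 2 ^ n \<le> \<bar>real_of_rat (a n)\<bar> \<longrightarrow>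
        ((\<forall>n. 2 / 2 ^ n \<le> \<bar>real_of_rat (a n)\<bar> \<longrightarrow> 0 < a n) \<longrightarrow>
           (\<exists>c'. bss_halts P' Q' c' \<and> (\<forall>i<CARD('n). c' (int i) = ?u v1 ! i))) \<and>
        ((\<forall>n. 2 / 2 ^ n \<le> \<bar>real_of_rat (a n)\<bar> \<longrightarrow> a n < 0) \<longrightarrow>
           (\<exists>c'. bss_halts P' Q' c' \<and> (\<forall>i<CARD('n). c' (int i) = ?u v2 ! i)))))"
    using bss_corrects[OF length_vec_list[of "rvec v1"] length_vec_list[of "rvec v2"], of P j] by (rule exE)
  have out: "outputs_vec (BSS P') Q' x" if "bss_halts P' Q' c'" "\<forall>i<CARD('n). c' (int i) = vec_list x ! i"
    for Q' c' and x :: "real ^ ('n::enum)"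
    using that by (auto intro!: exI[of _ c'] nth_equalityI simp: length_vec_list)
  show ?thesis
  proof (intro exI[of _ "BSS P'"] conjI allI impI)
    fix Q Q' and x :: "real ^ ('n::enum)" and b
    assume ext: "\<forall>k a. Q k = Some a \<longrightarrow> Q' k = Some a" and x: "outputs_vec M Q x"
      and Q: "Q' (Extra 0) = Some (of_bool b)"
    obtain c where c: "bss_halts P Q c" "vec_list x = map (\<lambda>i. c (int i)) [0..<CARD('n)]"
      using x BSS by auto
    note step = P'[THEN spec, THEN spec, THEN spec, THEN spec, THEN mp, OF ext, THEN mp, OF c(1), THEN mp, OF Q]
    show "outputs_vec (BSS P') Q' x" if b: b
    proof -
      obtain c' where "bss_halts P' Q' c'" "\<forall>i<CARD('n). c' (int i) = c (int i)" using step b by blast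
      then show ?thesis using out[of Q' c' x] c(2) by simp
    qed
    fix a and t :: real and m
    assume nb: "\<not> b" and t: "\<bar>t\<bar> = 3 / 2 ^ m" and a: "\<forall>n. Q' (Coord j n) = Some (a n) \<and> a n \<in> dyadics n \<and> \<bar>of_rat (a n) - t\<bar> \<le> 1 / 2 ^ n"
    have big: "2 / 2 ^ (m + 2) \<le> \<bar>real_of_rat (a (m + 2))\<bar>"
      using big_numerator_ge eventually_big_numerator a t by blast
    have sgn: "0 < t \<Longrightarrow> 0 < a n" "t < 0 \<Longrightarrow> a n < 0" if "2 / 2 ^ n \<le> \<bar>real_of_rat (a n)\<bar>" for n
      using sign_of_approximation[OF that] a by blast+
    have step': "((\<forall>n. 2 / 2 ^ n \<le> \<bar>real_of_rat (a n)\<bar> \<longrightarrow> 0 < a n) \<longrightarrow>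
           (\<exists>c'. bss_halts P' Q' c' \<and> (\<forall>i<CARD('n). c' (int i) = ?u v1 ! i))) \<and>
        ((\<forall>n. 2 / 2 ^ n \<le> \<bar>real_of_rat (a n)\<bar> \<longrightarrow> a n < 0) \<longrightarrow>
           (\<exists>c'. bss_halts P' Q' c' \<and> (\<forall>i<CARD('n). c' (int i) = ?u v2 ! i)))"
      using step nb a big by blast
    show "outputs_vec (BSS P') Q' (rvec v1)" if "0 < t" using step' sgn(1) that out by blast
    show "outputs_vec (BSS P') Q' (rvec v2)" if "t < 0" using step' sgn(2) that out by blast
  qed (use BSS in auto)
qed

text \<open>A monotone function converges from the right to its infimum, so \<open>Lim\<close> is a
  genuine limit here and lies below each value.\<close>

lemma Lim_at_right_le:
  fixes F :: "real \<Rightarrow> ennreal"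
  assumes mono: "\<And>a b. 0 < a \<Longrightarrow> a \<le> b \<Longrightarrow> F a \<le> F b" and e: "0 < e" "F e \<le> c"
  shows "Lim (at_right 0) F \<le> c"
proof -
  let ?L = "INF a\<in>{0<..}. F a"
  have "(F \<longlongrightarrow> ?L) (at_right 0)"
  proof (rule order_tendstoI)
    fix a assume "a < ?L"
    then have "a < F x" if "0 < x" for x
      using that by (metis INF_lower greaterThan_iff less_le_trans)
    then show "eventually (\<lambda>x. a < F x) (at_right 0)"
      by (auto simp: eventually_at_right_field intro!: exI[of _ 1])
  next
    fix a assume "?L < a"
    then obtain b where "0 < b" "F b < a" by (auto simp: Inf_less_iff)
    then show "eventually (\<lambda>x. F x < a) (at_right 0)"
      using mono by (auto simp: eventually_at_right_field intro!: exI[of _ b]) (metis le_less_trans less_imp_le)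
  qed
  then have "Lim (at_right 0) F = ?L" by (intro tendsto_Lim) simp_all
  also have "\<dots> \<le> F e" using e(1) by (intro INF_lower) simp
  finally show ?thesis using e(2) by simp
qed

section \<open>Queries of bounded precision and small parameters\<close>

lemma ev_rep_agree:
  assumes "finite F"
  obtains N where "\<And>r r' e. e \<in> F \<Longrightarrow> (\<And>j n. n \<le> N \<Longrightarrow> r j n = r' j n) \<Longrightarrow> ev_rep e r = ev_rep e r'"
proof -
  have "finite (snd ` F)" using assms by simp
  then obtain N where N: "\<forall>n\<in>snd ` F. n \<le> N" using finite_nat_set_iff_bounded_le by blast
  have "ev_rep e r = ev_rep e r'" if "e \<in> F" "\<And>j n. n \<le> N \<Longrightarrow> r j n = r' j n" for r r' e
    using N that by (cases e) force
  then show ?thesis using that by blast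
qed

lemma ev_orc_agree:
  assumes "finite F"
  obtains N where "\<And>r r' e \<rho>. e \<in> F \<Longrightarrow> (\<And>j n. n \<le> N \<Longrightarrow> r j n = r' j n) \<Longrightarrow> ev_orc e (r, \<rho>) = ev_orc e (r', \<rho>)"
proof -
  have "finite {jn. Inl jn \<in> F}" using finite_vimageI[OF assms, of Inl] by (simp add: vimage_def)
  then obtain N where N: "\<And>r r' e. e \<in> {jn. Inl jn \<in> F} \<Longrightarrow> (\<And>j n. n \<le> N \<Longrightarrow> r j n = r' j n) \<Longrightarrow> ev_rep e r = ev_rep e r'"
    using ev_rep_agree by blast
  have "ev_orc e (r, \<rho>) = ev_orc e (r', \<rho>)" if "e \<in> F" "\<And>j n. n \<le> N \<Longrightarrow> r j n = r' j n" for r r' e \<rho>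
  proof (cases e)
    case (Inl jn)
    then show ?thesis using N[of jn r r'] that by (cases jn) auto
  qed simp
  then show ?thesis using that by blast
qed

lemma small_power:
  fixes e C :: real
  assumes "0 < e"
  obtains M where "\<And>m. M \<le> m \<Longrightarrow> C * (3 / 2 ^ m) < e"
proof -
  have "(\<lambda>m. C * (3 * (1 / 2) ^ m)) \<longlonglongrightarrow> C * (3 * 0)"
    by (intro tendsto_mult tendsto_const LIMSEQ_realpow_zero) auto
  then have "eventually (\<lambda>m. C * (3 * (1 / 2) ^ m) < e) sequentially"
    using assms by (intro order_tendstoD) auto
  then show ?thesis using that by (auto simp: eventually_sequentially power_one_over)
qed

lemma orc_extend: "orc r [] k = Some a \<Longrightarrow> orc r ex k = Some a"
  by (cases k) (auto simp: Let_def split: if_splits)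

lemma ball_reps: "(\<And>\<iota> r. \<iota> \<in> \<Omega> \<Longrightarrow> represents r \<iota> \<Longrightarrow> P r) \<Longrightarrow> \<forall>r\<in>reps \<Omega>. P r"
  by (auto simp: reps_def)

lemma tenth_power_le: "1 \<le> K \<Longrightarrow> (1 / 10 :: real) ^ K \<le> 1 / 10"
  using power_decreasing[of 1 K "1 / 10 :: real"] by simp

lemma admissible_result:
  assumes "admissible pr p \<alpha> \<Omega> \<Gamma>" "\<iota> \<in> \<Omega>" "represents r \<iota>"
  obtains v \<iota>' \<xi> where "result \<Gamma> r = Some v" "\<iota>' \<in> \<Omega>" "\<xi> \<in> Sol pr \<iota>'" "pnorm p (v - \<xi>) < \<alpha>"
proof -
  have "err p (result \<Gamma> r) (\<Union>\<iota>\<in>\<Omega>. Sol pr \<iota>) < ennreal \<alpha>"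
    using assms unfolding admissible_def reps_def by blast
  then show ?thesis using that by (elim err_Some_less) blast
qed

section \<open>Conditioning of the unstable class\<close>

context unstable_family
begin

definition inputs :: "nat \<Rightarrow> ('m, 'n) input set" where
  "inputs M = \<iota> ` ({0} \<union> {t. \<exists>m\<ge>M. \<bar>t\<bar> = 3 / 2 ^ m})"

lemma inputs_cases:
  assumes "x \<in> inputs M"
  obtains "x = \<iota> 0" | t m where "x = \<iota> t" "M \<le> m" "\<bar>t\<bar> = 3 / 2 ^ m" "t \<noteq> 0"
proof -
  obtain t where t: "x = \<iota> t" "t = 0 \<or> (\<exists>m\<ge>M. \<bar>t\<bar> = 3 / 2 ^ m)" using assms by (auto simp: inputs_def)
  then show ?thesis using that by (cases "t = 0") auto
qed

lemma mem_Sol1: "t \<in> {0..1 / 1000} \<Longrightarrow> s1 t \<in> Sol pr (\<iota> t)"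
  using Sol_zero Sol_pos[of t] by (cases "t = 0") auto

lemma mem_Sol2: "t \<in> {- 1 / 1000..0} \<Longrightarrow> s2 t \<in> Sol pr (\<iota> t)"
  using Sol_zero Sol_neg[of t] by (cases "t = 0") auto

text \<open>Only the entry \<open>c\<close> varies within the class, so perturbations within the
  hull are shifts of t, though by arbitrary reals and not only to values used in the class.\<close>

lemma active_hull_inputs:
  assumes "x \<in> active_hull (inputs M)"
  obtains t where "x = \<iota> t"
proof -
  have "active_coords (inputs M) \<subseteq> {c}"
    using coord_other by (auto simp: active_coords_def inputs_def)
  then obtain t where "coord x j = coord (\<iota> t) j" if "j \<noteq> c" for j
    using assms by (auto simp: active_hull_def inputs_def)
  then have "x = \<iota> (coord x c)"
    using coord_active coord_other by (intro coord_eqI) metis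
  then show ?thesis using that by blast
qed

text \<open>The distance of solution sets is an infimum over pairs. Hence at t = 0 the branch on the
  side of t' can be used. For t other than 0 the radius |t| keeps t' on the closed side of t and, as
  |t| \<le> 1/2000, within the range 1/1000 of the branches.\<close>

lemma Sol_lipschitz:
  assumes "\<bar>t\<bar> \<le> 1 / 2000"
  obtains e where "0 < e" "\<And>t'. \<bar>t' - t\<bar> \<le> e \<Longrightarrow> dist_inf (Sol pr (\<iota> t')) (Sol pr (\<iota> t)) \<le> ennreal (100 * \<bar>t' - t\<bar>)"
proof -
  have d: "dist_inf S S' \<le> ennreal b" if "s \<in> S" "s' \<in> S'" "infnorm (s - s') \<le> b" for S S' :: "(real ^ ('n::enum)) set" and s s' b
    unfolding dist_inf_def using that by (intro INF_lower2[of s] INF_lower2[of s'] ennreal_leI) auto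
  have pos: "dist_inf (Sol pr (\<iota> t')) (Sol pr (\<iota> t)) \<le> ennreal (100 * \<bar>t' - t\<bar>)"
    if "t \<in> {0..1 / 1000}" "t' \<in> {0..1 / 1000}" for t'
    using that by (intro d[OF mem_Sol1 mem_Sol1] lipschitz1)
  have neg: "dist_inf (Sol pr (\<iota> t')) (Sol pr (\<iota> t)) \<le> ennreal (100 * \<bar>t' - t\<bar>)"
    if "t \<in> {- 1 / 1000..0}" "t' \<in> {- 1 / 1000..0}" for t'
    using that by (intro d[OF mem_Sol2 mem_Sol2] lipschitz2)
  consider "t = 0" | "0 < t" | "t < 0" by linarith
  then show ?thesis
  proof cases
    case 1
    show ?thesis
    proof (rule that[of "1 / 1000"])
      show "dist_inf (Sol pr (\<iota> t')) (Sol pr (\<iota> t)) \<le> ennreal (100 * \<bar>t' - t\<bar>)" if "\<bar>t' - t\<bar> \<le> 1 / 1000" for t'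
        using 1 pos[of t'] neg[of t'] that by (cases "0 \<le> t'") auto
    qed simp
  next
    case 2
    show ?thesis
    proof (rule that[of t])
      show "dist_inf (Sol pr (\<iota> t')) (Sol pr (\<iota> t)) \<le> ennreal (100 * \<bar>t' - t\<bar>)" if "\<bar>t' - t\<bar> \<le> t" for t'
      proof (rule pos)
        show "t \<in> {0..1 / 1000}" "t' \<in> {0..1 / 1000}" using that 2 assms by (auto simp: abs_le_iff)
      qed
    qed (use 2 in simp)
  next
    case 3
    show ?thesis
    proof (rule that[of "- t"])
      show "dist_inf (Sol pr (\<iota> t')) (Sol pr (\<iota> t)) \<le> ennreal (100 * \<bar>t' - t\<bar>)" if "\<bar>t' - t\<bar> \<le> - t" for t'
      proof (rule neg)
        show "t \<in> {- 1 / 1000..0}" "t' \<in> {- 1 / 1000..0}" using that 3 assms by (auto simp: abs_le_iff)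
      qed
    qed (use 3 in simp)
  qed
qed

lemma Cond_Sol_inputs:
  assumes small: "3 / 2 ^ M \<le> (1 / 2000 :: real)"
  shows "Cond_Sol pr (inputs M) \<le> 179"
  unfolding Cond_Sol_def
proof (rule SUP_least)
  fix x assume "x \<in> inputs M"
  then obtain t where x: "x = \<iota> t" and t: "\<bar>t\<bar> \<le> 1 / 2000"
  proof (cases rule: inputs_cases)
    case (2 t m)
    have "\<bar>t\<bar> \<le> 3 / 2 ^ M" unfolding 2(3) using 2(2) by (intro divide_left_mono power_increasing) auto
    then have "\<bar>t\<bar> \<le> 1 / 2000" using small by linarith
    with 2(1) show ?thesis by (rule that)
  qed (use that[of 0] in simp)
  let ?Z = "\<lambda>\<epsilon>. {z. x + z \<in> active_hull (inputs M) \<inter> feasible_inputs pr \<and> 0 < infnorm z \<and> infnorm z \<le> \<epsilon>}"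
  obtain e where e: "0 < e" "\<And>t'. \<bar>t' - t\<bar> \<le> e \<Longrightarrow> dist_inf (Sol pr (\<iota> t')) (Sol pr (\<iota> t)) \<le> ennreal (100 * \<bar>t' - t\<bar>)"
    by (rule Sol_lipschitz[OF t]) blast
  show "Lim (at_right 0) (\<lambda>\<epsilon>. SUP z\<in>?Z \<epsilon>. dist_inf (Sol pr (x + z)) (Sol pr x) / ennreal (infnorm z)) \<le> 179"
  proof (rule Lim_at_right_le[OF _ e(1)])
    show "(SUP z\<in>?Z a. dist_inf (Sol pr (x + z)) (Sol pr x) / ennreal (infnorm z))
        \<le> (SUP z\<in>?Z b. dist_inf (Sol pr (x + z)) (Sol pr x) / ennreal (infnorm z))" if "a \<le> b" for a b
      using that by (intro SUP_subset_mono) auto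
    show "(SUP z\<in>?Z e. dist_inf (Sol pr (x + z)) (Sol pr x) / ennreal (infnorm z)) \<le> 179"
    proof (rule SUP_least)
      fix z assume z: "z \<in> ?Z e"
      then obtain t' where t': "x + z = \<iota> t'" using active_hull_inputs by blast
      have "coord z c = t' - t" using coord_add[of x z c, unfolded t'] coord_active[of t] coord_active[of t'] x by simp
      then have tz: "\<bar>t' - t\<bar> \<le> infnorm z" using coord_le_infnorm[of z c] by simp
      have "dist_inf (Sol pr (x + z)) (Sol pr x) \<le> ennreal (100 * \<bar>t' - t\<bar>)"
        unfolding t' unfolding x using z tz by (intro e(2)) auto
      also have "\<dots> \<le> ennreal (100 * infnorm z)" using tz by (intro ennreal_leI) simp
      finally have "dist_inf (Sol pr (x + z)) (Sol pr x) / ennreal (infnorm z) \<le> ennreal (100 * infnorm z) / ennreal (infnorm z)"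
        by (rule divide_right_mono_ennreal)
      also have "\<dots> = ennreal 100" using z by (subst divide_ennreal) (auto simp: infnorm_pos_le)
      finally show "dist_inf (Sol pr (x + z)) (Sol pr x) / ennreal (infnorm z) \<le> 179"
        by (rule order_trans) simp
    qed
  qed
qed

lemma well_conditioned_inputs:
  assumes small: "3 / 2 ^ M \<le> (1 / 2000 :: real)"
  shows "well_conditioned pr (inputs M)"
proof -
  have "x \<in> feasible_inputs pr" if "x \<in> active_hull (inputs M)" for x
    using that feasible by (elim active_hull_inputs) simp
  then have "- feasible_inputs pr \<inter> active_hull (inputs M) = {}" by blast
  \<comment> \<open>The distance to an empty set is \<infinity>, and the quotient by it is
    0.\<close>
  then have CFP: "C_FP pr (inputs M) x = 0" for x
    by (simp add: C_FP_def dist2_input_def Let_def)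
  have "Cond_mat (A ** transpose A) \<le> ereal (32 / 10) \<and> infnorm y \<le> 2 \<and> max_entry A = 1" if "(y, A) \<in> inputs M" for y A
  proof -
    from that obtain t where x: "(y, A) = \<iota> t" and t: "\<bar>t\<bar> \<le> 1 / 1000"
    proof (cases rule: inputs_cases)
      case (2 t m)
      have "\<bar>t\<bar> \<le> 3 / 2 ^ M" unfolding 2(3) using 2(2) by (intro divide_left_mono power_increasing) auto
      then have "\<bar>t\<bar> \<le> 1 / 1000" using small by linarith
      with 2(1) show ?thesis by (rule that)
    qed (use that[of 0] in simp)
    have "fst (\<iota> t) = y" "snd (\<iota> t) = A" using x[symmetric] by simp_all
    then show ?thesis using Cond_le[OF t] y_le[of t] max_entry_eq[OF t] by simp
  qed
  then show ?thesis
    unfolding well_conditioned_def using Cond_Sol_inputs[OF small] CFP by auto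
qed

end

section \<open>The exit flag on the unstable class\<close>

locale unstable_class = unstable_family pr \<iota> c s1 s2
  for pr :: problem and \<iota> :: "real \<Rightarrow> ('m::enum, 'n::enum) input" and c s1 s2 +
  fixes p :: ereal and K M :: nat and \<alpha> \<omega> :: real
    and \<Gamma> :: "(('m, 'n) rep, ('m, 'n) coord \<times> nat, real ^ ('n::enum)) alg"
  assumes p: "1 \<le> p" and K: "1 \<le> K" and \<alpha>: "0 < \<alpha>" "\<alpha> \<le> \<omega>" "\<omega> < (1 / 10) ^ K"
    and small: "3 / 2 ^ M \<le> (1 / 2000 :: real)"
    and gap: "CARD('n) * 100 * (3 / 2 ^ M) \<le> (1 / 10) ^ K - \<omega>"
    and adm: "admissible pr p \<alpha> (inputs M) \<Gamma>"
begin

lemma le_small: "M \<le> m \<Longrightarrow> 3 / 2 ^ m \<le> (3 / 2 ^ M :: real)"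
  by (intro divide_left_mono power_increasing) auto

lemma pnorm_lipschitz:
  fixes x y :: "real ^ ('n::enum)" and e :: real
  assumes "infnorm (x - y) \<le> 100 * e"
  shows "pnorm p (x - y) \<le> CARD('n) * 100 * e"
proof -
  from assms have A: "CARD('n) * infnorm (x - y :: real ^ ('n::enum)) \<le> CARD('n) * (100 * e)" by (intro mult_left_mono) auto
  show ?thesis using order_trans[OF pnorm_le_infnorm[OF p] A] by (simp only: mult.assoc)
qed

lemma near_zero:
  fixes t :: real
  assumes "M \<le> m" "t = 3 / 2 ^ m"
  shows "Sol pr (\<iota> t) = {s1 t}" "pnorm p (s1 t - s1 0) \<le> CARD('n) * 100 * t"
    "Sol pr (\<iota> (- t)) = {s2 (- t)}" "pnorm p (s2 (- t) - s2 0) \<le> CARD('n) * 100 * t"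
    "t \<in> {0..1 / 1000}"
proof -
  have "t \<le> 1 / 1000" using le_small[OF assms(1)] small unfolding assms(2) by linarith
  moreover have "0 < t" by (simp add: assms(2))
  ultimately have t: "0 < t" "t \<le> 1 / 1000" by simp_all
  show "Sol pr (\<iota> t) = {s1 t}" "Sol pr (\<iota> (- t)) = {s2 (- t)}" "t \<in> {0..1 / 1000}"
    using Sol_pos[of t] Sol_neg[of "- t"] t by auto
  show "pnorm p (s1 t - s1 0) \<le> CARD('n) * 100 * t"
    using lipschitz1[of t 0] t by (intro pnorm_lipschitz) auto
  show "pnorm p (s2 (- t) - s2 0) \<le> CARD('n) * 100 * t"
    using lipschitz2[of "- t" 0] t by (intro pnorm_lipschitz) auto
qed

text \<open>The purpose of \<open>gap\<close>: an error below \<alpha> against some solution of the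
  class becomes an error of at most \<alpha> + 10^-K - \<omega> \<le> 10^-K against a solution at t
  = 0.\<close>

lemma Sol_near_zero:
  assumes "x \<in> inputs M" "\<xi> \<in> Sol pr x"
  obtains \<xi>0 where "\<xi>0 \<in> Sol pr (\<iota> 0)" "pnorm p (\<xi> - \<xi>0) \<le> (1 / 10) ^ K - \<omega>"
  using assms(1)
proof (cases rule: inputs_cases)
  case 1
  then show ?thesis using that[of \<xi>] assms(2) \<alpha> pnorm_le_infnorm[OF p, of "\<xi> - \<xi>"] by (auto simp: infnorm_0)
next
  case (2 t m)
  let ?t = "3 / 2 ^ m :: real"
  have "CARD('n) * 100 * ?t \<le> CARD('n) * 100 * (3 / 2 ^ M)"
    using le_small[OF 2(2)] by (intro mult_left_mono) auto
  then have g: "CARD('n) * 100 * ?t \<le> (1 / 10) ^ K - \<omega>" using gap by linarith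
  note n = near_zero[OF 2(2) refl]
  have "t = ?t \<or> t = - ?t" using 2(3) by (metis abs_eq_iff abs_of_nonneg zero_le_divide_iff zero_le_numeral zero_le_power)
  then show ?thesis
  proof
    assume "t = ?t"
    then have "\<xi> = s1 ?t" using n(1) assms(2) 2(1) by simp
    then show ?thesis using that[OF Sol_zero(1)] n(2) g by simp
  next
    assume "t = - ?t"
    then have "\<xi> = s2 (- ?t)" using n(3) assms(2) 2(1) by simp
    then show ?thesis using that[OF Sol_zero(2)] n(4) g by simp
  qed
qed

lemma zero_input: "\<iota> 0 \<in> inputs M"
  by (auto simp: inputs_def)

lemma flag_zero: "represents r (\<iota> 0) \<Longrightarrow> exit_flag pr p K \<Gamma> r"
proof -
  assume r: "represents r (\<iota> 0)"
  obtain v x \<xi> where v: "result \<Gamma> r = Some v" "x \<in> inputs M" "\<xi> \<in> Sol pr x" "pnorm p (v - \<xi>) < \<alpha>"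
    using admissible_result[OF adm zero_input r] .
  obtain \<xi>0 where "\<xi>0 \<in> Sol pr (\<iota> 0)" "pnorm p (\<xi> - \<xi>0) \<le> (1 / 10) ^ K - \<omega>"
    using Sol_near_zero[OF v(2,3)] .
  moreover from this have "pnorm p (v - \<xi>0) \<le> (1 / 10) ^ K"
    using pnorm_triangle_diff[OF p, of v \<xi>0 \<xi>] v(4) \<alpha> by linarith
  ultimately show ?thesis
    unfolding exit_flag_def represented_eq[OF r] v(1) by (intro err_Some_le)
qed

text \<open>The output of \<open>\<Gamma>\<close> at a representation of the degenerate input cannot be close to both
  ends of its solution set. At one side of the family it fails, with the same oracle answers.\<close>

lemma flag_discontinuous:
  assumes R: "\<And>x. exact_oracle pr p \<omega> x \<subseteq> R x"
  obtains x0 where "x0 \<in> with_oracle R (inputs M)"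
    "\<And>F. finite F \<Longrightarrow> \<exists>x\<in>with_oracle R (inputs M). (\<forall>e\<in>F. ev_orc e x = ev_orc e x0) \<and>
      (\<lambda>(r, \<rho>). exit_flag pr p K \<Gamma> r) x \<noteq> (\<lambda>(r, \<rho>). exit_flag pr p K \<Gamma> r) x0"
proof -
  note found = that
  define r0 where "r0 = (\<lambda>j. approx (coord (\<iota> 0) j))"
  have r0: "represents r0 (\<iota> 0)" unfolding r0_def by (rule represents_approx)
  obtain v where v: "result \<Gamma> r0 = Some v" using admissible_result[OF adm zero_input r0] .
  have GA: "general_algorithm ev_rep (reps (inputs M)) \<Gamma>" using adm by (simp add: admissible_def)
  have r0I: "r0 \<in> reps (inputs M)" using r0 zero_input by (auto simp: reps_def)
  have "result \<Gamma> r0 \<noteq> None" using v by simp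
  then have fin: "finite (queries \<Gamma> r0)" using GA r0I unfolding general_algorithm_def by blast
  obtain N0 where N0: "\<And>r r' e. e \<in> queries \<Gamma> r0 \<Longrightarrow> (\<And>j n. n \<le> N0 \<Longrightarrow> r j n = r' j n) \<Longrightarrow> ev_rep e r = ev_rep e r'"
    using ev_rep_agree[OF fin] by blast
  have same: "result \<Gamma> r = Some v" if "r \<in> reps (inputs M)" "\<And>j n. n \<le> N0 \<Longrightarrow> r j n = r0 j n" for r
  proof -
    have "\<forall>e\<in>queries \<Gamma> r0. ev_rep e r = ev_rep e r0" using N0 that(2) by blast
    then show ?thesis using GA that(1) r0I v unfolding general_algorithm_def by metis
  qed
  have main: thesis
    if S: "S 0 \<in> Sol pr (\<iota> 0)" and sg: "\<bar>sg\<bar> = (1::real)"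
      and Sol: "\<And>m. M \<le> m \<Longrightarrow> Sol pr (\<iota> (sg * (3 / 2 ^ m))) = {S (sg * (3 / 2 ^ m))}"
      and lip: "\<And>m. M \<le> m \<Longrightarrow> pnorm p (S (sg * (3 / 2 ^ m)) - S 0) \<le> CARD('n) * 100 * (3 / 2 ^ m)"
      and far: "\<And>m. M \<le> m \<Longrightarrow> 1 / 10 < infnorm (v - S (sg * (3 / 2 ^ m)))"
    for S :: "real \<Rightarrow> real ^ ('n::enum)" and sg
  proof -
    \<comment> \<open>Half of \<omega> is kept in reserve, so that \<rho> stays admissible when the
      solution moves by less than \<omega> / 2.\<close>
    obtain \<rho> where \<rho>: "dyadic_vec \<rho>" "pnorm p (rvec \<rho> - S 0) < \<omega> / 2"
      using dyadic_vec_dense[OF p, of "\<omega> / 2" "S 0"] \<alpha> by auto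
    have "pnorm p (rvec \<rho> - S 0) < \<omega>" using \<rho>(2) \<alpha> by linarith
    then have "\<rho> \<in> exact_oracle pr p \<omega> (\<iota> 0)" unfolding exact_oracle_def using \<rho>(1) S by blast
    then have "\<rho> \<in> R (\<iota> 0)" using R[of "\<iota> 0"] by blast
    then have x0: "(r0, \<rho>) \<in> with_oracle R (inputs M)" using r0 zero_input by (auto simp: with_oracle_def)
    have "\<exists>x\<in>with_oracle R (inputs M). (\<forall>e\<in>F. ev_orc e x = ev_orc e (r0, \<rho>)) \<and>
        (\<lambda>(r, \<rho>). exit_flag pr p K \<Gamma> r) x \<noteq> (\<lambda>(r, \<rho>). exit_flag pr p K \<Gamma> r) (r0, \<rho>)" if F: "finite F" for F
    proof -
      obtain N1 where N1: "\<And>r r' e \<rho>. e \<in> F \<Longrightarrow> (\<And>j n. n \<le> N1 \<Longrightarrow> r j n = r' j n) \<Longrightarrow> ev_orc e (r, \<rho>) = ev_orc e (r', \<rho>)"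
        using ev_orc_agree[OF F] by blast
      \<comment> \<open>Precision \<open>N0\<close> preserves the output of \<Gamma>, precision
        \<open>N1\<close> the evaluations in \<open>F\<close>.\<close>
      define N where "N = max N0 N1"
      obtain M1 where M1: "\<And>m. M1 \<le> m \<Longrightarrow> (CARD('n) * 100 :: real) * (3 / 2 ^ m) < \<omega> / 2"
        using small_power[of "\<omega> / 2" "CARD('n) * 100"] \<alpha> by auto
      obtain M2 where M2: "\<And>m. M2 \<le> m \<Longrightarrow> 1 * (3 / 2 ^ m) < (1 / 2 ^ N :: real)"
        using small_power[of "1 / 2 ^ N" 1] by auto
      define m where "m = max M (max M1 M2)"
      define t where "t = sg * (3 / 2 ^ m)"
      have m: "M \<le> m" "M1 \<le> m" "M2 \<le> m" by (simp_all add: m_def)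
      have at: "\<bar>t\<bar> = 3 / 2 ^ m" using sg by (simp add: t_def abs_mult)
      have tI: "\<iota> t \<in> inputs M" using at m(1) by (auto simp: inputs_def)
      obtain r where r: "represents r (\<iota> t)" "\<And>j n. n \<le> N \<Longrightarrow> r j n = r0 j n"
        using close_representation[of c "\<iota> t" "\<iota> 0" N] coord_other coord_active M2[OF m(3)] at
        unfolding r0_def by (metis less_imp_le mult_1)
      have rI: "r \<in> reps (inputs M)" using r(1) tI by (auto simp: reps_def)
      have "pnorm p (rvec \<rho> - S t) \<le> pnorm p (rvec \<rho> - S 0) + pnorm p (S 0 - S t)"
        by (rule pnorm_triangle_diff[OF p])
      also have "pnorm p (S 0 - S t) = pnorm p (S t - S 0)" using pnorm_minus[of p "S t - S 0"] by simp
      finally have "pnorm p (rvec \<rho> - S t) < \<omega>"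
        using lip[OF m(1)] M1[OF m(2)] \<rho>(2) unfolding t_def by linarith
      then have "\<rho> \<in> R (\<iota> t)"
        using \<rho>(1) R[of "\<iota> t"] Sol[OF m(1)] unfolding exact_oracle_def t_def by auto
      then have "(r, \<rho>) \<in> with_oracle R (inputs M)" using r(1) tI by (auto simp: with_oracle_def)
      moreover have "\<forall>e\<in>F. ev_orc e (r, \<rho>) = ev_orc e (r0, \<rho>)"
      proof
        fix e assume "e \<in> F"
        then show "ev_orc e (r, \<rho>) = ev_orc e (r0, \<rho>)" by (rule N1) (simp add: r(2) N_def)
      qed
      moreover have "\<not> exit_flag pr p K \<Gamma> r"
      proof -
        have "result \<Gamma> r = Some v" using same[OF rI] r(2) by (simp add: N_def)
        moreover have "(1 / 10) ^ K < pnorm p (v - S t)"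
          using infnorm_le_pnorm[OF p, of "v - S t"] far[OF m(1)] tenth_power_le[OF K] unfolding t_def by linarith
        ultimately show ?thesis
          unfolding exit_flag_def represented_eq[OF r(1)] using Sol[OF m(1)]
          by (simp add: t_def err_singleton_le_iff)
      qed
      moreover have "exit_flag pr p K \<Gamma> r0" using flag_zero[OF r0] .
      ultimately show ?thesis by (intro bexI[of _ "(r, \<rho>)"]) auto
    qed
    then show thesis by (rule found[OF x0])
  qed
  show thesis
  \<comment> \<open>Either the output is far from the whole first branch, or it is within 1/10 of
    one of its points; the separation by more than 1/5 then makes it far from the whole second
    branch.\<close>
  proof (cases "\<forall>m\<ge>M. 1 / 10 < infnorm (v - s1 (3 / 2 ^ m))")
    case True
    show thesis
    proof (rule main[of s1 1])
      show "1 / 10 < infnorm (v - s1 (1 * (3 / 2 ^ m)))" if "M \<le> m" for m using True that by simp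
    qed (use Sol_zero(1) near_zero(1,2)[OF _ refl] in simp_all)
  next
    case False
    then obtain m1 where m1: "M \<le> m1" "infnorm (v - s1 (3 / 2 ^ m1)) \<le> 1 / 10" by (auto simp: not_less)
    have far: "1 / 10 < infnorm (v - s2 (- (3 / 2 ^ m)))" if "M \<le> m" for m
    proof -
      have "1 / 5 < infnorm (s1 (3 / 2 ^ m1) - s2 (- (3 / 2 ^ m)))"
        using near_zero(5)[OF m1(1) refl] near_zero(5)[OF that refl] by (intro separated) auto
      also have "\<dots> \<le> infnorm (s1 (3 / 2 ^ m1) - v) + infnorm (v - s2 (- (3 / 2 ^ m)))"
        using infnorm_triangle[of "s1 (3 / 2 ^ m1) - v" "v - s2 (- (3 / 2 ^ m))"] by simp
      finally show ?thesis using m1(2) by (simp add: infnorm_sub)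
    qed
    show thesis
      by (rule main[of s2 "- 1"]) (use Sol_zero(2) near_zero(3,4)[OF _ refl] far in simp_all)
  qed
qed

text \<open>Success is demanded for every admissible answer, so an oracle with more admissible
  answers than the exact one helps no more. This treats the exact oracle and the K-digit oracle
  together.\<close>

lemma flag_not_computable:
  assumes "\<And>x. exact_oracle pr p \<omega> x \<subseteq> R x"
  shows "\<not> det_computable ev_orc (with_oracle R (inputs M)) (\<lambda>(r, \<rho>). exit_flag pr p K \<Gamma> r)"
    and "1 / 2 < q \<Longrightarrow> \<not> rand_computable ev_orc (with_oracle R (inputs M)) q (\<lambda>(r, \<rho>). exit_flag pr p K \<Gamma> r)"
proof -
  obtain x0 where x0: "x0 \<in> with_oracle R (inputs M)"
    "\<And>F. finite F \<Longrightarrow> \<exists>x\<in>with_oracle R (inputs M). (\<forall>e\<in>F. ev_orc e x = ev_orc e x0) \<and>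
      (\<lambda>(r, \<rho>). exit_flag pr p K \<Gamma> r) x \<noteq> (\<lambda>(r, \<rho>). exit_flag pr p K \<Gamma> r) x0"
    using flag_discontinuous[OF assms] by blast
  show "\<not> det_computable ev_orc (with_oracle R (inputs M)) (\<lambda>(r, \<rho>). exit_flag pr p K \<Gamma> r)"
    using x0 by (rule not_det_computable)
  show "\<not> rand_computable ev_orc (with_oracle R (inputs M)) q (\<lambda>(r, \<rho>). exit_flag pr p K \<Gamma> r)"
    if "1 / 2 < q" using x0 that by (rule not_rand_computable)
qed

text \<open>Flag 1 certifies the output of \<Gamma>, and flag 0 excludes t = 0. Then constant
  outputs suffice: \<open>v1\<close> and \<open>v2\<close> are within \<omega> of the ends of the
  branches at t = 0, and each branch stays within 10^-K - \<omega> of its end.\<close>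

lemma digits_from_flag:
  assumes "realises Mach (inputs M) \<Gamma>"
  shows "\<exists>M'. wf_machine M' \<and> is_Turing M' = is_Turing Mach \<and>
    (\<forall>r\<in>reps (inputs M). \<exists>x. outputs_vec M' (orc r [of_bool (exit_flag pr p K \<Gamma> r)]) x \<and>
       err p (Some x) (Sol pr (represented r)) \<le> ennreal ((1 / 10) ^ K))"
proof -
  obtain j where j: "j < length (enum_class.enum :: ('m, 'n) coord list)" "enum_class.enum ! j = c"
    by (metis UNIV_I UNIV_enum in_set_conv_nth)
  have om: "0 < \<omega>" using \<alpha> by linarith
  obtain v1 where v1: "pnorm p (rvec v1 - s1 0) < \<omega>" using dyadic_vec_dense[OF p om, of "s1 0"] by auto
  obtain v2 where v2: "pnorm p (rvec v2 - s2 0) < \<omega>" using dyadic_vec_dense[OF p om, of "s2 0"] by auto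
  have wf: "wf_machine Mach" using assms by (simp add: realises_def)
  obtain M' where M': "wf_machine M'" "is_Turing M' = is_Turing Mach"
    "\<forall>Q Q' (x :: real ^ ('n::enum)) b. (\<forall>k a. Q k = Some a \<longrightarrow> Q' k = Some a) \<longrightarrow> outputs_vec Mach Q x \<longrightarrow>
       Q' (Extra 0) = Some (of_bool b) \<longrightarrow>
       (b \<longrightarrow> outputs_vec M' Q' x) \<and>
       (\<not> b \<longrightarrow> (\<forall>a (t :: real) m. (\<forall>n. Q' (Coord j n) = Some (a n) \<and> a n \<in> dyadics n \<and> \<bar>of_rat (a n) - t\<bar> \<le> 1 / 2 ^ n) \<longrightarrow>
          \<bar>t\<bar> = 3 / 2 ^ m \<longrightarrow> (0 < t \<longrightarrow> outputs_vec M' Q' (rvec v1)) \<and> (t < 0 \<longrightarrow> outputs_vec M' Q' (rvec v2))))"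
    using machine_corrects[OF wf, of j v1 v2] by (elim exE conjE)
  have "\<exists>x. outputs_vec M' (orc r [of_bool (exit_flag pr p K \<Gamma> r)]) x \<and>
       err p (Some x) (Sol pr (represented r)) \<le> ennreal ((1 / 10) ^ K)"
    if i: "i \<in> inputs M" and r: "represents r i" for i r
  proof -
    let ?b = "exit_flag pr p K \<Gamma> r"
    let ?Q = "orc r [of_bool ?b]"
    obtain v where v: "result \<Gamma> r = Some v" using admissible_result[OF adm i r] .
    have "r \<in> reps (inputs M)" using i r by (auto simp: reps_def)
    then have out: "outputs_vec Mach (orc r []) v" using assms v unfolding realises_def by blast
    have ext: "\<forall>k a. orc r [] k = Some a \<longrightarrow> ?Q k = Some a" using orc_extend by blast
    have Q0: "?Q (Extra 0) = Some (of_bool ?b)" by simp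
    note step = M'(3)[THEN spec, THEN spec, THEN spec, THEN spec, THEN mp, OF ext, THEN mp, OF out, THEN mp, OF Q0]
    show ?thesis
    proof (cases ?b)
      case True
      then have "outputs_vec M' ?Q v" using step by blast
      moreover have "err p (Some v) (Sol pr (represented r)) \<le> ennreal ((1 / 10) ^ K)"
        using True v unfolding exit_flag_def by simp
      ultimately show ?thesis by blast
    next
      case False
      then have "i \<noteq> \<iota> 0" using flag_zero r by blast
      with i obtain t m where t: "i = \<iota> t" "M \<le> m" "\<bar>t\<bar> = 3 / 2 ^ m" "t \<noteq> 0"
        by (cases rule: inputs_cases) auto
      have a: "\<forall>n. ?Q (Coord j n) = Some (r c n) \<and> r c n \<in> dyadics n \<and> \<bar>of_rat (r c n) - t\<bar> \<le> 1 / 2 ^ n"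
      proof
        fix n
        have "r c n \<in> dyadics n \<and> \<bar>of_rat (r c n) - coord i c\<bar> \<le> 1 / 2 ^ n"
          using r unfolding represents_def by blast
        then show "?Q (Coord j n) = Some (r c n) \<and> r c n \<in> dyadics n \<and> \<bar>of_rat (r c n) - t\<bar> \<le> 1 / 2 ^ n"
          using j by (simp add: Let_def t(1) coord_active)
      qed
      have step': "(0 < t \<longrightarrow> outputs_vec M' ?Q (rvec v1)) \<and> (t < 0 \<longrightarrow> outputs_vec M' ?Q (rvec v2))"
        using step False a t(3) by blast
      let ?t = "3 / 2 ^ m :: real"
      have "CARD('n) * 100 * ?t \<le> CARD('n) * 100 * (3 / 2 ^ M)"
        using le_small[OF t(2)] by (intro mult_left_mono) auto
      then have g: "CARD('n) * 100 * ?t \<le> (1 / 10) ^ K - \<omega>" using gap by linarith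
      note n = near_zero[OF t(2) refl]
      show ?thesis
      proof (cases "0 < t")
        case True
        then have tt: "t = ?t" using t(3) by simp
        have "pnorm p (rvec v1 - s1 t) \<le> pnorm p (rvec v1 - s1 0) + pnorm p (s1 0 - s1 t)"
          by (rule pnorm_triangle_diff[OF p])
        also have "pnorm p (s1 0 - s1 t) = pnorm p (s1 t - s1 0)" using pnorm_minus[of p "s1 t - s1 0"] by simp
        finally have "pnorm p (rvec v1 - s1 t) \<le> (1 / 10) ^ K" using n(2) g v1 unfolding tt by linarith
        then have "err p (Some (rvec v1)) (Sol pr (represented r)) \<le> ennreal ((1 / 10) ^ K)"
          unfolding represented_eq[OF r] t(1) using n(1) unfolding tt by (intro err_Some_le) auto
        then show ?thesis using step' True by blast
      next
        case False
        then have tt: "t = - ?t" using t(3) by simp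
        have "pnorm p (rvec v2 - s2 t) \<le> pnorm p (rvec v2 - s2 0) + pnorm p (s2 0 - s2 t)"
          by (rule pnorm_triangle_diff[OF p])
        also have "pnorm p (s2 0 - s2 t) = pnorm p (s2 t - s2 0)" using pnorm_minus[of p "s2 t - s2 0"] by simp
        finally have "pnorm p (rvec v2 - s2 t) \<le> (1 / 10) ^ K" using n(4) g v2 unfolding tt by linarith
        then have "err p (Some (rvec v2)) (Sol pr (represented r)) \<le> ennreal ((1 / 10) ^ K)"
          unfolding represented_eq[OF r] t(1) using n(3) unfolding tt by (intro err_Some_le) auto
        then show ?thesis using step' False t(4) by auto
      qed
    qed
  qed
  then show ?thesis using M'(1,2) by (intro exI[of _ M'] conjI ball_reps) auto
qed

end

section \<open>A family with a jump of the solution\<close>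

text \<open>The first entry alone tells the cases apart: it is at least 2 at t = 0 and at most 0 for
  t > 0, while the errors of outputs and oracle answers are below 1/10. The solutions for t > 0 are
  only asked to cluster as t tends to 0. The bound on y makes the class differ from the
  well-conditioned one.\<close>

locale jump_family =
  fixes pr :: problem and \<iota> :: "real \<Rightarrow> ('m::enum, 'n::enum) input" and c :: "('m, 'n) coord"
    and s0 :: "real ^ ('n::enum)" and s :: "real \<Rightarrow> real ^ ('n::enum)"
  assumes coord_active: "coord (\<iota> t) c = t"
    and coord_other: "j \<noteq> c \<Longrightarrow> coord (\<iota> t) j = coord (\<iota> t') j"
    and Sol_zero: "Sol pr (\<iota> 0) = {s0}"
    and Sol_pos: "0 < t \<Longrightarrow> t \<le> 1 / 2 \<Longrightarrow> Sol pr (\<iota> t) = {s t}"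
    and s0_ge: "2 \<le> s0 !. 0" and s_le: "0 < t \<Longrightarrow> t \<le> 1 / 2 \<Longrightarrow> s t !. 0 \<le> 0"
    and s_close: "0 < t \<Longrightarrow> t \<le> 1 / 2 \<Longrightarrow> 0 < t' \<Longrightarrow> t' \<le> 1 / 2 \<Longrightarrow> infnorm (s t - s t') \<le> 100 * (t + t')"
    and y_large: "2 < infnorm (fst (\<iota> 0))"
begin

definition inputs :: "nat \<Rightarrow> ('m, 'n) input set" where
  "inputs M = \<iota> ` ({0} \<union> {3 / 2 ^ m | m. M \<le> m})"

lemma inputs_cases:
  assumes "x \<in> inputs M"
  obtains "x = \<iota> 0" | m where "x = \<iota> (3 / 2 ^ m)" "M \<le> m"
  using assms by (auto simp: inputs_def)

lemma feasible_inputs: "3 / 2 ^ M \<le> (1 / 2 :: real) \<Longrightarrow> inputs M \<subseteq> feasible_inputs pr"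
proof
  fix x assume M: "3 / 2 ^ M \<le> (1 / 2 :: real)" and "x \<in> inputs M"
  from this(2) have "Sol pr x \<noteq> {}"
  proof (cases rule: inputs_cases)
    case (2 m)
    have "3 / 2 ^ m \<le> (3 / 2 ^ M :: real)" using 2(2) by (intro divide_left_mono power_increasing) auto
    then have "3 / 2 ^ m \<le> (1 / 2 :: real)" using M by linarith
    then show ?thesis using Sol_pos[of "3 / 2 ^ m"] 2(1) by simp
  qed (simp add: Sol_zero)
  then show "x \<in> feasible_inputs pr" by (auto simp: feasible_inputs_def Sol_def is_arg_min_def)
qed

end

section \<open>The exit flag on the class with a jump\<close>

locale jump_class = jump_family pr \<iota> c s0 s
  for pr :: problem and \<iota> :: "real \<Rightarrow> ('m::enum, 'n::enum) input" and c s0 s +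
  fixes p :: ereal and K M :: nat and \<alpha> \<omega> :: real
    and \<Gamma> :: "(('m, 'n) rep, ('m, 'n) coord \<times> nat, real ^ ('n::enum)) alg"
  assumes p: "1 \<le> p" and K: "1 \<le> K" and \<alpha>: "0 < \<alpha>" "\<alpha> \<le> \<omega>" "\<omega> < (1 / 10) ^ K"
    and small: "3 / 2 ^ M \<le> (1 / 2 :: real)"
    and gap: "2 * (CARD('n) * 100 * (3 / 2 ^ M)) \<le> (1 / 10) ^ K - \<omega>"
    and adm: "admissible pr p \<alpha> (inputs M) \<Gamma>"
begin

lemma near_zero:
  fixes t :: real
  assumes "M \<le> m" "t = 3 / 2 ^ m"
  shows "Sol pr (\<iota> t) = {s t}" "s t !. 0 \<le> 0" "0 < t" "t \<le> 1 / 2" "t \<le> 3 / 2 ^ M"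
proof -
  show t: "t \<le> 3 / 2 ^ M" unfolding assms(2) using assms(1) by (intro divide_left_mono power_increasing) auto
  show t2: "t \<le> 1 / 2" using t small by linarith
  show t0: "0 < t" by (simp add: assms(2))
  show "Sol pr (\<iota> t) = {s t}" "s t !. 0 \<le> 0" using Sol_pos[OF t0 t2] s_le[OF t0 t2] by auto
qed

lemma s_near:
  assumes "M \<le> m" "M \<le> m'"
  shows "pnorm p (s (3 / 2 ^ m) - s (3 / 2 ^ m')) \<le> (1 / 10) ^ K - \<omega>"
proof -
  note n = near_zero[OF assms(1) refl] and n' = near_zero[OF assms(2) refl]
  have "infnorm (s (3 / 2 ^ m) - s (3 / 2 ^ m')) \<le> 100 * (3 / 2 ^ m + 3 / 2 ^ m')"
    using n n' by (intro s_close) auto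
  also have "\<dots> \<le> 100 * (2 * (3 / 2 ^ M))" using n(5) n'(5) by argo
  finally have "CARD('n) * infnorm (s (3 / 2 ^ m) - s (3 / 2 ^ m')) \<le> CARD('n) * (100 * (2 * (3 / 2 ^ M)))"
    by (intro mult_left_mono) auto
  also have "\<dots> = 2 * (CARD('n) * 100 * (3 / 2 ^ M))" by simp
  finally show ?thesis using gap pnorm_le_infnorm[OF p, of "s (3 / 2 ^ m) - s (3 / 2 ^ m')"] by linarith
qed

lemma first_entry: "pnorm p (x - y) < b \<Longrightarrow> \<bar>x !. 0 - y !. 0\<bar> < b" for x y :: "real ^ ('n::enum)"
  using infnorm_le_pnorm[OF p, of "x - y"] entry_le_infnorm[of 0 "x - y"] by simp

lemma output_bound: "\<omega> < 1 / 10"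
  using \<alpha>(3) tenth_power_le[OF K] by linarith

text \<open>The output is near a solution of some input of the class, possibly of the other kind,
  and its first entry tells which kind. All solutions for t > 0 are so close together that an output
  near one of them is correct for each.\<close>

lemma flag_iff:
  assumes "x \<in> inputs M" "represents r x" "result \<Gamma> r = Some v"
  shows "exit_flag pr p K \<Gamma> r \<longleftrightarrow> (1 \<le> v !. 0 \<longleftrightarrow> x = \<iota> 0)"
proof -
  obtain v' x' \<xi> where v': "result \<Gamma> r = Some v'" "x' \<in> inputs M" "\<xi> \<in> Sol pr x'" "pnorm p (v' - \<xi>) < \<alpha>"
    using admissible_result[OF adm assms(1,2)] .
  then have v: "x' \<in> inputs M" "\<xi> \<in> Sol pr x'" "pnorm p (v - \<xi>) < \<alpha>" using assms(3) by simp_all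
  have flag: "exit_flag pr p K \<Gamma> r \<longleftrightarrow> pnorm p (v - \<eta>) \<le> (1 / 10) ^ K" if "Sol pr x = {\<eta>}" for \<eta>
    unfolding exit_flag_def represented_eq[OF assms(2)] assms(3) that by (rule err_singleton_le_iff) simp
  have far: "\<not> pnorm p (v - \<eta>) \<le> (1 / 10) ^ K" if "1 / 2 \<le> \<bar>v !. 0 - \<eta> !. 0\<bar>" for \<eta>
  proof
    assume "pnorm p (v - \<eta>) \<le> (1 / 10) ^ K"
    then have "pnorm p (v - \<eta>) < 1 / 2" using tenth_power_le[OF K] by linarith
    from first_entry[OF this] that show False by simp
  qed
  have zero_ne: "\<iota> 0 \<noteq> \<iota> (3 / 2 ^ m)" for m using coord_active[of 0] coord_active[of "3 / 2 ^ m"] by auto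
  have "\<bar>v !. 0 - \<xi> !. 0\<bar> < 1 / 10" using first_entry[OF v(3)] \<alpha> output_bound by linarith
  then have v01: "v !. 0 - \<xi> !. 0 < 1 / 10" "\<xi> !. 0 - v !. 0 < 1 / 10"
    by (simp_all only: abs_less_iff minus_diff_eq)
  consider "\<xi> = s0" "1 \<le> v !. 0" | m where "M \<le> m" "\<xi> = s (3 / 2 ^ m)" "v !. 0 \<le> 1 / 10"
    using v(1)
  proof (cases rule: inputs_cases)
    case 1
    then have "\<xi> = s0" using v(2) Sol_zero by simp
    moreover have "1 \<le> v !. 0" using v01 s0_ge unfolding \<open>\<xi> = s0\<close> by linarith
    ultimately show ?thesis using that(1) by blast
  next
    case (2 m)
    then have "\<xi> = s (3 / 2 ^ m)" using v(2) near_zero(1)[OF 2(2) refl] by simp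
    moreover have "v !. 0 \<le> 1 / 10"
      using v01 near_zero(2)[OF 2(2) refl] unfolding \<open>\<xi> = s (3 / 2 ^ m)\<close> by linarith
    ultimately show ?thesis using that(2) 2(2) by blast
  qed
  then show ?thesis
  proof cases
    case 1
    show ?thesis using assms(1)
    proof (cases rule: inputs_cases)
      case x: 1
      have "pnorm p (v - s0) \<le> (1 / 10) ^ K" using v(3) \<alpha> 1(1) by simp
      then show ?thesis using flag[of s0] Sol_zero x 1(2) by simp
    next
      case (2 m)
      have "1 / 2 \<le> v !. 0 - s (3 / 2 ^ m) !. 0" using 1(2) near_zero(2)[OF 2(2) refl] by linarith
      then have "1 / 2 \<le> \<bar>v !. 0 - s (3 / 2 ^ m) !. 0\<bar>" by (rule order_trans[OF _ abs_ge_self])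
      then show ?thesis using flag[OF near_zero(1)[OF 2(2) refl, folded 2(1)]] far 1(2) zero_ne 2(1) by metis
    qed
  next
    case v': (2 m')
    then have n1: "\<not> 1 \<le> v !. 0" by linarith
    show ?thesis using assms(1)
    proof (cases rule: inputs_cases)
      case 1
      have "1 / 2 \<le> - (v !. 0 - s0 !. 0)" using v'(3) s0_ge by linarith
      then have "1 / 2 \<le> \<bar>v !. 0 - s0 !. 0\<bar>" by (rule order_trans[OF _ abs_ge_minus_self])
      then show ?thesis using flag[of s0] Sol_zero 1 far n1 by simp
    next
      case (2 m)
      have "pnorm p (v - s (3 / 2 ^ m)) \<le> (1 / 10) ^ K"
        using pnorm_triangle_diff[OF p, of v "s (3 / 2 ^ m)" \<xi>] s_near[OF v'(1) 2(2)] v(3) v'(2) \<alpha> by simp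
      then show ?thesis using flag[OF near_zero(1)[OF 2(2) refl, folded 2(1)]] n1 zero_ne 2(1) by metis
    qed
  qed
qed

lemma oracle_iff:
  assumes "x \<in> inputs M" "\<rho> \<in> exact_oracle pr p \<omega> x"
  shows "1 \<le> \<rho> !. 0 \<longleftrightarrow> x = \<iota> 0"
proof -
  have zero_ne: "\<iota> 0 \<noteq> \<iota> (3 / 2 ^ m)" for m using coord_active[of 0] coord_active[of "3 / 2 ^ m"] by auto
  obtain \<xi> where \<xi>: "\<xi> \<in> Sol pr x" "pnorm p (rvec \<rho> - \<xi>) < \<omega>" using assms(2) by (auto simp: exact_oracle_def)
  have "\<bar>real_of_rat (\<rho> !. 0) - \<xi> !. 0\<bar> < 1 / 10"
    using first_entry[OF \<xi>(2)] output_bound unfolding rvec_entry by linarith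
  then have r: "real_of_rat (\<rho> !. 0) - \<xi> !. 0 < 1 / 10" "\<xi> !. 0 - real_of_rat (\<rho> !. 0) < 1 / 10"
    by (simp_all only: abs_less_iff minus_diff_eq)
  have one: "1 \<le> \<rho> !. 0 \<longleftrightarrow> 1 \<le> real_of_rat (\<rho> !. 0)"
    using of_rat_less_eq[of 1 "\<rho> !. 0", where ?'a = real] by simp
  show ?thesis using assms(1)
  proof (cases rule: inputs_cases)
    case 1
    then have "\<xi> = s0" using \<xi>(1) Sol_zero by simp
    have "1 \<le> real_of_rat (\<rho> !. 0)" using s0_ge r unfolding \<open>\<xi> = s0\<close> by linarith
    then show ?thesis using one 1 by blast
  next
    case (2 m)
    then have "\<xi> !. 0 \<le> 0" using \<xi>(1) near_zero(1,2)[OF 2(2) refl] by simp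
    then have "\<not> 1 \<le> real_of_rat (\<rho> !. 0)" using r by linarith
    then have "\<not> 1 \<le> \<rho> !. 0" using one by blast
    then show ?thesis using 2(1) zero_ne[of m] by simp
  qed
qed

lemma zero_input: "\<iota> 0 \<in> inputs M"
  by (auto simp: inputs_def)

text \<open>If the output is kept while t becomes positive, the truth of
  \<open>x = \<iota> 0\<close> changes and that of \<open>1 \<le> v !. 0\<close> does not. By
  \<open>flag_iff\<close> the flag flips, whatever the output is.\<close>

lemma flag_discontinuous:
  obtains r0 where "r0 \<in> reps (inputs M)"
    "\<And>F. finite F \<Longrightarrow> \<exists>r\<in>reps (inputs M). (\<forall>e\<in>F. ev_rep e r = ev_rep e r0) \<and>
      exit_flag pr p K \<Gamma> r \<noteq> exit_flag pr p K \<Gamma> r0"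
proof -
  note found = that
  define r0 where "r0 = (\<lambda>j. approx (coord (\<iota> 0) j))"
  have r0: "represents r0 (\<iota> 0)" unfolding r0_def by (rule represents_approx)
  obtain v where v: "result \<Gamma> r0 = Some v" using admissible_result[OF adm zero_input r0] .
  have GA: "general_algorithm ev_rep (reps (inputs M)) \<Gamma>" using adm by (simp add: admissible_def)
  have r0I: "r0 \<in> reps (inputs M)" using r0 zero_input by (auto simp: reps_def)
  have "result \<Gamma> r0 \<noteq> None" using v by simp
  then have fin: "finite (queries \<Gamma> r0)" using GA r0I unfolding general_algorithm_def by blast
  have "\<exists>r\<in>reps (inputs M). (\<forall>e\<in>F. ev_rep e r = ev_rep e r0) \<and> exit_flag pr p K \<Gamma> r \<noteq> exit_flag pr p K \<Gamma> r0"
    if F: "finite F" for F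
  proof -
    have "finite (F \<union> queries \<Gamma> r0)" using F fin by simp
    then obtain N where N: "\<And>r r' e. e \<in> F \<union> queries \<Gamma> r0 \<Longrightarrow> (\<And>j n. n \<le> N \<Longrightarrow> r j n = r' j n) \<Longrightarrow> ev_rep e r = ev_rep e r'"
      by (rule ev_rep_agree) blast
    obtain M2 where M2: "\<And>m. M2 \<le> m \<Longrightarrow> 1 * (3 / 2 ^ m) < (1 / 2 ^ N :: real)"
      using small_power[of "1 / 2 ^ N" 1] by auto
    define m where "m = max M M2"
    define t where "t = (3 / 2 ^ m :: real)"
    have m: "M \<le> m" "M2 \<le> m" by (simp_all add: m_def)
    have tI: "\<iota> t \<in> inputs M" using m(1) by (auto simp: inputs_def t_def)
    have bnd: "\<bar>coord (\<iota> t) c\<bar> \<le> 1 / 2 ^ N" using M2[OF m(2)] by (simp add: coord_active t_def)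
    have "\<exists>r. represents r (\<iota> t) \<and> (\<forall>j n. n \<le> N \<longrightarrow> r j n = approx (coord (\<iota> 0) j) n)"
      by (rule close_representation[OF coord_other coord_active bnd])
    then obtain r where r: "represents r (\<iota> t)" "\<And>j n. n \<le> N \<Longrightarrow> r j n = r0 j n"
      by (auto simp: r0_def)
    have rI: "r \<in> reps (inputs M)" using r(1) tI by (auto simp: reps_def)
    have agree: "ev_rep e r = ev_rep e r0" if "e \<in> F \<union> queries \<Gamma> r0" for e
      using that by (rule N) (simp add: r(2))
    have "\<forall>e\<in>queries \<Gamma> r0. ev_rep e r = ev_rep e r0" using agree by blast
    then have "result \<Gamma> r = Some v" using GA rI r0I v unfolding general_algorithm_def by metis
    moreover have "\<iota> t \<noteq> \<iota> 0" using coord_active[of 0] coord_active[of t] by (auto simp: t_def)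
    ultimately have "exit_flag pr p K \<Gamma> r \<noteq> exit_flag pr p K \<Gamma> r0"
      using flag_iff[OF tI r(1)] flag_iff[OF zero_input r0 v] by auto
    then show ?thesis using rI agree by blast
  qed
  then show thesis by (rule found[OF r0I])
qed

lemma flag_not_computable:
  shows "\<not> det_computable ev_rep (reps (inputs M)) (exit_flag pr p K \<Gamma>)"
    and "1 / 2 < q \<Longrightarrow> \<not> rand_computable ev_rep (reps (inputs M)) q (exit_flag pr p K \<Gamma>)"
proof -
  obtain r0 where r0: "r0 \<in> reps (inputs M)"
    "\<And>F. finite F \<Longrightarrow> \<exists>r\<in>reps (inputs M). (\<forall>e\<in>F. ev_rep e r = ev_rep e r0) \<and>
      exit_flag pr p K \<Gamma> r \<noteq> exit_flag pr p K \<Gamma> r0"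
    using flag_discontinuous by blast
  show "\<not> det_computable ev_rep (reps (inputs M)) (exit_flag pr p K \<Gamma>)"
    using r0 by (rule not_det_computable)
  show "\<not> rand_computable ev_rep (reps (inputs M)) q (exit_flag pr p K \<Gamma>)" if "1 / 2 < q"
    using r0 that by (rule not_rand_computable)
qed

lemma flag_from_oracle:
  assumes "realises Mach (inputs M) \<Gamma>"
  shows "\<exists>M'. wf_machine M' \<and> is_Turing M' = is_Turing Mach \<and>
    (\<forall>(r, \<rho>)\<in>with_oracle (exact_oracle pr p \<omega>) (inputs M).
       outputs_bit M' (orc r (vec_list \<rho>)) (exit_flag pr p K \<Gamma> r))"
proof -
  have wf: "wf_machine Mach" using assms by (simp add: realises_def)
  obtain M' where M': "wf_machine M'" "is_Turing M' = is_Turing Mach"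
    "\<forall>Q Q' (x :: real ^ ('n::enum)) \<rho>. (\<forall>k a. Q k = Some a \<longrightarrow> Q' k = Some a) \<longrightarrow> outputs_vec Mach Q x \<longrightarrow>
       Q' (Extra 0) = Some \<rho> \<longrightarrow> outputs_bit M' Q' ((1 \<le> x !. 0) = (1 \<le> \<rho>))"
    using machine_decides[OF wf] by (elim exE conjE)
  have "outputs_bit M' (orc r (vec_list \<rho>)) (exit_flag pr p K \<Gamma> r)"
    if i: "i \<in> inputs M" and r: "represents r i" and \<rho>: "\<rho> \<in> exact_oracle pr p \<omega> i" for i r \<rho>
  proof -
    let ?Q = "orc r (vec_list \<rho>)"
    obtain v where v: "result \<Gamma> r = Some v" using admissible_result[OF adm i r] .
    have "r \<in> reps (inputs M)" using i r by (auto simp: reps_def)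
    then have out: "outputs_vec Mach (orc r []) v" using assms v unfolding realises_def by blast
    have ext: "\<forall>k a. orc r [] k = Some a \<longrightarrow> ?Q k = Some a" using orc_extend by blast
    have Q0: "?Q (Extra 0) = Some (\<rho> !. 0)" by (simp add: length_vec_list vec_list_nth)
    have "outputs_bit M' ?Q ((1 \<le> v !. 0) = (1 \<le> \<rho> !. 0))"
      using M'(3)[THEN spec, THEN spec, THEN spec, THEN spec, THEN mp, OF ext, THEN mp, OF out, THEN mp, OF Q0] .
    then show ?thesis using flag_iff[OF i r v] oracle_iff[OF i \<rho>] by simp
  qed
  then show ?thesis using M'(1,2) by (intro exI[of _ M']) (auto simp: with_oracle_def)
qed

end

section \<open>Concrete inputs with a jump\<close>

definition tail_delta :: "problem \<Rightarrow> real" where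
  "tail_delta pr = (case pr of BP _ \<delta> \<Rightarrow> \<delta> | _ \<Rightarrow> 0)"

text \<open>Row 0 reads t x0 with datum - \<delta>, row 1 reads a x0 + b x1 with datum 4. For t > 0
  the tolerance \<delta> forces t x0 \<le> 0, hence x0 \<le> 0; at t = 0 row 0 says nothing about x.
  Then x0 = 2 is cheapest for the 1-norm with a = 2, b = 1, and the constant vector 4 for total
  variation with a = 0, b = 1.\<close>

definition A3 :: "real \<Rightarrow> real \<Rightarrow> real \<Rightarrow> real ^ ('n::enum) ^ ('m::enum)" where
  "A3 a b t = mat_of (\<lambda>i j. t * of_bool (i = 0 \<and> j = 0) + a * of_bool (i = 1 \<and> j = 0) + b * of_bool (i = 1 \<and> j = 1))"

definition y3 :: "real \<Rightarrow> real ^ ('m::enum)" where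
  "y3 \<delta> = vec_of (\<lambda>i. if i = 0 then - \<delta> else if i = 1 then 4 else 0)"

definition vec2 :: "real \<Rightarrow> real \<Rightarrow> real ^ ('m::enum)" where
  "vec2 u v = vec_of (\<lambda>i. if i = 0 then u else if i = 1 then v else 0)"

lemma A3_entry:
  assumes "4 \<le> CARD('m)" "CARD('m) < CARD('n)"
  shows "(A3 a b t :: real ^ ('n::enum) ^ ('m::enum)) *v x = vec2 (t * x !. 0) (a * x !. 0 + b * x !. 1)"
proof -
  have "((A3 a b t :: real ^ ('n::enum) ^ ('m::enum)) *v x) !. i = (vec2 (t * x !. 0) (a * x !. 0 + b * x !. 1) :: real ^ ('m::enum)) !. i"
    if "i < CARD('m)" for i
  proof -
    have s: "(\<Sum>l<CARD('n). (t * of_bool (i = 0 \<and> l = 0) + a * of_bool (i = 1 \<and> l = 0) + b * of_bool (i = 1 \<and> l = 1)) * x !. l)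
     = t * of_bool (i = 0) * (\<Sum>l<CARD('n). of_bool (l = 0) * x !. l)
       + a * of_bool (i = 1) * (\<Sum>l<CARD('n). of_bool (l = 0) * x !. l)
       + b * of_bool (i = 1) * (\<Sum>l<CARD('n). of_bool (l = 1) * x !. l)"
      by (simp only: sum_distrib_left sum.distrib[symmetric])
        (rule sum.cong, auto simp: algebra_simps of_bool_def)
    show ?thesis
      unfolding A3_def mult_entry[OF that] s using assms that by (auto simp: sum_of_bool_eq vec2_def)
  qed
  then show ?thesis by (simp add: vec_eq_entry_iff)
qed

lemma inner_vec2:
  assumes "4 \<le> CARD('m)"
  shows "vec2 u v \<bullet> (x :: real ^ ('m::enum)) = u * x !. 0 + v * x !. 1"
proof -
  have "vec2 u v \<bullet> x = (\<Sum>k<CARD('m). of_bool (k = 0) * (u * x !. k) + of_bool (k = 1) * (v * x !. k))"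
    unfolding inner_entry by (rule sum.cong) (auto simp: vec2_def)
  also have "\<dots> = u * x !. 0 + v * x !. 1"
    using assms by (simp only: sum.distrib sum_of_bool_eq finite_lessThan) simp
  finally show ?thesis .
qed

lemma vec2_simps:
  assumes "4 \<le> CARD('m)"
  shows "(vec2 u v :: real ^ ('m::enum)) !. 0 = u" "(vec2 u v :: real ^ ('m::enum)) !. 1 = v"
  using assms by (simp_all add: vec2_def)

lemma vec2_eq_iff:
  assumes "4 \<le> CARD('m)"
  shows "(vec2 u v :: real ^ ('m::enum)) = vec2 u' v' \<longleftrightarrow> u = u' \<and> v = v'"
  using vec2_simps[OF assms] by metis

lemma vec2_arith: "vec2 u v - k *\<^sub>R vec2 u' v' = vec2 (u - k * u') (v - k * v')"
  by (simp add: vec_eq_iff vec2_def vec_of_def)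

lemma y3_vec2: "y3 \<delta> = vec2 (- \<delta>) 4"
  by (simp add: y3_def vec2_def)

lemma norm_vec2:
  assumes "4 \<le> CARD('m)"
  shows "norm (vec2 u v :: real ^ ('m::enum)) = sqrt (u\<^sup>2 + v\<^sup>2)"
  using inner_vec2[OF assms, of u v "vec2 u v"] unfolding vec2_simps[OF assms]
  by (simp add: norm_eq_sqrt_inner power2_eq_square)

text \<open>At \<open>t = 0\<close> the first row vanishes and uses up the whole residual \<open>\<delta>\<close>.\<close>

lemma certifies_degenerate:
  assumes "valid_param pr" "is_LP pr \<or> is_BP pr" "4 \<le> CARD('m)" "CARD('m) < CARD('n)"
  shows "certifies pr (y3 (tail_delta pr)) (A3 a b 0 :: real ^ ('n::enum) ^ ('m::enum)) z (vec2 0 4)"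
proof (cases pr)
  case (BP J \<delta>)
  have \<delta>: "0 \<le> \<delta>" using assms(1) BP by simp
  have d: "vec2 u v - y3 \<delta> = (vec2 (u + \<delta>) (v - 4) :: real ^ ('m::enum))" for u v
    unfolding y3_vec2 using vec2_arith[of u v 1 "- \<delta>" 4] by simp
  have "A3 a b 0 *v x = (vec2 0 4 :: real ^ ('m::enum))"
    if "norm ((A3 a b 0 :: real ^ ('n::enum) ^ ('m::enum)) *v x - y3 \<delta>) \<le> \<delta>" for x
  proof -
    let ?v = "a * x !. 0 + b * x !. 1"
    have "sqrt (\<delta>\<^sup>2 + (?v - 4)\<^sup>2) \<le> \<delta>"
      using that unfolding A3_entry[OF assms(3,4)] d norm_vec2[OF assms(3)] by simp
    then have "\<delta>\<^sup>2 + (?v - 4)\<^sup>2 \<le> \<delta>\<^sup>2" by (rule sqrt_le_D)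
    then have "?v = 4" by simp
    then show ?thesis unfolding A3_entry[OF assms(3,4)] by simp
  qed
  moreover have "norm (vec2 0 4 - y3 \<delta> :: real ^ ('m::enum)) \<le> \<delta>"
    unfolding d norm_vec2[OF assms(3)] using \<delta> by simp
  ultimately show ?thesis using BP by (simp add: certifies_def tail_delta_def)
qed (use assms in \<open>auto simp: certifies_def tail_delta_def y3_vec2\<close>)

text \<open>The multiple \<delta> / ||z|| of the dual vector z = (- h / t, 1) for t > 0;
  \<open>first3\<close> is the resulting entry x0, from t x0 = - \<delta> + \<kappa> h / t. The
  value of h makes the dual weight of entry 0, or of the first difference, equal to -1: h = 3 for
  the 1-norm and h = 1 for total variation.\<close>

definition kappa3 :: "real \<Rightarrow> real \<Rightarrow> real \<Rightarrow> real" where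
  "kappa3 \<delta> h t = \<delta> * t / sqrt (h\<^sup>2 + t\<^sup>2)"

definition first3 :: "real \<Rightarrow> real \<Rightarrow> real \<Rightarrow> real" where
  "first3 \<delta> h t = (kappa3 \<delta> h t * h / t - \<delta>) / t"

lemma certifies_jump:
  assumes "valid_param pr" "is_LP pr \<or> is_BP pr" "4 \<le> CARD('m)" "CARD('m) < CARD('n)" "0 < t" "1 \<le> h"
  shows "certifies pr (y3 (tail_delta pr)) (A3 a b t :: real ^ ('n::enum) ^ ('m::enum)) (vec2 (- h / t) 1)
    (vec2 (t * first3 (tail_delta pr) h t) (4 - kappa3 (tail_delta pr) h t))"
proof -
  have b: "y3 \<delta> - kappa3 \<delta> h t *\<^sub>R vec2 (- h / t) 1 = vec2 (t * first3 \<delta> h t) (4 - kappa3 \<delta> h t)" for \<delta>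
    unfolding y3_vec2 vec2_arith using assms(5) by (simp add: first3_def)
  show ?thesis
  proof (cases pr)
    case (BP J \<delta>)
    have \<delta>: "0 \<le> \<delta>" using assms(1) BP by simp
    have "(- h / t)\<^sup>2 + 1\<^sup>2 = (h\<^sup>2 + t\<^sup>2) / t\<^sup>2"
      using assms(5) by (simp add: power_divide add_divide_distrib)
    then have "norm (vec2 (- h / t) 1 :: real ^ ('m::enum)) = sqrt (h\<^sup>2 + t\<^sup>2) / t"
      using assms(5) by (simp only: norm_vec2[OF assms(3)]) (simp add: real_sqrt_divide)
    moreover have "0 < sqrt (h\<^sup>2 + t\<^sup>2)" using assms(5) by (simp add: add_nonneg_pos)
    ultimately have "kappa3 \<delta> h t * norm (vec2 (- h / t) 1 :: real ^ ('m::enum)) = \<delta>"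
      using assms(5) by (simp add: kappa3_def)
    moreover have "0 \<le> kappa3 \<delta> h t" using \<delta> assms(5) by (simp add: kappa3_def)
    ultimately show ?thesis
      unfolding b[symmetric] using BP by (auto simp: certifies_def tail_delta_def)
  next
    case LP
    then show ?thesis unfolding b[symmetric] by (simp add: certifies_def tail_delta_def kappa3_def)
  qed (use assms(2) in auto)
qed

lemma tail_delta_bounds: "valid_param pr \<Longrightarrow> 0 \<le> tail_delta pr \<and> tail_delta pr \<le> 1"
  by (cases pr) (auto simp: tail_delta_def)

text \<open>The excess of sqrt (h^2 + t^2) over h is at most t^2, which outweighs the division by t
  in \<open>first3\<close>. So entry 0 tends to 0 with t.\<close>

lemma jump_bounds:
  assumes "0 \<le> \<delta>" "\<delta> \<le> 1" "0 < t" "t \<le> 1 / 2" "1 \<le> h"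
  shows "0 \<le> kappa3 \<delta> h t" "kappa3 \<delta> h t \<le> t" "first3 \<delta> h t \<le> 0" "- t \<le> first3 \<delta> h t"
proof -
  let ?r = "sqrt (h\<^sup>2 + t\<^sup>2)"
  have r: "h \<le> ?r" by (rule real_le_rsqrt) simp
  have "h\<^sup>2 + t\<^sup>2 \<le> (h + t\<^sup>2)\<^sup>2"
  proof -
    have "1 * t\<^sup>2 \<le> 2 * h * t\<^sup>2" using assms(5) by (intro mult_right_mono) auto
    then show ?thesis unfolding power2_sum using zero_le_power2[of "t\<^sup>2"] by linarith
  qed
  then have r2: "?r \<le> h + t\<^sup>2" using assms(5) by (intro real_le_lsqrt) auto
  have r1: "1 \<le> ?r" using r assms(5) by linarith
  show "0 \<le> kappa3 \<delta> h t" using assms by (simp add: kappa3_def)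
  have "\<delta> * t / ?r \<le> (1 * t) / 1" using assms r1 by (intro frac_le mult_right_mono) auto
  then show "kappa3 \<delta> h t \<le> t" by (simp add: kappa3_def)
  have f: "first3 \<delta> h t = - (\<delta> * ((?r - h) / ?r) / t)"
    unfolding first3_def kappa3_def using assms(3) r1 by (simp add: field_simps)
  have q: "0 \<le> (?r - h) / ?r" using r r1 by simp
  have "(?r - h) / ?r \<le> t\<^sup>2 / 1" using r2 r1 r by (intro frac_le) auto
  then have "\<delta> * ((?r - h) / ?r) \<le> 1 * t\<^sup>2" using assms(1,2) q by (intro mult_mono) auto
  then have "\<delta> * ((?r - h) / ?r) / t \<le> t\<^sup>2 / t" using assms(3) by (intro divide_right_mono) auto
  then show "- t \<le> first3 \<delta> h t" unfolding f by (simp add: power2_eq_square)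
  show "first3 \<delta> h t \<le> 0" unfolding f using assms(1,3) q by simp
qed

lemma coord_A3:
  assumes "4 \<le> CARD('m)" "CARD('m) < CARD('n)"
  shows "coord (y :: real ^ ('m::enum), A3 a b t :: real ^ ('n::enum) ^ ('m::enum)) (Inr (enum_class.enum ! 0, enum_class.enum ! 0)) = t"
    and "j \<noteq> Inr (enum_class.enum ! 0, enum_class.enum ! 0) \<Longrightarrow>
      coord (y :: real ^ ('m::enum), A3 a b t :: real ^ ('n::enum) ^ ('m::enum)) j = coord (y, A3 a b t') j"
proof -
  show "coord (y :: real ^ ('m::enum), A3 a b t :: real ^ ('n::enum) ^ ('m::enum)) (Inr (enum_class.enum ! 0, enum_class.enum ! 0)) = t"
    using assms by (simp add: A3_def mat_of_def)
  show "coord (y :: real ^ ('m::enum), A3 a b t :: real ^ ('n::enum) ^ ('m::enum)) j = coord (y, A3 a b t') j"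
    if "j \<noteq> Inr (enum_class.enum ! 0, enum_class.enum ! 0)"
  proof (cases j)
    case (Inr p)
    obtain i l where p: "p = (i, l)" by (cases p)
    have "\<not> (pos i = 0 \<and> pos l = 0)" using that enum_pos[of i] enum_pos[of l] unfolding Inr p by metis
    then show ?thesis by (auto simp: Inr p A3_def mat_of_def)
  qed simp
qed

lemma y3_large:
  assumes "4 \<le> CARD('m)" shows "2 < infnorm (y3 \<delta> :: real ^ ('m::enum))"
proof -
  have "\<bar>(y3 \<delta> :: real ^ ('m::enum)) !. 1\<bar> \<le> infnorm (y3 \<delta> :: real ^ ('m::enum))"
    using assms by (intro entry_le_infnorm) simp
  then show ?thesis unfolding y3_vec2 vec2_simps[OF assms] by simp
qed

text \<open>The common form of the duality argument: \<open>l\<close> stands for the entries in the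
  case of the 1-norm and for the successive differences in the case of total variation, and
  \<open>w\<close> for the dual weights on them.\<close>

lemma Sol_singletonI:
  fixes A :: "real ^ ('n::enum) ^ 'm" and l :: "nat \<Rightarrow> real ^ ('n::enum) \<Rightarrow> real"
  assumes "valid_param pr" "certifies pr y A z b"
    and J: "\<And>x. reg_fun (reg_of pr) x = (\<Sum>k<n. \<bar>l k x\<bar>)"
    and pair: "\<And>x. z \<bullet> (A *v x) = (\<Sum>k<n. w k * l k x)" and w: "\<And>k. k < n \<Longrightarrow> \<bar>w k\<bar> \<le> 1"
    and s: "A *v s = b" "\<And>k. k < n \<Longrightarrow> \<bar>l k s\<bar> = w k * l k s" "is_LP pr \<longrightarrow> (\<forall>i. 0 \<le> s $ i)"
    and unique: "\<And>x. A *v x = b \<Longrightarrow> (\<And>k. k < n \<Longrightarrow> \<bar>l k x\<bar> = w k * l k x) \<Longrightarrow> x = s"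
  shows "Sol pr (y, A) = {s}"
proof -
  have tight: "reg_fun (reg_of pr) x = z \<bullet> b \<longleftrightarrow> (\<forall>k<n. \<bar>l k x\<bar> = w k * l k x)" if "A *v x = b" for x
    unfolding that[symmetric] pair J using sum_abs_tight(2)[OF w] .
  have Sol: "Sol pr (y, A) = {x. A *v x = b \<and> reg_fun (reg_of pr) x = z \<bullet> b \<and> (is_LP pr \<longrightarrow> (\<forall>i. 0 \<le> x $ i))}"
  proof (rule Sol_eq[OF assms(1,2) _ s(1) _ s(3)])
    show "z \<bullet> (A *v x) \<le> reg_fun (reg_of pr) x" for x
      unfolding pair J using sum_abs_tight(1)[OF w] .
    show "reg_fun (reg_of pr) s = z \<bullet> b" using tight[OF s(1)] s(2) by blast
  qed
  have "s \<in> Sol pr (y, A)" unfolding Sol using tight[OF s(1)] s by simp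
  moreover have "x = s" if x: "x \<in> Sol pr (y, A)" for x
  proof -
    have Ax: "A *v x = b" and J: "reg_fun (reg_of pr) x = z \<bullet> b" using x unfolding Sol by simp_all
    show ?thesis using Ax J[unfolded tight[OF Ax]] by (intro unique) simp_all
  qed
  ultimately show ?thesis by blast
qed

definition s_jump :: "problem \<Rightarrow> real \<Rightarrow> real ^ ('n::enum)" where
  "s_jump pr t = (case reg_of pr of
     L1 \<Rightarrow> vec2 (first3 (tail_delta pr) 3 t) (4 - kappa3 (tail_delta pr) 3 t - 2 * first3 (tail_delta pr) 3 t)
   | TV \<Rightarrow> vec_of (\<lambda>k. if k = 0 then first3 (tail_delta pr) 1 t else 4 - kappa3 (tail_delta pr) 1 t))"

lemma jump_family_one:
  assumes valid: "valid_param pr" and LB: "is_LP pr \<or> is_BP pr" and L1: "reg_of pr = L1"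
    and card: "4 \<le> CARD('m)" "CARD('m) < CARD('n)"
  shows "jump_family pr (\<lambda>t. (y3 (tail_delta pr), A3 2 1 t :: real ^ ('n::enum) ^ ('m::enum)))
    (Inr (enum_class.enum ! 0, enum_class.enum ! 0)) (vec2 2 0) (s_jump pr)"
proof -
  let ?\<delta> = "tail_delta pr"
  let ?y = "y3 ?\<delta> :: real ^ ('m::enum)" and ?A = "\<lambda>t. A3 2 1 t :: real ^ ('n::enum) ^ ('m::enum)"
  have n: "4 \<le> CARD('n)" using card by simp
  have J: "reg_fun (reg_of pr) x = (\<Sum>k<CARD('n). \<bar>x !. k\<bar>)" for x :: "real ^ ('n::enum)"
    by (simp add: L1 norm1_entry)
  have sum2: "(\<Sum>k<CARD('n). (if k = 0 then u else if k = 1 then v else 0) * x !. k) = u * x !. 0 + v * x !. 1"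
    for u v and x :: "real ^ ('n::enum)"
    using inner_vec2[OF n, of u v x] unfolding inner_entry by (simp add: vec2_def)
  have pair: "vec2 u v \<bullet> (?A t *v x) = (\<Sum>k<CARD('n). (if k = 0 then u * t + 2 * v else if k = 1 then v else 0) * x !. k)" for u v t x
    unfolding sum2 inner_vec2[OF card(1)] A3_entry[OF card] vec2_simps[OF card(1)] by (simp add: algebra_simps)
  have eqI: "x = vec2 u v" if "x !. 0 = u" "x !. 1 = v" "\<And>k. 2 \<le> k \<Longrightarrow> k < CARD('n) \<Longrightarrow> x !. k = 0"
    for x :: "real ^ ('n::enum)" and u v
    unfolding vec_eq_entry_iff using that by (auto simp: vec2_def)
  have LPd: "?\<delta> = 0" if "is_LP pr" using that by (cases pr) (auto simp: tail_delta_def)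
  have sj: "s_jump pr t = vec2 (first3 ?\<delta> 3 t) (4 - kappa3 ?\<delta> 3 t - 2 * first3 ?\<delta> 3 t)" for t
    by (simp add: s_jump_def L1)
  note bounds = jump_bounds[where \<delta> = ?\<delta> and h = 3]
  have bd: "0 \<le> kappa3 ?\<delta> 3 t" "kappa3 ?\<delta> 3 t \<le> t" "first3 ?\<delta> 3 t \<le> 0" "- t \<le> first3 ?\<delta> 3 t"
    if "0 < t" "t \<le> 1 / 2" for t
    using bounds[of t] tail_delta_bounds[OF valid] that by auto
  show ?thesis
  proof
    show "coord (?y, ?A t) (Inr (enum_class.enum ! 0, enum_class.enum ! 0)) = t" for t
      by (rule coord_A3(1)[OF card])
    show "coord (?y, ?A t) j = coord (?y, ?A t') j" if "j \<noteq> Inr (enum_class.enum ! 0, enum_class.enum ! 0)" for j t t'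
      using that by (rule coord_A3(2)[OF card])
    show "Sol pr (?y, ?A 0) = {vec2 2 0}"
    \<comment> \<open>The dual vector (0, 1/2) gives weight 1 to entry 0 and 1/2 to entry 1, so that
      entry 1 vanishes and row 1 becomes 2 x0 = 4.\<close>
    proof (rule Sol_singletonI[OF valid certifies_degenerate[OF valid LB card] J pair[of 0 "1 / 2" 0]])
      show "?A 0 *v vec2 2 0 = vec2 0 4" unfolding A3_entry[OF card] vec2_simps[OF n] by simp
      fix x assume x: "?A 0 *v x = vec2 0 4" and t: "\<And>k. k < CARD('n) \<Longrightarrow>
        \<bar>x !. k\<bar> = (if k = 0 then 0 * 0 + 2 * (1 / 2) else if k = 1 then 1 / 2 else 0) * x !. k"
      have z: "x !. k = 0" if "1 \<le> k" "k < CARD('n)" for k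
        by (rule tight_zero[OF t[OF that(2)]]) (use that in auto)
      have "2 * x !. 0 + x !. 1 = 4" using x unfolding A3_entry[OF card] vec2_eq_iff[OF card(1)] by simp
      then show "x = vec2 2 0" using z n by (intro eqI) auto
    qed (use n in \<open>auto simp: vec2_def all_entry_iff\<close>)
    show "Sol pr (?y, ?A t) = {s_jump pr t}" if t: "0 < t" "t \<le> 1 / 2" for t
    proof -
      have cert: "certifies pr ?y (?A t) (vec2 (- 3 / t) 1) (vec2 (t * first3 ?\<delta> 3 t) (4 - kappa3 ?\<delta> 3 t))"
        by (rule certifies_jump[OF valid LB card t(1)]) simp
      have w: "(- 3 / t) * t + 2 * 1 = - 1" using t(1) by simp
      note b = bd[OF t]
      show ?thesis
      proof (rule Sol_singletonI[OF valid cert J pair[of "- 3 / t" 1 t, unfolded w]])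
        show "?A t *v s_jump pr t = vec2 (t * first3 ?\<delta> 3 t) (4 - kappa3 ?\<delta> 3 t)"
          unfolding A3_entry[OF card] sj vec2_simps[OF n] by simp
        show "is_LP pr \<longrightarrow> (\<forall>i. 0 \<le> (s_jump pr t :: real ^ ('n::enum)) $ i)"
          using LPd by (auto simp: sj vec2_def all_entry_iff first3_def kappa3_def)
        have "0 \<le> 4 - kappa3 ?\<delta> 3 t - 2 * first3 ?\<delta> 3 t" using b t by linarith
        then show "\<bar>(s_jump pr t :: real ^ ('n::enum)) !. k\<bar> = (if k = 0 then - 1 else if k = 1 then 1 else 0) * (s_jump pr t :: real ^ ('n::enum)) !. k"
          if "k < CARD('n)" for k using that b by (auto simp: sj vec2_def)
        fix x assume x: "?A t *v x = vec2 (t * first3 ?\<delta> 3 t) (4 - kappa3 ?\<delta> 3 t)" and tx: "\<And>k. k < CARD('n) \<Longrightarrow>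
          \<bar>x !. k\<bar> = (if k = 0 then - 1 else if k = 1 then 1 else 0) * x !. k"
        have z: "x !. k = 0" if "2 \<le> k" "k < CARD('n)" for k
          by (rule tight_zero[OF tx[OF that(2)]]) (use that in auto)
        have "t * x !. 0 = t * first3 ?\<delta> 3 t" "2 * x !. 0 + x !. 1 = 4 - kappa3 ?\<delta> 3 t"
          using x unfolding A3_entry[OF card] vec2_eq_iff[OF card(1)] by simp_all
        then show "x = s_jump pr t" unfolding sj using z t(1) by (intro eqI) auto
      qed auto
    qed
    show "2 \<le> (vec2 2 0 :: real ^ ('n::enum)) !. 0" by (simp add: vec2_simps[OF n])
    show "(s_jump pr t :: real ^ ('n::enum)) !. 0 \<le> 0" if "0 < t" "t \<le> 1 / 2" for t
      using bd[OF that] by (simp add: sj vec2_simps[OF n])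
    show "infnorm (s_jump pr t - s_jump pr t' :: real ^ ('n::enum)) \<le> 100 * (t + t')"
      if t: "0 < t" "t \<le> 1 / 2" and t': "0 < t'" "t' \<le> 1 / 2" for t t'
      unfolding infnorm_entry_le_iff using bd[OF t] bd[OF t'] t t' by (auto simp: sj vec2_def abs_le_iff)
    show "2 < infnorm (fst (?y, ?A 0))" using y3_large[OF card(1)] by simp
  qed
qed

lemma jump_family_tv:
  assumes valid: "valid_param pr" and LB: "is_LP pr \<or> is_BP pr" and TV: "reg_of pr = TV"
    and card: "4 \<le> CARD('m)" "CARD('m) < CARD('n)"
  shows "jump_family pr (\<lambda>t. (y3 (tail_delta pr), A3 0 1 t :: real ^ ('n::enum) ^ ('m::enum)))
    (Inr (enum_class.enum ! 0, enum_class.enum ! 0)) (vec_of (\<lambda>k. 4)) (s_jump pr)"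
proof -
  let ?\<delta> = "tail_delta pr"
  let ?y = "y3 ?\<delta> :: real ^ ('m::enum)" and ?A = "\<lambda>t. A3 0 1 t :: real ^ ('n::enum) ^ ('m::enum)"
  let ?d = "\<lambda>k. \<lambda>x :: real ^ ('n::enum). x !. k - x !. Suc k"
  have n: "4 \<le> CARD('n)" using card by simp
  obtain N where N: "CARD('n) - 1 = Suc N" using n by (metis Suc_diff_1 Suc_eq_numeral diff_Suc_1 le_Suc_ex numeral_eq_Suc pred_numeral_simps(2) add_Suc)
  have nLP: "\<not> is_LP pr" using TV by (auto simp: reg_of_def split: problem.splits)
  have J: "reg_fun (reg_of pr) x = (\<Sum>k<CARD('n) - 1. \<bar>?d k x\<bar>)" for x :: "real ^ ('n::enum)"
    by (simp add: TV normTV_def)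
  have pair: "vec2 (- u) v \<bullet> (?A t *v x) = (\<Sum>k<CARD('n) - 1. (if k = 0 then - v else 0) * ?d k x)" if "u * t = v" for u v t x
  proof -
    have S: "(\<Sum>k<CARD('n) - 1. (if k = 0 then - v else 0) * ?d k x) = - v * ?d 0 x"
      unfolding N sum.lessThan_Suc_shift by simp
    show ?thesis
      unfolding S inner_vec2[OF card(1)] A3_entry[OF card] vec2_simps[OF card(1)]
      unfolding that[symmetric] by (simp add: algebra_simps)
  qed
  have const: "x !. k = x !. 1" if "\<And>k. 1 \<le> k \<Longrightarrow> k < CARD('n) - 1 \<Longrightarrow> ?d k x = 0" "1 \<le> k" "k < CARD('n)" for x k
    using that(2,3)
  proof (induction k rule: dec_induct)
    case (step k)
    then show ?case using that(1)[of k] by simp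
  qed simp
  have sj: "s_jump pr t = vec_of (\<lambda>k. if k = 0 then first3 ?\<delta> 1 t else 4 - kappa3 ?\<delta> 1 t)" for t
    by (simp add: s_jump_def TV)
  have bd: "0 \<le> kappa3 ?\<delta> 1 t" "kappa3 ?\<delta> 1 t \<le> t" "first3 ?\<delta> 1 t \<le> 0" "- t \<le> first3 ?\<delta> 1 t"
    if "0 < t" "t \<le> 1 / 2" for t
    using jump_bounds[where \<delta> = ?\<delta> and h = 1 and t = t] tail_delta_bounds[OF valid] that by auto
  show ?thesis
  proof
    show "coord (?y, ?A t) (Inr (enum_class.enum ! 0, enum_class.enum ! 0)) = t" for t
      by (rule coord_A3(1)[OF card])
    show "coord (?y, ?A t) j = coord (?y, ?A t') j" if "j \<noteq> Inr (enum_class.enum ! 0, enum_class.enum ! 0)" for j t t'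
      using that by (rule coord_A3(2)[OF card])
    show "Sol pr (?y, ?A 0) = {vec_of (\<lambda>k. 4)}"
    \<comment> \<open>The dual vector 0 certifies that total variation 0 is optimal; row 1 then
      fixes the constant 4.\<close>
    proof (rule Sol_singletonI[OF valid certifies_degenerate[OF valid LB card] J pair[of 0 0 0]])
      show "?A 0 *v vec_of (\<lambda>k. 4) = vec2 0 4" unfolding A3_entry[OF card] using n by simp
      fix x assume x: "?A 0 *v x = vec2 0 4" and t: "\<And>k. k < CARD('n) - 1 \<Longrightarrow>
        \<bar>?d k x\<bar> = (if k = 0 then - 0 else 0) * ?d k x"
      have z: "?d k x = 0" if "k < CARD('n) - 1" for k using t[OF that] by (cases "k = 0") simp_all
      have x1: "x !. 1 = 4" using x unfolding A3_entry[OF card] vec2_eq_iff[OF card(1)] by simp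
      have x0: "x !. 0 = 4" using z[of 0] x1 n by simp
      show "x = vec_of (\<lambda>k. 4)" unfolding vec_eq_entry_iff
      proof (intro allI impI)
        fix k assume k: "k < CARD('n)"
        show "x !. k = (vec_of (\<lambda>k. 4) :: real ^ ('n::enum)) !. k" using const[of x k] z x0 x1 k by (cases "k = 0") auto
      qed
    qed (use nLP in auto)
    show "Sol pr (?y, ?A t) = {s_jump pr t}" if t: "0 < t" "t \<le> 1 / 2" for t
    proof -
      have cert: "certifies pr ?y (?A t) (vec2 (- (1 / t)) 1) (vec2 (t * first3 ?\<delta> 1 t) (4 - kappa3 ?\<delta> 1 t))"
        using certifies_jump[OF valid LB card t(1), of 1] by simp
      have w: "1 / t * t = 1" using t(1) by simp
      note b = bd[OF t]
      show ?thesis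
      proof (rule Sol_singletonI[OF valid cert J pair[OF w]])
        show "?A t *v s_jump pr t = vec2 (t * first3 ?\<delta> 1 t) (4 - kappa3 ?\<delta> 1 t)"
          unfolding A3_entry[OF card] sj using n by simp
        have "first3 ?\<delta> 1 t \<le> 4 - kappa3 ?\<delta> 1 t" using b t by linarith
        then show "\<bar>?d k (s_jump pr t)\<bar> = (if k = 0 then - 1 else 0) * ?d k (s_jump pr t)" if "k < CARD('n) - 1" for k
          using that by (auto simp: sj)
        fix x assume x: "?A t *v x = vec2 (t * first3 ?\<delta> 1 t) (4 - kappa3 ?\<delta> 1 t)" and tx: "\<And>k. k < CARD('n) - 1 \<Longrightarrow>
          \<bar>?d k x\<bar> = (if k = 0 then - 1 else 0) * ?d k x"
        have z: "?d k x = 0" if "1 \<le> k" "k < CARD('n) - 1" for k using tx[OF that(2)] that(1) by simp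
        have x01: "x !. 0 = first3 ?\<delta> 1 t" "x !. 1 = 4 - kappa3 ?\<delta> 1 t"
          using x t(1) unfolding A3_entry[OF card] vec2_eq_iff[OF card(1)] by simp_all
        show "x = s_jump pr t" unfolding vec_eq_entry_iff
        proof (intro allI impI)
          fix k assume k: "k < CARD('n)"
          show "x !. k = (s_jump pr t :: real ^ ('n::enum)) !. k" using const[of x k] z x01 k by (cases "k = 0") (auto simp: sj)
        qed
      qed (use nLP in auto)
    qed
    show "2 \<le> (vec_of (\<lambda>k. 4) :: real ^ ('n::enum)) !. 0" by simp
    show "(s_jump pr t :: real ^ ('n::enum)) !. 0 \<le> 0" if "0 < t" "t \<le> 1 / 2" for t
      using bd[OF that] by (simp add: sj)
    show "infnorm (s_jump pr t - s_jump pr t' :: real ^ ('n::enum)) \<le> 100 * (t + t')"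
      if t: "0 < t" "t \<le> 1 / 2" and t': "0 < t'" "t' \<le> 1 / 2" for t t'
      unfolding infnorm_entry_le_iff using bd[OF t] bd[OF t'] t t' by (auto simp: sj abs_le_iff)
    show "2 < infnorm (fst (?y, ?A 0))" using y3_large[OF card(1)] by simp
  qed
qed

theorem theorem5p1:
  fixes pr :: problem and p :: ereal and K :: nat and \<alpha> \<omega> :: real
  assumes "valid_param pr" and "1 \<le> p" and "1 \<le> K"
    and "0 < \<alpha>" and "\<alpha> \<le> \<omega>" and "\<omega> < (1 / 10) ^ K"
    and "4 \<le> CARD('m)" and "CARD('m) < CARD('n)"
  shows "\<exists>\<Omega> :: ('m::enum, 'n::enum) input set.
    \<Omega> \<subseteq> feasible_inputs pr \<and> well_conditioned pr \<Omega> \<and>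
    (\<forall>\<Gamma>. admissible pr p \<alpha> \<Omega> \<Gamma> \<longrightarrow>
      (let flag = exit_flag pr p K \<Gamma>;
           I = with_oracle (exact_oracle pr p \<omega>) \<Omega>;
           I\<^sub>K = with_oracle (digits_oracle pr p K) \<Omega>
       in
        \<comment> \<open>(i)\<close>
        (\<not> det_computable ev_orc I (\<lambda>(r, \<rho>). flag r) \<and>
         (\<forall>q>1/2. \<not> halting_rand_computable ev_orc I q (\<lambda>(r, \<rho>). flag r))) \<and>
        \<comment> \<open>(ii)\<close>
        (\<forall>q>1/2. \<not> rand_computable ev_orc I q (\<lambda>(r, \<rho>). flag r)) \<and>
        \<comment> \<open>(iii)\<close>
        (\<forall>M. realises M \<Omega> \<Gamma> \<and> (is_Turing M \<longrightarrow> rational_param pr) \<longrightarrow>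
          (\<exists>M'. wf_machine M' \<and> is_Turing M' = is_Turing M \<and>
            (\<forall>r\<in>reps \<Omega>. \<exists>x. outputs_vec M' (orc r [of_bool (flag r)]) x \<and>
              err p (Some x) (Sol pr (represented r)) \<le> ennreal ((1 / 10) ^ K)))) \<and>
        \<not> det_computable ev_orc I\<^sub>K (\<lambda>(r, \<rho>). flag r) \<and>
        (\<forall>q>1/2. \<not> rand_computable ev_orc I\<^sub>K q (\<lambda>(r, \<rho>). flag r)))) \<and>
    \<comment> \<open>(iv)\<close>
    (is_LP pr \<or> is_BP pr \<longrightarrow>
      (\<exists>\<Omega>'. \<Omega>' \<noteq> \<Omega> \<and> \<Omega>' \<subseteq> feasible_inputs pr \<and>
        (\<forall>\<Gamma>. admissible pr p \<alpha> \<Omega>' \<Gamma> \<longrightarrow>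
          (let flag = exit_flag pr p K \<Gamma> in
            \<not> det_computable ev_rep (reps \<Omega>') flag \<and>
            (\<forall>q>1/2. \<not> rand_computable ev_rep (reps \<Omega>') q flag) \<and>
            (\<forall>M. realises M \<Omega>' \<Gamma> \<and> (is_Turing M \<longrightarrow> rational_param pr) \<longrightarrow>
              (\<exists>M'. wf_machine M' \<and> is_Turing M' = is_Turing M \<and>
                (\<forall>(r, \<rho>)\<in>with_oracle (exact_oracle pr p \<omega>) \<Omega>'.
                  outputs_bit M' (orc r (vec_list \<rho>)) (flag r))))))))"
proof -
  obtain \<iota> :: "real \<Rightarrow> ('m, 'n) input" and c s1 s2 where fam: "unstable_family pr \<iota> c s1 s2"
  proof (cases "reg_of pr")
    case L1
    show ?thesis by (rule that[OF unstable_family_one[OF assms(1) L1 assms(7,8)]])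
  next
    case TV
    show ?thesis by (rule that[OF unstable_family_tv[OF assms(1) TV assms(7,8)]])
  qed
  interpret U: unstable_family pr \<iota> c s1 s2 by (rule fam)
  obtain M1 where M1: "\<And>m. M1 \<le> m \<Longrightarrow> 1 * (3 / 2 ^ m) < (1 / 2000 :: real)" using small_power[of "1 / 2000" 1] by auto
  have gap0: "0 < (1 / 10) ^ K - \<omega>" using assms(6) by simp
  \<comment> \<open>The factor 2 is for the second class, in which two solutions for positive
    parameters are compared; the same M then serves both classes.\<close>
  obtain M2 where M2: "\<And>m. M2 \<le> m \<Longrightarrow> (2 * (CARD('n) * 100)) * (3 / 2 ^ m) < (1 / 10) ^ K - \<omega>"
    using small_power[OF gap0, of "2 * (CARD('n) * 100)"] by auto
  define M where "M = max M1 M2"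
  have small: "3 / 2 ^ M \<le> (1 / 2000 :: real)" using M1[of M] by (simp add: M_def)
  have gap2: "2 * (CARD('n) * 100 * (3 / 2 ^ M)) \<le> (1 / 10) ^ K - \<omega>" using M2[of M] by (simp add: M_def)
  have "0 \<le> CARD('n) * 100 * (3 / 2 ^ M :: real)" by simp
  then have gap: "CARD('n) * 100 * (3 / 2 ^ M) \<le> (1 / 10) ^ K - \<omega>" using gap2 by argo
  let ?\<Omega> = "U.inputs M"
  have digits: "exact_oracle pr p \<omega> x \<subseteq> digits_oracle pr p K x" for x :: "('m, 'n) input"
  proof
    fix \<rho> assume "\<rho> \<in> exact_oracle pr p \<omega> x"
    then obtain \<xi> where "dyadic_vec \<rho>" "\<xi> \<in> Sol pr x" "pnorm p (rvec \<rho> - \<xi>) < \<omega>"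
      by (auto simp: exact_oracle_def)
    then show "\<rho> \<in> digits_oracle pr p K x"
      using assms(6) by (auto simp: digits_oracle_def intro!: err_Some_le)
  qed
  have cls: "unstable_class pr \<iota> c s1 s2 p K M \<alpha> \<omega> \<Gamma>" if "admissible pr p \<alpha> ?\<Omega> \<Gamma>" for \<Gamma>
    by unfold_locales (use assms small gap that in auto)
  have part4: "\<exists>\<Omega>' :: ('m, 'n) input set. \<Omega>' \<noteq> ?\<Omega> \<and> \<Omega>' \<subseteq> feasible_inputs pr \<and>
        (\<forall>\<Gamma>. admissible pr p \<alpha> \<Omega>' \<Gamma> \<longrightarrow>
          (let flag = exit_flag pr p K \<Gamma> in
            \<not> det_computable ev_rep (reps \<Omega>') flag \<and>
            (\<forall>q>1/2. \<not> rand_computable ev_rep (reps \<Omega>') q flag) \<and>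
            (\<forall>M. realises M \<Omega>' \<Gamma> \<and> (is_Turing M \<longrightarrow> rational_param pr) \<longrightarrow>
              (\<exists>M'. wf_machine M' \<and> is_Turing M' = is_Turing M \<and>
                (\<forall>(r, \<rho>)\<in>with_oracle (exact_oracle pr p \<omega>) \<Omega>'.
                  outputs_bit M' (orc r (vec_list \<rho>)) (flag r))))))"
    if LB: "is_LP pr \<or> is_BP pr"
  proof -
    obtain \<iota>' :: "real \<Rightarrow> ('m, 'n) input" and c' s0 s where fam': "jump_family pr \<iota>' c' s0 s"
    proof (cases "reg_of pr")
      case L1
      show ?thesis by (rule that[OF jump_family_one[OF assms(1) LB L1 assms(7,8)]])
    next
      case TV
      show ?thesis by (rule that[OF jump_family_tv[OF assms(1) LB TV assms(7,8)]])
    qed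
    interpret J: jump_family pr \<iota>' c' s0 s by (rule fam')
    have small': "3 / 2 ^ M \<le> (1 / 2 :: real)" using small by linarith
    have cls': "jump_class pr \<iota>' c' s0 s p K M \<alpha> \<omega> \<Gamma>" if "admissible pr p \<alpha> (J.inputs M) \<Gamma>" for \<Gamma>
      by unfold_locales (use assms small' gap2 that in auto)
    have "\<iota>' 0 \<in> J.inputs M" by (auto simp: J.inputs_def)
    \<comment> \<open>The maximum norm of y is at most 2 throughout the first class and exceeds 2
      here.\<close>
    moreover have "\<iota>' 0 \<notin> ?\<Omega>"
    proof
      assume "\<iota>' 0 \<in> ?\<Omega>"
      then obtain t where "\<iota>' 0 = \<iota> t" by (auto simp: U.inputs_def)
      then show False using J.y_large U.y_le[of t] by simp
    qed
    ultimately have "J.inputs M \<noteq> ?\<Omega>" by blast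
    show ?thesis
      unfolding Let_def
    proof (rule exI[of _ "J.inputs M"], intro conjI allI impI)
      show "J.inputs M \<noteq> ?\<Omega>" by fact
      show "J.inputs M \<subseteq> feasible_inputs pr" using J.feasible_inputs[OF small'] .
      fix \<Gamma> assume adm: "admissible pr p \<alpha> (J.inputs M) \<Gamma>"
      interpret C: jump_class pr \<iota>' c' s0 s p K M \<alpha> \<omega> \<Gamma> by (rule cls'[OF adm])
      show "\<not> det_computable ev_rep (reps (J.inputs M)) (exit_flag pr p K \<Gamma>)"
        by (rule C.flag_not_computable(1))
      show "\<not> rand_computable ev_rep (reps (J.inputs M)) q (exit_flag pr p K \<Gamma>)" if "1 / 2 < q" for q
        using that by (rule C.flag_not_computable(2))
      show "\<exists>M'. wf_machine M' \<and> is_Turing M' = is_Turing Mach \<and>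
          (\<forall>(r, \<rho>)\<in>with_oracle (exact_oracle pr p \<omega>) (J.inputs M).
            outputs_bit M' (orc r (vec_list \<rho>)) (exit_flag pr p K \<Gamma> r))"
        if "realises Mach (J.inputs M) \<Gamma> \<and> (is_Turing Mach \<longrightarrow> rational_param pr)" for Mach
        using that by (intro C.flag_from_oracle) blast
    qed
  qed
  have main: "?\<Omega> \<subseteq> feasible_inputs pr \<and> well_conditioned pr ?\<Omega>"
    using U.feasible U.well_conditioned_inputs[OF small] by (auto simp: U.inputs_def)
  show ?thesis
    unfolding Let_def
  proof (rule exI[of _ ?\<Omega>], intro conjI allI impI)
    show "?\<Omega> \<subseteq> feasible_inputs pr" "well_conditioned pr ?\<Omega>" using main by auto
    fix \<Gamma> assume adm: "admissible pr p \<alpha> ?\<Omega> \<Gamma>"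
    interpret C: unstable_class pr \<iota> c s1 s2 p K M \<alpha> \<omega> \<Gamma> by (rule cls[OF adm])
    let ?flag = "\<lambda>(r, \<rho>). exit_flag pr p K \<Gamma> r"
    let ?I = "with_oracle (exact_oracle pr p \<omega>) ?\<Omega>" and ?I' = "with_oracle (digits_oracle pr p K) ?\<Omega>"
    show "\<not> det_computable ev_orc ?I ?flag" by (rule C.flag_not_computable(1)) simp
    show "\<not> det_computable ev_orc ?I' ?flag" by (rule C.flag_not_computable(1)) (rule digits)
    show rand: "\<not> rand_computable ev_orc ?I q ?flag" if "1 / 2 < q" for q
      by (rule C.flag_not_computable(2)) (simp, rule that)
    show "\<not> halting_rand_computable ev_orc ?I q ?flag" if "1 / 2 < q" for q
      using rand[OF that] halting_rand_computable_imp_rand_computable by blast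
    show "\<not> rand_computable ev_orc ?I' q ?flag" if "1 / 2 < q" for q
      by (rule C.flag_not_computable(2)) (rule digits, rule that)
    show "\<exists>M'. wf_machine M' \<and> is_Turing M' = is_Turing Mach \<and>
        (\<forall>r\<in>reps ?\<Omega>. \<exists>x. outputs_vec M' (orc r [of_bool (exit_flag pr p K \<Gamma> r)]) x \<and>
          err p (Some x) (Sol pr (represented r)) \<le> ennreal ((1 / 10) ^ K))"
      if "realises Mach ?\<Omega> \<Gamma> \<and> (is_Turing Mach \<longrightarrow> rational_param pr)" for Mach
      using that by (intro C.digits_from_flag) blast
  qed (rule part4[unfolded Let_def])
qed

end
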